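(* Let $\pi_1\in\mathrm{Irr}_R^{\mathrm{gen}}(\widehat H_{1,S})$ be admissible and let $D_1=\mathrm{End}_{\widehat H_{1,S}}(\pi_1)$. There exists a representation $\Theta(\pi_1)$ in $\mathrm{Rep}_R^{\mathrm{gen}}(\widehat H_{2,S})$, endowed with a right $D_1$-module structure compatible with its structure of representation, such that the largest $\pi_1$-isotypic quotient $(\omega_{\psi,S})_{\pi_1}$ of $\omega_{\psi,S}$ is isomorphic to $\Theta(\pi_1)\otimes_{D_1}\pi_1$. Moreover, as an $R[\widehat H_{2,S}]$-$D_1$-bimodule, $\Theta(\pi_1)$ is unique up to isomorphism.
   Context: $F$ is a field which is either finite of characteristic $p$ or non-archimedean local of residual characteristic $p$, of characteristic different from $2$; $(W,\langle\,,\rangle)$ is a finite-dimensional symplectic space over $F$; $R$ is a field with a fixed non-trivial smooth character $\psi:F\to R^\times$ (so $\mathrm{char}\,R\neq p$). $\mathrm{Rep}_R(G)$ is the category of smooth $R$-representations of a locally profinite group $G$. Heisenberg group: $H=W\times F$ with $(w,t)(w',t')=(w+w',t+t'+\tfrac12\langle w,w'\rangle)$, centre $F=\{(0,t)\}$. $(\rho_\psi,S)$ is a model of the unique (up to isomorphism) irreducible smooth $R$-representation of $H$ with central character $\psi$. Metaplectic group: $\widetilde{\mathrm{Sp}}_{\psi,S}^R(W)=\{(g,M)\in\mathrm{Sp}(W)\times\mathrm{GL}_R(S): M\rho_\psi(w,t)M^{-1}=\rho_\psi(g^{-1}w,t)\ \forall (w,t)\in H\}$ (topologized as a subgroup of $\mathrm{Sp}(W)\times\mathrm{GL}_R(S)$,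 $\mathrm{GL}_R(S)$ having the compact-open topology for discrete $S$); $\widehat{\mathrm{Sp}}_{\psi,S}^R(W)$ is its derived group. The Weil representation is $\omega_{\psi,S}(g,M)=M$ on $S$. $(H_1,H_2)$ is a reductive dual pair in $\mathrm{Sp}(W)$ (two reductive subgroups that are mutual centralizers). $\widehat H_{i,S}$ is the inverse image of $H_i$ in $\widehat{\mathrm{Sp}}_{\psi,S}^R(W)$. The groups $\widehat H_{1,S}$ and $\widehat H_{2,S}$ commute, so $\omega_{\psi,S}$ restricts to a representation of $\widehat H_{1,S}\times\widehat H_{2,S}$. $\mathrm{Rep}_R^{\mathrm{gen}}(\widehat H_{i,S})$ is the full subcategory of $\mathrm{Rep}_R(\widehat H_{i,S})$ of representations in which every element $(\mathrm{Id}_W,\lambda\,\mathrm{Id}_S)$ of $\widehat H_{i,S}$ acts by the scalar $\lambda$, and $\mathrm{Irr}_R^{\mathrm{gen}}(\widehat H_{i,S})$ denotes its simple objects. $\pi_1$ is a left $D_1$-module. The largest $\pi_1$-isotypic quotient of $V=\omega_{\psi,S}$ is $V_{\pi_1}=V/\bigcap_{f\in\mathrm{Hom}_{\widehat H_{1,S}}(V,\pi_1)}\ker f$, a representation of $\widehat H_{1,S}\times\widehat H_{2,S}$; the isomorphism of the statement is in $\mathrm{Rep}_R(\widehat H_{1,S}\times\widehat H_{2,S})$. *)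

theory Defs
  imports
    "HOL-Analysis.Analysis"
    "HOL-Algebra.Algebra"
    "HOL-Algebra.Algebraic_Closure_Type"
    "HOL-Library.Poly_Mapping"
begin

section \<open>The base field\<close>

text \<open>
  The topology of the base field is the metric topology of a non-archimedean absolute value;
  for a finite field the absolute value is the trivial one and the topology is discrete.
\<close>

definition nonarch_abs :: "('f::field \<Rightarrow> real) \<Rightarrow> bool" where
  "nonarch_abs v \<longleftrightarrow>
     (\<forall>x. 0 \<le> v x) \<and> (\<forall>x. v x = 0 \<longleftrightarrow> x = 0) \<and>
     (\<forall>x y. v (x * y) = v x * v y) \<and> (\<forall>x y. v (x + y) \<le> max (v x) (v y))"

definition field_top :: "('f::field \<Rightarrow> real) \<Rightarrow> 'f topology" where
  "field_top v = Metric_space.mtopology UNIV (\<lambda>x y. v (x - y))"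

text \<open>Complete, discretely (and non-trivially) valued, with finite residue field.\<close>

definition nonarch_local_field :: "('f::field \<Rightarrow> real) \<Rightarrow> bool" where
  "nonarch_local_field v \<longleftrightarrow>
     nonarch_abs v \<and>
     Metric_space.mcomplete UNIV (\<lambda>x y. v (x - y)) \<and>
     (\<exists>\<pi>. 0 < v \<pi> \<and> v \<pi> < 1 \<and> (\<forall>x. x \<noteq> 0 \<longrightarrow> (\<exists>n::int. v x = v \<pi> powi n))) \<and>
     finite ({x. v x \<le> 1} // {(x, y). v x \<le> 1 \<and> v y \<le> 1 \<and> v (x - y) < 1})"

text \<open>
  The condition \<open>v p < 1\<close> says that the prime \<open>p\<close> vanishes in the residue field.
\<close>

definition base_field :: "nat \<Rightarrow> ('f::field \<Rightarrow> real) \<Rightarrow> bool" where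
  "base_field p v \<longleftrightarrow>
     (finite (UNIV :: 'f set) \<and> CHAR('f) = p \<and> v = (\<lambda>x. if x = 0 then 0 else 1)) \<or>
     (nonarch_local_field v \<and> Factorial_Ring.prime p \<and> v (of_nat p) < 1)"

definition smooth_character :: "('f::field \<Rightarrow> real) \<Rightarrow> ('f \<Rightarrow> 'r::field) \<Rightarrow> bool" where
  "smooth_character v \<psi> \<longleftrightarrow>
     (\<forall>x. \<psi> x \<noteq> 0) \<and> (\<forall>x y. \<psi> (x + y) = \<psi> x * \<psi> y) \<and> openin (field_top v) {x. \<psi> x = 1}"


section \<open>Smooth representations\<close>

text \<open>
  Groups are \<open>monoid\<close> records together with a topology on the carrier. Coefficient spaces are
  HOL-Algebra modules over the field type \<open>'r\<close>, so that subspaces, quotients and tensor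
  products can be formed. The ring fields \<open>mult\<close> and \<open>one\<close> of a module record play no role.
\<close>

definition space_of :: "('r::field \<Rightarrow> 'a::ab_group_add \<Rightarrow> 'a) \<Rightarrow> ('r, 'a) module" where
  "space_of sc = \<lparr>carrier = UNIV, monoid.mult = undefined, one = undefined,
                  ring.zero = 0, add = (+), smult = sc\<rparr>"

definition lin_maps ::
  "('r::field, 'a, 'm) module_scheme \<Rightarrow> ('r, 'b, 'n) module_scheme \<Rightarrow> ('a \<Rightarrow> 'b) set" where
  "lin_maps M N = {f. f \<in> carrier M \<rightarrow> carrier N \<and>
     (\<forall>x\<in>carrier M. \<forall>y\<in>carrier M. f (x \<oplus>\<^bsub>M\<^esub> y) = f x \<oplus>\<^bsub>N\<^esub> f y) \<and>
     (\<forall>r. \<forall>x\<in>carrier M. f (r \<odot>\<^bsub>M\<^esub> x) = r \<odot>\<^bsub>N\<^esub> f x)}"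

definition representation ::
  "('g, 'm) monoid_scheme \<Rightarrow> ('r::field, 'a, 'n) module_scheme \<Rightarrow> ('g \<Rightarrow> 'a \<Rightarrow> 'a) \<Rightarrow> bool" where
  "representation G M \<sigma> \<longleftrightarrow>
     Module.module (ring_of_type_algebra :: 'r ring) M \<and>
     (\<forall>g\<in>carrier G. \<sigma> g \<in> lin_maps M M) \<and>
     (\<forall>x\<in>carrier M. \<sigma> \<one>\<^bsub>G\<^esub> x = x) \<and>
     (\<forall>g\<in>carrier G. \<forall>h\<in>carrier G. \<forall>x\<in>carrier M. \<sigma> (g \<otimes>\<^bsub>G\<^esub> h) x = \<sigma> g (\<sigma> h x))"

definition smooth_rep ::
  "('g, 'm) monoid_scheme \<Rightarrow> 'g topology \<Rightarrow> ('r::field, 'a, 'n) module_scheme \<Rightarrow>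
   ('g \<Rightarrow> 'a \<Rightarrow> 'a) \<Rightarrow> bool" where
  "smooth_rep G T M \<sigma> \<longleftrightarrow> representation G M \<sigma> \<and>
     (\<forall>x\<in>carrier M. openin T {g \<in> carrier G. \<sigma> g x = x})"

definition irreducible_rep ::
  "('g, 'm) monoid_scheme \<Rightarrow> ('r::field, 'a, 'n) module_scheme \<Rightarrow> ('g \<Rightarrow> 'a \<Rightarrow> 'a) \<Rightarrow> bool" where
  "irreducible_rep G M \<sigma> \<longleftrightarrow> carrier M \<noteq> {\<zero>\<^bsub>M\<^esub>} \<and>
     (\<forall>N. submodule N (ring_of_type_algebra :: 'r ring) M \<and> (\<forall>g\<in>carrier G. \<sigma> g ` N \<subseteq> N)
        \<longrightarrow> N = {\<zero>\<^bsub>M\<^esub>} \<or> N = carrier M)"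

text \<open>
  Admissibility in the form of Bernstein and Zelevinsky, with all open subgroups. As the fixed
  space decreases when the subgroup grows, only compact open subgroups matter when the group is
  locally profinite.
\<close>

definition admissible ::
  "('g, 'm) monoid_scheme \<Rightarrow> 'g topology \<Rightarrow> ('r::field \<Rightarrow> 'v::ab_group_add \<Rightarrow> 'v) \<Rightarrow>
   ('g \<Rightarrow> 'v \<Rightarrow> 'v) \<Rightarrow> bool" where
  "admissible G T sc \<sigma> \<longleftrightarrow>
     (\<forall>K. subgroup K G \<and> openin T K \<longrightarrow>
        (\<exists>B. finite B \<and> {x. \<forall>k\<in>K. \<sigma> k x = x} = Modules.module.span sc B))"

definition intertwiners ::
  "('g, 'm) monoid_scheme \<Rightarrow> ('r::field, 'a, 'n) module_scheme \<Rightarrow> ('g \<Rightarrow> 'a \<Rightarrow> 'a) \<Rightarrow>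
   ('r, 'b, 'k) module_scheme \<Rightarrow> ('g \<Rightarrow> 'b \<Rightarrow> 'b) \<Rightarrow> ('a \<Rightarrow> 'b) set" where
  "intertwiners G M \<sigma> N \<tau> =
     {f \<in> lin_maps M N. \<forall>g\<in>carrier G. \<forall>x\<in>carrier M. f (\<sigma> g x) = \<tau> g (f x)}"

text \<open>Isomorphism in the category of smooth representations.\<close>

definition smooth_rep_iso ::
  "('g, 'm) monoid_scheme \<Rightarrow> 'g topology \<Rightarrow> ('r::field, 'a, 'n) module_scheme \<Rightarrow>
   ('g \<Rightarrow> 'a \<Rightarrow> 'a) \<Rightarrow> ('r, 'b, 'k) module_scheme \<Rightarrow> ('g \<Rightarrow> 'b \<Rightarrow> 'b) \<Rightarrow> bool" where
  "smooth_rep_iso G T M \<sigma> N \<tau> \<longleftrightarrow> smooth_rep G T M \<sigma> \<and> smooth_rep G T N \<tau> \<and>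
     (\<exists>f\<in>intertwiners G M \<sigma> N \<tau>. bij_betw f (carrier M) (carrier N))"

definition End_ring ::
  "('g, 'm) monoid_scheme \<Rightarrow> ('r::field \<Rightarrow> 'v::ab_group_add \<Rightarrow> 'v) \<Rightarrow> ('g \<Rightarrow> 'v \<Rightarrow> 'v) \<Rightarrow>
   ('v \<Rightarrow> 'v) ring" where
  "End_ring G sc \<sigma> = \<lparr>carrier = intertwiners G (space_of sc) \<sigma> (space_of sc) \<sigma>,
     monoid.mult = (\<circ>), one = id, ring.zero = (\<lambda>_. 0), add = (\<lambda>d e x. d x + e x)\<rparr>"


section \<open>Quotients and tensor products\<close>

definition quot_space ::
  "('r, 'a, 'm) module_scheme \<Rightarrow> 'a set \<Rightarrow> ('r, 'a set) module" where
  "quot_space M N = \<lparr>carrier = a_rcosets\<^bsub>M\<^esub> N, monoid.mult = undefined, one = undefined,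
     ring.zero = N, add = set_add M, smult = (\<lambda>r C. set_add M N (smult M r ` C))\<rparr>"

definition free_scale :: "'r::field \<Rightarrow> ('a \<Rightarrow>\<^sub>0 'r) \<Rightarrow> ('a \<Rightarrow>\<^sub>0 'r)" where
  "free_scale r = Poly_Mapping.map ((*) r)"

definition free_space :: "'a set \<Rightarrow> ('r::field, 'a \<Rightarrow>\<^sub>0 'r) module" where
  "free_space A = (space_of free_scale)\<lparr>carrier := {f. Poly_Mapping.keys f \<subseteq> A}\<rparr>"

text \<open>
  \<open>\<Theta> \<otimes>\<^sub>D V\<close> for a right \<open>D\<close>-module \<open>\<Theta>\<close> (action \<open>act\<close>) and a vector space \<open>V\<close>, with scalar
  multiplication \<open>sc\<close>, on which the ring \<open>D\<close> of operators acts on the left by evaluation: the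
  free vector space on symbols \<open>(x, y)\<close> modulo bilinearity and \<open>D\<close>-balancedness.
\<close>

definition tensor_relations ::
  "('v \<Rightarrow> 'v) ring \<Rightarrow> ('r::field, 't, 'm) module_scheme \<Rightarrow> ('t \<Rightarrow> ('v \<Rightarrow> 'v) \<Rightarrow> 't) \<Rightarrow>
   ('r \<Rightarrow> 'v::ab_group_add \<Rightarrow> 'v) \<Rightarrow> ('t \<times> 'v \<Rightarrow>\<^sub>0 'r) set" where
  "tensor_relations D \<Theta> act sc = (let e = (\<lambda>x y. Poly_Mapping.single (x, y) 1) in
     {e (x \<oplus>\<^bsub>\<Theta>\<^esub> x') y - e x y - e x' y | x x' y. x \<in> carrier \<Theta> \<and> x' \<in> carrier \<Theta>} \<union>
     {e x (y + y') - e x y - e x y' | x y y'. x \<in> carrier \<Theta>} \<union>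
     {e (r \<odot>\<^bsub>\<Theta>\<^esub> x) y - free_scale r (e x y) | r x y. x \<in> carrier \<Theta>} \<union>
     {e x (sc r y) - free_scale r (e x y) | r x y. x \<in> carrier \<Theta>} \<union>
     {e (act x d) y - e x (d y) | x d y. x \<in> carrier \<Theta> \<and> d \<in> carrier D})"

definition tensor_space ::
  "('v \<Rightarrow> 'v) ring \<Rightarrow> ('r::field, 't, 'm) module_scheme \<Rightarrow> ('t \<Rightarrow> ('v \<Rightarrow> 'v) \<Rightarrow> 't) \<Rightarrow>
   ('r \<Rightarrow> 'v::ab_group_add \<Rightarrow> 'v) \<Rightarrow> ('r, ('t \<times> 'v \<Rightarrow>\<^sub>0 'r) set) module" where
  "tensor_space D \<Theta> act sc = quot_space (free_space (carrier \<Theta> \<times> UNIV))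
     (Modules.module.span free_scale (tensor_relations D \<Theta> act sc))"

text \<open>The map induced on the tensor product by \<open>(x, y) \<mapsto> (f x, g y)\<close>, on cosets.\<close>

definition tensor_map ::
  "('t \<Rightarrow> 't) \<Rightarrow> ('v \<Rightarrow> 'v) \<Rightarrow> ('t \<times> 'v \<Rightarrow>\<^sub>0 'r::field) set \<Rightarrow> ('t \<times> 'v \<Rightarrow>\<^sub>0 'r) set" where
  "tensor_map f g C = (\<lambda>u. \<Sum>k\<in>Poly_Mapping.keys u.
     Poly_Mapping.single (f (fst k), g (snd k)) (Poly_Mapping.lookup u k)) ` C"


section \<open>Symplectic spaces, the Heisenberg group and reductive dual pairs\<close>

definition symplectic_space ::
  "('f::field \<Rightarrow> 'w::ab_group_add \<Rightarrow> 'w) \<Rightarrow> ('w \<Rightarrow> 'w \<Rightarrow> 'f) \<Rightarrow> bool" where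
  "symplectic_space scW B \<longleftrightarrow> (\<exists>E. finite_dimensional_vector_space scW E) \<and>
     (\<forall>w. Vector_Spaces.linear scW (*) (B w)) \<and>
     (\<forall>w. Vector_Spaces.linear scW (*) (\<lambda>u. B u w)) \<and>
     (\<forall>w. B w w = 0) \<and> (\<forall>w. (\<forall>u. B w u = 0) \<longrightarrow> w = 0)"

text \<open>
  The natural topology of a finite-dimensional space: the initial topology of all linear forms,
  which is the product topology in the coordinates of any basis.
\<close>

definition vec_top ::
  "('f::field \<Rightarrow> real) \<Rightarrow> ('f \<Rightarrow> 'w::ab_group_add \<Rightarrow> 'w) \<Rightarrow> 'w topology" where
  "vec_top v scW = topology_generated_by
     {l -` U | l U. Vector_Spaces.linear scW (*) l \<and> openin (field_top v) U}"

definition heisenberg :: "('w::ab_group_add \<Rightarrow> 'w \<Rightarrow> 'f::field) \<Rightarrow> ('w \<times> 'f) monoid" where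
  "heisenberg B = \<lparr>carrier = UNIV,
     monoid.mult = (\<lambda>(w, t) (w', t'). (w + w', t + t' + B w w' / 2)), one = (0, 0)\<rparr>"

definition heisenberg_top ::
  "('f::field \<Rightarrow> real) \<Rightarrow> ('f \<Rightarrow> 'w::ab_group_add \<Rightarrow> 'w) \<Rightarrow> ('w \<times> 'f) topology" where
  "heisenberg_top v scW = prod_topology (vec_top v scW) (field_top v)"

text \<open>
  Symplectic transformations are multiplied as right operators: the product of \<open>g\<close> and \<open>h\<close> is
  \<open>h \<circ> g\<close>. With this convention the relation \<open>M \<rho>(w,t) M\<^sup>-\<^sup>1 = \<rho>(g\<^sup>-\<^sup>1 w, t)\<close> below defines a
  subgroup of \<open>Sp(W) \<times> GL(S)\<close>; with left operators it would do so only after replacing \<open>g\<close>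
  by its inverse.
\<close>

definition Sp_group ::
  "('f::field \<Rightarrow> 'w::ab_group_add \<Rightarrow> 'w) \<Rightarrow> ('w \<Rightarrow> 'w \<Rightarrow> 'f) \<Rightarrow> ('w \<Rightarrow> 'w) monoid" where
  "Sp_group scW B = \<lparr>carrier = {g. Vector_Spaces.linear scW scW g \<and> bij g \<and>
                                   (\<forall>x y. B (g x) (g y) = B x y)},
     monoid.mult = (\<lambda>g h. h \<circ> g), one = id\<rparr>"

definition Sp_top ::
  "('f::field \<Rightarrow> real) \<Rightarrow> ('f \<Rightarrow> 'w::ab_group_add \<Rightarrow> 'w) \<Rightarrow> ('w \<Rightarrow> 'w \<Rightarrow> 'f) \<Rightarrow>
   ('w \<Rightarrow> 'w) topology" where
  "Sp_top v scW B = subtopology (product_topology (\<lambda>_. vec_top v scW) UNIV)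
                                (carrier (Sp_group scW B))"

text \<open>
  A subgroup of \<open>Sp(W)\<close> is called reductive when it acts reductively on \<open>W\<close>, as in Howe's
  definition of reductive dual pairs: every stable subspace has a stable complement.
\<close>

definition reductive_subgroup ::
  "('f::field \<Rightarrow> 'w::ab_group_add \<Rightarrow> 'w) \<Rightarrow> ('w \<Rightarrow> 'w \<Rightarrow> 'f) \<Rightarrow> ('w \<Rightarrow> 'w) set \<Rightarrow> bool" where
  "reductive_subgroup scW B H \<longleftrightarrow> subgroup H (Sp_group scW B) \<and>
     (\<forall>U. Modules.module.subspace scW U \<and> (\<forall>h\<in>H. h ` U \<subseteq> U) \<longrightarrow>
        (\<exists>U'. Modules.module.subspace scW U' \<and> (\<forall>h\<in>H. h ` U' \<subseteq> U') \<and>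
              U \<inter> U' = {0} \<and> (\<forall>w. \<exists>x\<in>U. \<exists>y\<in>U'. w = x + y)))"

definition Sp_centralizer ::
  "('f::field \<Rightarrow> 'w::ab_group_add \<Rightarrow> 'w) \<Rightarrow> ('w \<Rightarrow> 'w \<Rightarrow> 'f) \<Rightarrow> ('w \<Rightarrow> 'w) set \<Rightarrow>
   ('w \<Rightarrow> 'w) set" where
  "Sp_centralizer scW B H = {g \<in> carrier (Sp_group scW B). \<forall>h\<in>H. g \<circ> h = h \<circ> g}"

definition reductive_dual_pair ::
  "('f::field \<Rightarrow> 'w::ab_group_add \<Rightarrow> 'w) \<Rightarrow> ('w \<Rightarrow> 'w \<Rightarrow> 'f) \<Rightarrow> ('w \<Rightarrow> 'w) set \<Rightarrow>
   ('w \<Rightarrow> 'w) set \<Rightarrow> bool" where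
  "reductive_dual_pair scW B H\<^sub>1 H\<^sub>2 \<longleftrightarrow>
     reductive_subgroup scW B H\<^sub>1 \<and> reductive_subgroup scW B H\<^sub>2 \<and>
     H\<^sub>2 = Sp_centralizer scW B H\<^sub>1 \<and> H\<^sub>1 = Sp_centralizer scW B H\<^sub>2"


section \<open>The metaplectic group and the Weil representation\<close>

definition compact_open_top :: "'a topology \<Rightarrow> 'b topology \<Rightarrow> ('a \<Rightarrow> 'b) topology" where
  "compact_open_top T T' =
     topology_generated_by {{f. f ` K \<subseteq> U} | K U. compactin T K \<and> openin T' U}"

definition GL_group ::
  "('r::field \<Rightarrow> 's::ab_group_add \<Rightarrow> 's) \<Rightarrow> ('s \<Rightarrow> 's) monoid" where
  "GL_group scS = \<lparr>carrier = {M. Vector_Spaces.linear scS scS M \<and> bij M},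
     monoid.mult = (\<circ>), one = id\<rparr>"

definition GL_top ::
  "('r::field \<Rightarrow> 's::ab_group_add \<Rightarrow> 's) \<Rightarrow> ('s \<Rightarrow> 's) topology" where
  "GL_top scS = subtopology (compact_open_top (discrete_topology UNIV) (discrete_topology UNIV))
                            (carrier (GL_group scS))"

definition Mp_group ::
  "('f::field \<Rightarrow> 'w::ab_group_add \<Rightarrow> 'w) \<Rightarrow> ('w \<Rightarrow> 'w \<Rightarrow> 'f) \<Rightarrow>
   ('r::field \<Rightarrow> 's::ab_group_add \<Rightarrow> 's) \<Rightarrow> ('w \<times> 'f \<Rightarrow> 's \<Rightarrow> 's) \<Rightarrow>
   (('w \<Rightarrow> 'w) \<times> ('s \<Rightarrow> 's)) monoid" where
  "Mp_group scW B scS \<rho> = (Sp_group scW B \<times>\<times> GL_group scS)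
     \<lparr>carrier := {(g, M). g \<in> carrier (Sp_group scW B) \<and> M \<in> carrier (GL_group scS) \<and>
        (\<forall>w t. M \<circ> \<rho> (w, t) \<circ> inv_into UNIV M = \<rho> (inv_into UNIV g w, t))}\<rparr>"

definition Mp_top ::
  "('f::field \<Rightarrow> real) \<Rightarrow> ('f \<Rightarrow> 'w::ab_group_add \<Rightarrow> 'w) \<Rightarrow> ('w \<Rightarrow> 'w \<Rightarrow> 'f) \<Rightarrow>
   ('r::field \<Rightarrow> 's::ab_group_add \<Rightarrow> 's) \<Rightarrow> ('w \<times> 'f \<Rightarrow> 's \<Rightarrow> 's) \<Rightarrow>
   (('w \<Rightarrow> 'w) \<times> ('s \<Rightarrow> 's)) topology" where
  "Mp_top v scW B scS \<rho> = subtopology (prod_topology (Sp_top v scW B) (GL_top scS))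
                                       (carrier (Mp_group scW B scS \<rho>))"

text \<open>The inverse image of \<open>H\<close> in the derived group of the metaplectic group.\<close>

definition hat_group ::
  "('f::field \<Rightarrow> 'w::ab_group_add \<Rightarrow> 'w) \<Rightarrow> ('w \<Rightarrow> 'w \<Rightarrow> 'f) \<Rightarrow>
   ('r::field \<Rightarrow> 's::ab_group_add \<Rightarrow> 's) \<Rightarrow> ('w \<times> 'f \<Rightarrow> 's \<Rightarrow> 's) \<Rightarrow> ('w \<Rightarrow> 'w) set \<Rightarrow>
   (('w \<Rightarrow> 'w) \<times> ('s \<Rightarrow> 's)) monoid" where
  "hat_group scW B scS \<rho> H = (Mp_group scW B scS \<rho>)
     \<lparr>carrier := {(g, M) \<in> derived (Mp_group scW B scS \<rho>) (carrier (Mp_group scW B scS \<rho>)). g \<in> H}\<rparr>"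

definition hat_top ::
  "('f::field \<Rightarrow> real) \<Rightarrow> ('f \<Rightarrow> 'w::ab_group_add \<Rightarrow> 'w) \<Rightarrow> ('w \<Rightarrow> 'w \<Rightarrow> 'f) \<Rightarrow>
   ('r::field \<Rightarrow> 's::ab_group_add \<Rightarrow> 's) \<Rightarrow> ('w \<times> 'f \<Rightarrow> 's \<Rightarrow> 's) \<Rightarrow> ('w \<Rightarrow> 'w) set \<Rightarrow>
   (('w \<Rightarrow> 'w) \<times> ('s \<Rightarrow> 's)) topology" where
  "hat_top v scW B scS \<rho> H =
     subtopology (Mp_top v scW B scS \<rho>) (carrier (hat_group scW B scS \<rho> H))"

definition weil_rep :: "('w \<Rightarrow> 'w) \<times> ('s \<Rightarrow> 's) \<Rightarrow> 's \<Rightarrow> 's" where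
  "weil_rep = (\<lambda>(g, M). M)"

definition genuine ::
  "(('w \<Rightarrow> 'w) \<times> ('s \<Rightarrow> 's), 'm) monoid_scheme \<Rightarrow> ('r::field \<Rightarrow> 's::ab_group_add \<Rightarrow> 's) \<Rightarrow>
   ('r, 'a, 'n) module_scheme \<Rightarrow> (('w \<Rightarrow> 'w) \<times> ('s \<Rightarrow> 's) \<Rightarrow> 'a \<Rightarrow> 'a) \<Rightarrow> bool" where
  "genuine G scS M \<sigma> \<longleftrightarrow>
     (\<forall>r. (id, scS r) \<in> carrier G \<longrightarrow> (\<forall>x\<in>carrier M. \<sigma> (id, scS r) x = r \<odot>\<^bsub>M\<^esub> x))"


section \<open>Isotypic quotients and theta lifts\<close>

definition isotypic_kernel ::
  "(('w \<Rightarrow> 'w) \<times> ('s \<Rightarrow> 's), 'm) monoid_scheme \<Rightarrow> ('r::field \<Rightarrow> 's::ab_group_add \<Rightarrow> 's) \<Rightarrow>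
   ('r \<Rightarrow> 'v::ab_group_add \<Rightarrow> 'v) \<Rightarrow> (('w \<Rightarrow> 'w) \<times> ('s \<Rightarrow> 's) \<Rightarrow> 'v \<Rightarrow> 'v) \<Rightarrow> 's set" where
  "isotypic_kernel G scS scV \<pi> =
     (\<Inter>f\<in>intertwiners G (space_of scS) weil_rep (space_of scV) \<pi>. {x. f x = 0})"

text \<open>
  A genuine smooth representation \<open>\<theta>\<close> of \<open>G\<^sub>2\<close> with a compatible right action of \<open>D\<close>. Since \<open>D\<close>
  is an algebra over the coefficient field, compatibility includes that its scalars act on \<open>\<Theta>\<close>
  by scalar multiplication.
\<close>

definition right_module_rep ::
  "(('w \<Rightarrow> 'w) \<times> ('s \<Rightarrow> 's), 'm) monoid_scheme \<Rightarrow> (('w \<Rightarrow> 'w) \<times> ('s \<Rightarrow> 's)) topology \<Rightarrow>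
   ('r::field \<Rightarrow> 's::ab_group_add \<Rightarrow> 's) \<Rightarrow> ('v \<Rightarrow> 'v) ring \<Rightarrow> ('r \<Rightarrow> 'v::ab_group_add \<Rightarrow> 'v) \<Rightarrow>
   ('r, 't, 'n) module_scheme \<Rightarrow> (('w \<Rightarrow> 'w) \<times> ('s \<Rightarrow> 's) \<Rightarrow> 't \<Rightarrow> 't) \<Rightarrow>
   ('t \<Rightarrow> ('v \<Rightarrow> 'v) \<Rightarrow> 't) \<Rightarrow> bool" where
  "right_module_rep G\<^sub>2 T\<^sub>2 scS D scV \<Theta> \<theta> act \<longleftrightarrow>
     smooth_rep G\<^sub>2 T\<^sub>2 \<Theta> \<theta> \<and> genuine G\<^sub>2 scS \<Theta> \<theta> \<and>
     (\<forall>d\<in>carrier D. (\<lambda>x. act x d) \<in> intertwiners G\<^sub>2 \<Theta> \<theta> \<Theta> \<theta>) \<and>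
     (\<forall>x\<in>carrier \<Theta>. act x \<one>\<^bsub>D\<^esub> = x) \<and>
     (\<forall>x\<in>carrier \<Theta>. \<forall>d\<in>carrier D. \<forall>e\<in>carrier D. act x (d \<otimes>\<^bsub>D\<^esub> e) = act (act x d) e) \<and>
     (\<forall>x\<in>carrier \<Theta>. \<forall>d\<in>carrier D. \<forall>e\<in>carrier D. act x (d \<oplus>\<^bsub>D\<^esub> e) = act x d \<oplus>\<^bsub>\<Theta>\<^esub> act x e) \<and>
     (\<forall>x\<in>carrier \<Theta>. \<forall>r. act x (scV r) = r \<odot>\<^bsub>\<Theta>\<^esub> x)"

text \<open>
  \<open>(\<Theta>, \<theta>, act)\<close> is a theta lift of \<open>\<pi>\<close>: the largest \<open>\<pi>\<close>-isotypic quotient of the Weil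
  representation is isomorphic to \<open>\<Theta> \<otimes>\<^sub>D \<pi>\<close> as a smooth representation of \<open>G\<^sub>1 \<times> G\<^sub>2\<close>.
\<close>

definition theta_lift ::
  "(('w \<Rightarrow> 'w) \<times> ('s \<Rightarrow> 's)) monoid \<Rightarrow> (('w \<Rightarrow> 'w) \<times> ('s \<Rightarrow> 's)) topology \<Rightarrow>
   (('w \<Rightarrow> 'w) \<times> ('s \<Rightarrow> 's)) monoid \<Rightarrow> (('w \<Rightarrow> 'w) \<times> ('s \<Rightarrow> 's)) topology \<Rightarrow>
   ('r::field \<Rightarrow> 's::ab_group_add \<Rightarrow> 's) \<Rightarrow>
   ('r \<Rightarrow> 'v::ab_group_add \<Rightarrow> 'v) \<Rightarrow> (('w \<Rightarrow> 'w) \<times> ('s \<Rightarrow> 's) \<Rightarrow> 'v \<Rightarrow> 'v) \<Rightarrow>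
   ('r, 't) module \<Rightarrow> (('w \<Rightarrow> 'w) \<times> ('s \<Rightarrow> 's) \<Rightarrow> 't \<Rightarrow> 't) \<Rightarrow>
   ('t \<Rightarrow> ('v \<Rightarrow> 'v) \<Rightarrow> 't) \<Rightarrow> bool" where
  "theta_lift G\<^sub>1 T\<^sub>1 G\<^sub>2 T\<^sub>2 scS scV \<pi> \<Theta> \<theta> act \<longleftrightarrow>
     right_module_rep G\<^sub>2 T\<^sub>2 scS (End_ring G\<^sub>1 scV \<pi>) scV \<Theta> \<theta> act \<and>
     smooth_rep_iso (G\<^sub>1 \<times>\<times> G\<^sub>2) (prod_topology T\<^sub>1 T\<^sub>2)
       (quot_space (space_of scS) (isotypic_kernel G\<^sub>1 scS scV \<pi>))
       (\<lambda>(g\<^sub>1, g\<^sub>2) C. (weil_rep g\<^sub>1 \<circ> weil_rep g\<^sub>2) ` C)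
       (tensor_space (End_ring G\<^sub>1 scV \<pi>) \<Theta> act scV)
       (\<lambda>(g\<^sub>1, g\<^sub>2). tensor_map (\<theta> g\<^sub>2) (\<pi> g\<^sub>1))"

definition bimodule_iso ::
  "('g, 'm) monoid_scheme \<Rightarrow> 'd ring \<Rightarrow>
   ('r::field, 't) module \<Rightarrow> ('g \<Rightarrow> 't \<Rightarrow> 't) \<Rightarrow> ('t \<Rightarrow> 'd \<Rightarrow> 't) \<Rightarrow>
   ('r, 'u) module \<Rightarrow> ('g \<Rightarrow> 'u \<Rightarrow> 'u) \<Rightarrow> ('u \<Rightarrow> 'd \<Rightarrow> 'u) \<Rightarrow> bool" where
  "bimodule_iso G D \<Theta> \<theta> act \<Theta>' \<theta>' act' \<longleftrightarrow>
     (\<exists>f\<in>intertwiners G \<Theta> \<theta> \<Theta>' \<theta>'. bij_betw f (carrier \<Theta>) (carrier \<Theta>') \<and>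
        (\<forall>x\<in>carrier \<Theta>. \<forall>d\<in>carrier D. f (act x d) = act' (f x) d))"

end

(*
  Commutation. Write U w for rho(w, 0). Every operator on S, restricted to the vectors fixed by a
  compact open isotropic subgroup L, is a finite combination of the U w, and by
  independence of characters the sum of the coefficients with w in L, the "coefficient at the
  origin", is well defined. Let M and N lift commuting symplectic transformations. By Schur's lemma
  N M N^-1 = c M. The coefficient of N M N^-1 relative to h L is that of M relative to L, where h is
  the action of N on W. For small L the coefficient of M depends on L only through indices in the
  image I of T = k - 1, with k the action of M. As h commutes with k, it acts on I and
  respects the duality of I with itself given by T, so its modulus on I is 1. As
  the coefficient is non-zero for a suitable L, this gives c = 1.

  Existence. A vector of the maximal pi-isotypic quotient Q is fixed by an open subgroup, so its
  images under all homomorphisms to pi span a finite-dimensional space by admissibility. Hence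
  finitely many homomorphisms separate the module it generates, which is a sum of copies of pi.
  So Q is generated by copies of pi, and evaluation Hom(pi, Q) (x) pi --> Q is an isomorphism over
  the division ring D = End(pi).

  Uniqueness. The theta lift is recovered from the tensor product as Hom(pi, Theta (x) pi).
*)
theory Submission
  imports Defs
begin

section \<open>Characters and duality of finite quotients\<close>

subsection \<open>Linear algebra of characters\<close>

text \<open>The field R of coefficients has no topology, need not be algebraically closed and may
  have any characteristic that psi allows, and the model S is abstract. So there are no integrals
  and no explicit polarization. Integrals become finite sums over quotients of lattices, and the
  indices by which one divides are shown to be non-zero in R by counting characters. A polarization
  is replaced by a vector that is an eigenvector of as many U w as possible: its eigencharacter
  occurs on a single line, which yields Schur's lemma with a scalar in R itself, and projections
  onto a line.

  The obstacle in comparing the coefficients relative to L and h L is that translations of the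
  coefficient carry quadratic phases. They are avoided by restricting to lattices on which these
  phases are trivial; such lattices are stable under h and under shrinking.

  Commutation matters because the second group acts on the isotypic quotient only if it permutes the
  homomorphisms from S to pi. Over a general R, End(pi) may be larger than R, and linear algebra
  over it uses bases and dual forms over a division ring.\<close>

lemma homogeneous_system_nontrivial:
  fixes a :: "'j \<Rightarrow> 'q \<Rightarrow> 'r::field"
  assumes "finite Q" "finite J" "card Q < card J"
  shows "\<exists>c. (\<exists>j\<in>J. c j \<noteq> 0) \<and> (\<forall>q\<in>Q. (\<Sum>j\<in>J. c j * a j q) = 0)"
  using assms
proof (induction Q arbitrary: J a rule: finite_induct)
  case empty
  then obtain j where "j \<in> J" by fastforce
  then show ?case by (intro exI[of _ "\<lambda>_. 1"]) auto
next
  case (insert q Q)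
  show ?case
  proof (cases "\<forall>j\<in>J. a j q = 0")
    case True
    from insert.IH[OF insert.prems(1), of a] insert.prems insert.hyps
    obtain c where "\<exists>j\<in>J. c j \<noteq> 0" "\<forall>q\<in>Q. (\<Sum>j\<in>J. c j * a j q) = 0" by auto
    with True show ?thesis by (intro exI[of _ c]) auto
  next
    case False
    then obtain j0 where j0: "j0 \<in> J" "a j0 q \<noteq> 0" by auto
    \<comment> \<open>Gaussian elimination: equation \<open>q\<close> is solved for the unknown at
      \<open>j0\<close>, and the result is substituted into the other equations.\<close>
    let ?a = "\<lambda>j q'. a j q' - a j q / a j0 q * a j0 q'"
    have "card Q < card (J - {j0})" using insert.prems insert.hyps j0 by simp
    from insert.IH[OF _ this, of ?a] insert.prems(1)
    obtain c where c: "\<exists>j\<in>J - {j0}. c j \<noteq> 0" "\<forall>q'\<in>Q. (\<Sum>j\<in>J - {j0}. c j * ?a j q') = 0"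
      by auto
    let ?s = "\<Sum>j\<in>J - {j0}. c j * a j q"
    let ?c = "c(j0 := - ?s / a j0 q)"
    have split: "(\<Sum>j\<in>J. ?c j * a j x) = - ?s / a j0 q * a j0 x + (\<Sum>j\<in>J - {j0}. c j * a j x)" for x
    proof -
      have "(\<Sum>j\<in>J. ?c j * a j x) = ?c j0 * a j0 x + (\<Sum>j\<in>J - {j0}. ?c j * a j x)"
        using insert.prems(1) j0(1) by (rule sum.remove)
      also have "(\<Sum>j\<in>J - {j0}. ?c j * a j x) = (\<Sum>j\<in>J - {j0}. c j * a j x)"
        by (rule sum.cong) auto
      finally show ?thesis by simp
    qed
    have 1: "(\<Sum>j\<in>J. ?c j * a j x) = 0" if "x \<in> insert q Q" for x
    proof (cases "x = q")
      case True
      then show ?thesis unfolding split using j0 by simp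
    next
      case False
      then have "(\<Sum>j\<in>J - {j0}. c j * ?a j x) = 0" using c that by auto
      moreover have "(\<Sum>j\<in>J - {j0}. c j * ?a j x)
          = (\<Sum>j\<in>J - {j0}. c j * a j x - c j * a j q * (a j0 x / a j0 q))"
        by (rule sum.cong) (auto simp: algebra_simps)
      moreover have "\<dots> = (\<Sum>j\<in>J - {j0}. c j * a j x) - ?s * (a j0 x / a j0 q)"
        by (simp only: sum_subtractf sum_distrib_right)
      ultimately show ?thesis unfolding split by simp
    qed
    have 2: "\<exists>j\<in>J. ?c j \<noteq> 0"
    proof -
      obtain i where "i \<in> J - {j0}" "c i \<noteq> 0" using c by blast
      then have "i \<in> J" "?c i \<noteq> 0" by auto
      then show ?thesis by blast
    qed
    show ?thesis by (rule exI[of _ ?c], rule conjI[OF 2], rule ballI, rule 1)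
  qed
qed

text \<open>Dedekind's argument with vectors as coefficients. Two indices may carry the same
  character on \<open>P\<close>, so what vanishes is the sum of the coefficients over each class of
  indices with equal characters; this is the form needed for combinations with repetitions.\<close>

lemma (in vector_space) character_independence:
  fixes \<kappa> :: "'j \<Rightarrow> 'w::monoid_add \<Rightarrow> 'a"
  assumes "finite J" "0 \<in> P" "\<And>u v. u \<in> P \<Longrightarrow> v \<in> P \<Longrightarrow> u + v \<in> P"
    and "\<And>j. j \<in> J \<Longrightarrow> \<kappa> j 0 = 1"
    and "\<And>j u v. j \<in> J \<Longrightarrow> u \<in> P \<Longrightarrow> v \<in> P \<Longrightarrow> \<kappa> j (u + v) = \<kappa> j u * \<kappa> j v"
    and "\<And>u. u \<in> P \<Longrightarrow> (\<Sum>j\<in>J. scale (\<kappa> j u) (y j)) = 0"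
    and "j0 \<in> J"
  shows "(\<Sum>j | j \<in> J \<and> (\<forall>u\<in>P. \<kappa> j u = \<kappa> j0 u). y j) = 0"
  using assms
proof (induction "card J" arbitrary: J y rule: less_induct)
  case less
  show ?case
  proof (cases "\<forall>j\<in>J. \<forall>u\<in>P. \<kappa> j u = \<kappa> j0 u")
    case True
    then have "{j \<in> J. \<forall>u\<in>P. \<kappa> j u = \<kappa> j0 u} = J" by auto
    then show ?thesis using less.prems(6)[OF less.prems(2)] less.prems(4) by simp
  next
    case False
    then obtain j1 u1 where j1: "j1 \<in> J" "u1 \<in> P" "\<kappa> j1 u1 \<noteq> \<kappa> j0 u1" by auto
    \<comment> \<open>Subtracting the relation at \<open>u\<close>, scaled by the value of the
      character \<open>j1\<close> at \<open>u1\<close>, from the relation at \<open>u + u1\<close>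
      removes the index \<open>j1\<close>. On the class of \<open>j0\<close> it multiplies all
      coefficients by one and the same non-zero scalar.\<close>
    let ?y = "\<lambda>j. scale (\<kappa> j u1 - \<kappa> j1 u1) (y j)"
    have 1: "(\<Sum>j\<in>J - {j1}. scale (\<kappa> j u) (?y j)) = 0" if u: "u \<in> P" for u
    proof -
      have "(\<Sum>j\<in>J - {j1}. scale (\<kappa> j u) (?y j)) = (\<Sum>j\<in>J. scale (\<kappa> j u) (?y j))"
        using j1 less.prems(1) by (subst (2) sum.remove[of _ j1]) auto
      also have "\<dots> = (\<Sum>j\<in>J. scale (\<kappa> j (u + u1)) (y j) - scale (\<kappa> j1 u1) (scale (\<kappa> j u) (y j)))"
        using less.prems(5)[OF _ u j1(2)]
        by (intro sum.cong) (auto simp: scale_left_diff_distrib algebra_simps)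
      also have "\<dots> = 0"
        using less.prems(6)[OF u] less.prems(6)[OF less.prems(3)[OF u j1(2)]]
        by (simp only: sum_subtractf scale_sum_right[symmetric]) simp
      finally show ?thesis .
    qed
    have "card (J - {j1}) < card J" using j1 less.prems(1) by (meson card_Diff1_less)
    moreover have "j0 \<in> J - {j1}" using j1 less.prems by auto
    ultimately have "(\<Sum>j | j \<in> J - {j1} \<and> (\<forall>u\<in>P. \<kappa> j u = \<kappa> j0 u). ?y j) = 0"
      using less.prems 1 by (intro less.hyps) auto
    also have "{j. j \<in> J - {j1} \<and> (\<forall>u\<in>P. \<kappa> j u = \<kappa> j0 u)} = {j \<in> J. \<forall>u\<in>P. \<kappa> j u = \<kappa> j0 u}"
      using j1 by auto
    also have "(\<Sum>j\<in>{j \<in> J. \<forall>u\<in>P. \<kappa> j u = \<kappa> j0 u}. ?y j)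
        = scale (\<kappa> j0 u1 - \<kappa> j1 u1) (\<Sum>j\<in>{j \<in> J. \<forall>u\<in>P. \<kappa> j u = \<kappa> j0 u}. y j)"
      using j1 by (simp add: scale_sum_right)
    finally show ?thesis using j1 by simp
  qed
qed

lemma vector_space_self: "vector_space ((*) :: 'r::field \<Rightarrow> 'r \<Rightarrow> 'r)"
  by unfold_locales (auto simp: algebra_simps)

subsection \<open>Cosets\<close>

definition add_subgroup :: "'a::ab_group_add set \<Rightarrow> bool" where
  "add_subgroup A \<longleftrightarrow> 0 \<in> A \<and> (\<forall>x\<in>A. \<forall>y\<in>A. x - y \<in> A)"

definition coset :: "'a::ab_group_add set \<Rightarrow> 'a \<Rightarrow> 'a set" where
  "coset B x = {y. y - x \<in> B}"

text \<open>The sets need not be nested, and \<open>A\<close> need not be a subgroup: this is the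
  image of \<open>A\<close> in the quotient by \<open>B\<close>. For subgroups it has as many
  elements as A / (A \<inter> B).\<close>

definition cosets :: "'a::ab_group_add set \<Rightarrow> 'a set \<Rightarrow> 'a set set" where
  "cosets A B = coset B ` A"

definition rep :: "'a set \<Rightarrow> 'a" where
  "rep C = (SOME x. x \<in> C)"

lemma add_subgroupD:
  assumes "add_subgroup A"
  shows "0 \<in> A" "x \<in> A \<Longrightarrow> y \<in> A \<Longrightarrow> x - y \<in> A" "x \<in> A \<Longrightarrow> - x \<in> A"
    "x \<in> A \<Longrightarrow> y \<in> A \<Longrightarrow> x + y \<in> A"
proof -
  have 0: "0 \<in> A" and diff: "\<And>x y. x \<in> A \<Longrightarrow> y \<in> A \<Longrightarrow> x - y \<in> A"
    using assms by (auto simp: add_subgroup_def)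
  have minus: "- x \<in> A" if "x \<in> A" for x using diff[OF 0 that] by simp
  show "0 \<in> A" "x \<in> A \<Longrightarrow> y \<in> A \<Longrightarrow> x - y \<in> A" "x \<in> A \<Longrightarrow> - x \<in> A" using 0 diff minus by auto
  show "x \<in> A \<Longrightarrow> y \<in> A \<Longrightarrow> x + y \<in> A" using diff[OF _ minus] by fastforce
qed

lemma add_subgroup_swap: "add_subgroup A \<Longrightarrow> x - y \<in> A \<longleftrightarrow> y - x \<in> A"
  using add_subgroupD(3)[of A "x - y"] add_subgroupD(3)[of A "y - x"] by auto

lemma add_subgroup_Int: "add_subgroup A \<Longrightarrow> add_subgroup B \<Longrightarrow> add_subgroup (A \<inter> B)"
  by (auto simp: add_subgroup_def)

lemma add_subgroup_add_iff:
  assumes "add_subgroup A" "y \<in> A"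
  shows "x + y \<in> A \<longleftrightarrow> x \<in> A" "y + x \<in> A \<longleftrightarrow> x \<in> A" "x - y \<in> A \<longleftrightarrow> x \<in> A"
proof -
  show 1: "x + y \<in> A \<longleftrightarrow> x \<in> A" for x
    using add_subgroupD(2)[OF assms(1) _ assms(2), of "x + y"] add_subgroupD(4)[OF assms(1) _ assms(2)]
    by auto
  then show "y + x \<in> A \<longleftrightarrow> x \<in> A" by (simp add: add.commute)
  show "x - y \<in> A \<longleftrightarrow> x \<in> A" using 1[of "x - y"] by simp
qed

lemma coset_eq_iff:
  assumes "add_subgroup B"
  shows "coset B x = coset B y \<longleftrightarrow> x - y \<in> B"
proof
  assume "coset B x = coset B y"
  moreover have "x \<in> coset B x" using add_subgroupD(1)[OF assms] by (simp add: coset_def)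
  ultimately show "x - y \<in> B" by (simp add: coset_def)
next
  assume xy: "x - y \<in> B"
  have "z - x \<in> B \<longleftrightarrow> z - y \<in> B" for z
    using add_subgroup_add_iff(1)[OF assms xy, of "z - x"] by simp
  then show "coset B x = coset B y" by (auto simp: coset_def)
qed

lemma rep_mem:
  assumes "add_subgroup A" "add_subgroup B" "B \<subseteq> A" "C \<in> cosets A B"
  shows "rep C \<in> A" "coset B (rep C) = C" "rep C \<in> C"
proof -
  obtain x where x: "x \<in> A" "C = coset B x" using assms(4) by (auto simp: cosets_def)
  have "x \<in> C" using add_subgroupD(1)[OF assms(2)] x by (simp add: coset_def)
  then show r: "rep C \<in> C" unfolding rep_def by (rule someI)
  then have "rep C - x \<in> B" using x by (simp add: coset_def)
  then show "coset B (rep C) = C" using coset_eq_iff[OF assms(2)] x by simp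
  have "rep C - x \<in> A" using \<open>rep C - x \<in> B\<close> assms(3) by blast
  then show "rep C \<in> A" using add_subgroup_add_iff(3)[OF assms(1) x(1)] by blast
qed

lemma rep_coset:
  assumes "add_subgroup B"
  shows "rep (coset B x) - x \<in> B"
proof -
  have "x \<in> coset B x" using add_subgroupD(1)[OF assms] by (simp add: coset_def)
  then have "rep (coset B x) \<in> coset B x" unfolding rep_def by (rule someI)
  then show ?thesis by (simp add: coset_def)
qed

text \<open>Translation by \<open>a\<close> permutes the cosets. It respects chosen representatives
  only up to elements of \<open>B\<close>, and these are absorbed by the invariance of
  \<open>f\<close>.\<close>

lemma cosets_sum_translate:
  assumes A: "add_subgroup A" and B: "add_subgroup B" "B \<subseteq> A"
    and f: "\<And>x y. x \<in> A \<Longrightarrow> y \<in> B \<Longrightarrow> f (x + y) = f x" and a: "a \<in> A"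
  shows "(\<Sum>C\<in>cosets A B. f (rep C + a)) = (\<Sum>C\<in>cosets A B. f (rep C))"
proof -
  have *: "coset B (rep (coset B (rep C + a)) - a) = C"
    "coset B (rep C + a) \<in> cosets A B" "f (rep (coset B (rep C + a))) = f (rep C + a)"
    if "C \<in> cosets A B" "a \<in> A" for C a
  proof -
    note r = rep_mem[OF A B that(1)]
    have ra: "rep C + a \<in> A" using r that add_subgroupD(4)[OF A] by blast
    then show "coset B (rep C + a) \<in> cosets A B" by (auto simp: cosets_def)
    have d: "rep (coset B (rep C + a)) - (rep C + a) \<in> B" by (rule rep_coset[OF B(1)])
    then have "coset B (rep (coset B (rep C + a)) - a) = coset B (rep C)"
      unfolding coset_eq_iff[OF B(1)] by (simp add: algebra_simps)
    then show "coset B (rep (coset B (rep C + a)) - a) = C" using r by simp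
    show "f (rep (coset B (rep C + a))) = f (rep C + a)"
      using f[OF ra d] by simp
  qed
  have ma: "- a \<in> A" using a add_subgroupD(3)[OF A] by simp
  have minus: "coset B (rep (coset B (rep C - a)) + a) = C" "coset B (rep C - a) \<in> cosets A B"
    if "C \<in> cosets A B" for C
    using *(1,2)[OF that ma] by simp_all
  show ?thesis
    by (rule sum.reindex_bij_witness[of _ "\<lambda>C. coset B (rep C - a)" "\<lambda>C. coset B (rep C + a)"])
      (simp_all only: *[OF _ a] minus)
qed

lemma card_image_eq_kernel:
  assumes "\<And>x y. x \<in> A \<Longrightarrow> y \<in> A \<Longrightarrow> f x = f y \<longleftrightarrow> g x = g y"
  shows "card (f ` A) = card (g ` A)" "finite (f ` A) \<longleftrightarrow> finite (g ` A)"
proof -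
  have "bij_betw (\<lambda>z. g (SOME x. x \<in> A \<and> f x = z)) (f ` A) (g ` A)"
  proof (rule bij_betw_byWitness[where f' = "\<lambda>z. f (SOME x. x \<in> A \<and> g x = z)"])
    have 1: "(SOME x. x \<in> A \<and> f x = f a) \<in> A \<and> f (SOME x. x \<in> A \<and> f x = f a) = f a" if "a \<in> A" for a
      by (rule someI[of "\<lambda>x. x \<in> A \<and> f x = f a" a]) (use that in auto)
    have 2: "(SOME x. x \<in> A \<and> g x = g a) \<in> A \<and> g (SOME x. x \<in> A \<and> g x = g a) = g a" if "a \<in> A" for a
      by (rule someI[of "\<lambda>x. x \<in> A \<and> g x = g a" a]) (use that in auto)
    have 3: "g (SOME x. x \<in> A \<and> f x = f a) = g a" "f (SOME x. x \<in> A \<and> g x = g a) = f a" if "a \<in> A" for a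
      using 1[OF that] 2[OF that] assms that by metis+
    show "\<forall>z\<in>f ` A. f (SOME x. x \<in> A \<and> g x = g (SOME x. x \<in> A \<and> f x = z)) = z"
      using 3 by auto
    show "\<forall>z\<in>g ` A. g (SOME x. x \<in> A \<and> f x = f (SOME x. x \<in> A \<and> g x = z)) = z"
      using 3 by auto
    show "(\<lambda>z. g (SOME x. x \<in> A \<and> f x = z)) ` f ` A \<subseteq> g ` A" using 1 by auto
    show "(\<lambda>z. f (SOME x. x \<in> A \<and> g x = z)) ` g ` A \<subseteq> f ` A" using 2 by auto
  qed
  then show "card (f ` A) = card (g ` A)" "finite (f ` A) \<longleftrightarrow> finite (g ` A)"
    by (auto dest: bij_betw_same_card bij_betw_finite)
qed

text \<open>Both families are images of \<open>A\<close> under maps with the same fibres. With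
  \<open>T\<close> the identity this exchanges \<open>B\<close> for its intersection with
  \<open>A\<close>; with \<open>T\<close> equal to k - 1 it transports an index from W to the image
  of k - 1.\<close>

lemma card_cosets_image:
  assumes "add_subgroup B" "add_subgroup B'"
    and "\<And>x y. x \<in> A \<Longrightarrow> y \<in> A \<Longrightarrow> T x - T y \<in> B' \<longleftrightarrow> x - y \<in> B"
  shows "card (cosets (T ` A) B') = card (cosets A B)" "finite (cosets (T ` A) B') \<longleftrightarrow> finite (cosets A B)"
proof -
  have eq: "coset B' (T x) = coset B' (T y) \<longleftrightarrow> coset B x = coset B y" if "x \<in> A" "y \<in> A" for x y
    using assms that by (simp add: coset_eq_iff)
  show "card (cosets (T ` A) B') = card (cosets A B)" "finite (cosets (T ` A) B') \<longleftrightarrow> finite (cosets A B)"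
    unfolding cosets_def image_image using card_image_eq_kernel[of A "\<lambda>x. coset B' (T x)" "coset B"] eq
    by auto
qed

text \<open>An element of \<open>A\<close> is a representative modulo \<open>B\<close> plus a
  representative modulo \<open>C\<close>. The bijection holds for infinite families as well, where
  the cardinality 0 makes the equation true but void; positivity is therefore proved separately
  where it is used for cancellation.\<close>

lemma index_mult:
  assumes A: "add_subgroup A" and B: "add_subgroup B" "B \<subseteq> A" and C: "add_subgroup C" "C \<subseteq> B"
  shows "card (cosets A C) = card (cosets A B) * card (cosets B C)"
proof -
  have CA: "C \<subseteq> A" using B C by auto
  have "bij_betw (\<lambda>(Q, Y). coset C (rep Q + rep Y)) (cosets A B \<times> cosets B C) (cosets A C)"
    unfolding bij_betw_def
  proof
    show "inj_on (\<lambda>(Q, Y). coset C (rep Q + rep Y)) (cosets A B \<times> cosets B C)"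
    proof (rule inj_onI, clarify)
      fix Q Y Q' Y' assume Q: "Q \<in> cosets A B" "Q' \<in> cosets A B" and Y: "Y \<in> cosets B C" "Y' \<in> cosets B C"
        and "coset C (rep Q + rep Y) = coset C (rep Q' + rep Y')"
      then have d: "rep Q + rep Y - (rep Q' + rep Y') \<in> C" using coset_eq_iff[OF C(1)] by blast
      note rX = rep_mem[OF A B Q(1)] rep_mem[OF A B Q(2)]
      note rY = rep_mem[OF B(1) C Y(1)] rep_mem[OF B(1) C Y(2)]
      have "rep Q - rep Q' + (rep Y - rep Y') \<in> B" using d C by (auto simp: algebra_simps)
      then have "rep Q - rep Q' \<in> B"
        using add_subgroup_add_iff(1)[OF B(1)] add_subgroupD(2)[OF B(1)] rY by blast
      then have XX: "Q = Q'" using coset_eq_iff[OF B(1)] rX by metis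
      then have "rep Y - rep Y' \<in> C" using d by (simp add: algebra_simps)
      then have "Y = Y'" using coset_eq_iff[OF C(1)] rY by metis
      with XX show "Q = Q' \<and> Y = Y'" by simp
    qed
    show "(\<lambda>(Q, Y). coset C (rep Q + rep Y)) ` (cosets A B \<times> cosets B C) = cosets A C"
    proof safe
      fix Q Y assume Q: "Q \<in> cosets A B" and Y: "Y \<in> cosets B C"
      then have "rep Q + rep Y \<in> A"
        using rep_mem(1)[OF A B Q] rep_mem(1)[OF B(1) C Y] B(2) add_subgroupD(4)[OF A] by blast
      then show "coset C (rep Q + rep Y) \<in> cosets A C" by (auto simp: cosets_def)
    next
      fix Z assume Z: "Z \<in> cosets A C"
      then obtain z where z: "z \<in> A" "Z = coset C z" by (auto simp: cosets_def)
      let ?Q = "coset B z"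
      have Q: "?Q \<in> cosets A B" using z by (auto simp: cosets_def)
      have "z - rep ?Q \<in> B" using rep_coset[OF B(1), of z] add_subgroup_swap[OF B(1)] by blast
      then have Y: "coset C (z - rep ?Q) \<in> cosets B C" by (auto simp: cosets_def)
      have "rep (coset C (z - rep ?Q)) - (z - rep ?Q) \<in> C" by (rule rep_coset[OF C(1)])
      then have "rep ?Q + rep (coset C (z - rep ?Q)) - z \<in> C" by (simp add: algebra_simps)
      then have "coset C (rep ?Q + rep (coset C (z - rep ?Q))) = Z"
        using coset_eq_iff[OF C(1)] z by blast
      then show "Z \<in> (\<lambda>(Q, Y). coset C (rep Q + rep Y)) ` (cosets A B \<times> cosets B C)"
        using Q Y by (intro image_eqI[of _ _ "(?Q, coset C (z - rep ?Q))"]) auto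
    qed
  qed
  then have "card (cosets A B \<times> cosets B C) = card (cosets A C)" by (rule bij_betw_same_card)
  then show ?thesis by (simp add: card_cartesian_product)
qed

lemma finite_cosets_mono:
  assumes "add_subgroup B" "add_subgroup B'" "A' \<subseteq> A" "B \<subseteq> B'" "finite (cosets A B)"
  shows "finite (cosets A' B')"
proof -
  have "cosets A' B' \<subseteq> (\<lambda>C. coset B' (rep C)) ` cosets A B"
  proof
    fix Z assume "Z \<in> cosets A' B'"
    then obtain z where z: "z \<in> A'" "Z = coset B' z" by (auto simp: cosets_def)
    have "coset B' (rep (coset B z)) = Z"
      using rep_coset[OF assms(1), of z] assms(4) z by (auto simp: coset_eq_iff[OF assms(2)])
    then show "Z \<in> (\<lambda>C. coset B' (rep C)) ` cosets A B" using z assms(3) by (auto simp: cosets_def)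
  qed
  then show ?thesis using assms(5) finite_surj by blast
qed

subsection \<open>Duality for an alternating bicharacter\<close>

text \<open>The instances are the cocycle of the Heisenberg group and its square, the commutator
  pairing.\<close>

locale bicharacter =
  fixes b :: "'w::ab_group_add \<Rightarrow> 'w \<Rightarrow> 'r::field"
  assumes b_add_left: "b (x + y) z = b x z * b y z"
    and b_add_right: "b x (y + z) = b x y * b x z"
    and b_nonzero: "b x y \<noteq> 0"
    and b_alternating: "b x x = 1"
begin

lemma b_zero [simp]: "b 0 y = 1" "b x 0 = 1"
  using b_add_left[of 0 0 y] b_add_right[of x 0 0] b_nonzero by auto

lemma b_minus_left: "b (- x) y = inverse (b x y)"
  using b_add_left[of x "- x" y] b_nonzero[of x y] by (simp add: field_simps)

lemma b_minus_right: "b x (- y) = inverse (b x y)"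
  using b_add_right[of x y "- y"] b_nonzero[of x y] by (simp add: field_simps)

lemma b_diff_left: "b (x - y) z = b x z / b y z"
  using b_add_left[of x "- y" z] by (simp add: b_minus_left field_simps)

lemma b_diff_right: "b x (y - z) = b x y / b x z"
  using b_add_right[of x y "- z"] by (simp add: b_minus_right field_simps)

lemma b_swap: "b y x = inverse (b x y)"
proof -
  have "b (x + y) (x + y) = (b x x * b x y) * (b y x * b y y)"
    by (simp only: b_add_left b_add_right mult_ac)
  then have "b x y * b y x = 1" by (simp add: b_alternating)
  then show ?thesis using b_nonzero[of x y] by (simp add: field_simps)
qed

definition perp :: "'w set \<Rightarrow> 'w set" where
  "perp A = {y. \<forall>x\<in>A. b x y = 1}"

lemma perpD: "y \<in> perp A \<Longrightarrow> x \<in> A \<Longrightarrow> b x y = 1" "y \<in> perp A \<Longrightarrow> x \<in> A \<Longrightarrow> b y x = 1"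
  using b_swap[of y x] by (auto simp: perp_def)

lemma perpI: "(\<And>x. x \<in> A \<Longrightarrow> b x y = 1) \<Longrightarrow> y \<in> perp A"
  by (auto simp: perp_def)

lemma perpI': "(\<And>x. x \<in> A \<Longrightarrow> b y x = 1) \<Longrightarrow> y \<in> perp A"
  using b_swap[of y] by (auto simp: perp_def)

lemma add_subgroup_perp: "add_subgroup (perp A)"
  by (auto simp: add_subgroup_def perp_def b_diff_right)

lemma perp_antimono: "A \<subseteq> B \<Longrightarrow> perp B \<subseteq> perp A"
  by (auto simp: perp_def)

lemma subset_perp_perp: "A \<subseteq> perp (perp A)"
  by (auto intro!: perpI dest: perpD)

lemma perp_perp_perp [simp]: "perp (perp (perp A)) = perp A"
  using subset_perp_perp perp_antimono by (metis subset_antisym)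

lemma perp_perp_Int:
  assumes "perp (perp A) = A" "perp (perp B) = B"
  shows "perp (perp (A \<inter> B)) = A \<inter> B"
proof -
  have "A \<inter> B = perp (perp A \<union> perp B)"
    using assms unfolding perp_def by blast
  then show ?thesis by simp
qed

text \<open>If two of the \<open>w j\<close> induced the same character of \<open>perp B\<close>,
  their difference would lie in \<open>perp (perp B)\<close>, which is \<open>B\<close>. So every
  class in \<open>character_independence\<close> is a singleton.\<close>

lemma character_sums_independent:
  assumes "add_subgroup B" "perp (perp B) = B" "finite J"
    and "\<And>j k. j \<in> J \<Longrightarrow> k \<in> J \<Longrightarrow> w j - w k \<in> B \<Longrightarrow> j = k"
    and "\<And>u. u \<in> perp B \<Longrightarrow> (\<Sum>j\<in>J. c j * b (w j) u) = 0" and "i \<in> J"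
  shows "c i = 0"
proof -
  have "(\<Sum>j | j \<in> J \<and> (\<forall>u\<in>perp B. b (w j) u = b (w i) u). c j) = 0"
    using assms(3,5,6) add_subgroupD[OF add_subgroup_perp]
    by (intro vector_space.character_independence[OF vector_space_self]) (auto simp: b_add_right mult.commute)
  also have "{j. j \<in> J \<and> (\<forall>u\<in>perp B. b (w j) u = b (w i) u)} = {i}"
  proof -
    have "j = i" if "j \<in> J" "\<forall>u\<in>perp B. b (w j) u = b (w i) u" for j
    proof -
      have "w j - w i \<in> perp (perp B)"
        using that b_nonzero by (intro perpI') (auto simp: b_diff_left)
      then show ?thesis using assms that by auto
    qed
    then show ?thesis using assms(6) by auto
  qed
  finally show ?thesis by simp
qed

text \<open>The elements of A / B give functions on \<open>perp B\<close> that depend only on the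
  class modulo \<open>perp A\<close>. If there were more of them than such classes, they would
  satisfy a linear relation, against the independence of characters.\<close>

lemma card_cosets_le:
  assumes A: "add_subgroup A" and B: "add_subgroup B" "B \<subseteq> A" "perp (perp B) = B"
    and fin: "finite (cosets (perp B) (perp A))"
  shows "finite (cosets A B)" "card (cosets A B) \<le> card (cosets (perp B) (perp A))"
proof -
  let ?Q = "cosets (perp B) (perp A)"
  have *: "card J \<le> card ?Q" if J: "finite J" "J \<subseteq> cosets A B" for J
  proof (rule ccontr)
    assume "\<not> ?thesis"
    then have "card ?Q < card J" by simp
    from homogeneous_system_nontrivial[OF fin J(1) this, of "\<lambda>C D. b (rep C) (rep D)"]
    obtain c i where c: "i \<in> J" "c i \<noteq> 0" "\<forall>D\<in>?Q. (\<Sum>C\<in>J. c C * b (rep C) (rep D)) = 0" by auto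
    have "c i = 0"
    proof (rule character_sums_independent[OF B(1,3) J(1) _ _ c(1)])
      fix C D assume "C \<in> J" "D \<in> J" "rep C - rep D \<in> B"
      then show "C = D" using J rep_mem(2)[OF A B(1,2)] coset_eq_iff[OF B(1)] by (metis (no_types, lifting) subsetD)
    next
      fix u assume u: "u \<in> perp B"
      let ?D = "coset (perp A) u"
      have "?D \<in> ?Q" using u by (auto simp: cosets_def)
      then have "(\<Sum>C\<in>J. c C * b (rep C) (rep ?D)) = 0" using c by auto
      moreover have "b (rep C) (rep ?D) = b (rep C) u" if "C \<in> J" for C
      proof -
        have "rep C \<in> A" using that J rep_mem(1)[OF A B(1,2)] by auto
        moreover have "rep ?D - u \<in> perp A" by (rule rep_coset[OF add_subgroup_perp])
        ultimately have "b (rep C) (rep ?D - u) = 1" by (auto dest: perpD)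
        then show ?thesis using b_nonzero[of "rep C" u] by (simp add: b_diff_right)
      qed
      ultimately show "(\<Sum>C\<in>J. c C * b (rep C) u) = 0" by simp
    qed
    with c show False by simp
  qed
  show f: "finite (cosets A B)"
  proof (rule ccontr)
    assume "infinite (cosets A B)"
    then obtain J where "J \<subseteq> cosets A B" "finite J" "card J = Suc (card ?Q)"
      by (meson infinite_arbitrarily_large)
    with *[of J] show False by simp
  qed
  show "card (cosets A B) \<le> card ?Q" using *[OF f] by simp
qed

text \<open>The inequality is used in both directions, for A / B and for its dual.\<close>

lemma card_cosets_dual:
  assumes A: "add_subgroup A" "perp (perp A) = A" and B: "add_subgroup B" "B \<subseteq> A" "perp (perp B) = B"
    and fin: "finite (cosets A B)"
  shows "finite (cosets (perp B) (perp A))" "card (cosets (perp B) (perp A)) = card (cosets A B)"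
proof -
  have 1: "finite (cosets (perp B) (perp A))" "card (cosets (perp B) (perp A)) \<le> card (cosets A B)"
    using card_cosets_le[OF add_subgroup_perp[of B] add_subgroup_perp[of A] perp_antimono[OF B(2)]]
      A B fin by auto
  then show "finite (cosets (perp B) (perp A))" "card (cosets (perp B) (perp A)) = card (cosets A B)"
    using card_cosets_le[OF A(1) B] by auto
qed

lemma character_sum_zero:
  assumes A: "add_subgroup A" and B: "add_subgroup B" "B \<subseteq> A" and v: "v \<in> perp B" "v \<notin> perp A"
  shows "(\<Sum>C\<in>cosets A B. b (rep C) v) = 0"
proof -
  obtain a where a: "a \<in> A" "b a v \<noteq> 1" using v(2) by (auto simp: perp_def)
  have "(\<Sum>C\<in>cosets A B. b (rep C + a) v) = (\<Sum>C\<in>cosets A B. b (rep C) v)"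
    using v perpD by (intro cosets_sum_translate[OF A B _ a(1), where f = "\<lambda>x. b x v"])
      (auto simp: b_add_left)
  moreover have "(\<Sum>C\<in>cosets A B. b (rep C + a) v) = (\<Sum>C\<in>cosets A B. b (rep C) v) * b a v"
    by (simp add: b_add_left sum_distrib_right)
  ultimately show ?thesis using a(2) by simp
qed

lemma character_sum_one:
  assumes "add_subgroup A" "add_subgroup B" "B \<subseteq> A" "v \<in> perp A"
  shows "(\<Sum>C\<in>cosets A B. b (rep C) v) = of_nat (card (cosets A B))"
  using assms rep_mem(1)[OF assms(1-3)] by (simp add: perpD)

text \<open>
  The characters of a finite quotient given by a perfect pairing form a basis of the functions on
  it, and they are all killed by summation if the order of the quotient vanishes.
\<close>

lemma index_nonzero:
  assumes A: "add_subgroup A" "perp (perp A) = A" and B: "add_subgroup B" "B \<subseteq> A" "perp (perp B) = B"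
    and fin: "finite (cosets A B)"
  shows "of_nat (card (cosets A B)) \<noteq> (0 :: 'r)"
proof
  assume n0: "of_nat (card (cosets A B)) = (0 :: 'r)"
  let ?Q = "cosets (perp B) (perp A)"
  note dual = card_cosets_dual[OF A B fin]
  \<comment> \<open>\<open>Some C\<close> stands for the character given by \<open>C\<close>, and
    \<open>None\<close> for the delta function at the class of 0. That is one function more than the
    quotient has points, so there is a relation.\<close>
  let ?J = "insert None (Some ` cosets A B)"
  let ?a = "\<lambda>j D. case j of None \<Rightarrow> if D = coset (perp A) 0 then 1 else 0 | Some C \<Rightarrow> b (rep C) (rep D)"
  have "finite ?J" using fin by simp
  moreover have "card ?Q < card ?J" using fin dual by (simp add: card_image card_insert_if)
  ultimately obtain c where c: "\<exists>j\<in>?J. c j \<noteq> 0" "\<forall>D\<in>?Q. (\<Sum>j\<in>?J. c j * ?a j D) = (0::'r)"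
    using homogeneous_system_nontrivial[OF dual(1), of ?J ?a] by blast
  have c2: "c None * ?a None D + (\<Sum>C\<in>cosets A B. c (Some C) * b (rep C) (rep D)) = 0" if "D \<in> ?Q" for D
    using c(2) that fin by (auto simp: sum.reindex)
  have PP: "perp A \<subseteq> perp B" using B(2) by (rule perp_antimono)
  have z: "coset (perp A) 0 \<in> ?Q"
    using add_subgroupD(1)[OF add_subgroup_perp] by (auto simp: cosets_def)
  \<comment> \<open>Summation of the relation over the quotient. The delta function contributes its
    coefficient; a non-trivial character sums to 0, and the trivial one sums to the order of the
    quotient, which is 0 by assumption. So the delta function drops out, and the characters alone
    would be dependent.\<close>
  have "0 = (\<Sum>D\<in>?Q. c None * ?a None D + (\<Sum>C\<in>cosets A B. c (Some C) * b (rep C) (rep D)))"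
    using c2 by simp
  also have "\<dots> = (\<Sum>D\<in>?Q. c None * ?a None D) + (\<Sum>C\<in>cosets A B. \<Sum>D\<in>?Q. c (Some C) * b (rep C) (rep D))"
    by (simp only: sum.distrib) (subst (2) sum.swap, simp)
  also have "(\<Sum>D\<in>?Q. c None * ?a None D) = c None"
  proof -
    have "(\<Sum>D\<in>?Q. c None * ?a None D) = (\<Sum>D\<in>?Q. if D = coset (perp A) 0 then c None else 0)"
      by (rule sum.cong) auto
    then show ?thesis using dual(1) z by simp
  qed
  also have "(\<Sum>C\<in>cosets A B. \<Sum>D\<in>?Q. c (Some C) * b (rep C) (rep D)) = 0"
  proof (rule sum.neutral, rule ballI)
    fix C assume "C \<in> cosets A B"
    have "rep C \<in> perp (perp A)" using rep_mem(1)[OF A(1) B(1,2) \<open>C \<in> _\<close>] A by simp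
    moreover have "(\<Sum>D\<in>?Q. b (rep D) (- rep C)) = 0"
    proof (cases "- rep C \<in> perp (perp B)")
      case True
      then show ?thesis
        using character_sum_one[OF add_subgroup_perp add_subgroup_perp PP] dual n0 by simp
    next
      case False
      then show ?thesis
        using character_sum_zero[OF add_subgroup_perp add_subgroup_perp PP]
          add_subgroupD(3)[OF add_subgroup_perp] \<open>rep C \<in> perp (perp A)\<close> by blast
    qed
    moreover have "b (rep D) (- rep C) = b (rep C) (rep D)" for D
      using b_swap[of "rep C" "rep D"] by (simp add: b_minus_right)
    ultimately show "(\<Sum>D\<in>?Q. c (Some C) * b (rep C) (rep D)) = 0"
      by (simp add: sum_distrib_left[symmetric])
  qed
  finally have cN: "c None = 0" by simp
  have "c (Some C0) = 0" if C0: "C0 \<in> cosets A B" for C0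
  proof (rule character_sums_independent[OF B(1,3) fin _ _ C0, of rep "\<lambda>C. c (Some C)"])
    fix C D assume "C \<in> cosets A B" "D \<in> cosets A B" "rep C - rep D \<in> B"
    then show "C = D" using rep_mem(2)[OF A(1) B(1,2)] coset_eq_iff[OF B(1)] by metis
  next
    fix u assume u: "u \<in> perp B"
    let ?D = "coset (perp A) u"
    have "?D \<in> ?Q" using u by (auto simp: cosets_def)
    then have "(\<Sum>C\<in>cosets A B. c (Some C) * b (rep C) (rep ?D)) = 0" using c2 cN by fastforce
    moreover have "b (rep C) (rep ?D) = b (rep C) u" if "C \<in> cosets A B" for C
    proof -
      have "rep C \<in> A" using that rep_mem(1)[OF A(1) B(1,2)] by auto
      moreover have "rep ?D - u \<in> perp A" by (rule rep_coset[OF add_subgroup_perp])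
      ultimately have "b (rep C) (rep ?D - u) = 1" by (auto dest: perpD)
      then show ?thesis using b_nonzero[of "rep C" u] by (simp add: b_diff_right)
    qed
    ultimately show "(\<Sum>C\<in>cosets A B. c (Some C) * b (rep C) u) = 0" by simp
  qed
  with cN c(1) show False by auto
qed

text \<open>
  Characters of \<open>P / (P \<inter> L)\<close> extend to characters trivial on \<open>L\<close>: otherwise there would be more
  characters on this quotient than it has elements.
\<close>

lemma perp_Int_decompose:
  assumes P: "add_subgroup P" and L: "add_subgroup L" "perp (perp L) = L"
    and fin: "finite (cosets P (P \<inter> L))" and w: "w \<in> perp (P \<inter> L)"
  obtains y where "y \<in> perp L" "w - y \<in> perp P"
proof (rule ccontr)
  assume neg: "\<not> thesis"
  define PL where "PL = P \<inter> L"
  have PL: "add_subgroup PL" "PL \<subseteq> P" using add_subgroup_Int[OF P L(1)] by (auto simp: PL_def)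
  note PP = add_subgroup_perp[of P]
  let ?Q = "cosets P PL"
  have fQ: "finite ?Q" using fin by (simp add: PL_def)
  define S where "S = insert w (perp L)"
  have S_perp: "S \<subseteq> perp PL" using w perp_antimono[of PL L] by (auto simp: S_def PL_def)
  have b_rep: "b (rep (coset PL x)) u = b x u" if "x \<in> P" "u \<in> perp PL" for x u
  proof -
    have "b (rep (coset PL x) - x) u = 1" using rep_coset[OF PL(1), of x] that by (auto dest: perpD)
    then show ?thesis using b_nonzero[of x u] by (simp add: b_diff_left)
  qed
  \<comment> \<open>Elements of \<open>S\<close> that differ modulo \<open>perp P\<close> restrict
    to distinct characters of \<open>P\<close>, all trivial on \<open>P \<inter> L\<close>. Their
    independence bounds their number by the order of the quotient.\<close>
  have upper: "card K \<le> card ?Q" if K: "finite K" "K \<subseteq> cosets S (perp P)" for K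
  proof (rule ccontr)
    assume "\<not> ?thesis"
    then have "card ?Q < card K" by simp
    from homogeneous_system_nontrivial[OF fQ K(1) this, of "\<lambda>C D. b (rep D) (rep C)"]
    obtain c i where c: "i \<in> K" "c i \<noteq> 0" "\<forall>D\<in>?Q. (\<Sum>C\<in>K. c C * b (rep D) (rep C)) = 0" by auto
    have repK: "rep C \<in> perp PL" if C: "C \<in> K" for C
    proof -
      obtain s where s: "s \<in> S" "C = coset (perp P) s" using C K by (auto simp: cosets_def)
      have "rep C - s \<in> perp P" using rep_coset[OF PP] s by simp
      then have "rep C - s \<in> perp PL" using perp_antimono[OF PL(2)] by auto
      then show ?thesis using s S_perp add_subgroup_add_iff(3)[OF add_subgroup_perp] by blast
    qed
    have "(\<Sum>C | C \<in> K \<and> (\<forall>u\<in>P. b u (rep C) = b u (rep i)). c C) = 0"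
    proof (rule vector_space.character_independence[OF vector_space_self K(1) add_subgroupD(1)[OF P]])
      fix u assume u: "u \<in> P"
      have "coset PL u \<in> ?Q" using u by (auto simp: cosets_def)
      then have "(\<Sum>C\<in>K. c C * b (rep (coset PL u)) (rep C)) = 0" using c by auto
      then show "(\<Sum>C\<in>K. b u (rep C) * c C) = 0"
        using b_rep[OF u] repK by (simp add: mult.commute)
    qed (use add_subgroupD(4)[OF P] c in \<open>auto simp: b_add_left\<close>)
    also have "{C. C \<in> K \<and> (\<forall>u\<in>P. b u (rep C) = b u (rep i))} = {i}"
    proof -
      have "C = i" if "C \<in> K" "\<forall>u\<in>P. b u (rep C) = b u (rep i)" for C
      proof -
        have *: "coset (perp P) (rep D) = D" if D: "D \<in> K" for D
        proof -
          obtain s where s: "s \<in> S" "D = coset (perp P) s" using D K by (auto simp: cosets_def)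
          have "rep D - s \<in> perp P" using rep_coset[OF PP] s by simp
          then show ?thesis using coset_eq_iff[OF PP] s by blast
        qed
        have "rep C - rep i \<in> perp P" using that b_nonzero by (intro perpI) (auto simp: b_diff_right)
        then show ?thesis using coset_eq_iff[OF PP] * that c(1) by metis
      qed
      then show ?thesis using c(1) by auto
    qed
    finally show False using c by simp
  qed
  have finK: "finite (cosets S (perp P))"
  proof (rule ccontr)
    assume "infinite (cosets S (perp P))"
    then obtain J where "J \<subseteq> cosets S (perp P)" "finite J" "card J = Suc (card ?Q)"
      by (meson infinite_arbitrarily_large)
    with upper[of J] show False by simp
  qed
  let ?Z = "cosets (perp L) (perp P)"
  have new: "coset (perp P) w \<notin> ?Z"
  proof
    assume "coset (perp P) w \<in> ?Z"
    then obtain y where "y \<in> perp L" "w - y \<in> perp P"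
      using coset_eq_iff[OF PP] by (auto simp: cosets_def)
    then show False using neg that by auto
  qed
  have SZ: "cosets S (perp P) = insert (coset (perp P) w) ?Z" by (auto simp: cosets_def S_def)
  then have finZ: "finite ?Z" and "card (cosets S (perp P)) = Suc (card ?Z)"
    using finK new by auto
  \<comment> \<open>As \<open>w\<close> has no decomposition, it adds a coset to \<open>?Z\<close>,
    so the bound is strict for \<open>?Z\<close>. But the elements of \<open>?Q\<close> differ
    modulo the closed group \<open>L\<close>, hence are independent as functions on
    \<open>perp L\<close>, and these functions only depend on the class in \<open>?Z\<close>: there
    are more independent functions than points.\<close>
  then have "card ?Z < card ?Q" using upper[OF finK] by simp
  from homogeneous_system_nontrivial[OF finZ fQ this, of "\<lambda>C D. b (rep C) (rep D)"]
  obtain c i where c: "i \<in> ?Q" "c i \<noteq> 0" "\<forall>D\<in>?Z. (\<Sum>C\<in>?Q. c C * b (rep C) (rep D)) = 0" by auto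
  have "c i = 0"
  proof (rule character_sums_independent[OF L fQ _ _ c(1)])
    fix C D assume CD: "C \<in> ?Q" "D \<in> ?Q" "rep C - rep D \<in> L"
    then have "rep C - rep D \<in> PL"
      using rep_mem(1)[OF P PL] add_subgroupD(2)[OF P] by (auto simp: PL_def)
    then show "C = D" using CD rep_mem(2)[OF P PL] coset_eq_iff[OF PL(1)] by metis
  next
    fix u assume u: "u \<in> perp L"
    let ?D = "coset (perp P) u"
    have "?D \<in> ?Z" using u by (auto simp: cosets_def)
    then have "(\<Sum>C\<in>?Q. c C * b (rep C) (rep ?D)) = 0" using c by auto
    moreover have "b (rep C) (rep ?D) = b (rep C) u" if "C \<in> ?Q" for C
    proof -
      have "rep C \<in> P" using that rep_mem(1)[OF P PL] by auto
      moreover have "rep ?D - u \<in> perp P" by (rule rep_coset[OF PP])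
      ultimately have "b (rep C) (rep ?D - u) = 1" by (auto dest: perpD)
      then show ?thesis using b_nonzero[of "rep C" u] by (simp add: b_diff_right)
    qed
    ultimately show "(\<Sum>C\<in>?Q. c C * b (rep C) u) = 0" by simp
  qed
  with c show False by simp
qed

end

section \<open>Heisenberg representations: eigenvectors, Schur's lemma, expansions and
  coefficients\<close>

subsection \<open>Irreducible Heisenberg systems\<close>

text \<open>
  \<open>be w w'\<close> plays the role of \<open>\<psi> (\<langle>w, w'\<rangle> / 2)\<close>, \<open>U w\<close> that of \<open>\<rho> (w, 0)\<close>, and \<open>Bl r\<close> that of
  the ball of radius \<open>r\<close> of \<open>W\<close>.
\<close>

locale heisenberg_system = vector_space sc
  for sc :: "'r::field \<Rightarrow> 's::ab_group_add \<Rightarrow> 's" (infixr "\<star>" 75) +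
  fixes be :: "'w::ab_group_add \<Rightarrow> 'w \<Rightarrow> 'r" and U :: "'w \<Rightarrow> 's \<Rightarrow> 's" and Bl :: "real \<Rightarrow> 'w set"
  assumes be_add_left: "be (x + y) z = be x z * be y z"
    and be_add_right: "be x (y + z) = be x y * be x z"
    and be_nonzero: "be x y \<noteq> 0"
    and be_alternating: "be x x = 1"
    and U_add: "U w (s + t) = U w s + U w t"
    and U_scale: "U w (a \<star> s) = a \<star> U w s"
    and U_zero: "U 0 s = s"
    and U_mult: "U w (U w' s) = be w w' \<star> U (w + w') s"
    and irreducible: "subspace N \<Longrightarrow> (\<And>w s. s \<in> N \<Longrightarrow> U w s \<in> N) \<Longrightarrow> N = {0} \<or> N = UNIV"
    and nontrivial: "\<exists>s::'s. s \<noteq> 0"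
    and Bl_subgroup: "0 < r \<Longrightarrow> add_subgroup (Bl r)"
    and Bl_mono: "r \<le> r' \<Longrightarrow> Bl r \<subseteq> Bl r'"
    and Bl_cover: "\<exists>r>0. w \<in> Bl r"
    and Bl_index: "0 < r \<Longrightarrow> 0 < r' \<Longrightarrow> finite (cosets (Bl r) (Bl r'))"
    and Bl_continuous: "0 < r \<Longrightarrow> \<exists>r'>0. \<forall>x\<in>Bl r. \<forall>y\<in>Bl r'. be x y = 1"
    and Bl_nondegenerate: "\<exists>C>0. \<forall>r>0. \<forall>y. (\<forall>x\<in>Bl r. be x y ^ 2 = 1) \<longrightarrow> y \<in> Bl (C / r)"
    and smooth: "\<exists>r>0. \<forall>w\<in>Bl r. U w s = s"
begin

text \<open>\<open>be\<close> is the cocycle of the projective representation \<open>U\<close>.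
  Since it is alternating, its square is the commutator pairing, and orthogonality is always taken
  with respect to the latter.\<close>

definition b :: "'w \<Rightarrow> 'w \<Rightarrow> 'r" where "b x y = be x y ^ 2"

sublocale half: bicharacter be
  by unfold_locales (simp_all add: be_add_left be_add_right be_nonzero be_alternating)

sublocale bicharacter b
  by unfold_locales
    (simp_all add: b_def be_add_left be_add_right be_nonzero be_alternating power_mult_distrib)

lemma U_0 [simp]: "U w 0 = 0"
  using U_scale[of w 0 0] by simp

lemma U_sum: "U w (\<Sum>j\<in>J. f j) = (\<Sum>j\<in>J. U w (f j))"
  by (induction J rule: infinite_finite_induct) (auto simp: U_add)

lemma U_inverse [simp]: "U w (U (- w) s) = s" "U (- w) (U w s) = s"
  using U_mult[of w "- w" s] U_mult[of "- w" w s]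
  by (simp_all add: half.b_minus_left half.b_minus_right be_alternating U_zero)

lemma U_eq_0_iff [simp]: "U w s = 0 \<longleftrightarrow> s = 0"
  using U_inverse(2)[of w s] by (metis U_0)

lemma U_plus: "U (w + w') s = inverse (be w w') \<star> U w (U w' s)"
  by (simp add: U_mult be_nonzero)

lemma U_commute: "U w (U w' s) = b w w' \<star> U w' (U w s)"
proof -
  have "b w w' * be w' w = be w w'"
    using half.b_swap[of w' w] be_nonzero[of w w'] by (simp add: b_def power2_eq_square)
  then show ?thesis by (simp add: U_mult add.commute)
qed

definition linear_op :: "('s \<Rightarrow> 's) \<Rightarrow> bool" where
  "linear_op A \<longleftrightarrow> (\<forall>s t. A (s + t) = A s + A t) \<and> (\<forall>r s. A (r \<star> s) = r \<star> A s)"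

lemma linear_opD:
  assumes "linear_op A"
  shows "A (s + t) = A s + A t" "A (r \<star> s) = r \<star> A s" "A 0 = 0"
    "A (\<Sum>j\<in>J. f j) = (\<Sum>j\<in>J. A (f j))"
proof -
  show *: "A (s + t) = A s + A t" "A (r \<star> s) = r \<star> A s" for s t r
    using assms by (auto simp: linear_op_def)
  show z: "A 0 = 0" using *(2)[of 0 0] by simp
  show "A (\<Sum>j\<in>J. f j) = (\<Sum>j\<in>J. A (f j))"
    by (induction J rule: infinite_finite_induct) (auto simp: * z)
qed

lemma linear_op_U: "linear_op (U w)"
  by (simp add: linear_op_def U_add U_scale)

lemma linear_op_comp: "linear_op A \<Longrightarrow> linear_op A' \<Longrightarrow> linear_op (\<lambda>s. A (A' s))"
  by (simp add: linear_op_def)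

text \<open>Formal combinations are lists, so that translations may repeat and no normal form is
  needed; the coefficients extracted from them are later shown to depend on the operator
  only.\<close>

definition comb :: "('r \<times> 'w) list \<Rightarrow> 's \<Rightarrow> 's" where
  "comb ps s = (\<Sum>p\<leftarrow>ps. fst p \<star> U (snd p) s)"

lemma comb_Nil [simp]: "comb [] s = 0"
  and comb_Cons [simp]: "comb (p # ps) s = fst p \<star> U (snd p) s + comb ps s"
  and comb_append [simp]: "comb (ps @ qs) s = comb ps s + comb qs s"
  by (simp_all add: comb_def)

lemma comb_scale: "comb (map (\<lambda>p. (r * fst p, snd p)) ps) s = r \<star> comb ps s"
  by (induction ps) (auto simp: scale_right_distrib)

lemma U_comb: "U w (comb ps s) = comb (map (\<lambda>p. (fst p * be w (snd p), w + snd p)) ps) s"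
  by (induction ps) (auto simp: U_add U_scale U_mult)

lemma linear_op_comb: "linear_op (comb ps)"
  unfolding linear_op_def
  by (induction ps) (auto simp: U_add U_scale scale_right_distrib algebra_simps)

lemma comb_nth: "comb ps s = (\<Sum>j<length ps. fst (ps ! j) \<star> U (snd (ps ! j)) s)"
  by (simp add: comb_def sum_list_sum_nth atLeast0LessThan)

lemma U_generates:
  assumes "x \<noteq> 0"
  obtains ps where "y = comb ps x"
proof -
  let ?N = "range (\<lambda>ps. comb ps x)"
  have "subspace ?N"
    unfolding subspace_def
  proof (intro conjI ballI allI)
    show "0 \<in> ?N" by (rule range_eqI[of _ _ "[]"]) simp
    show "s + t \<in> ?N" if st: "s \<in> ?N" "t \<in> ?N" for s t
    proof -
      obtain ps qs where "s = comb ps x" "t = comb qs x" using st by auto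
      then show ?thesis by (intro range_eqI[of _ _ "ps @ qs"]) simp
    qed
    show "r \<star> s \<in> ?N" if s: "s \<in> ?N" for r s
    proof -
      obtain ps where "s = comb ps x" using s by auto
      then show ?thesis
        by (intro range_eqI[of _ _ "map (\<lambda>p. (r * fst p, snd p)) ps"]) (simp add: comb_scale)
    qed
  qed
  moreover have "U w s \<in> ?N" if s: "s \<in> ?N" for w s
  proof -
    obtain ps where "s = comb ps x" using s by auto
    then show ?thesis
      by (intro range_eqI[of _ _ "map (\<lambda>p. (fst p * be w (snd p), w + snd p)) ps"]) (simp only: U_comb)
  qed
  moreover have "x \<in> ?N"
    by (rule range_eqI[of _ _ "[(1, 0)]"]) (simp add: U_zero)
  ultimately have "?N = UNIV" using irreducible[of ?N] assms by blast
  then have "y \<in> ?N" by simp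
  then show thesis using that by auto
qed

subsection \<open>Lattices and their fixed vectors\<close>

text \<open>A compact open subgroup in terms of balls: containing a ball stands for open, and being
  contained in a ball for compact. Equality with the double orthogonal is part of the notion because
  all counting arguments rest on it.\<close>

definition lattice :: "'w set \<Rightarrow> bool" where
  "lattice L \<longleftrightarrow> add_subgroup L \<and> perp (perp L) = L \<and> (\<exists>r>0. Bl r \<subseteq> L) \<and> (\<exists>r>0. L \<subseteq> Bl r)"

definition isotropic :: "'w set \<Rightarrow> bool" where
  "isotropic L \<longleftrightarrow> (\<forall>x\<in>L. \<forall>y\<in>L. be x y = 1)"

definition fix_space :: "'w set \<Rightarrow> 's set" where
  "fix_space L = {s. \<forall>l\<in>L. U l s = s}"

lemma latticeD:
  assumes "lattice L"
  shows "add_subgroup L" "perp (perp L) = L" "\<exists>r>0. Bl r \<subseteq> L" "\<exists>r>0. L \<subseteq> Bl r"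
  using assms by (auto simp: lattice_def)

lemma be_eq_1D: "be x y = 1 \<Longrightarrow> b x y = 1"
  by (simp add: b_def)

lemma perp_Bl_bounded: "0 < r \<Longrightarrow> \<exists>r'>0. perp (Bl r) \<subseteq> Bl r'"
proof -
  assume "0 < r"
  moreover obtain C where "C > 0" "\<forall>r>0. \<forall>y. (\<forall>x\<in>Bl r. be x y ^ 2 = 1) \<longrightarrow> y \<in> Bl (C / r)"
    using Bl_nondegenerate by auto
  ultimately show ?thesis by (intro exI[of _ "C / r"]) (auto simp: perp_def b_def)
qed

lemma perp_Bl_small: "0 < r \<Longrightarrow> \<exists>r'>0. perp (Bl r') \<subseteq> Bl r"
proof -
  assume r: "0 < r"
  obtain C where "C > 0" "\<forall>r>0. \<forall>y. (\<forall>x\<in>Bl r. be x y ^ 2 = 1) \<longrightarrow> y \<in> Bl (C / r)"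
    using Bl_nondegenerate by auto
  moreover from this r have "C / (C / r) = r" "C / r > 0" by auto
  ultimately show ?thesis by (intro exI[of _ "C / r"]) (auto simp: perp_def b_def)
qed

lemma lattice_perp:
  assumes "add_subgroup L" "0 < r" "Bl r \<subseteq> L" "0 < r'" "L \<subseteq> Bl r'"
  shows "lattice (perp L)"
proof -
  obtain s where s: "s > 0" "\<forall>x\<in>Bl r'. \<forall>y\<in>Bl s. be x y = 1"
    using Bl_continuous[OF assms(4)] by auto
  then have "Bl s \<subseteq> perp L" using assms(5) be_eq_1D by (auto intro!: perpI)
  moreover obtain s' where "s' > 0" "perp (Bl r) \<subseteq> Bl s'" using perp_Bl_bounded[OF assms(2)] by auto
  moreover have "perp L \<subseteq> perp (Bl r)" using assms(3) by (rule perp_antimono)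
  ultimately show ?thesis
    using s(1) by (auto simp: lattice_def add_subgroup_perp intro: exI[of _ s'])
qed

lemma lattice_perp': "lattice L \<Longrightarrow> lattice (perp L)"
  using lattice_perp[of L] latticeD[of L] by blast

lemma lattice_perp_Bl: "0 < r \<Longrightarrow> lattice (perp (Bl r))"
  using lattice_perp[of "Bl r" r r] Bl_subgroup by simp

lemma lattice_Int:
  assumes "lattice L" "lattice L'"
  shows "lattice (L \<inter> L')"
proof -
  obtain r r' where r: "r > 0" "Bl r \<subseteq> L" "r' > 0" "Bl r' \<subseteq> L'"
    using assms latticeD(3) by meson
  have "Bl (min r r') \<subseteq> L \<inter> L'"
    using r Bl_mono[of "min r r'" r] Bl_mono[of "min r r'" r'] by auto
  moreover have "min r r' > 0" using r by simp
  moreover obtain r1 where "r1 > 0" "L \<subseteq> Bl r1" using assms latticeD(4) by meson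
  moreover have "perp (perp (L \<inter> L')) = L \<inter> L'"
    using perp_perp_Int assms latticeD(2) by blast
  moreover have "add_subgroup (L \<inter> L')" using add_subgroup_Int assms latticeD(1) by blast
  ultimately show ?thesis unfolding lattice_def by blast
qed

lemma finite_cosets_lattice:
  assumes "lattice L" "lattice L'"
  shows "finite (cosets L L')"
proof -
  obtain r r' where r: "r > 0" "L \<subseteq> Bl r" "r' > 0" "Bl r' \<subseteq> L'"
    using assms latticeD(3,4) by meson
  show ?thesis
    using finite_cosets_mono[OF Bl_subgroup[OF r(3)] latticeD(1)[OF assms(2)] r(2,4)] Bl_index r by auto
qed

lemma isotropic_subset_perp: "isotropic L \<Longrightarrow> L \<subseteq> perp L"
  by (auto simp: isotropic_def be_eq_1D intro!: perpI)

lemma isotropic_mono: "isotropic L \<Longrightarrow> L' \<subseteq> L \<Longrightarrow> isotropic L'"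
  by (auto simp: isotropic_def)

lemma isotropic_small: "\<exists>r>0. isotropic (Bl r)"
proof -
  obtain s where s: "s > 0" "\<forall>x\<in>Bl 1. \<forall>y\<in>Bl s. be x y = 1" using Bl_continuous[of 1] by auto
  have "Bl (min s 1) \<subseteq> Bl 1" "Bl (min s 1) \<subseteq> Bl s" by (auto intro!: Bl_mono)
  then have "isotropic (Bl (min s 1))" using s unfolding isotropic_def by blast
  then show ?thesis using s(1) by (intro exI[of _ "min s 1"]) auto
qed

lemma fix_space_mono: "L' \<subseteq> L \<Longrightarrow> fix_space L \<subseteq> fix_space L'"
  by (auto simp: fix_space_def)

definition nice :: "'w set \<Rightarrow> bool" where
  "nice L \<longleftrightarrow> lattice L \<and> isotropic L \<and> (\<exists>s\<in>fix_space L. s \<noteq> 0)"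

lemma niceD:
  assumes "nice L"
  shows "lattice L" "isotropic L" "\<exists>s\<in>fix_space L. s \<noteq> 0" "add_subgroup L" "perp (perp L) = L"
    "L \<subseteq> perp L" "l \<in> L \<Longrightarrow> l' \<in> L \<Longrightarrow> be l l' = 1"
  using assms latticeD isotropic_subset_perp by (auto simp: nice_def isotropic_def)

lemma nice_mono: "nice L \<Longrightarrow> lattice L' \<Longrightarrow> L' \<subseteq> L \<Longrightarrow> nice L'"
  using fix_space_mono[of L' L] isotropic_mono[of L L'] by (auto simp: nice_def)

text \<open>The lattice is the orthogonal of a large ball rather than a small ball, because
  orthogonals equal their double orthogonal automatically.\<close>

lemma nice_small:
  assumes "0 < r"
  shows "\<exists>L. nice L \<and> L \<subseteq> Bl r"
proof -
  obtain r1 where r1: "r1 > 0" "isotropic (Bl r1)" using isotropic_small by auto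
  obtain s :: 's where s: "s \<noteq> 0" using nontrivial by auto
  obtain r2 where r2: "r2 > 0" "\<forall>w\<in>Bl r2. U w s = s" using smooth by auto
  define q where "q = min r (min r1 r2)"
  have q: "q > 0" "Bl q \<subseteq> Bl r" "Bl q \<subseteq> Bl r1" "Bl q \<subseteq> Bl r2"
    using assms r1 r2 by (auto simp: q_def intro!: Bl_mono)
  obtain q' where q': "q' > 0" "perp (Bl q') \<subseteq> Bl q" using perp_Bl_small[OF q(1)] by auto
  let ?L = "perp (Bl q')"
  have "isotropic ?L" using isotropic_mono[OF r1(2)] q q' by blast
  moreover have "s \<in> fix_space ?L" using r2 q q' by (auto simp: fix_space_def)
  ultimately have "nice ?L" using lattice_perp_Bl[OF q'(1)] s by (auto simp: nice_def)
  then show ?thesis using q q' by blast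
qed

lemma fix_space_perp:
  assumes "s \<in> fix_space L" "u \<in> perp L"
  shows "U u s \<in> fix_space L"
  using assms by (auto simp: fix_space_def U_commute[of _ u] perpD)

end

context heisenberg_system begin

subsection \<open>Schur's lemma and expansion of operators\<close>

text \<open>The translations under which the line of \<open>s\<close> is stable. When this isotropic
  subgroup equals its orthogonal, it serves as a polarization, with \<open>s\<close> as an
  eigenvector.\<close>

definition eigen_stab :: "'s \<Rightarrow> 'w set" where
  "eigen_stab s = {v. \<exists>c. U v s = c \<star> s}"

lemma eigen_stab_subgroup:
  assumes "s \<noteq> 0"
  shows "add_subgroup (eigen_stab s)"
  unfolding add_subgroup_def
proof (intro conjI ballI)
  show "0 \<in> eigen_stab s" using scale_one[of s] by (auto simp: eigen_stab_def U_zero intro: exI[of _ 1])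
  fix v w assume "v \<in> eigen_stab s" "w \<in> eigen_stab s"
  then obtain c d where cd: "U v s = c \<star> s" "U w s = d \<star> s" by (auto simp: eigen_stab_def)
  have d: "d \<noteq> 0" using cd(2) assms by (metis U_eq_0_iff scale_zero_left)
  have "s = d \<star> U (- w) s" using arg_cong[OF cd(2), of "U (- w)"] by (simp add: U_scale)
  then have "U (- w) s = inverse d \<star> s" using d by (metis scale_scale left_inverse scale_one)
  then have "U v (U (- w) s) = (inverse d * c) \<star> s" using cd by (simp add: U_scale)
  then have "U (v - w) s = (inverse (be v (- w)) * (inverse d * c)) \<star> s"
    using U_plus[of v "- w" s] by simp
  then show "v - w \<in> eigen_stab s" by (auto simp: eigen_stab_def)
qed

lemma eigen_stab_isotropic:
  assumes "s \<noteq> 0"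
  shows "eigen_stab s \<subseteq> perp (eigen_stab s)"
proof (intro subsetI perpI)
  fix v w assume "v \<in> eigen_stab s" "w \<in> eigen_stab s"
  then obtain c d where cd: "U v s = c \<star> s" "U w s = d \<star> s" by (auto simp: eigen_stab_def)
  have nz: "c \<noteq> 0" "d \<noteq> 0" using cd assms by (metis U_eq_0_iff scale_zero_left)+
  have "(d * c) \<star> s = (b w v * (d * c)) \<star> s"
    using U_commute[of w v s] cd by (simp add: U_scale mult.commute)
  then show "b w v = 1" using nz assms by simp
qed

lemma fix_space_eigen_stab: "s \<in> fix_space L \<Longrightarrow> L \<subseteq> eigen_stab s"
  unfolding fix_space_def eigen_stab_def using scale_one[of s] by (auto intro!: exI[of _ 1])

definition nmul :: "nat \<Rightarrow> 'w \<Rightarrow> 'w" where "nmul i v = (\<Sum>_<i. v)"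

lemma nmul_0 [simp]: "nmul 0 v = 0" and nmul_Suc [simp]: "nmul (Suc i) v = v + nmul i v"
  by (simp_all add: nmul_def add.commute)

lemma nmul_add: "nmul (i + j) v = nmul i v + nmul j v"
  by (induction i) (auto simp: add.assoc)

lemma nmul_mem: "add_subgroup A \<Longrightarrow> v \<in> A \<Longrightarrow> nmul i v \<in> A"
  by (induction i) (auto dest: add_subgroupD)

lemma be_nmul: "be v (nmul i v) = 1"
  by (induction i) (auto simp: be_add_right be_alternating)

lemma b_nmul_eq_1: "b u v = 1 \<Longrightarrow> b u (nmul i v) = 1"
  by (induction i) (auto simp: b_add_right)

text \<open>The eigenvalues for the new translation \<open>v\<close> have to be in R, and they are:
  a multiple of \<open>v\<close> lies in \<open>L\<close>, and the characters \<open>b u\<close>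
  with \<open>u\<close> in \<open>perp L\<close> supply candidates for the eigenvalue. The average
  over the orbit of \<open>x\<close>, twisted by such a character, is an eigenvector of
  \<open>v\<close>, and it keeps the eigenvalues of \<open>x\<close> because \<open>v\<close> is
  orthogonal to \<open>eigen_stab x\<close>.\<close>

lemma eigenvector_extend:
  assumes L: "nice L" and x: "x \<in> fix_space L" "x \<noteq> 0" and v: "v \<in> perp (eigen_stab x)"
  obtains y where "y \<in> fix_space L" "y \<noteq> 0" "eigen_stab x \<subseteq> eigen_stab y" "v \<in> eigen_stab y"
proof -
  note Ls = niceD(4)[OF L]
  have fin: "finite (cosets (perp L) L)" using finite_cosets_lattice lattice_perp' niceD(1)[OF L] by blast
  have vL: "v \<in> perp L" using v perp_antimono[OF fix_space_eigen_stab[OF x(1)]] by auto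
  \<comment> \<open>Pigeonhole in the finite quotient of \<open>perp L\<close> by \<open>L\<close>:
    some positive multiple of \<open>v\<close> lies in \<open>L\<close>, and \<open>m\<close> will
    be the least one.\<close>
  have "\<not> inj_on (\<lambda>i. coset L (nmul i v)) (UNIV :: nat set)"
  proof
    assume "inj_on (\<lambda>i. coset L (nmul i v)) (UNIV :: nat set)"
    moreover have "(\<lambda>i. coset L (nmul i v)) ` UNIV \<subseteq> cosets (perp L) L"
      using nmul_mem[OF add_subgroup_perp vL] by (auto simp: cosets_def)
    ultimately show False using fin finite_imageD finite_subset infinite_UNIV_nat by metis
  qed
  then obtain i j where "i < j" and "coset L (nmul i v) = coset L (nmul j v)"
    unfolding inj_on_def by (metis linorder_neqE_nat)
  moreover from \<open>i < j\<close> obtain d where d: "j = i + d" "d > 0" by (auto simp: less_iff_Suc_add)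
  ultimately have "nmul i v - nmul (i + d) v \<in> L" using coset_eq_iff[OF Ls] by auto
  then have "nmul d v \<in> L"
    using add_subgroupD(3)[OF Ls, of "nmul i v - nmul (i + d) v"] by (simp add: nmul_add)
  with d(2) have "nmul d v \<in> L \<and> d > 0" by simp
  then have ex: "\<exists>m. nmul m v \<in> L \<and> m > 0" by blast
  define m where "m = (LEAST m. nmul m v \<in> L \<and> m > 0)"
  have m: "nmul m v \<in> L" "m > 0" using LeastI_ex[OF ex] by (auto simp: m_def)
  have least: "nmul i v \<notin> L" if "0 < i" "i < m" for i
    using not_less_Least[of i "\<lambda>m. nmul m v \<in> L \<and> m > 0"] that by (auto simp: m_def)
  define g where "g u i = b u (- nmul i v) \<star> U (nmul i v) x" for u i
  define y where "y u = (\<Sum>i<m. g u i)" for u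
  \<comment> \<open>Summed over all classes of \<open>u\<close>, the term \<open>i\<close> survives
    only if \<open>nmul i v\<close> lies in \<open>L\<close>, hence only for \<open>i = 0\<close> by
    minimality of \<open>m\<close>. What remains is the index times \<open>x\<close>, and the index
    is non-zero in R.\<close>
  have "\<exists>u\<in>perp L. y u \<noteq> 0"
  proof (rule ccontr)
    assume "\<not> ?thesis"
    then have "(\<Sum>C\<in>cosets (perp L) L. y (rep C)) = 0"
      using rep_mem(1)[OF add_subgroup_perp Ls niceD(6)[OF L]] by (intro sum.neutral) auto
    also have "(\<Sum>C\<in>cosets (perp L) L. y (rep C))
        = (\<Sum>i<m. (\<Sum>C\<in>cosets (perp L) L. b (rep C) (- nmul i v)) \<star> U (nmul i v) x)"
      unfolding y_def g_def by (subst sum.swap) (simp add: scale_sum_left)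
    also have "\<dots> = (\<Sum>i<m. if i = 0 then of_nat (card (cosets (perp L) L)) \<star> x else 0)"
    proof (rule sum.cong[OF refl])
      fix i assume "i \<in> {..<m}"
      show "(\<Sum>C\<in>cosets (perp L) L. b (rep C) (- nmul i v)) \<star> U (nmul i v) x
        = (if i = 0 then of_nat (card (cosets (perp L) L)) \<star> x else 0)"
      proof (cases "i = 0")
        case True
        then show ?thesis by (simp add: U_zero)
      next
        case False
        then have "- nmul i v \<notin> perp (perp L)"
          using least \<open>i \<in> {..<m}\<close> niceD(5)[OF L] add_subgroupD(3)[OF Ls, of "- nmul i v"] by auto
        moreover have "- nmul i v \<in> perp L"
          using nmul_mem[OF add_subgroup_perp vL] add_subgroupD(3)[OF add_subgroup_perp] by blast
        ultimately show ?thesis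
          using character_sum_zero[OF add_subgroup_perp Ls niceD(6)[OF L]] False by simp
      qed
    qed
    also have "\<dots> = of_nat (card (cosets (perp L) L)) \<star> x" using m(2) by simp
    finally have "of_nat (card (cosets (perp L) L)) = (0::'r)" using x(2) by simp
    then show False
      using index_nonzero[of "perp L" L] fin niceD(4,5,6)[OF L] add_subgroup_perp by auto
  qed
  then obtain u where u: "u \<in> perp L" "y u \<noteq> 0" by auto
  have comm: "U z (y u) = c \<star> y u" if "U z x = c \<star> x" "b z v = 1" for z c
    unfolding y_def g_def U_sum
    by (auto simp: scale_sum_right U_scale U_commute[of z] that b_nmul_eq_1 intro!: sum.cong)
  have "U v (y u) = b u v \<star> y u"
  proof -
    have step: "U v (g u i) = b u v \<star> g u (Suc i)" for i
    proof -
      have "b u v * b u (- nmul (Suc i) v) = b u (- nmul i v)"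
        by (simp only: b_add_right[symmetric]) simp
      then show ?thesis by (simp add: g_def U_scale U_mult be_nmul)
    qed
    \<comment> \<open>The shift is cyclic: \<open>nmul m v\<close> lies in \<open>L\<close>, so it
      fixes \<open>x\<close> and pairs trivially with \<open>u\<close>.\<close>
    have "(\<Sum>i<m. g u (Suc i)) = (\<Sum>i<m. g u i)"
    proof -
      have "g u m = g u 0"
        using m(1) x(1) perpD(2)[OF u(1) m(1)] by (simp add: g_def U_zero b_minus_right fix_space_def)
      moreover have "(\<Sum>i<Suc m. g u i) = g u 0 + (\<Sum>i<m. g u (Suc i))" by (rule sum.lessThan_Suc_shift)
      ultimately show ?thesis by simp
    qed
    then show ?thesis unfolding y_def U_sum step scale_sum_right[symmetric] by simp
  qed
  then have "v \<in> eigen_stab (y u)" by (auto simp: eigen_stab_def)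
  moreover have "eigen_stab x \<subseteq> eigen_stab (y u)"
  proof
    fix z assume z: "z \<in> eigen_stab x"
    then obtain c where "U z x = c \<star> x" by (auto simp: eigen_stab_def)
    then show "z \<in> eigen_stab (y u)" using comm perpD(1)[OF v z] by (auto simp: eigen_stab_def)
  qed
  moreover have "y u \<in> fix_space L"
    unfolding fix_space_def
  proof (intro CollectI ballI)
    fix l assume "l \<in> L"
    then show "U l (y u) = y u" using comm[of l 1] x(1) perpD(1)[OF vL, of l] by (simp add: fix_space_def)
  qed
  ultimately show thesis using that u by blast
qed

text \<open>The number of classes of \<open>eigen_stab x\<close> modulo \<open>L\<close> is bounded
  by that of \<open>perp L\<close>, so some \<open>x\<close> attains the maximum. An element
  \<open>v\<close> orthogonal to \<open>eigen_stab x\<close> could be adjoined without increasing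
  this number; hence it lies in \<open>eigen_stab x\<close> up to \<open>L\<close>, which is itself
  contained in \<open>eigen_stab x\<close>.\<close>

lemma maximal_eigenvector:
  assumes L: "nice L"
  obtains x where "x \<in> fix_space L" "x \<noteq> 0" "perp (eigen_stab x) = eigen_stab x"
proof -
  note Ls = niceD(4)[OF L]
  have fin: "finite (cosets (perp L) L)" using finite_cosets_lattice lattice_perp' niceD(1)[OF L] by blast
  let ?P = "\<lambda>x. x \<in> fix_space L \<and> x \<noteq> 0"
  let ?f = "\<lambda>x. card (cosets (eigen_stab x) L)"
  have sub: "cosets (eigen_stab x) L \<subseteq> cosets (perp L) L" if "?P x" for x
    using eigen_stab_isotropic[of x] perp_antimono[OF fix_space_eigen_stab[of x L]] that
    unfolding cosets_def by blast
  obtain x0 where "?P x0" using niceD(3)[OF L] by auto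
  moreover have "\<forall>x. ?P x \<longrightarrow> ?f x < Suc (card (cosets (perp L) L))"
    using sub fin by (auto simp: less_Suc_eq_le intro: card_mono)
  ultimately have "\<exists>x. ?P x \<and> (\<forall>y. ?P y \<longrightarrow> ?f y \<le> ?f x)" by (rule ex_has_greatest_nat)
  then obtain x where x: "?P x" "\<And>y. ?P y \<Longrightarrow> ?f y \<le> ?f x" by blast
  have "v \<in> eigen_stab x" if v: "v \<in> perp (eigen_stab x)" for v
  proof -
    obtain y where y: "?P y" "eigen_stab x \<subseteq> eigen_stab y" "v \<in> eigen_stab y"
      using eigenvector_extend[OF L conjunct1[OF x(1)] conjunct2[OF x(1)] v] by metis
    have "finite (cosets (eigen_stab y) L)" using sub[OF y(1)] fin finite_subset by blast
    moreover have "cosets (eigen_stab x) L \<subseteq> cosets (eigen_stab y) L"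
      using y by (auto simp: cosets_def)
    ultimately have "cosets (eigen_stab x) L = cosets (eigen_stab y) L"
      using x(2)[OF y(1)] card_seteq by blast
    then have "coset L v \<in> cosets (eigen_stab x) L" using y by (auto simp: cosets_def)
    then obtain z where z: "z \<in> eigen_stab x" "v - z \<in> L"
      using coset_eq_iff[OF Ls] by (auto simp: cosets_def)
    then have "v - z \<in> eigen_stab x" using fix_space_eigen_stab[of x L] x by auto
    then show ?thesis using add_subgroup_add_iff(3)[OF eigen_stab_subgroup z(1)] x by blast
  qed
  then show thesis using that[of x] x eigen_stab_isotropic[of x] by blast
qed

text \<open>In a combination whose twists by all elements of \<open>P\<close> have the same value
  \<open>t\<close>, the terms on which \<open>P\<close> acts by the trivial character already sum to
  \<open>t\<close>. The index \<open>None\<close> carries the trivial character with coefficient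
  \<open>- t\<close>.\<close>

lemma character_independence_comb:
  assumes "\<And>u. u \<in> P \<Longrightarrow> (\<Sum>j<length ps. b u (snd (ps ! j)) \<star> (fst (ps ! j) \<star> U (snd (ps ! j)) s)) = t"
    and P: "add_subgroup P"
  shows "(\<Sum>j | j < length ps \<and> snd (ps ! j) \<in> perp P. fst (ps ! j) \<star> U (snd (ps ! j)) s) = t"
proof -
  let ?J = "insert None (Some ` {..<length ps})"
  let ?k = "\<lambda>j u. case j of None \<Rightarrow> 1 | Some i \<Rightarrow> b u (snd (ps ! i))"
  let ?y = "\<lambda>j. case j of None \<Rightarrow> - t | Some i \<Rightarrow> fst (ps ! i) \<star> U (snd (ps ! i)) s"
  have "(\<Sum>j | j \<in> ?J \<and> (\<forall>u\<in>P. ?k j u = ?k None u). ?y j) = 0"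
    using assms(1) add_subgroupD[OF P]
    by (intro character_independence) (auto simp: b_add_left sum.reindex)
  also have "{j. j \<in> ?J \<and> (\<forall>u\<in>P. ?k j u = ?k None u)}
      = insert None (Some ` {j. j < length ps \<and> snd (ps ! j) \<in> perp P})"
    by (auto simp: perp_def)
  finally show ?thesis by (simp add: sum.reindex)
qed

text \<open>By irreducibility \<open>y\<close> is a combination of translates of \<open>x\<close>.
  The translate by \<open>w\<close> has the eigencharacter of \<open>x\<close> twisted by
  \<open>w\<close>, so comparison of eigencharacters leaves only those \<open>w\<close> orthogonal
  to \<open>eigen_stab x\<close>. These lie in \<open>eigen_stab x\<close>, and their translates are
  multiples of \<open>x\<close>.\<close>

lemma eigenspace_one_dimensional:
  assumes x: "x \<noteq> 0" "perp (eigen_stab x) = eigen_stab x"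
    and y: "\<And>v c. U v x = c \<star> x \<Longrightarrow> U v y = c \<star> y"
  obtains c where "y = c \<star> x"
proof -
  obtain ps where ps: "y = comb ps x" using U_generates[OF x(1)] by blast
  let ?t = "\<lambda>j. fst (ps ! j) \<star> U (snd (ps ! j)) x"
  have "(\<Sum>j<length ps. b u (snd (ps ! j)) \<star> ?t j) = y" if u: "u \<in> eigen_stab x" for u
  proof -
    obtain c where c: "U u x = c \<star> x" using u by (auto simp: eigen_stab_def)
    have c0: "c \<noteq> 0" using c x(1) by (metis U_eq_0_iff scale_zero_left)
    have "c \<star> y = U u (comb ps x)" using y[OF c] ps by simp
    also have "\<dots> = c \<star> (\<Sum>j<length ps. b u (snd (ps ! j)) \<star> ?t j)"
      unfolding comb_nth U_sum scale_sum_right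
      by (rule sum.cong) (auto simp: U_scale U_commute[of u] c mult_ac)
    finally show ?thesis using c0 by simp
  qed
  from character_independence_comb[OF this eigen_stab_subgroup[OF x(1)]]
  have *: "(\<Sum>j | j < length ps \<and> snd (ps ! j) \<in> eigen_stab x. ?t j) = y" by (simp only: x(2))
  have "\<forall>j. snd (ps ! j) \<in> eigen_stab x \<longrightarrow> (\<exists>d. ?t j = d \<star> x)"
    by (auto simp: eigen_stab_def)
  then obtain d where d: "\<And>j. snd (ps ! j) \<in> eigen_stab x \<Longrightarrow> ?t j = d j \<star> x" by metis
  have "y = (\<Sum>j | j < length ps \<and> snd (ps ! j) \<in> eigen_stab x. d j) \<star> x"
    unfolding *[symmetric] scale_sum_left by (rule sum.cong) (auto simp: d)
  then show thesis by (rule that)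
qed

text \<open>\<open>A\<close> preserves the eigenspace of a maximal eigenvector \<open>x\<close>,
  which is a line, so \<open>A\<close> acts on \<open>x\<close> by a scalar of R. The corresponding
  eigenspace of \<open>A\<close> is stable under all \<open>U w\<close>.\<close>

lemma schur:
  assumes A: "linear_op A" and comm: "\<And>w s. A (U w s) = U w (A s)"
  obtains c where "\<And>s. A s = c \<star> s"
proof -
  obtain L where "nice L" using nice_small[of 1] by auto
  then obtain x where x: "x \<noteq> 0" "perp (eigen_stab x) = eigen_stab x"
    using maximal_eigenvector by metis
  have "U v (A x) = c \<star> A x" if "U v x = c \<star> x" for v c
    using that comm[of v x] by (simp add: linear_opD[OF A])
  then obtain c where c: "A x = c \<star> x" using eigenspace_one_dimensional[OF x] by metis
  let ?N = "{s. A s = c \<star> s}"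
  have "subspace ?N"
    unfolding subspace_def by (auto simp: linear_opD[OF A] scale_right_distrib mult.commute)
  moreover have "U w s \<in> ?N" if "s \<in> ?N" for w s using that by (simp add: comm U_scale)
  ultimately have "?N = {0} \<or> ?N = UNIV" by (rule irreducible)
  then have "?N = UNIV" using c x(1) by blast
  then show thesis using that by blast
qed

definition expands :: "'w set \<Rightarrow> ('s \<Rightarrow> 's) \<Rightarrow> ('r \<times> 'w) list \<Rightarrow> bool" where
  "expands L A ps \<longleftrightarrow> (\<forall>s\<in>fix_space L. A s = comb ps s)"

lemma expands_sum:
  assumes "\<And>j. j \<in> J \<Longrightarrow> \<exists>ps. expands L (A j) ps"
  shows "\<exists>ps. expands L (\<lambda>s. \<Sum>j\<in>J. A j s) ps"
  using assms
proof (induction J rule: infinite_finite_induct)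
  case (insert j J)
  then obtain ps qs where "expands L (A j) ps" "expands L (\<lambda>s. \<Sum>j\<in>J. A j s) qs" by fastforce
  then show ?case using insert.hyps by (intro exI[of _ "ps @ qs"]) (auto simp: expands_def)
qed (auto simp: expands_def intro: exI[of _ "[]"])

lemma expands_scale: "expands L A ps \<Longrightarrow> expands L (\<lambda>s. r \<star> A s) (map (\<lambda>p. (r * fst p, snd p)) ps)"
  by (simp add: expands_def comb_scale)

lemma expands_U: "expands L A ps \<Longrightarrow>
    expands L (\<lambda>s. U w (A s)) (map (\<lambda>p. (fst p * be w (snd p), w + snd p)) ps)"
  by (simp add: expands_def U_comb)

lemma expands_comb:
  assumes "\<exists>qs. expands L A qs"
  shows "\<exists>qs. expands L (\<lambda>s. comb ps (A s)) qs"
proof (induction ps)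
  case Nil
  then show ?case by (auto simp: expands_def intro: exI[of _ "[]"])
next
  case (Cons p ps)
  then obtain qs where "expands L (\<lambda>s. comb ps (A s)) qs" by auto
  moreover obtain rs where "expands L (\<lambda>s. fst p \<star> U (snd p) (A s)) rs"
    using assms expands_U expands_scale by meson
  ultimately show ?case by (intro exI[of _ "rs @ qs"]) (auto simp: expands_def)
qed

text \<open>
  Averaging the projection to a line \<open>R x\<close> over \<open>perp L / L\<close> gives a non-zero scalar, and an
  operator is determined on \<open>R x\<close> by one vector, which is a combination of the \<open>U w x\<close>.
\<close>

lemma expansion_exists:
  assumes L: "nice L" and A: "linear_op A"
  shows "\<exists>ps. expands L A ps"
proof -
  note Ls = niceD(4)[OF L]
  obtain x where x: "x \<in> fix_space L" "x \<noteq> 0" "perp (eigen_stab x) = eigen_stab x"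
    using maximal_eigenvector[OF L] by metis
  define P where "P = eigen_stab x"
  have P: "add_subgroup P" "L \<subseteq> P" "perp P = P"
    using eigen_stab_subgroup fix_space_eigen_stab x by (auto simp: P_def)
  have PL: "P \<subseteq> perp L" using perp_antimono[OF P(2)] P(3) by simp
  have "\<forall>v. \<exists>c. v \<in> P \<longrightarrow> U v x = c \<star> x" by (auto simp: P_def eigen_stab_def)
  \<comment> \<open>\<open>k\<close> is the eigencharacter of \<open>x\<close>; it is multiplicative
    only up to the cocycle \<open>be\<close>.\<close>
  then obtain k where k: "\<And>v. v \<in> P \<Longrightarrow> U v x = k v \<star> x" by metis
  have k0: "k v \<noteq> 0" if "v \<in> P" for v using k[OF that] x(2) by (metis U_eq_0_iff scale_zero_left)
  have kL: "k l = 1" if "l \<in> L" for l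
  proof -
    have "k l \<star> x = 1 \<star> x" using k[of l] that P x by (auto simp: fix_space_def)
    then show ?thesis using x(2) by (simp only: scale_cancel_right) simp
  qed
  have kmult: "k v * k w = be v w * k (v + w)" if "v \<in> P" "w \<in> P" for v w
  proof -
    have "U v (U w x) = (k v * k w) \<star> x" using k that by (simp add: U_scale mult.commute)
    moreover have "U v (U w x) = (be v w * k (v + w)) \<star> x"
      by (simp only: U_mult k[OF add_subgroupD(4)[OF P(1) that]] scale_scale)
    ultimately show ?thesis using x(2) by simp
  qed
  \<comment> \<open>Up to a scalar the projection from the \<open>L\<close>-fixed vectors onto the
    \<open>P\<close>-eigenspace with the eigenvalues of \<open>x\<close>, which is the line of
    \<open>x\<close>.\<close>
  define E where "E s = (\<Sum>D\<in>cosets P L. inverse (k (rep D)) \<star> U (rep D) s)" for s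
  have repP: "rep D \<in> P" if "D \<in> cosets P L" for D using rep_mem(1)[OF P(1) Ls P(2) that] .
  have E_eigen: "U v (E s) = k v \<star> E s" if s: "s \<in> fix_space L" and v: "v \<in> P" for s v
  proof -
    let ?F = "\<lambda>w. inverse (k w) \<star> U w s"
    have inv: "?F (w + l) = ?F w" if "w \<in> P" "l \<in> L" for w l
    proof -
      have kl: "be w l * k (w + l) = k w" using kmult[of w l] kL that P by auto
      moreover have "U (w + l) s = inverse (be w l) \<star> U w s"
        using U_plus[of w l s] s that by (simp add: fix_space_def)
      ultimately show ?thesis by (simp flip: kl add: mult.commute)
    qed
    have "U v (E s) = (\<Sum>D\<in>cosets P L. k v \<star> ?F (rep D + v))"
      unfolding E_def U_sum
    proof (rule sum.cong[OF refl])
      fix D assume D: "D \<in> cosets P L"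
      have nz: "k (rep D) \<noteq> 0" "k (v + rep D) \<noteq> 0"
        using k0 repP[OF D] v add_subgroupD(4)[OF P(1)] by auto
      have "inverse (k (rep D)) * be v (rep D) = k v * inverse (k (v + rep D))"
        using kmult[OF v repP[OF D]] nz by (simp add: field_simps)
      then show "U v (?F (rep D)) = k v \<star> ?F (rep D + v)"
        by (simp add: U_scale U_mult add.commute)
    qed
    also have "\<dots> = k v \<star> (\<Sum>D\<in>cosets P L. ?F (rep D + v))" by (simp add: scale_sum_right)
    also have "(\<Sum>D\<in>cosets P L. ?F (rep D + v)) = E s"
      unfolding E_def by (rule cosets_sum_translate[OF P(1) Ls P(2) inv v])
    finally show ?thesis .
  qed
  have E_line: "\<exists>c. E s = c \<star> x" if s: "s \<in> fix_space L" for s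
  proof -
    have "U v (E s) = c \<star> E s" if "U v x = c \<star> x" for v c
    proof -
      have v: "v \<in> P" using that by (auto simp: P_def eigen_stab_def)
      then have "k v \<star> x = c \<star> x" using k that by metis
      then have "c = k v" using x(2) by simp
      then show ?thesis using E_eigen[OF s v] by simp
    qed
    then show ?thesis using eigenspace_one_dimensional[OF x(2,3)] by metis
  qed
  let ?Q = "cosets (perp L) L"
  define n where "n = (of_nat (card ?Q) :: 'r)"
  have fin: "finite ?Q" using finite_cosets_lattice lattice_perp' niceD(1)[OF L] by blast
  have n0: "n \<noteq> 0"
    using index_nonzero[of "perp L" L] fin niceD(4,5,6)[OF L] add_subgroup_perp by (auto simp: n_def)
  have repQ: "rep C \<in> perp L" if "C \<in> ?Q" for C
    using rep_mem(1)[OF add_subgroup_perp Ls niceD(6)[OF L] that] .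
  \<comment> \<open>Conjugation by \<open>rep C\<close> twists the term at \<open>rep D\<close> by a
    character of the class \<open>C\<close>. By orthogonality only the class of 0 survives, where
    the operator is the identity on \<open>L\<close>-fixed vectors.\<close>
  have average: "n \<star> s = (\<Sum>C\<in>?Q. U (rep C) (E (U (- rep C) s)))" if s: "s \<in> fix_space L" for s
  proof -
    have "(\<Sum>C\<in>?Q. U (rep C) (E (U (- rep C) s)))
        = (\<Sum>C\<in>?Q. \<Sum>D\<in>cosets P L. b (rep C) (rep D) \<star> (inverse (k (rep D)) \<star> U (rep D) s))"
      unfolding E_def U_sum
      by (intro sum.cong refl) (simp add: U_scale U_commute[of "rep _" "rep _"] mult.commute)
    also have "\<dots> = (\<Sum>D\<in>cosets P L. (\<Sum>C\<in>?Q. b (rep C) (rep D)) \<star> (inverse (k (rep D)) \<star> U (rep D) s))"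
      by (subst sum.swap) (simp only: scale_sum_left)
    also have "\<dots> = (\<Sum>D\<in>cosets P L. if D = coset L 0 then n \<star> s else 0)"
    proof (rule sum.cong[OF refl])
      fix D assume D: "D \<in> cosets P L"
      show "(\<Sum>C\<in>?Q. b (rep C) (rep D)) \<star> (inverse (k (rep D)) \<star> U (rep D) s)
          = (if D = coset L 0 then n \<star> s else 0)"
      proof (cases "D = coset L 0")
        case True
        then have r: "rep D \<in> L" using rep_coset[OF Ls, of 0] by simp
        then have "rep D \<in> perp (perp L)" using niceD(5)[OF L] by simp
        then have "(\<Sum>C\<in>?Q. b (rep C) (rep D)) = n"
          using character_sum_one[OF add_subgroup_perp Ls niceD(6)[OF L]] by (simp add: n_def)
        then show ?thesis using True r s kL by (simp add: fix_space_def)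
      next
        case False
        have "rep D \<notin> L"
          using False rep_mem(2)[OF P(1) Ls P(2) D] coset_eq_iff[OF Ls, of "rep D" 0] by auto
        then have "rep D \<notin> perp (perp L)" using niceD(5)[OF L] by simp
        then show ?thesis
          using character_sum_zero[OF add_subgroup_perp Ls niceD(6)[OF L]] repP[OF D] PL False by auto
      qed
    qed
    also have "\<dots> = n \<star> s"
    proof -
      have "finite (cosets P L)" using finite_cosets_mono[OF Ls Ls PL subset_refl fin] .
      moreover have "coset L 0 \<in> cosets P L" using add_subgroupD(1)[OF P(1)] by (auto simp: cosets_def)
      ultimately show ?thesis by simp
    qed
    finally show ?thesis by simp
  qed
  \<comment> \<open>After \<open>E\<close> the vector is a multiple of \<open>x\<close>, so one
    combination \<open>ps\<close>, chosen for the single vector \<open>A (U (rep C) x)\<close>,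
    describes the operator on all of them. \<open>E\<close> is a combination of translations
    itself.\<close>
  have "\<exists>ps. expands L (\<lambda>s. A (U (rep C) (E (U (- rep C) s)))) ps" if C: "C \<in> ?Q" for C
  proof -
    obtain ps where ps: "A (U (rep C) x) = comb ps x" using U_generates[OF x(2)] by blast
    have "A (U (rep C) t) = comb ps t" if "t = c \<star> x" for t c
      using that ps by (simp add: linear_opD[OF A] linear_opD[OF linear_op_comb] U_scale)
    then have *: "A (U (rep C) (E (U (- rep C) s))) = comb ps (E (U (- rep C) s))"
      if "s \<in> fix_space L" for s
      using E_line[of "U (- rep C) s"] fix_space_perp[OF that] repQ[OF C]
        add_subgroupD(3)[OF add_subgroup_perp] by metis
    have "\<exists>ps. expands L (\<lambda>s. inverse (k (rep D)) \<star> U (rep D) (U (- rep C) s)) ps" for D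
    proof -
      have "expands L (U (- rep C)) [(1, - rep C)]" by (simp add: expands_def)
      then show ?thesis using expands_U expands_scale by meson
    qed
    then have "\<exists>ps. expands L (\<lambda>s. E (U (- rep C) s)) ps" unfolding E_def by (intro expands_sum)
    then obtain qs where "expands L (\<lambda>s. comb ps (E (U (- rep C) s))) qs" using expands_comb by meson
    then show ?thesis using * by (auto simp: expands_def)
  qed
  then have "\<exists>ps. expands L (\<lambda>s. \<Sum>C\<in>?Q. A (U (rep C) (E (U (- rep C) s)))) ps"
    by (rule expands_sum)
  then obtain ps where "expands L (\<lambda>s. \<Sum>C\<in>?Q. A (U (rep C) (E (U (- rep C) s)))) ps"
    by blast
  then have "expands L (\<lambda>s. n \<star> A s) ps"
    using average by (auto simp: expands_def linear_opD(4)[OF A, symmetric] linear_opD(2)[OF A, symmetric])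
  then have "expands L (\<lambda>s. inverse n \<star> (n \<star> A s)) (map (\<lambda>p. (inverse n * fst p, snd p)) ps)"
    by (rule expands_scale)
  then show ?thesis using n0 by auto
qed

end

context heisenberg_system begin

subsection \<open>The coefficient of an operator at the origin\<close>

definition list_coeff :: "'w set \<Rightarrow> ('r \<times> 'w) list \<Rightarrow> 'r" where
  "list_coeff L ps = (\<Sum>p\<leftarrow>ps. if snd p \<in> L then fst p else 0)"

definition coeff :: "'w set \<Rightarrow> ('s \<Rightarrow> 's) \<Rightarrow> 'r" where
  "coeff L A = list_coeff L (SOME ps. expands L A ps)"

text \<open>Conjugation by \<open>u\<close> in \<open>perp L\<close> preserves the fixed vectors and
  multiplies each term by the value of a character at \<open>u\<close>. Independence isolates the
  terms whose translation lies in the double orthogonal of \<open>L\<close>, which is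
  \<open>L\<close>, and these act on a fixed vector by their coefficients.\<close>

lemma list_coeff_unique:
  assumes L: "nice L" and z: "\<And>s. s \<in> fix_space L \<Longrightarrow> comb ps s = 0"
  shows "list_coeff L ps = 0"
proof -
  obtain s where s: "s \<in> fix_space L" "s \<noteq> 0" using niceD(3)[OF L] by auto
  have twisted: "(\<Sum>j<length ps. b u (snd (ps ! j)) \<star> (fst (ps ! j) \<star> U (snd (ps ! j)) s)) = 0"
    if u: "u \<in> perp L" for u
  proof -
    have "U (- u) s \<in> fix_space L"
      using fix_space_perp[OF s(1)] u add_subgroupD(3)[OF add_subgroup_perp] by blast
    then have "U u (comb ps (U (- u) s)) = 0" using z by simp
    then show ?thesis
      unfolding comb_nth U_sum by (simp add: U_scale U_commute[of u] mult.commute)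
  qed
  have "(\<Sum>j | j < length ps \<and> snd (ps ! j) \<in> perp (perp L). fst (ps ! j) \<star> U (snd (ps ! j)) s) = 0"
    by (intro character_independence_comb add_subgroup_perp twisted)
  then have "(\<Sum>j | j < length ps \<and> snd (ps ! j) \<in> L. fst (ps ! j) \<star> U (snd (ps ! j)) s) = 0"
    by (simp only: niceD(5)[OF L])
  also have "(\<Sum>j | j < length ps \<and> snd (ps ! j) \<in> L. fst (ps ! j) \<star> U (snd (ps ! j)) s)
      = (\<Sum>j | j < length ps \<and> snd (ps ! j) \<in> L. fst (ps ! j)) \<star> s"
    unfolding scale_sum_left using s(1) by (intro sum.cong) (auto simp: fix_space_def)
  also have "(\<Sum>j | j < length ps \<and> snd (ps ! j) \<in> L. fst (ps ! j)) = list_coeff L ps"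
  proof -
    have "{j. j < length ps \<and> snd (ps ! j) \<in> L} = {j \<in> {..<length ps}. snd (ps ! j) \<in> L}" by auto
    then show ?thesis
      using sum.inter_filter[of "{..<length ps}" "\<lambda>j. fst (ps ! j)" "\<lambda>j. snd (ps ! j) \<in> L"]
      by (simp add: list_coeff_def sum_list_sum_nth atLeast0LessThan)
  qed
  finally show ?thesis using s(2) by simp
qed

lemma list_coeff_append: "list_coeff L (ps @ qs) = list_coeff L ps + list_coeff L qs"
  by (simp add: list_coeff_def)

lemma list_coeff_scale: "list_coeff L (map (\<lambda>p. (r * fst p, snd p)) ps) = r * list_coeff L ps"
  by (induction ps) (auto simp: list_coeff_def algebra_simps)

lemma coeff_eq:
  assumes L: "nice L" and ps: "expands L A ps"
  shows "coeff L A = list_coeff L ps"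
proof -
  define qs where "qs = (SOME ps. expands L A ps)"
  have qs: "expands L A qs" unfolding qs_def using ps by (rule someI)
  have "list_coeff L (ps @ map (\<lambda>p. (- 1 * fst p, snd p)) qs) = 0"
    using ps qs comb_scale[of "- 1" qs]
    by (intro list_coeff_unique[OF L]) (simp add: expands_def)
  then show ?thesis
    using list_coeff_scale[of L "- 1" qs] by (simp add: list_coeff_append coeff_def qs_def)
qed

lemma coeff_scale:
  assumes L: "nice L" and A: "linear_op A"
  shows "coeff L (\<lambda>s. r \<star> A s) = r * coeff L A"
proof -
  obtain ps where ps: "expands L A ps" using expansion_exists[OF L A] by auto
  show ?thesis using coeff_eq[OF L ps] coeff_eq[OF L expands_scale[OF ps]] by (simp add: list_coeff_scale)
qed

text \<open>Conjugation multiplies the term at \<open>w\<close> by \<open>b u w\<close>, which is 1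
  for the terms that count.\<close>

lemma coeff_conj:
  assumes L: "nice L" and A: "linear_op A" and u: "u \<in> perp L"
  shows "coeff L (\<lambda>s. U u (A (U (- u) s))) = coeff L A"
proof -
  obtain ps where ps: "expands L A ps" using expansion_exists[OF L A] by auto
  let ?qs = "map (\<lambda>p. (b u (snd p) * fst p, snd p)) ps"
  have "U u (comb ps (U (- u) s)) = comb ?qs s" for s
    by (induction ps) (auto simp: U_add U_scale U_commute[of u] mult.commute)
  then have "expands L (\<lambda>s. U u (A (U (- u) s))) ?qs"
    using ps fix_space_perp u add_subgroupD(3)[OF add_subgroup_perp] by (auto simp: expands_def)
  moreover have "list_coeff L ?qs = list_coeff L ps"
    using perpD(2)[OF u] by (induction ps) (auto simp: list_coeff_def)
  ultimately show ?thesis using coeff_eq[OF L] ps by metis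
qed

lemma coeff_shift:
  assumes L: "nice L" and A: "linear_op A" and l: "l \<in> L"
  shows "coeff L (\<lambda>s. U l (A s)) = coeff L A"
proof -
  obtain ps where ps: "expands L A ps" using expansion_exists[OF L A] by auto
  have "list_coeff L (map (\<lambda>p. (fst p * be l (snd p), l + snd p)) ps) = list_coeff L ps"
    using niceD(7)[OF L l] add_subgroup_add_iff(2)[OF niceD(4)[OF L] l]
    by (induction ps) (auto simp: list_coeff_def)
  then show ?thesis using coeff_eq[OF L] ps expands_U[OF ps, of l] by metis
qed

lemma list_coeff_cosets:
  assumes "finite (cosets L L')"
  shows "list_coeff L ps
    = (\<Sum>C\<in>cosets L L'. \<Sum>p\<leftarrow>ps. if snd p \<in> L \<and> coset L' (snd p) = C then fst p else 0)"
proof (induction ps)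
  case (Cons p ps)
  have "(\<Sum>C\<in>cosets L L'. if snd p \<in> L \<and> coset L' (snd p) = C then fst p else 0)
      = (if snd p \<in> L then fst p else 0)"
    using assms by (auto simp: cosets_def)
  then show ?case using Cons by (simp add: list_coeff_def sum.distrib)
qed (simp add: list_coeff_def)

text \<open>The terms with translation in \<open>L\<close> are distributed over the cosets of
  \<open>L'\<close>. Those in the coset of \<open>rep C\<close> are moved into \<open>L'\<close> by
  \<open>U (- rep C)\<close>, without a phase since \<open>L\<close> is isotropic.\<close>

lemma coeff_refine:
  assumes L: "nice L" and L': "lattice L'" "L' \<subseteq> L" and A: "linear_op A"
  shows "coeff L A = (\<Sum>C\<in>cosets L L'. coeff L' (\<lambda>s. U (- rep C) (A s)))"
proof -
  note n' = nice_mono[OF L L']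
  obtain ps where ps: "expands L' A ps" using expansion_exists[OF n' A] by auto
  then have "expands L A ps" using fix_space_mono[OF L'(2)] by (auto simp: expands_def)
  then have "coeff L A = list_coeff L ps" by (rule coeff_eq[OF L])
  also have "\<dots> = (\<Sum>C\<in>cosets L L'. \<Sum>p\<leftarrow>ps. if snd p \<in> L \<and> coset L' (snd p) = C then fst p else 0)"
    using finite_cosets_lattice[OF niceD(1)[OF L] L'(1)] by (rule list_coeff_cosets)
  also have "\<dots> = (\<Sum>C\<in>cosets L L'. coeff L' (\<lambda>s. U (- rep C) (A s)))"
  proof (rule sum.cong[OF refl])
    fix C assume C: "C \<in> cosets L L'"
    note r = rep_mem(1,2)[OF niceD(4)[OF L] niceD(4)[OF n'] L'(2) C]
    have mem: "(snd p \<in> L \<and> coset L' (snd p) = C) \<longleftrightarrow> - rep C + snd p \<in> L'" for p :: "'r \<times> 'w"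
    proof -
      have "coset L' (snd p) = C \<longleftrightarrow> snd p - rep C \<in> L'"
        using coset_eq_iff[OF niceD(4)[OF n'], of "snd p" "rep C"] r by simp
      moreover have "snd p \<in> L" if "snd p - rep C \<in> L'"
        using that L'(2) add_subgroup_add_iff(3)[OF niceD(4)[OF L] r(1), of "snd p"] by auto
      ultimately show ?thesis by auto
    qed
    have "be (- rep C) (snd p) = 1" if "- rep C + snd p \<in> L'" for p :: "'r \<times> 'w"
      using niceD(7)[OF L r(1), of "snd p"] mem[of p] that by (simp add: half.b_minus_left)
    with mem have "(\<Sum>p\<leftarrow>ps. if snd p \<in> L \<and> coset L' (snd p) = C then fst p else 0)
        = list_coeff L' (map (\<lambda>p. (fst p * be (- rep C) (snd p), - rep C + snd p)) ps)"
      unfolding list_coeff_def map_map by (intro arg_cong[of _ _ sum_list] map_cong) auto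
    then show "(\<Sum>p\<leftarrow>ps. if snd p \<in> L \<and> coset L' (snd p) = C then fst p else 0)
        = coeff L' (\<lambda>s. U (- rep C) (A s))"
      using coeff_eq[OF n' expands_U[OF ps, of "- rep C"]] by simp
  qed
  finally show ?thesis .
qed

text \<open>On a vector fixed by \<open>L\<close>, all translations from one coset of
  \<open>L\<close> act alike up to a phase. The translated coefficient collects exactly these terms,
  so an operator all of whose translated coefficients vanish is 0 on the fixed vectors.\<close>

lemma comb_cosets:
  assumes L: "nice L" and s: "s \<in> fix_space L"
    and z: "\<And>w. list_coeff L (map (\<lambda>p. (fst p * be (- w) (snd p), - w + snd p)) ps) = 0"
  shows "comb ps s = 0"
proof -
  note Ls = niceD(4)[OF L]
  let ?S = "coset L ` snd ` set ps"
  let ?c = "\<lambda>D p. if coset L (snd p) = D then fst p \<star> U (snd p) s else 0"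
  have "comb qs s = (\<Sum>D\<in>?S. \<Sum>p\<leftarrow>qs. ?c D p)" if "set qs \<subseteq> set ps" for qs
    using that
  proof (induction qs)
    case (Cons p qs)
    have "(\<Sum>D\<in>?S. ?c D p) = fst p \<star> U (snd p) s" using Cons.prems by simp
    then show ?case using Cons by (simp add: sum.distrib)
  qed simp
  then have "comb ps s = (\<Sum>D\<in>?S. \<Sum>p\<leftarrow>ps. ?c D p)" by simp
  also have "\<dots> = 0"
  proof (rule sum.neutral, rule ballI)
    fix D assume "D \<in> ?S"
    then obtain w where w: "D = coset L w" by auto
    have "(\<Sum>p\<leftarrow>qs. ?c D p)
        = list_coeff L (map (\<lambda>p. (fst p * be (- w) (snd p), - w + snd p)) qs) \<star> U w s" for qs
    proof (induction qs)
      case (Cons p qs)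
      have "?c D p = (if - w + snd p \<in> L then fst p * be (- w) (snd p) else 0) \<star> U w s"
      proof (cases "- w + snd p \<in> L")
        case True
        have fixed: "U (- w + snd p) s = s" using True s unfolding fix_space_def by blast
        have "U (snd p) s = U (w + (- w + snd p)) s" by simp
        also have "\<dots> = inverse (be w (- w + snd p)) \<star> U w s" using U_plus[of w "- w + snd p" s] by (simp only: fixed)
        also have "inverse (be w (- w + snd p)) = be (- w) (snd p)"
          by (simp add: half.b_diff_right half.b_minus_left be_alternating)
        finally show ?thesis using True coset_eq_iff[OF Ls, of "snd p" w] w by (simp add: mult.commute)
      next
        case False
        then show ?thesis using coset_eq_iff[OF Ls, of "snd p" w] w by simp
      qed
      then show ?case using Cons.IH by (simp add: list_coeff_def scale_left_distrib)
    qed (simp add: list_coeff_def)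
    then show "(\<Sum>p\<leftarrow>ps. ?c D p) = 0" using z by simp
  qed
  finally show ?thesis .
qed

lemma coeff_nonzero_exists:
  assumes L: "nice L" and A: "linear_op A" "\<And>s. A s = 0 \<Longrightarrow> s = 0"
  obtains w where "coeff L (\<lambda>s. U (- w) (A s)) \<noteq> 0"
proof (rule ccontr)
  assume "\<not> thesis"
  then have z: "coeff L (\<lambda>s. U (- w) (A s)) = 0" for w using that by blast
  obtain ps where ps: "expands L A ps" using expansion_exists[OF L A(1)] by auto
  obtain s where s: "s \<in> fix_space L" "s \<noteq> 0" using niceD(3)[OF L] by auto
  have "comb ps s = 0"
  proof (rule comb_cosets[OF L s(1)])
    show "list_coeff L (map (\<lambda>p. (fst p * be (- w) (snd p), - w + snd p)) ps) = 0" for w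
      using z[of w] coeff_eq[OF L expands_U[OF ps, of "- w"]] by simp
  qed
  then have "A s = 0" using ps s by (simp add: expands_def)
  then show False using A(2) s by blast
qed

end

section \<open>Commutation of lifts in an abstract setting\<close>

subsection \<open>Lifts of commuting automorphisms commute\<close>

text \<open>\<open>K\<close> and \<open>I\<close> are the kernel and the image of k - 1; they are
  orthogonal to each other although they may intersect. They are not compact, so the counting lemmas
  do not apply to them directly: \<open>K_decompose\<close> and \<open>I_decompose\<close> say that
  orthogonality to a large bounded part differs from orthogonality to the whole only by elements
  orthogonal to a given ball.\<close>

locale heisenberg_automorphism = heisenberg_system sc be U Bl
  for sc :: "'r::field \<Rightarrow> 's::ab_group_add \<Rightarrow> 's" (infixr "\<star>" 75)
    and be :: "'w::ab_group_add \<Rightarrow> 'w \<Rightarrow> 'r" and U :: "'w \<Rightarrow> 's \<Rightarrow> 's" and Bl :: "real \<Rightarrow> 'w set" +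
  fixes k :: "'w \<Rightarrow> 'w" and M :: "'s \<Rightarrow> 's" and K I :: "'w set"
  assumes k_diff: "k (x - y) = k x - k y"
    and be_k: "be (k x) (k y) = be x y"
    and M_linear: "linear_op M"
    and M_inj: "M s = 0 \<Longrightarrow> s = 0"
    and M_U: "M (U w s) = U (k w) (M s)"
    and K_def: "K = {w. k w = w}"
    and I_def: "I = range (\<lambda>w. k w - w)"
    and k_bounded: "\<exists>C>0. \<forall>r>0. k ` Bl r \<subseteq> Bl (C * r)"
    and I_open: "0 < r \<Longrightarrow> \<exists>r'>0. I \<inter> Bl r' \<subseteq> (\<lambda>w. k w - w) ` Bl r"
    and perp_I: "perp I = K"
    and perp_K: "perp K = I"
    and K_decompose: "0 < r \<Longrightarrow> \<exists>r'\<ge>r. \<forall>w\<in>perp (K \<inter> Bl r'). \<exists>a\<in>perp K. w - a \<in> perp (Bl r)"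
    and I_decompose: "0 < r \<Longrightarrow> \<exists>r'\<ge>r. \<forall>w\<in>perp (I \<inter> Bl r'). \<exists>a\<in>perp I. w - a \<in> perp (Bl r)"
begin

abbreviation T :: "'w \<Rightarrow> 'w" where "T w \<equiv> k w - w"

lemma k_0 [simp]: "k 0 = 0" and k_minus: "k (- x) = - k x" and k_plus: "k (x + y) = k x + k y"
proof -
  show 0: "k 0 = 0" using k_diff[of 0 0] by simp
  show m: "k (- x) = - k x" for x using k_diff[of 0 x] 0 by simp
  show "k (x + y) = k x + k y" using k_diff[of x "- y"] m[of y] by simp
qed

lemma K_subgroup: "add_subgroup K" and I_subgroup: "add_subgroup I"
  using add_subgroup_perp perp_I perp_K by metis+

text \<open>The orthogonal of \<open>A \<inter> L\<close> is the sum of those of \<open>A\<close>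
  and \<open>L\<close>. The bounded part of \<open>A\<close> in a large ball has finite image modulo
  \<open>L\<close>, so \<open>perp_Int_decompose\<close> applies to it; the locale assumptions lead
  from there to all of \<open>A\<close>.\<close>

lemma perp_Int_lattice:
  assumes A: "A = K \<or> A = I" and L: "lattice L" and w: "w \<in> perp (A \<inter> L)"
  obtains a where "a \<in> perp A" "w - a \<in> perp L"
proof -
  obtain r where r: "r > 0" "L \<subseteq> Bl r" using latticeD(4)[OF L] by auto
  obtain r' where r': "r' \<ge> r" "\<forall>w\<in>perp (A \<inter> Bl r'). \<exists>a\<in>perp A. w - a \<in> perp (Bl r)"
    using K_decompose[OF r(1)] I_decompose[OF r(1)] A by blast
  have r'0: "r' > 0" using r r' by simp
  have sub: "add_subgroup (A \<inter> Bl r')"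
    using A K_subgroup I_subgroup Bl_subgroup[OF r'0] add_subgroup_Int by blast
  have int: "A \<inter> Bl r' \<inter> L = A \<inter> L" using r(2) Bl_mono[OF r'(1)] by auto
  obtain q where q: "q > 0" "Bl q \<subseteq> L" using latticeD(3)[OF L] by auto
  have "finite (cosets (A \<inter> Bl r') L)"
    using finite_cosets_mono[OF Bl_subgroup[OF q(1)] latticeD(1)[OF L] _ q(2) Bl_index[OF r'0 q(1)]] by blast
  moreover have "finite (cosets (A \<inter> Bl r') L) \<longleftrightarrow> finite (cosets (A \<inter> Bl r') (A \<inter> Bl r' \<inter> L))"
    using card_cosets_image(2)[of "A \<inter> Bl r' \<inter> L" L "A \<inter> Bl r'" "\<lambda>x. x"]
      add_subgroup_Int[OF sub latticeD(1)[OF L]] latticeD(1)[OF L] add_subgroupD(2)[OF sub] by auto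
  ultimately have fin: "finite (cosets (A \<inter> Bl r') (A \<inter> Bl r' \<inter> L))" by simp
  have w': "w \<in> perp (A \<inter> Bl r' \<inter> L)" using w int by simp
  obtain y where y: "y \<in> perp L" "w - y \<in> perp (A \<inter> Bl r')"
    using perp_Int_decompose[OF sub latticeD(1,2)[OF L] fin w'] by blast
  then obtain a where a: "a \<in> perp A" "w - y - a \<in> perp (Bl r)" using r'(2) by blast
  then have "w - y - a \<in> perp L" using perp_antimono[OF r(2)] by blast
  then have "w - y - a + y \<in> perp L" using y add_subgroupD(4)[OF add_subgroup_perp] by blast
  then show thesis using that[OF a(1)] by (simp add: algebra_simps)
qed

text \<open>The condition under which all quadratic phases occurring below are trivial.\<close>

definition tame :: "'w set \<Rightarrow> bool" where
  "tame L \<longleftrightarrow> nice L \<and> (\<forall>t\<in>L \<inter> I. \<exists>u\<in>perp L. T u = t \<and> be u (k u) = 1)"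

lemma tame_mono:
  assumes "tame L" "lattice L'" "L' \<subseteq> L"
  shows "tame L'"
  using assms nice_mono[of L L'] perp_antimono[OF assms(3)] unfolding tame_def by blast

lemma tame_exists: "\<exists>L. tame L"
proof -
  obtain r1 where r1: "r1 > 0" "isotropic (Bl r1)" using isotropic_small by auto
  obtain C where C: "C > 0" "\<forall>r>0. k ` Bl r \<subseteq> Bl (C * r)" using k_bounded by auto
  \<comment> \<open>Chosen so that \<open>u\<close> and \<open>k u\<close> both lie in the isotropic
    ball of radius \<open>r1\<close>, which makes the phase \<open>be u (k u)\<close>
    trivial.\<close>
  define r2 where "r2 = min r1 (r1 / C)"
  have "C * r2 \<le> C * (r1 / C)" using C(1) unfolding r2_def by (intro mult_left_mono) auto
  then have r2: "r2 > 0" "r2 \<le> r1" "C * r2 \<le> r1" using r1 C by (auto simp: r2_def)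
  obtain q where q: "q > 0" "I \<inter> Bl q \<subseteq> T ` Bl r2" using I_open[OF r2(1)] by auto
  obtain L where L: "nice L" "L \<subseteq> Bl (min q r1)" using nice_small[of "min q r1"] q r1 by auto
  have Lq: "L \<subseteq> Bl q" "L \<subseteq> Bl r1" using L(2) Bl_mono[of "min q r1" q] Bl_mono[of "min q r1" r1] by auto
  have "\<exists>u\<in>perp L. T u = t \<and> be u (k u) = 1" if t: "t \<in> L \<inter> I" for t
  proof -
    obtain u where u: "u \<in> Bl r2" "t = T u" using t q Lq by blast
    have u1: "u \<in> Bl r1" using u Bl_mono[OF r2(2)] by auto
    have "k u \<in> Bl r1" using u C(2) r2 Bl_mono[OF r2(3)] by blast
    then have "be u (k u) = 1" using u1 r1 by (auto simp: isotropic_def)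
    moreover have "u \<in> perp L"
      using u1 Lq r1(2) by (auto simp: isotropic_def be_eq_1D intro!: perpI)
    ultimately show ?thesis using u by auto
  qed
  then show ?thesis using L by (auto simp: tame_def)
qed

text \<open>Formally the coefficient of \<open>M\<close> at the translation \<open>w\<close>,
  smeared over the lattice \<open>L\<close>.\<close>

definition mcoeff :: "'w set \<Rightarrow> 'w \<Rightarrow> 'r" where
  "mcoeff L w = coeff L (\<lambda>s. U (- w) (M s))"

lemma linear_op_UM: "linear_op (\<lambda>s. U w (M s))"
  using linear_op_comp[OF linear_op_U M_linear] .

text \<open>Conjugation of \<open>M\<close> by \<open>U u\<close> multiplies it by a translation by
  \<open>u - k u\<close> and a phase, and it does not change coefficients when \<open>u\<close> is
  in \<open>perp L\<close>. So the coefficients are quasi-invariant under translation by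
  \<open>T u\<close>.\<close>

lemma mcoeff_translate:
  assumes L: "nice L" and u: "u \<in> perp L"
  shows "mcoeff L w = be u (- w) * be (u - w) (- k u) * mcoeff L (w + T u)"
proof -
  have "mcoeff L w = coeff L (\<lambda>s. U u (U (- w) (M (U (- u) s))))"
    unfolding mcoeff_def using coeff_conj[OF L linear_op_UM u] by simp
  also have "\<dots> = coeff L (\<lambda>s. (be u (- w) * be (u - w) (- k u)) \<star> U (- (w + T u)) (M s))"
  proof -
    have "U u (U (- w) (M (U (- u) s))) = (be u (- w) * be (u - w) (- k u)) \<star> U (- (w + T u)) (M s)" for s
    proof -
      have "U u (U (- w) (M (U (- u) s))) = be u (- w) \<star> U (u - w) (U (- k u) (M s))"
        using U_mult[of u "- w" "U (- k u) (M s)"] by (simp add: M_U k_minus)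
      also have "U (u - w) (U (- k u) (M s)) = be (u - w) (- k u) \<star> U (- (w + T u)) (M s)"
        using U_mult[of "u - w" "- k u" "M s"] by (simp add: algebra_simps)
      finally show ?thesis by simp
    qed
    then show ?thesis by simp
  qed
  also have "\<dots> = be u (- w) * be (u - w) (- k u) * mcoeff L (w + T u)"
    unfolding mcoeff_def by (rule coeff_scale[OF L linear_op_UM])
  finally show ?thesis .
qed

lemma mcoeff_translate_nonzero:
  assumes "nice L" "u \<in> perp L"
  shows "mcoeff L w \<noteq> 0 \<longleftrightarrow> mcoeff L (w + T u) \<noteq> 0"
  using mcoeff_translate[OF assms, of w] be_nonzero by auto

lemma U_minus_add: "U (- (w + l)) s = inverse (be l w) \<star> U (- l) (U (- w) s)"
  using U_plus[of "- l" "- w" s] by (simp add: half.b_minus_left half.b_minus_right add.commute)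

lemma mcoeff_shift:
  assumes L: "nice L" and l: "l \<in> L"
  shows "mcoeff L (w + l) = inverse (be l w) * mcoeff L w"
proof -
  have "- l \<in> L" using l add_subgroupD(3)[OF niceD(4)[OF L]] by blast
  then have "coeff L (\<lambda>s. U (- l) (U (- w) (M s))) = mcoeff L w"
    unfolding mcoeff_def using coeff_shift[OF L linear_op_UM] by blast
  moreover have "mcoeff L (w + l) = inverse (be l w) * coeff L (\<lambda>s. U (- l) (U (- w) (M s)))"
    unfolding mcoeff_def U_minus_add
    by (rule coeff_scale[OF L linear_op_comp[OF linear_op_U linear_op_UM]])
  ultimately show ?thesis by simp
qed

text \<open>For \<open>u\<close> in \<open>K\<close> the translation \<open>T u\<close> is 0, and
  the phase is the inverse of \<open>b u w\<close>. A non-zero coefficient forces this phase to be 1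
  for all \<open>u\<close> in \<open>K \<inter> perp L\<close>, whose orthogonal is the sum of
  \<open>I\<close> and \<open>L\<close>.\<close>

lemma mcoeff_support:
  assumes L: "nice L" and w: "mcoeff L w \<noteq> 0"
  obtains i where "i \<in> I" "w - i \<in> L"
proof -
  have "w \<in> perp (K \<inter> perp L)"
  proof (rule perpI)
    fix u assume u: "u \<in> K \<inter> perp L"
    then have "k u = u" by (simp add: K_def)
    then have "mcoeff L w = be u (- w) * be (u - w) (- u) * mcoeff L w"
      using mcoeff_translate[OF L, of u w] u by simp
    then have "be u (- w) * be (u - w) (- u) = 1" using w by simp
    moreover have "be u (- w) * be (u - w) (- u) = inverse (b u w)"
      by (simp add: half.b_diff_left half.b_minus_right be_alternating b_def power2_eq_square
          half.b_swap[of u w])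
    ultimately show "b u w = 1" by simp
  qed
  then obtain a where "a \<in> perp K" "w - a \<in> perp (perp L)"
    using perp_Int_lattice[of K "perp L"] lattice_perp' niceD(1)[OF L] by blast
  then show thesis using that[of a] perp_K niceD(5)[OF L] by simp
qed

text \<open>Of the cosets of \<open>L'\<close> in \<open>L\<close>, only those meeting
  \<open>I\<close> contribute, and they contribute equally: the phase of the translation from 0 to
  \<open>T u\<close> is the inverse of \<open>be u (k u)\<close>, which tameness makes 1. So passing
  to a smaller lattice costs only an index inside \<open>I\<close>.\<close>

lemma mcoeff_refine:
  assumes L: "tame L" and L': "lattice L'" "L' \<subseteq> L"
  shows "mcoeff L 0 = of_nat (card (cosets (L \<inter> I) (L' \<inter> I))) * mcoeff L' 0"
proof -
  have nL: "nice L" using L by (simp add: tame_def)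
  note nL' = nice_mono[OF nL L']
  note sL = niceD(4)[OF nL] and sL' = niceD(4)[OF nL']
  have fin: "finite (cosets L L')" using finite_cosets_lattice niceD(1)[OF nL] L' by blast
  have val: "mcoeff L' (rep C) = (if C \<in> cosets (L \<inter> I) L' then mcoeff L' 0 else 0)"
    if C: "C \<in> cosets L L'" for C
  proof (cases "C \<in> cosets (L \<inter> I) L'")
    case True
    then obtain t where t: "t \<in> L \<inter> I" "C = coset L' t" by (auto simp: cosets_def)
    then obtain u where u: "u \<in> perp L" "T u = t" "be u (k u) = 1" using L unfolding tame_def by blast
    have d: "rep C - t \<in> L'" using rep_coset[OF sL', of t] t by simp
    have "mcoeff L' (t + (rep C - t)) = inverse (be (rep C - t) t) * mcoeff L' t"
      by (rule mcoeff_shift[OF nL' d])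
    also have "be (rep C - t) t = 1" using d t L' niceD(7)[OF nL] by blast
    also have "mcoeff L' t = mcoeff L' 0"
    proof -
      have "u \<in> perp L'" using u perp_antimono[OF L'(2)] by blast
      from mcoeff_translate[OF nL' this, of 0] show ?thesis
        using u by (simp add: half.b_minus_right)
    qed
    finally show ?thesis using True by simp
  next
    case False
    have "mcoeff L' (rep C) = 0"
    proof (rule ccontr)
      assume "mcoeff L' (rep C) \<noteq> 0"
      then obtain i where i: "i \<in> I" "rep C - i \<in> L'" using mcoeff_support[OF nL'] by blast
      note r = rep_mem[OF sL sL' L'(2) C]
      have "i \<in> L"
        using i(2) L' r(1) add_subgroupD(2)[OF sL r(1), of "rep C - i"] by auto
      moreover have "coset L' i = C" using i coset_eq_iff[OF sL', of "rep C" i] r by simp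
      ultimately show False using False i by (auto simp: cosets_def)
    qed
    then show ?thesis using False by simp
  qed
  have "mcoeff L 0 = (\<Sum>C\<in>cosets L L'. mcoeff L' (rep C))"
    unfolding mcoeff_def using coeff_refine[OF nL L' linear_op_UM[of 0]] by (simp add: U_zero)
  also have "\<dots> = (\<Sum>C\<in>cosets L L'. if C \<in> cosets (L \<inter> I) L' then mcoeff L' 0 else 0)"
    using val by (intro sum.cong) auto
  also have "\<dots> = (\<Sum>C\<in>cosets L L' \<inter> cosets (L \<inter> I) L'. mcoeff L' 0)"
    by (rule sum.inter_restrict[OF fin, symmetric])
  also have "cosets L L' \<inter> cosets (L \<inter> I) L' = cosets (L \<inter> I) L'" by (auto simp: cosets_def)
  also have "(\<Sum>C\<in>cosets (L \<inter> I) L'. mcoeff L' 0) = of_nat (card (cosets (L \<inter> I) L')) * mcoeff L' 0"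
    by simp
  also have "card (cosets (L \<inter> I) L') = card (cosets (L \<inter> I) (L' \<inter> I))"
    using card_cosets_image(1)[of "L' \<inter> I" L' "L \<inter> I" "\<lambda>x. x"] add_subgroup_Int[OF sL' I_subgroup] sL'
      add_subgroupD(2)[OF I_subgroup] by auto
  finally show ?thesis .
qed

text \<open>Some coefficient is non-zero and its position may be taken of the form
  \<open>T u\<close>. The return to 0 needs \<open>u\<close> in the orthogonal of the lattice, which
  holds only after shrinking it; shrinking moves the position again, but only within
  \<open>L\<close>, where tameness provides the correction.\<close>

lemma mcoeff_nonzero: "\<exists>L. tame L \<and> mcoeff L 0 \<noteq> 0"
proof -
  obtain L where L: "tame L" using tame_exists by auto
  then have nL: "nice L" by (simp add: tame_def)
  obtain w where "mcoeff L w \<noteq> 0"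
    using coeff_nonzero_exists[OF nL M_linear M_inj] unfolding mcoeff_def by blast
  moreover from this obtain i where i: "i \<in> I" "w - i \<in> L" using mcoeff_support[OF nL] by blast
  ultimately have "mcoeff L i \<noteq> 0" using mcoeff_shift[OF nL i(2), of i] by auto
  moreover obtain u where u: "i = T u" using i by (auto simp: I_def)
  ultimately have nz: "mcoeff L (T u) \<noteq> 0" by simp
  obtain r where r: "r > 0" "u \<in> Bl r" using Bl_cover by auto
  \<comment> \<open>The intersection with \<open>perp (Bl r)\<close> puts \<open>u\<close>, an
    element of \<open>Bl r\<close>, into \<open>perp L'\<close>.\<close>
  define L' where "L' = L \<inter> perp (Bl r)"
  have L': "lattice L'" "L' \<subseteq> L"
    using lattice_Int niceD(1)[OF nL] lattice_perp_Bl[OF r(1)] by (auto simp: L'_def)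
  note nL' = nice_mono[OF nL L']
  note sL = niceD(4)[OF nL] and sL' = niceD(4)[OF nL']
  have u': "u \<in> perp L'" using r by (auto simp: L'_def intro!: perpI dest: perpD(2))
  have "mcoeff L (T u) = (\<Sum>C\<in>cosets L L'. coeff L' (\<lambda>s. U (- rep C) (U (- T u) (M s))))"
    unfolding mcoeff_def using coeff_refine[OF nL L' linear_op_UM] by blast
  then obtain C where C: "C \<in> cosets L L'" "coeff L' (\<lambda>s. U (- rep C) (U (- T u) (M s))) \<noteq> 0"
    using nz by (metis (no_types, lifting) sum.neutral)
  let ?t = "rep C"
  have t: "?t \<in> L" using rep_mem(1)[OF sL sL' L'(2) C(1)] .
  have "mcoeff L' (T u + ?t) = inverse (be ?t (T u)) * coeff L' (\<lambda>s. U (- ?t) (U (- T u) (M s)))"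
    unfolding mcoeff_def U_minus_add
    by (rule coeff_scale[OF nL' linear_op_comp[OF linear_op_U linear_op_UM]])
  then have nz2: "mcoeff L' (T u + ?t) \<noteq> 0" using C be_nonzero by simp
  then obtain j where j: "j \<in> I" "T u + ?t - j \<in> L'" using mcoeff_support[OF nL'] by blast
  have jd: "j - T u \<in> I" using j u i add_subgroupD(2)[OF I_subgroup] by blast
  have "?t - (T u + ?t - j) \<in> L" using t j L' add_subgroupD(2)[OF sL] by blast
  then have "j - T u \<in> L \<inter> I" using jd by (simp add: algebra_simps)
  \<comment> \<open>The remaining displacement lies in \<open>L \<inter> I\<close>, so it is
    \<open>T v\<close> for some \<open>v\<close> orthogonal to \<open>L\<close>, a fortiori to
    \<open>L'\<close>.\<close>
  then obtain v where v: "v \<in> perp L" "T v = j - T u" using L unfolding tame_def by blast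
  have "mcoeff L' j \<noteq> 0" using mcoeff_shift[OF nL' j(2), of j] nz2 by auto
  moreover have "j = 0 + T (u + v)" using v(2) by (simp add: k_plus algebra_simps)
  moreover have "u + v \<in> perp L'"
    using u' v(1) perp_antimono[OF L'(2)] add_subgroupD(4)[OF add_subgroup_perp] by blast
  ultimately have "mcoeff L' 0 \<noteq> 0" using mcoeff_translate_nonzero[OF nL', of "u + v" 0] by simp
  then show ?thesis using tame_mono[OF L L'] by blast
qed

end

locale heisenberg_commuting = heisenberg_automorphism sc be U Bl k M K I
  for sc :: "'r::field \<Rightarrow> 's::ab_group_add \<Rightarrow> 's" (infixr "\<star>" 75)
    and be :: "'w::ab_group_add \<Rightarrow> 'w \<Rightarrow> 'r" and U :: "'w \<Rightarrow> 's \<Rightarrow> 's" and Bl :: "real \<Rightarrow> 'w set"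
    and k :: "'w \<Rightarrow> 'w" and M :: "'s \<Rightarrow> 's" and K I :: "'w set" +
  fixes h hi :: "'w \<Rightarrow> 'w" and N Mi Ni :: "'s \<Rightarrow> 's"
  assumes h_diff: "h (x - y) = h x - h y"
    and h_hi [simp]: "h (hi x) = x" and hi_h [simp]: "hi (h x) = x"
    and be_h: "be (h x) (h y) = be x y"
    and h_k: "h (k x) = k (h x)"
    and N_linear: "linear_op N"
    and N_U: "N (U w s) = U (h w) (N s)"
    and N_Ni [simp]: "N (Ni s) = s" and Ni_N [simp]: "Ni (N s) = s"
    and M_Mi [simp]: "M (Mi s) = s" and Mi_M [simp]: "Mi (M s) = s"
    and h_bounded: "\<exists>C>0. \<forall>r>0. h ` Bl r \<subseteq> Bl (C * r)"
    and hi_bounded: "\<exists>C>0. \<forall>r>0. hi ` Bl r \<subseteq> Bl (C * r)"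
begin

lemma mem_h_image: "x \<in> h ` A \<longleftrightarrow> hi x \<in> A"
  by (metis h_hi hi_h image_iff)

lemma hi_diff: "hi (x - y) = hi x - hi y"
  by (metis h_diff h_hi hi_h)

lemma h_0 [simp]: "h 0 = 0" and hi_0 [simp]: "hi 0 = 0" and h_minus: "h (- x) = - h x"
proof -
  show "h 0 = 0" using h_diff[of 0 0] by simp
  then show "h (- x) = - h x" using h_diff[of 0 x] by simp
  show "hi 0 = 0" using hi_diff[of 0 0] by simp
qed

lemma b_h: "b (h x) (h y) = b x y"
  by (simp add: b_def be_h)

lemma perp_h_image: "perp (h ` A) = h ` perp A"
proof -
  have "b (h x) y = b x (hi y)" for x y using b_h[of x "hi y"] by simp
  then show ?thesis by (auto simp: mem_h_image perp_def)
qed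

lemma h_image_T: "h ` T ` A = T ` h ` A"
proof -
  have "h (T w) = T (h w)" for w by (simp add: h_diff h_k)
  then show ?thesis by (simp add: image_image)
qed

lemma h_image_I: "h ` I = I"
proof -
  have "range h = UNIV" using h_hi by (rule surjI)
  then show ?thesis using h_image_T[of UNIV] by (simp add: I_def)
qed

lemma h_image_Int: "h ` (A \<inter> B) = h ` A \<inter> h ` B"
  by (rule image_Int) (metis hi_h injI)

lemma h_image_subgroup: "add_subgroup A \<Longrightarrow> add_subgroup (h ` A)"
  by (auto simp: add_subgroup_def mem_h_image hi_diff)

lemma lattice_h_image:
  assumes L: "lattice L"
  shows "lattice (h ` L)"
proof -
  obtain r r' where r: "r > 0" "Bl r \<subseteq> L" "r' > 0" "L \<subseteq> Bl r'"
    using latticeD(3,4)[OF L] by auto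
  obtain C where C: "C > 0" "\<forall>r>0. h ` Bl r \<subseteq> Bl (C * r)" using h_bounded by auto
  obtain D where D: "D > 0" "\<forall>r>0. hi ` Bl r \<subseteq> Bl (D * r)" using hi_bounded by auto
  have "h ` L \<subseteq> Bl (C * r')" "C * r' > 0" using C r by (auto simp: image_subset_iff)
  moreover have "Bl (r / D) \<subseteq> h ` L"
  proof
    fix x assume "x \<in> Bl (r / D)"
    moreover have "r / D > 0" using D r by simp
    ultimately have "hi x \<in> Bl (D * (r / D))" using D(2) by blast
    then show "x \<in> h ` L" using r D(1) by (auto simp: mem_h_image)
  qed
  moreover have "r / D > 0" using D r by simp
  moreover have "perp (perp (h ` L)) = h ` L" using latticeD(2)[OF L] by (simp add: perp_h_image)
  ultimately show ?thesis using h_image_subgroup[OF latticeD(1)[OF L]] unfolding lattice_def by blast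
qed

lemma fix_space_h_image: "s \<in> fix_space L \<Longrightarrow> N s \<in> fix_space (h ` L)"
  by (auto simp: fix_space_def N_U[symmetric])

lemma fix_space_h_image': "s \<in> fix_space (h ` L) \<Longrightarrow> Ni s \<in> fix_space L"
  unfolding fix_space_def by (auto simp: N_U[symmetric]) (metis N_Ni N_U Ni_N)

lemma nice_h_image:
  assumes L: "nice L"
  shows "nice (h ` L)"
proof -
  obtain s where "s \<in> fix_space L" "s \<noteq> 0" using niceD(3)[OF L] by auto
  then have "N s \<in> fix_space (h ` L)" "N s \<noteq> 0"
    using fix_space_h_image Ni_N linear_opD(3)[OF N_linear] by metis+
  then show ?thesis
    using lattice_h_image[OF niceD(1)[OF L]] niceD(2)[OF L] by (auto simp: nice_def isotropic_def be_h)
qed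

lemma tame_h_image:
  assumes L: "tame L"
  shows "tame (h ` L)"
  unfolding tame_def
proof (intro conjI ballI)
  show "nice (h ` L)" using L nice_h_image by (simp add: tame_def)
  fix t assume "t \<in> h ` L \<inter> I"
  then have "hi t \<in> L \<inter> I" using h_image_I by (metis IntD1 IntD2 IntI mem_h_image)
  then obtain u where u: "u \<in> perp L" "T u = hi t" "be u (k u) = 1" using L unfolding tame_def by blast
  have "T (h u) = t" using arg_cong[OF u(2), of h] by (simp add: h_diff h_k)
  moreover have "be (h u) (k (h u)) = 1" using u(3) be_h[of u "k u"] by (simp add: h_k)
  moreover have "h u \<in> perp (h ` L)" using u(1) by (simp add: perp_h_image)
  ultimately show "\<exists>u\<in>perp (h ` L). T u = t \<and> be u (k u) = 1" by blast
qed

lemma coeff_h_image: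
  assumes L: "nice L" and A: "linear_op A"
  shows "coeff (h ` L) (\<lambda>s. N (A (Ni s))) = coeff L A"
proof -
  obtain ps where ps: "expands L A ps" using expansion_exists[OF L A] by auto
  let ?qs = "map (\<lambda>p. (fst p, h (snd p))) ps"
  have "N (comb ps t) = comb ?qs (N t)" for t
    by (induction ps) (auto simp: linear_opD[OF N_linear] N_U)
  then have "N (comb ps (Ni s)) = comb ?qs s" for s by simp
  then have "expands (h ` L) (\<lambda>s. N (A (Ni s))) ?qs"
    using ps fix_space_h_image' by (auto simp: expands_def)
  moreover have "list_coeff (h ` L) ?qs = list_coeff L ps"
    by (induction ps) (auto simp: list_coeff_def mem_h_image)
  ultimately show ?thesis using coeff_eq[OF L ps] coeff_eq[OF nice_h_image[OF L]] by metis
qed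

text \<open>
  The group \<open>I = T ` W\<close> is dual to \<open>W / K\<close>, hence to itself through \<open>T\<close>, compatibly with \<open>h\<close>. So
  the modulus of \<open>h\<close> on \<open>I\<close>, computed with \<open>L \<inter> I\<close>, is the inverse of the modulus computed with
  \<open>T ` perp L\<close>. As the modulus does not depend on the lattice, it equals 1.
\<close>

lemma index_h_invariant:
  assumes L: "lattice L"
  shows "card (cosets (L \<inter> I) (L \<inter> h ` L \<inter> I)) = card (cosets (h ` L \<inter> I) (L \<inter> h ` L \<inter> I))"
proof -
  define L1 where "L1 = h ` L"
  define L' where "L' = L \<inter> h ` L"
  have lat: "lattice L1" "lattice L'"
    using lattice_h_image[OF L] lattice_Int[OF L] by (auto simp: L1_def L'_def)
  have clI: "perp (perp I) = I" using perp_I perp_K by simp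
  define N0 where "N0 = L \<inter> I"
  define N1 where "N1 = h ` N0"
  define D where "D = N0 \<inter> N1"
  define P0 where "P0 = T ` perp L"
  define P1 where "P1 = h ` P0"
  define Z where "Z = T ` perp L'"
  define E0 where "E0 = N0 \<inter> P0"
  define E1 where "E1 = h ` E0"
  define F where "F = E0 \<inter> E1"
  have N1: "N1 = L1 \<inter> I" unfolding N1_def N0_def L1_def by (simp add: h_image_Int h_image_I)
  have D: "D = L' \<inter> I" unfolding D_def N1 unfolding N0_def L'_def L1_def by auto
  have P1: "P1 = T ` perp L1" unfolding P1_def P0_def L1_def by (simp add: h_image_T perp_h_image)
  have Tdiff: "T (x - y) = T x - T y" for x y by (simp add: k_diff)
  have subT: "add_subgroup (T ` A)" if "add_subgroup A" for A
    unfolding add_subgroup_def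
  proof (intro conjI ballI)
    show "0 \<in> T ` A" using add_subgroupD(1)[OF that] by (intro image_eqI[of _ _ 0]) auto
    fix x y assume "x \<in> T ` A" "y \<in> T ` A"
    then obtain p q where "p \<in> A" "q \<in> A" "x = T p" "y = T q" by blast
    then show "x - y \<in> T ` A"
      using add_subgroupD(2)[OF that] Tdiff[of p q] by (intro image_eqI[of _ _ "p - q"]) auto
  qed
  have sg: "add_subgroup N0" "add_subgroup N1" "add_subgroup D" "add_subgroup P0" "add_subgroup P1"
    "add_subgroup Z" "add_subgroup E0" "add_subgroup E1" "add_subgroup F"
    unfolding N0_def N1_def D_def P0_def P1_def Z_def E0_def E1_def F_def
    by (intro add_subgroup_Int h_image_subgroup subT add_subgroup_perp latticeD(1)[OF L] I_subgroup)+
  have E1: "E1 = N1 \<inter> P1" unfolding E1_def E0_def N1_def P1_def by (rule h_image_Int)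
  have sub: "E0 \<subseteq> N0" "E1 \<subseteq> N1" "E0 \<subseteq> P0" "E1 \<subseteq> P1" "D \<subseteq> N0" "D \<subseteq> N1" "F \<subseteq> D" "F \<subseteq> E0" "F \<subseteq> E1"
    unfolding D_def F_def E1 E0_def by auto
  have PZ: "P0 \<subseteq> Z" "P1 \<subseteq> Z"
    unfolding P0_def P1 Z_def L'_def L1_def by (intro image_mono perp_antimono; blast)+
  \<comment> \<open>\<open>T\<close> identifies W / K with \<open>I\<close>. Modulo
    \<open>K\<close>, the orthogonal of \<open>Q\<close> is the orthogonal of
    \<open>Q \<inter> I\<close>, since \<open>K\<close> is the orthogonal of
    \<open>I\<close>.\<close>
  have in_perp: "T x - T y \<in> T ` perp Q \<longleftrightarrow> x - y \<in> perp (Q \<inter> I)" if Q: "lattice Q" for Q x y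
  proof
    assume "T x - T y \<in> T ` perp Q"
    then obtain p where p: "p \<in> perp Q" "T (x - y) = T p" by (auto simp: Tdiff)
    then have "T (x - y - p) = 0" unfolding Tdiff by simp
    then have "x - y - p \<in> perp I" unfolding perp_I K_def by simp
    then have "x - y - p \<in> perp (Q \<inter> I)" "p \<in> perp (Q \<inter> I)"
      using p perp_antimono[of "Q \<inter> I" I] perp_antimono[of "Q \<inter> I" Q] by auto
    then show "x - y \<in> perp (Q \<inter> I)" using add_subgroup_add_iff(3)[OF add_subgroup_perp] by blast
  next
    assume "x - y \<in> perp (Q \<inter> I)"
    then obtain a where a: "a \<in> perp I" "x - y - a \<in> perp Q"
      using perp_Int_lattice[of I Q "x - y"] Q by (auto simp: Int_commute)
    have "T a = 0" using a(1) perp_I by (simp add: K_def)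
    then have "T x - T y = T (x - y - a)" unfolding Tdiff by simp
    then show "T x - T y \<in> T ` perp Q" using a by blast
  qed
  have fin_lattice: "finite (cosets (Q \<inter> I) (L' \<inter> I))" if Q: "lattice Q" for Q
  proof -
    have "finite (cosets (Q \<inter> I) L')"
      using finite_cosets_mono[OF _ _ _ _ finite_cosets_lattice[OF Q lat(2)], of L' "Q \<inter> I"]
        latticeD(1)[OF lat(2)] by auto
    then show ?thesis
      using card_cosets_image(2)[of "L' \<inter> I" L' "Q \<inter> I" "\<lambda>x. x"] sg(3) D latticeD(1)[OF lat(2)]
        add_subgroupD(2)[OF I_subgroup] by auto
  qed
  have dual: "card (cosets Z (T ` perp Q)) = card (cosets (Q \<inter> I) D)"
    if Q: "lattice Q" "L' \<subseteq> Q" for Q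
  proof -
    have "Z = T ` perp (L' \<inter> I)"
    proof
      show "Z \<subseteq> T ` perp (L' \<inter> I)" unfolding Z_def by (intro image_mono perp_antimono) auto
      show "T ` perp (L' \<inter> I) \<subseteq> Z"
      proof
        fix z assume "z \<in> T ` perp (L' \<inter> I)"
        then obtain x where x: "x \<in> perp (L' \<inter> I)" "z = T x" by auto
        then have "T x - T 0 \<in> T ` perp L'" using in_perp[OF lat(2), of x 0] by simp
        then show "z \<in> Z" using x by (simp add: Z_def)
      qed
    qed
    then have "card (cosets Z (T ` perp Q)) = card (cosets (perp (L' \<inter> I)) (perp (Q \<inter> I)))"
      using card_cosets_image(1)[OF add_subgroup_perp subT[OF add_subgroup_perp] in_perp[OF Q(1)]] by simp
    also have "\<dots> = card (cosets (Q \<inter> I) (L' \<inter> I))"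
      using Q(2)
      by (intro card_cosets_dual(2) add_subgroup_Int I_subgroup latticeD(1)[OF Q(1)] latticeD(1)[OF lat(2)]
          perp_perp_Int latticeD(2)[OF Q(1)] latticeD(2)[OF lat(2)] clI fin_lattice[OF Q(1)]) auto
    finally show ?thesis by (simp add: D)
  qed
  define a0 where "a0 = card (cosets N0 D)"
  define a1 where "a1 = card (cosets N1 D)"
  define x where "x = card (cosets N0 E0)"
  define y where "y = card (cosets P0 E0)"
  define d where "d = card (cosets D F)"
  define e0 where "e0 = card (cosets E0 F)"
  define e1 where "e1 = card (cosets E1 F)"
  have h_index: "card (cosets (h ` A) (h ` B)) = card (cosets A B)" if "add_subgroup B" for A B
    using card_cosets_image(1)[OF that h_image_subgroup[OF that], of A h]
    by (simp add: mem_h_image hi_diff)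
  have "card (cosets Z P0) = a0" "card (cosets Z P1) = a1"
    using dual[OF L] dual[OF lat(1)] unfolding P0_def P1 a0_def a1_def N0_def N1
    by (auto simp: L'_def L1_def)
  moreover have "card (cosets N1 E1) = x" "card (cosets P1 E1) = y"
    unfolding x_def y_def N1_def E1_def P1_def using h_index sg by blast+
  \<comment> \<open>The index of \<open>F\<close> is computed in two ways: in \<open>N0\<close> and
    in \<open>N1\<close> through \<open>D\<close> and through \<open>E0\<close> or
    \<open>E1\<close>, and in \<open>Z\<close> through \<open>P0\<close> and through
    \<open>P1\<close>. The numbers \<open>x\<close> and \<open>y\<close> occur for both lattices
    because \<open>h\<close> preserves indices.\<close>
  ultimately have eqs: "a0 * d = x * e0" "a1 * d = x * e1" "a0 * (y * e0) = a1 * (y * e1)"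
    using index_mult[OF sg(1,3) sub(5) sg(9) sub(7)] index_mult[OF sg(2,3) sub(6) sg(9) sub(7)]
      index_mult[OF sg(1,7) sub(1) sg(9) sub(8)] index_mult[OF sg(2,8) sub(2) sg(9) sub(9)]
      index_mult[OF sg(6,4) PZ(1) sg(9)] index_mult[OF sg(6,5) PZ(2) sg(9)]
      index_mult[OF sg(4,7) sub(3) sg(9) sub(8)] index_mult[OF sg(5,8) sub(4) sg(9) sub(9)]
      sub
    unfolding a0_def a1_def x_def y_def d_def e0_def e1_def by (simp_all, metis subset_trans)
  \<comment> \<open>\<open>F\<close> contains a ball of \<open>I\<close>, because \<open>T\<close>
    is open onto \<open>I\<close>; so bounded subsets of \<open>I\<close> meet finitely many cosets
    of \<open>F\<close>, and all the indices to be cancelled are positive.\<close>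
  obtain r where r: "r > 0" "Bl r \<inter> I \<subseteq> F"
  proof -
    obtain r0 where r0: "r0 > 0" "Bl r0 \<subseteq> perp L"
      using latticeD(3)[OF lattice_perp'[OF L]] by auto
    obtain r1 where r1: "r1 > 0" "Bl r1 \<subseteq> perp L1"
      using latticeD(3)[OF lattice_perp'[OF lat(1)]] by auto
    obtain q0 where q0: "q0 > 0" "I \<inter> Bl q0 \<subseteq> T ` Bl r0" using I_open[OF r0(1)] by auto
    obtain q1 where q1: "q1 > 0" "I \<inter> Bl q1 \<subseteq> T ` Bl r1" using I_open[OF r1(1)] by auto
    obtain q where q: "q > 0" "Bl q \<subseteq> L'" using latticeD(3)[OF lat(2)] by auto
    define r where "r = min q (min q0 q1)"
    have "Bl r \<subseteq> Bl q" "Bl r \<subseteq> Bl q0" "Bl r \<subseteq> Bl q1" unfolding r_def by (auto intro!: Bl_mono)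
    then have "Bl r \<inter> I \<subseteq> F"
      using q q0 q1 r0 r1 unfolding F_def E1 N1 P1 unfolding E0_def N0_def P0_def L'_def L1_def by blast
    then show thesis using that[of r] q q0 q1 by (simp add: r_def)
  qed
  have pos: "card (cosets A F) > 0" if A: "A \<subseteq> I" "0 \<in> A" "A \<subseteq> Bl r'" "r' > 0" for A r'
  proof -
    have "finite (cosets A (Bl r))"
      using finite_cosets_mono[OF Bl_subgroup[OF r(1)] Bl_subgroup[OF r(1)] A(3) subset_refl Bl_index[OF A(4) r(1)]] .
    then have "finite (cosets A (Bl r \<inter> I))"
      using card_cosets_image(2)[of "Bl r \<inter> I" "Bl r" A "\<lambda>x. x"] Bl_subgroup[OF r(1)]
        add_subgroup_Int[OF Bl_subgroup[OF r(1)] I_subgroup] add_subgroupD(2)[OF I_subgroup] A(1) by (simp add: subset_iff)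
    then have "finite (cosets A F)"
      using finite_cosets_mono[OF add_subgroup_Int[OF Bl_subgroup[OF r(1)] I_subgroup] sg(9) subset_refl r(2)] by blast
    moreover have "cosets A F \<noteq> {}" using A(2) by (auto simp: cosets_def)
    ultimately show ?thesis by (simp add: card_gt_0_iff)
  qed
  obtain r1 where r1: "r1 > 0" "L \<subseteq> Bl r1" using latticeD(4)[OF L] by auto
  obtain r2 where r2: "r2 > 0" "L1 \<subseteq> Bl r2" using latticeD(4)[OF lat(1)] by auto
  obtain r3 where r3: "r3 > 0" "perp L \<subseteq> Bl r3" using latticeD(4)[OF lattice_perp'[OF L]] by auto
  obtain C where C: "C > 0" "\<forall>r>0. k ` Bl r \<subseteq> Bl (C * r)" using k_bounded by auto
  define r4 where "r4 = max r3 (C * r3)"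
  have r4: "r4 > 0" using r3 by (auto simp: r4_def)
  have PB: "P0 \<subseteq> Bl r4"
  proof
    fix z assume "z \<in> P0"
    then obtain p where p: "p \<in> perp L" "z = T p" by (auto simp: P0_def)
    then have "p \<in> Bl r3" using r3 by blast
    moreover from this have "k p \<in> Bl (C * r3)" using C(2) r3(1) by blast
    moreover have "Bl r3 \<subseteq> Bl r4" "Bl (C * r3) \<subseteq> Bl r4" unfolding r4_def by (auto intro!: Bl_mono)
    ultimately have "p \<in> Bl r4" "k p \<in> Bl r4" by auto
    then show "z \<in> Bl r4" using p add_subgroupD(2)[OF Bl_subgroup[OF r4]] by simp
  qed
  have inI: "N0 \<subseteq> I" "N1 \<subseteq> I" "P0 \<subseteq> I" unfolding N0_def N1 P0_def I_def by auto
  have "d > 0" "e0 > 0" "e1 > 0"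
    unfolding d_def e0_def e1_def
  proof -
    have B: "N0 \<subseteq> Bl r1" "N1 \<subseteq> Bl r2" using r1 r2 unfolding N0_def N1 by auto
    show "0 < card (cosets D F)"
      using sub(5) inI(1) B(1) add_subgroupD(1)[OF sg(3)] by (intro pos[of D r1] r1(1)) auto
    show "0 < card (cosets E0 F)"
      using sub(1) inI(1) B(1) add_subgroupD(1)[OF sg(7)] by (intro pos[of E0 r1] r1(1)) auto
    show "0 < card (cosets E1 F)"
      using sub(2) inI(2) B(2) add_subgroupD(1)[OF sg(8)] by (intro pos[of E1 r2] r2(1)) auto
  qed
  moreover have "y > 0"
  proof -
    have "card (cosets P0 F) = y * e0"
      unfolding y_def e0_def using index_mult[OF sg(4,7) sub(3) sg(9) sub(8)] .
    then show ?thesis using pos[of P0 r4] inI add_subgroupD(1)[OF sg(4)] PB r4 by (cases "y = 0") auto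
  qed
  \<comment> \<open>This relation comes from the dual side. The direct side gives
    \<open>a0 * e1 = a1 * e0\<close>; multiplied together they show that the square of the ratio of
    \<open>a0\<close> and \<open>a1\<close> is 1.\<close>
  ultimately have e: "a0 * e0 = a1 * e1" "e0 > 0" "e1 > 0" "d > 0" using eqs(3) by auto
  have "(a0 * e1) * d = (a0 * d) * e1" by (simp only: mult_ac)
  also have "\<dots> = (a1 * d) * e0" unfolding eqs(1,2) by (simp only: mult_ac)
  also have "\<dots> = (a1 * e0) * d" by (simp only: mult_ac)
  finally have "(a0 * e1) * d = (a1 * e0) * d" .
  then have e': "a0 * e1 = a1 * e0" using e(4) by simp
  have "(a0 * a0) * (e0 * e1) = (a0 * e0) * (a0 * e1)" by (simp only: mult_ac)
  also have "\<dots> = (a1 * a1) * (e0 * e1)" unfolding e(1) e' by (simp only: mult_ac)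
  finally have "a0 * a0 = a1 * a1" using e by simp
  then have "a0 = a1" by (simp add: power2_eq_square[symmetric])
  then show ?thesis using D unfolding a0_def a1_def N0_def N1 by (simp add: L'_def L1_def)
qed

theorem lifts_commute: "N (M s) = M (N s)"
proof -
  have Mi_lin: "linear_op Mi" and Ni_lin: "linear_op Ni"
    unfolding linear_op_def
    using linear_opD(1,2)[OF M_linear] linear_opD(1,2)[OF N_linear] by (metis M_Mi Mi_M, metis N_Ni Ni_N)
  have Ni_U: "Ni (U w s) = U (hi w) (Ni s)" for w s by (metis N_Ni N_U Ni_N h_hi)
  have k_hi: "k (hi w) = hi (k w)" for w using h_k[of "hi w"] by (metis h_hi hi_h)
  have Mi_U: "Mi (U (k w) s) = U w (Mi s)" for w s by (metis M_Mi M_U Mi_M)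
  \<comment> \<open>The commutator of the lifts lies over the identity of W, because
    \<open>h\<close> and \<open>k\<close> commute, so it is an intertwiner of \<open>U\<close> with
    itself.\<close>
  let ?Z = "\<lambda>s. Mi (N (M (Ni s)))"
  have "linear_op ?Z"
    using linear_op_comp[OF Mi_lin linear_op_comp[OF N_linear linear_op_comp[OF M_linear Ni_lin]]] .
  moreover have "?Z (U w s) = U w (?Z s)" for w s by (simp add: Ni_U M_U N_U k_hi Mi_U)
  ultimately obtain c where c: "\<And>s. ?Z s = c \<star> s" using schur by blast
  have NMN: "N (M (Ni s)) = c \<star> M s" for s
    using arg_cong[OF c[of s], of M] linear_opD(2)[OF M_linear] by simp
  obtain L where L: "tame L" "mcoeff L 0 \<noteq> 0" using mcoeff_nonzero by auto
  then have nL: "nice L" by (simp add: tame_def)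
  have L1: "tame (h ` L)" using tame_h_image[OF L(1)] .
  then have nL1: "nice (h ` L)" by (simp add: tame_def)
  have L': "lattice (L \<inter> h ` L)" using lattice_Int niceD(1) nL nL1 by blast
  have "mcoeff L 0 = coeff L M" "mcoeff (h ` L) 0 = coeff (h ` L) M"
    unfolding mcoeff_def by (simp_all add: U_zero)
  moreover have "coeff (h ` L) (\<lambda>s. N (M (Ni s))) = coeff L M" by (rule coeff_h_image[OF nL M_linear])
  moreover have "coeff (h ` L) (\<lambda>s. N (M (Ni s))) = c * coeff (h ` L) M"
    unfolding NMN by (rule coeff_scale[OF nL1 M_linear])
  moreover have "mcoeff L 0 = mcoeff (h ` L) 0"
    using mcoeff_refine[OF L(1) L'] mcoeff_refine[OF L1 L'] index_h_invariant[OF niceD(1)[OF nL]] by simp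
  ultimately have "c = 1" using L(2) by simp
  then have "N (M (Ni (N s))) = M (N s)" using NMN[of "N s"] by simp
  then show ?thesis by simp
qed

end

section \<open>The base field and its symplectic spaces\<close>

subsection \<open>Non-archimedean absolute values\<close>

lemma nonarch_absD:
  assumes "nonarch_abs v"
  shows "0 \<le> v x" "v x = 0 \<longleftrightarrow> x = 0" "v (x * y) = v x * v y" "v (x + y) \<le> max (v x) (v y)"
    "v 0 = 0" "v 1 = 1" "v (- x) = v x" "v (inverse x) = inverse (v x)" "v (x / y) = v x / v y"
    "v (x - y) \<le> max (v x) (v y)" "x \<noteq> 0 \<Longrightarrow> 0 < v x"
proof -
  show ge: "0 \<le> v x" and z: "v x = 0 \<longleftrightarrow> x = 0" and m: "v (x * y) = v x * v y"
    and a: "v (x + y) \<le> max (v x) (v y)" for x y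
    using assms unfolding nonarch_abs_def by blast+
  show v0: "v 0 = 0" using z by blast
  show o: "v 1 = 1" using m[of 1 1] z[of 1] by simp
  have "v (- 1) * v (- 1) = 1" using m[of "- 1" "- 1"] o by simp
  then have "v (- 1) = 1" using ge[of "- 1"] by (simp add: square_eq_1_iff)
  then show n: "v (- x) = v x" for x using m[of "- 1" x] by simp
  show i: "v (inverse x) = inverse (v x)" for x
  proof (cases "x = 0")
    case False
    then have "v x * v (inverse x) = 1" using m[of x "inverse x"] o by simp
    then show ?thesis using False z by (metis inverse_unique)
  qed (simp add: v0)
  show "v (x / y) = v x / v y" by (simp add: divide_inverse m i)
  show "v (x - y) \<le> max (v x) (v y)" using a[of x "- y"] n by simp
  show "x \<noteq> 0 \<Longrightarrow> 0 < v x" using ge[of x] z[of x] by linarith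
qed

lemma nonarch_abs_sum_le:
  assumes "nonarch_abs v" "0 \<le> c" "\<And>i. i \<in> A \<Longrightarrow> v (f i) \<le> c"
  shows "v (\<Sum>i\<in>A. f i) \<le> c"
  using assms(3)
proof (induction A rule: infinite_finite_induct)
  case (insert i A)
  then have "v (f i) \<le> c" "v (\<Sum>i\<in>A. f i) \<le> c" by auto
  then show ?case using nonarch_absD(4)[OF assms(1), of "f i" "\<Sum>i\<in>A. f i"] insert.hyps by simp
qed (simp_all add: nonarch_absD(5)[OF assms(1)] assms(2))

lemma base_field_nonarch_abs: "base_field p (v :: 'f::field \<Rightarrow> real) \<Longrightarrow> nonarch_abs v"
proof -
  have "nonarch_abs (\<lambda>x :: 'f. if x = 0 then 0 else 1)"
    unfolding nonarch_abs_def by (intro conjI allI) (simp_all split: if_splits)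
  then show "base_field p v \<Longrightarrow> nonarch_abs v"
    unfolding base_field_def nonarch_local_field_def by blast
qed

text \<open>Representatives of the residue field cover the unit ball by balls of radius
  \<open>v \<pi>\<close>. Successive digits in powers of \<open>\<pi>\<close> refine this to any
  radius, and multiplication by an element \<open>a\<close> of large absolute value carries it to
  balls of any size.\<close>

lemma local_field_cover:
  assumes v: "nonarch_local_field v" and r': "0 < r'"
  shows "\<exists>Z. finite Z \<and> (\<forall>x. v x \<le> r \<longrightarrow> (\<exists>z\<in>Z. v (x - z) \<le> r'))"
proof -
  have na: "nonarch_abs v" using v by (simp add: nonarch_local_field_def)
  note V = nonarch_absD[OF na]
  obtain \<pi> where \<pi>: "0 < v \<pi>" "v \<pi> < 1" "\<And>x. x \<noteq> 0 \<Longrightarrow> \<exists>n::int. v x = v \<pi> powi n"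
    using v by (auto simp: nonarch_local_field_def)
  have \<pi>0: "\<pi> \<noteq> 0" using \<pi>(1) V(5) by auto
  let ?R = "{(x, y). v x \<le> 1 \<and> v y \<le> 1 \<and> v (x - y) < 1}"
  have fin: "finite ({x. v x \<le> 1} // ?R)" using v by (simp add: nonarch_local_field_def)
  define Z0 where "Z0 = (\<lambda>C. SOME z. z \<in> C) ` ({x. v x \<le> 1} // ?R)"
  have Z0: "\<exists>z\<in>Z0. v (x - z) \<le> v \<pi>" if x: "v x \<le> 1" for x
  proof -
    let ?C = "?R `` {x}"
    have "?C \<in> {x. v x \<le> 1} // ?R" using x by (auto simp: quotient_def)
    moreover define z where "z = (SOME z. z \<in> ?C)"
    ultimately have mem: "z \<in> Z0" unfolding Z0_def by blast
    have "x \<in> ?C" using x V(5) by simp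
    then have "z \<in> ?C" unfolding z_def by (rule someI)
    then have lt: "v (x - z) < 1" by simp
    have "v y \<le> v \<pi>" if "v y < 1" for y
    proof (cases "y = 0")
      case False
      then obtain n where n: "v y = v \<pi> powi n" using \<pi>(3) by blast
      have "0 < n"
      proof (rule ccontr)
        assume "\<not> 0 < n"
        then have "1 \<le> v \<pi> powi n"
          using \<pi>(1,2) power_int_decreasing[of n 0 "v \<pi>"] by simp
        then show False using n that by simp
      qed
      then have "v \<pi> powi n \<le> v \<pi> powi 1" using \<pi> by (intro power_int_decreasing) auto
      then show ?thesis using n by simp
    qed (use \<pi> V(5) in simp)
    then show ?thesis using mem lt by blast
  qed
  have "\<exists>Z. finite Z \<and> (\<forall>x. v x \<le> 1 \<longrightarrow> (\<exists>z\<in>Z. v (x - z) \<le> v \<pi> ^ n))" for n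
  proof (induction n)
    case 0
    show ?case by (intro exI[of _ "{0}"]) simp
  next
    case (Suc n)
    then obtain Z where Z: "finite Z" "\<And>x. v x \<le> 1 \<Longrightarrow> \<exists>z\<in>Z. v (x - z) \<le> v \<pi> ^ n" by blast
    have vpow: "v (\<pi> ^ n) = v \<pi> ^ n" by (induction n) (auto simp: V(3,6))
    let ?Z = "(\<lambda>(z, z'). z + \<pi> ^ n * z') ` (Z \<times> Z0)"
    have "\<exists>z\<in>?Z. v (x - z) \<le> v \<pi> ^ Suc n" if x: "v x \<le> 1" for x
    proof -
      obtain z where z: "z \<in> Z" "v (x - z) \<le> v \<pi> ^ n" using Z(2)[OF x] by blast
      have "v ((x - z) / \<pi> ^ n) \<le> 1" using z(2) \<pi>(1) by (simp add: V(9) vpow)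
      then obtain z' where z': "z' \<in> Z0" "v ((x - z) / \<pi> ^ n - z') \<le> v \<pi>" using Z0 by blast
      have "x - (z + \<pi> ^ n * z') = \<pi> ^ n * ((x - z) / \<pi> ^ n - z')" using \<pi>0 by (simp add: field_simps)
      then have "v (x - (z + \<pi> ^ n * z')) = v \<pi> ^ n * v ((x - z) / \<pi> ^ n - z')" by (simp only: V(3) vpow)
      also have "\<dots> \<le> v \<pi> ^ n * v \<pi>" using z'(2) \<pi>(1) by (intro mult_left_mono) auto
      finally have "v (x - (z + \<pi> ^ n * z')) \<le> v \<pi> ^ Suc n" by (simp add: mult.commute)
      then show ?thesis using z(1) z'(1) by (intro bexI[of _ "z + \<pi> ^ n * z'"]) auto
    qed
    moreover have "finite ?Z" using Z(1) fin by (simp add: Z0_def)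
    ultimately show ?case by blast
  qed
  note unit_cover = this
  obtain a where a: "a \<noteq> 0" "r \<le> v a"
  proof -
    obtain m where m: "max r 1 < inverse (v \<pi>) ^ m"
      using real_arch_pow[of "inverse (v \<pi>)" "max r 1"] \<pi>(1,2) by (auto simp: one_less_inverse_iff)
    have "v (inverse \<pi> ^ m) = inverse (v \<pi>) ^ m" by (induction m) (auto simp: V(3,6,8))
    then show thesis using that[of "inverse \<pi> ^ m"] m \<pi>0 by simp
  qed
  have va: "0 < v a" using V(11) a by blast
  obtain n where "v \<pi> ^ n < r' / v a"
    using real_arch_pow_inv[of "r' / v a" "v \<pi>"] r' va \<pi> by auto
  then have n: "v \<pi> ^ n * v a \<le> r'" using va by (simp add: field_simps)
  obtain Z where Z: "finite Z" "\<And>x. v x \<le> 1 \<Longrightarrow> \<exists>z\<in>Z. v (x - z) \<le> v \<pi> ^ n"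
    using unit_cover[of n] by blast
  have "\<exists>z\<in>(*) a ` Z. v (x - z) \<le> r'" if x: "v x \<le> r" for x
  proof -
    have "v (x / a) \<le> 1" using x a va by (simp add: V(9))
    then obtain z where z: "z \<in> Z" "v (x / a - z) \<le> v \<pi> ^ n" using Z(2) by blast
    have "x - a * z = a * (x / a - z)" using a by (simp add: field_simps)
    then have "v (x - a * z) = v a * v (x / a - z)" by (simp only: V(3))
    also have "\<dots> \<le> v a * v \<pi> ^ n" using z(2) va by (intro mult_left_mono) auto
    also have "\<dots> \<le> r'" using n by (simp add: mult.commute)
    finally show ?thesis using z(1) by blast
  qed
  then show ?thesis using Z(1) by blast
qed

lemma base_field_cover:
  assumes "base_field p v" "0 < r'"
  shows "\<exists>Z. finite Z \<and> (\<forall>x. v x \<le> r \<longrightarrow> (\<exists>z\<in>Z. v (x - z) \<le> r'))"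
proof (cases "finite (UNIV :: 'a set)")
  case True
  have "v (x - x) = 0" for x using nonarch_absD(5)[OF base_field_nonarch_abs[OF assms(1)]] by simp
  then show ?thesis using True assms(2) by (intro exI[of _ UNIV]) (metis UNIV_I less_imp_le)
next
  case False
  then show ?thesis using assms local_field_cover by (auto simp: base_field_def)
qed

lemma openin_field_top:
  assumes "nonarch_abs v"
  shows "openin (field_top v) U \<longleftrightarrow> (\<forall>x\<in>U. \<exists>r>0. \<forall>y. v (x - y) < r \<longrightarrow> y \<in> U)"
proof -
  note V = nonarch_absD[OF assms]
  interpret Metric_space UNIV "\<lambda>x y. v (x - y)"
  proof
    show "0 \<le> v (x - y)" for x y by (rule V(1))
    show "v (x - y) = v (y - x)" for x y using V(7)[of "x - y"] by simp
    show "v (x - y) = 0 \<longleftrightarrow> x = y" for x y using V(2)[of "x - y"] by simp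
    show "v (x - z) \<le> v (x - y) + v (y - z)" for x y z
      using V(4)[of "x - y" "y - z"] V(1)[of "x - y"] V(1)[of "y - z"] by simp
  qed
  show ?thesis unfolding field_top_def openin_mtopology by (auto simp: mball_def subset_iff)
qed

subsection \<open>Symplectic spaces over a non-archimedean field\<close>

text \<open>Covers finite and local base fields alike; \<open>v_cover\<close>, the total boundedness
  of balls, is the form in which local compactness enters.\<close>

locale nonarch_symplectic = finite_dimensional_vector_space scW E
  for scW :: "'f::field \<Rightarrow> 'w::ab_group_add \<Rightarrow> 'w" and E +
  fixes v :: "'f \<Rightarrow> real" and B :: "'w \<Rightarrow> 'w \<Rightarrow> 'f" and \<psi> :: "'f \<Rightarrow> 'r::field"
  assumes v: "nonarch_abs v"
    and v_cover: "0 < r' \<Longrightarrow> \<exists>Z. finite Z \<and> (\<forall>x. v x \<le> r \<longrightarrow> (\<exists>z\<in>Z. v (x - z) \<le> r'))"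
    and B_add_left: "B (x + y) z = B x z + B y z" and B_scale_left: "B (scW a x) z = a * B x z"
    and B_add_right: "B x (y + z) = B x y + B x z" and B_scale_right: "B x (scW a y) = a * B x y"
    and B_self: "B x x = 0" and B_nondegenerate: "(\<And>y. B x y = 0) \<Longrightarrow> x = 0"
    and two: "(2 :: 'f) \<noteq> 0"
    and \<psi>_add: "\<psi> (a + c) = \<psi> a * \<psi> c" and \<psi>_nonzero: "\<psi> a \<noteq> 0"
    and \<psi>_cont: "\<exists>c>0. \<forall>x. v x \<le> c \<longrightarrow> \<psi> x = 1" and \<psi>_nontrivial: "\<exists>t. \<psi> t \<noteq> 1"
begin

lemmas V = nonarch_absD[OF v]

lemma \<psi>_0 [simp]: "\<psi> 0 = 1"
  using \<psi>_add[of 0 0] \<psi>_nonzero[of 0] by simp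

lemma B_zero [simp]: "B 0 y = 0" "B x 0 = 0"
  using B_scale_left[of 0 0 y] B_scale_right[of x 0 0] by auto

lemma B_diff_left: "B (x - y) z = B x z - B y z"
proof -
  have "B (x - y) z + B y z = B x z" unfolding B_add_left[symmetric] by simp
  then show ?thesis by (simp add: algebra_simps)
qed

lemma B_diff_right: "B x (y - z) = B x y - B x z"
proof -
  have "B x (y - z) + B x z = B x y" unfolding B_add_right[symmetric] by simp
  then show ?thesis by (simp add: algebra_simps)
qed

lemma B_swap: "B y x = - B x y"
proof -
  have "B (x + y) (x + y) = B x y + B y x" unfolding B_add_left B_add_right by (simp add: B_self)
  then have "B x y + B y x = 0" by (simp add: B_self)
  then show ?thesis by (simp add: eq_neg_iff_add_eq_0 add.commute)
qed

lemma B_nondegenerate': "(\<And>y. B y x = 0) \<Longrightarrow> x = 0"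
  using B_nondegenerate[of x] B_swap by (metis neg_equal_0_iff_equal)

definition additive_hom :: "('w \<Rightarrow> 'w) \<Rightarrow> bool" where
  "additive_hom f \<longleftrightarrow> (\<forall>x y. f (x + y) = f x + f y) \<and> (\<forall>a x. f (scW a x) = scW a (f x))"

definition functional :: "('w \<Rightarrow> 'f) \<Rightarrow> bool" where
  "functional l \<longleftrightarrow> (\<forall>x y. l (x + y) = l x + l y) \<and> (\<forall>a x. l (scW a x) = a * l x)"

lemma linear_iff_additive_hom: "Vector_Spaces.linear scW scW f \<longleftrightarrow> additive_hom f"
  using vector_space_axioms by (auto simp: Vector_Spaces.linear_iff additive_hom_def)

lemma linear_iff_functional: "Vector_Spaces.linear scW (*) l \<longleftrightarrow> functional l"
  using vector_space_axioms vector_space_self by (auto simp: Vector_Spaces.linear_iff functional_def)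

definition coord :: "'w \<Rightarrow> 'w \<Rightarrow> 'f" where "coord e w = representation E w e"

lemma coord_sum: "w = (\<Sum>e\<in>E. scW (coord e w) e)"
  unfolding coord_def
  using sum_representation_eq[of E w E] independent_Basis span_Basis finite_Basis by auto

lemma functional_coord: "functional (coord e)"
  using independent_Basis span_Basis
  by (simp add: functional_def coord_def representation_add representation_scale)

lemma functional_0: "functional l \<Longrightarrow> l 0 = 0"
  unfolding functional_def by (metis mult_zero_left scale_zero_left)

lemma functional_diff: "functional l \<Longrightarrow> l (x - y) = l x - l y"
proof -
  assume "functional l"
  then have "l (x - y) + l y = l x" unfolding functional_def by (metis diff_add_cancel)
  then show ?thesis by (simp add: algebra_simps)
qed

lemma functional_sum:
  assumes "functional l"
  shows "l (\<Sum>e\<in>A. scW (a e) e) = (\<Sum>e\<in>A. a e * l e)"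
  using assms functional_0[OF assms]
  by (induction A rule: infinite_finite_induct) (auto simp: functional_def)

lemma functional_expand: "functional l \<Longrightarrow> l w = (\<Sum>e\<in>E. coord e w * l e)"
  using functional_sum[of l "\<lambda>e. coord e w" E] coord_sum[of w] by simp

lemma coord_lincomb:
  assumes "e \<in> E"
  shows "coord e (\<Sum>e\<in>E. scW (a e) e) = a e"
proof -
  have "a e' * coord e e' = (if e' = e then a e else 0)" if "e' \<in> E" for e'
    using representation_basis[OF independent_Basis that] by (simp add: coord_def)
  then have "(\<Sum>e'\<in>E. a e' * coord e e') = (\<Sum>e'\<in>E. if e' = e then a e else 0)" by simp
  then show ?thesis using functional_sum[OF functional_coord, of e a E] assms finite_Basis by simp
qed

lemma additive_hom_coord: "additive_hom f \<Longrightarrow> functional (\<lambda>w. coord e (f w))"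
  using functional_coord by (simp add: functional_def additive_hom_def)

lemma additive_hom_0: "additive_hom f \<Longrightarrow> f 0 = 0"
  unfolding additive_hom_def by (metis scale_zero_left)

lemma additive_hom_diff: "additive_hom f \<Longrightarrow> f (x - y) = f x - f y"
proof -
  assume "additive_hom f"
  then have "f (x - y) + f y = f x" unfolding additive_hom_def by (metis diff_add_cancel)
  then show ?thesis by (simp add: algebra_simps)
qed

definition ball :: "real \<Rightarrow> 'w set" where "ball r = {w. \<forall>e\<in>E. v (coord e w) \<le> r}"

lemma functional_bounded:
  assumes "functional l"
  shows "\<exists>C>0. \<forall>r>0. \<forall>w\<in>ball r. v (l w) \<le> C * r"
proof -
  \<comment> \<open>The summand 1 makes the constant positive even if \<open>l\<close>
    vanishes.\<close>
  define C where "C = 1 + (\<Sum>e\<in>E. v (l e))"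
  have C: "0 < C" "\<And>e. e \<in> E \<Longrightarrow> v (l e) \<le> C"
    using sum_nonneg[of E "\<lambda>e. v (l e)"] member_le_sum[of _ E "\<lambda>e. v (l e)"] V(1) finite_Basis
    by (auto simp: C_def intro: add_pos_nonneg) (smt (verit) V(1) sum_nonneg)
  have "v (l w) \<le> C * r" if "0 < r" "w \<in> ball r" for r w
    unfolding functional_expand[OF assms, of w]
  proof (rule nonarch_abs_sum_le[OF v])
    show "0 \<le> C * r" using C that by simp
    fix e assume e: "e \<in> E"
    have "v (coord e w) * v (l e) \<le> r * C"
      using that e C V(1) by (intro mult_mono) (auto simp: ball_def)
    then show "v (coord e w * l e) \<le> C * r" by (simp add: V(3) mult.commute)
  qed
  then show ?thesis using C by blast
qed

lemma ball_mono: "r \<le> r' \<Longrightarrow> ball r \<subseteq> ball r'"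
  by (auto simp: ball_def)

lemma additive_hom_bounded:
  assumes "additive_hom f"
  shows "\<exists>C>0. \<forall>r>0. f ` ball r \<subseteq> ball (C * r)"
proof -
  have "\<forall>e. \<exists>C>0. \<forall>r>0. \<forall>w\<in>ball r. v (coord e (f w)) \<le> C * r"
    using functional_bounded additive_hom_coord[OF assms] by blast
  then obtain C where C: "\<And>e. C e > 0" "\<And>e r w. 0 < r \<Longrightarrow> w \<in> ball r \<Longrightarrow> v (coord e (f w)) \<le> C e * r"
    by metis
  define D where "D = 1 + (\<Sum>e\<in>E. C e)"
  have D: "0 < D" using sum_nonneg[of E C] C(1) by (auto simp: D_def less_imp_le intro: add_pos_nonneg)
  have "f w \<in> ball (D * r)" if "0 < r" "w \<in> ball r" for r w
    unfolding ball_def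
  proof (intro CollectI ballI)
    fix e assume e: "e \<in> E"
    have "C e \<le> D" using member_le_sum[of e E C] e C(1) finite_Basis by (simp add: D_def less_imp_le)
    then have "C e * r \<le> D * r" using that by (intro mult_right_mono) auto
    then show "v (coord e (f w)) \<le> D * r" using C(2)[OF that, of e] by linarith
  qed
  then show ?thesis using D by blast
qed

text \<open>The map \<open>f\<close>, whose coordinates are the values of the form on the basis, is
  injective by non-degeneracy, hence surjective by finite dimension.\<close>

lemma riesz:
  assumes "functional l"
  obtains u where "\<And>w. l w = B u w"
proof -
  define f where "f w = (\<Sum>e\<in>E. scW (B w e) e)" for w
  have f: "additive_hom f"
    by (simp add: additive_hom_def f_def B_add_left B_scale_left scale_left_distrib sum.distrib scale_sum_right)
  have Blin: "functional (B u)" for u by (simp add: functional_def B_add_right B_scale_right)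
  have cf: "coord e (f w) = B w e" if "e \<in> E" for e w unfolding f_def by (rule coord_lincomb[OF that])
  have "inj f"
  proof (rule injI)
    fix x y assume "f x = f y"
    then have "B (x - y) e = 0" if "e \<in> E" for e
      using cf[OF that, of x] cf[OF that, of y] by (simp add: B_diff_left)
    then have "B (x - y) w = 0" for w using functional_expand[OF Blin, of "x - y" w] by simp
    then show "x = y" using B_nondegenerate[of "x - y"] by simp
  qed
  then have "surj f" using linear_inj_imp_surj f linear_iff_additive_hom by blast
  then obtain u where u: "f u = (\<Sum>e\<in>E. scW (l e) e)" by (metis surj_def)
  then have "l e = B u e" if "e \<in> E" for e using cf[OF that, of u] coord_lincomb[OF that, of l] by simp
  then have "l w = B u w" for w
    unfolding functional_expand[OF assms, of w] functional_expand[OF Blin, of u w] by simp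
  then show thesis by (rule that)
qed

end

context nonarch_symplectic begin

definition half_pairing :: "'w \<Rightarrow> 'w \<Rightarrow> 'r" where "half_pairing x y = \<psi> (B x y / 2)"

lemma half_pairing_square: "half_pairing x y ^ 2 = \<psi> (B x y)"
proof -
  have "B x y / 2 + B x y / 2 = B x y" using two by (simp add: field_simps)
  then show ?thesis unfolding half_pairing_def power2_eq_square \<psi>_add[symmetric] by simp
qed

lemma ball_subgroup: "0 < r \<Longrightarrow> add_subgroup (ball r)"
  unfolding add_subgroup_def ball_def
proof (intro conjI ballI; clarsimp simp: functional_0[OF functional_coord] V(5) functional_diff[OF functional_coord])
  fix x y e assume "\<forall>e\<in>E. v (coord e x) \<le> r" "\<forall>e\<in>E. v (coord e y) \<le> r" "e \<in> E"
  then show "v (coord e x - coord e y) \<le> r" using V(10)[of "coord e x" "coord e y"] by fastforce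
qed

lemma ball_cover: "\<exists>r>0. w \<in> ball r"
proof -
  let ?r = "1 + (\<Sum>e\<in>E. v (coord e w))"
  have "v (coord e w) \<le> ?r" if "e \<in> E" for e
    using member_le_sum[of e E "\<lambda>e. v (coord e w)"] V(1) finite_Basis that by simp
  moreover have "?r > 0" using sum_nonneg[of E "\<lambda>e. v (coord e w)"] V(1) by (simp add: add_pos_nonneg)
  ultimately show ?thesis unfolding ball_def by blast
qed

lemma ball_index:
  assumes "0 < r" "0 < r'"
  shows "finite (cosets (ball r) (ball r'))"
proof -
  obtain Z where Z: "finite Z" "\<And>x. v x \<le> r \<Longrightarrow> \<exists>z\<in>Z. v (x - z) \<le> r'" using v_cover[OF assms(2)] by blast
  let ?F = "\<lambda>f. coset (ball r') (\<Sum>e\<in>E. scW (f e) e)"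
  have "cosets (ball r) (ball r') \<subseteq> ?F ` (PiE E (\<lambda>_. Z))"
  proof
    fix D assume "D \<in> cosets (ball r) (ball r')"
    then obtain w where w: "w \<in> ball r" "D = coset (ball r') w" by (auto simp: cosets_def)
    then have "\<forall>e\<in>E. \<exists>z\<in>Z. v (coord e w - z) \<le> r'" using Z by (auto simp: ball_def)
    then obtain f where f: "\<And>e. e \<in> E \<Longrightarrow> f e \<in> Z \<and> v (coord e w - f e) \<le> r'" by metis
    define f' where "f' = restrict f E"
    have "coord e (w - (\<Sum>e\<in>E. scW (f' e) e)) = coord e w - f e" if "e \<in> E" for e
      using that by (simp add: functional_diff[OF functional_coord] coord_lincomb f'_def)
    then have "w - (\<Sum>e\<in>E. scW (f' e) e) \<in> ball r'" using f by (simp add: ball_def)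
    then have "D = ?F f'" using coset_eq_iff[OF ball_subgroup[OF assms(2)]] w by blast
    moreover have "f' \<in> PiE E (\<lambda>_. Z)" using f by (auto simp: f'_def)
    ultimately show "D \<in> ?F ` (PiE E (\<lambda>_. Z))" by blast
  qed
  moreover have "finite (PiE E (\<lambda>_. Z))" using Z(1) finite_Basis by (intro finite_PiE) auto
  ultimately show ?thesis by (meson finite_imageI finite_subset)
qed

lemma functional_B: "functional (B u)" and functional_B': "functional (\<lambda>u. B u w)"
  by (simp_all add: functional_def B_add_right B_scale_right B_add_left B_scale_left)

lemma ball_continuous:
  assumes "0 < r"
  shows "\<exists>r'>0. \<forall>x\<in>ball r. \<forall>y\<in>ball r'. half_pairing x y = 1"
proof -
  obtain c where c: "c > 0" "\<And>x. v x \<le> c \<Longrightarrow> \<psi> x = 1" using \<psi>_cont by blast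
  have "\<forall>e. \<exists>C>0. \<forall>r>0. \<forall>w\<in>ball r. v (B e w) \<le> C * r" using functional_bounded[OF functional_B] by blast
  then obtain C where C: "\<And>e. C e > 0" "\<And>e r w. 0 < r \<Longrightarrow> w \<in> ball r \<Longrightarrow> v (B e w) \<le> C e * r" by metis
  define D where "D = 1 + (\<Sum>e\<in>E. C e)"
  have D: "0 < D" using sum_nonneg[of E C] C(1) by (auto simp: D_def less_imp_le intro: add_pos_nonneg)
  have CD: "C e \<le> D" if "e \<in> E" for e
    using member_le_sum[of e E C] that C(1) finite_Basis by (simp add: D_def less_imp_le)
  have v2: "v 2 > 0" using V(11) two by blast
  \<comment> \<open>Chosen to make the bound \<open>r * (D * r')\<close> for the form equal to
    \<open>c * v 2\<close>, so that half of the form is at most \<open>c\<close> in absolute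
    value.\<close>
  define r' where "r' = c * v 2 / (D * r)"
  have r': "r' > 0" using c D v2 assms by (simp add: r'_def)
  have "half_pairing x y = 1" if xy: "x \<in> ball r" "y \<in> ball r'" for x y
  proof -
    have "v (B x y) \<le> r * (D * r')"
      unfolding functional_expand[OF functional_B', of x y]
    proof (rule nonarch_abs_sum_le[OF v])
      show "0 \<le> r * (D * r')" using assms D r' by simp
      fix e assume e: "e \<in> E"
      have "v (B e y) \<le> C e * r'" using C(2)[OF r' xy(2)] .
      also have "\<dots> \<le> D * r'" using CD[OF e] r' by (intro mult_right_mono) auto
      finally have "v (coord e x) * v (B e y) \<le> r * (D * r')"
        using xy(1) e V(1) assms by (intro mult_mono) (auto simp: ball_def)
      then show "v (coord e x * B e y) \<le> r * (D * r')" by (simp add: V(3))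
    qed
    also have "r * (D * r') = c * v 2" using D assms by (simp add: r'_def)
    finally have "v (B x y / 2) \<le> c" using v2 by (simp add: V(9) field_simps)
    then show ?thesis using c by (simp add: half_pairing_def)
  qed
  then show ?thesis using r' by blast
qed

text \<open>Each coordinate is pairing with some \<open>u e\<close>. If a coordinate of
  \<open>y\<close> exceeds \<open>v t * D / r\<close>, then \<open>u e\<close>, scaled so that its
  pairing with \<open>y\<close> is an element \<open>t\<close> on which psi is non-trivial, still
  lies in the ball of radius \<open>r\<close>.\<close>

lemma ball_nondegenerate:
  "\<exists>C>0. \<forall>r>0. \<forall>y. (\<forall>x\<in>ball r. half_pairing x y ^ 2 = 1) \<longrightarrow> y \<in> ball (C / r)"
proof -
  obtain t where t: "\<psi> t \<noteq> 1" using \<psi>_nontrivial by blast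
  have t0: "v t > 0" using V(11)[of t] t by (cases "t = 0") auto
  have "\<forall>e. \<exists>u. \<forall>w. coord e w = B u w" using riesz[OF functional_coord] by metis
  then obtain u where u: "\<And>e w. coord e w = B (u e) w" by metis
  define D where "D = 1 + (\<Sum>e\<in>E. \<Sum>e'\<in>E. v (coord e' (u e)))"
  have D0: "D > 0"
    using sum_nonneg[of E "\<lambda>e. \<Sum>e'\<in>E. v (coord e' (u e))"] V(1)
    by (auto simp: D_def sum_nonneg intro!: add_pos_nonneg)
  have D: "v (coord e' (u e)) \<le> D" if "e \<in> E" "e' \<in> E" for e e'
  proof -
    have "v (coord e' (u e)) \<le> (\<Sum>e'\<in>E. v (coord e' (u e)))"
      using that(2) V(1) finite_Basis by (intro member_le_sum) auto
    also have "\<dots> \<le> (\<Sum>e\<in>E. \<Sum>e'\<in>E. v (coord e' (u e)))"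
      using that(1) V(1) finite_Basis
      by (intro member_le_sum[of e E "\<lambda>e. \<Sum>e'\<in>E. v (coord e' (u e))"]) (auto simp: sum_nonneg)
    finally show ?thesis by (simp add: D_def)
  qed
  have "y \<in> ball (v t * D / r)" if r: "0 < r" and y: "\<forall>x\<in>ball r. half_pairing x y ^ 2 = 1" for r y
  proof (rule ccontr)
    assume "y \<notin> ball (v t * D / r)"
    then obtain e where e: "e \<in> E" "v t * D / r < v (coord e y)" by (auto simp: ball_def not_le)
    have "v t * D / r > 0" using t0 D0 r by simp
    then have a0: "v (coord e y) > 0" using e(2) by linarith
    define s where "s = t / coord e y"
    have s: "v s * D \<le> r"
      using e(2) r a0 by (simp add: s_def V(9) field_simps)
    have "scW s (u e) \<in> ball r"
      unfolding ball_def
    proof (intro CollectI ballI)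
      fix e' assume e': "e' \<in> E"
      have "v (coord e' (scW s (u e))) = v s * v (coord e' (u e))"
        using functional_coord[of e'] by (simp add: functional_def V(3))
      also have "\<dots> \<le> v s * D" using D[OF e(1) e'] V(1) by (intro mult_left_mono) auto
      finally show "v (coord e' (scW s (u e))) \<le> r" using s by linarith
    qed
    then have "\<psi> (B (scW s (u e)) y) = 1" using y half_pairing_square by metis
    moreover have "coord e y \<noteq> 0" using a0 V(5) by auto
    then have "B (scW s (u e)) y = t" using u[of e y] by (simp add: B_scale_left s_def)
    ultimately show False using t by simp
  qed
  moreover have "v t * D > 0" using t0 D0 by simp
  ultimately show ?thesis by blast
qed

definition dperp :: "'w set \<Rightarrow> 'w set" where
  "dperp A = {y. \<forall>x\<in>A. half_pairing x y ^ 2 = 1}"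

text \<open>A subspace is stable under scaling, so a non-zero value of the form could be rescaled to
  an element at which psi is not 1.\<close>

lemma dperp_subspace:
  assumes "subspace A"
  shows "dperp A = {w. \<forall>a\<in>A. B a w = 0}"
proof -
  obtain t where t: "\<psi> t \<noteq> 1" using \<psi>_nontrivial by blast
  have "B a w = 0" if "\<forall>x\<in>A. \<psi> (B x w) = 1" "a \<in> A" for a w
  proof (rule ccontr)
    assume "B a w \<noteq> 0"
    then have "B (scW (t / B a w) a) w = t" by (simp add: B_scale_left)
    moreover have "scW (t / B a w) a \<in> A" using assms that(2) by (rule subspace_scale)
    ultimately show False using that(1) t by metis
  qed
  then show ?thesis by (auto simp: dperp_def half_pairing_square)
qed

lemma projection:
  assumes "subspace A"
  obtains q where "additive_hom q" "\<And>w. q w \<in> A" "\<And>a. a \<in> A \<Longrightarrow> q a = a"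
proof -
  interpret vector_space_pair scW scW by unfold_locales
  obtain q where q: "range q \<subseteq> A" "Vector_Spaces.linear scW scW q" "\<forall>a\<in>A. q (id a) = a"
    using linear_exists_left_inverse_on[of id A] linear_id assms by auto
  then show thesis using that[of q] linear_iff_additive_hom by auto
qed

text \<open>Let \<open>q\<close> be a linear projection onto \<open>A\<close>, and let
  \<open>u\<close> represent the form \<open>B w\<close> composed with \<open>q\<close>. Then
  \<open>w - u\<close> is orthogonal to \<open>A\<close>, while \<open>u\<close> pairs with
  \<open>x\<close> as \<open>w\<close> does with \<open>q x\<close>. The radius \<open>r'\<close>
  bounds \<open>q\<close> on the ball of radius \<open>r\<close>.\<close>

lemma dperp_decompose:
  assumes A: "subspace A" and r: "0 < r"
  shows "\<exists>r'\<ge>r. \<forall>w\<in>dperp (A \<inter> ball r'). \<exists>a\<in>dperp A. w - a \<in> dperp (ball r)"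
proof -
  obtain q where q: "additive_hom q" "\<And>w. q w \<in> A" "\<And>a. a \<in> A \<Longrightarrow> q a = a"
    using projection[OF A] by blast
  obtain C where C: "C > 0" "\<forall>r>0. q ` ball r \<subseteq> ball (C * r)" using additive_hom_bounded[OF q(1)] by blast
  define r' where "r' = max r (C * r)"
  have "\<exists>a\<in>dperp A. w - a \<in> dperp (ball r)" if w: "w \<in> dperp (A \<inter> ball r')" for w
  proof -
    have "functional (\<lambda>x. B w (q x))"
      using q(1) by (simp add: functional_def additive_hom_def B_add_right B_scale_right)
    then obtain u where u: "\<And>x. B w (q x) = B u x" using riesz by blast
    have "w - u \<in> dperp A"
      unfolding dperp_subspace[OF A]
    proof (intro CollectI ballI)
      fix a assume "a \<in> A"
      then have "B (w - u) a = 0" using u[of a] q(3) by (simp add: B_diff_left)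
      then show "B a (w - u) = 0" using B_swap[of a "w - u"] by simp
    qed
    moreover have "w - (w - u) \<in> dperp (ball r)"
      unfolding dperp_def
    proof (intro CollectI ballI)
      fix x assume "x \<in> ball r"
      then have "q x \<in> ball (C * r)" using C(2) r by blast
      then have "q x \<in> A \<inter> ball r'" using q(2) ball_mono[of "C * r" r'] by (auto simp: r'_def)
      then have "\<psi> (B (q x) w) = 1" using w by (auto simp: dperp_def half_pairing_square)
      moreover have "B x u = B (q x) w" using u[of x] B_swap by metis
      ultimately show "half_pairing x (w - (w - u)) ^ 2 = 1" by (simp add: half_pairing_square)
    qed
    ultimately show ?thesis by blast
  qed
  then show ?thesis by (intro exI[of _ r']) (auto simp: r'_def)
qed

lemma symplectic_inverse:
  assumes k: "additive_hom k" "\<And>x y. B (k x) (k y) = B x y" "bij k"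
  shows "additive_hom (inv_into UNIV k)" "\<And>x y. B (inv_into UNIV k x) (inv_into UNIV k y) = B x y"
    "\<And>x. k (inv_into UNIV k x) = x" "\<And>x. inv_into UNIV k (k x) = x"
proof -
  show 1: "k (inv_into UNIV k x) = x" for x using k(3) by (simp add: bij_is_surj surj_f_inv_f)
  show 2: "inv_into UNIV k (k x) = x" for x using k(3) by (simp add: bij_is_inj)
  have "k (inv_into UNIV k x + inv_into UNIV k y) = x + y" "k (scW a (inv_into UNIV k x)) = scW a x" for x y a
    using k(1) 1 by (simp_all add: additive_hom_def)
  then show "additive_hom (inv_into UNIV k)" unfolding additive_hom_def using 2 by metis
  show "B (inv_into UNIV k x) (inv_into UNIV k y) = B x y" for x y using k(2)[of "inv_into UNIV k x" "inv_into UNIV k y"] 1 by simp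
qed

context
  fixes k :: "'w \<Rightarrow> 'w" and K I
  assumes k: "additive_hom k" "\<And>x y. B (k x) (k y) = B x y" "bij k"
    and K: "K = {w. k w = w}" and I: "I = range (\<lambda>w. k w - w)"
begin

lemma displacement_hom: "additive_hom (\<lambda>w. k w - w)"
  using k(1) by (simp add: additive_hom_def scale_right_diff_distrib)

lemma subspace_fixed: "subspace K" and subspace_displaced: "subspace I"
proof -
  show "subspace K" using k(1) additive_hom_0[OF k(1)] by (simp add: subspace_def K additive_hom_def)
  interpret vector_space_pair scW scW by unfold_locales
  have "Vector_Spaces.linear scW scW (\<lambda>w. k w - w)"
    using displacement_hom linear_iff_additive_hom by blast
  then show "subspace I" unfolding I using linear_subspace_image subspace_UNIV by blast
qed

lemma dperp_displaced: "dperp I = K"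
proof -
  have "(\<forall>a\<in>I. B a u = 0) \<longleftrightarrow> k u = u" for u
  proof
    assume "\<forall>a\<in>I. B a u = 0"
    then have *: "B (k x) u = B (k x) (k u)" for x using k(2)[of x u] by (auto simp: I B_diff_left)
    have "B y (u - k u) = 0" for y
      using *[of "inv_into UNIV k y"] symplectic_inverse(3)[OF k, of y] by (simp add: B_diff_right)
    then show "k u = u" using B_nondegenerate'[of "u - k u"] by simp
  next
    assume "k u = u"
    then show "\<forall>a\<in>I. B a u = 0" using k(2)[of _ u] by (auto simp: I B_diff_left)
  qed
  then show ?thesis unfolding dperp_subspace[OF subspace_displaced] K by blast
qed

text \<open>If \<open>w\<close> were orthogonal to \<open>K\<close> but not in \<open>I\<close>,
  some linear form would vanish on \<open>I\<close> and not at \<open>w\<close>. The vector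
  representing it is orthogonal to \<open>I\<close>, hence in \<open>K\<close>, and pairs
  non-trivially with \<open>w\<close>.\<close>

lemma dperp_fixed: "dperp K = I"
proof
  show "I \<subseteq> dperp K"
  proof
    fix i assume i: "i \<in> I"
    have "B a i = 0" if "a \<in> K" for a
      using that i dperp_displaced dperp_subspace[OF subspace_displaced] B_swap[of a i] by auto
    then show "i \<in> dperp K" unfolding dperp_subspace[OF subspace_fixed] by blast
  qed
  show "dperp K \<subseteq> I"
  proof (rule subsetI, rule ccontr)
    fix w assume w: "w \<in> dperp K" "w \<notin> I"
    obtain q where q: "additive_hom q" "\<And>w. q w \<in> I" "\<And>a. a \<in> I \<Longrightarrow> q a = a"
      using projection[OF subspace_displaced] by blast
    have "w - q w \<noteq> 0" using w(2) q(2)[of w] by auto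
    then obtain e where e: "coord e (w - q w) \<noteq> 0"
      using coord_sum[of "w - q w"] by (metis (no_types, lifting) scale_zero_left sum.neutral)
    have "functional (\<lambda>x. coord e (x - q x))"
      using functional_coord[of e] q(1)
      by (simp add: functional_diff[OF functional_coord] functional_def additive_hom_def algebra_simps)
    then obtain u where u: "\<And>x. coord e (x - q x) = B u x" using riesz by blast
    have "B i u = 0" if "i \<in> I" for i
      using u[of i] q(3)[OF that] functional_0[OF functional_coord] B_swap[of i u] by simp
    then have "u \<in> dperp I" unfolding dperp_subspace[OF subspace_displaced] by blast
    then have "u \<in> K" using dperp_displaced by simp
    then have "B u w = 0" using w(1) dperp_subspace[OF subspace_fixed] by auto
    then show False using e u by simp
  qed
qed

text \<open>A linear right inverse of k - 1 on \<open>I\<close> is bounded, so it maps a small ball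
  of \<open>I\<close> into the given ball.\<close>

lemma displacement_open:
  assumes "0 < r"
  shows "\<exists>r'>0. I \<inter> ball r' \<subseteq> (\<lambda>w. k w - w) ` ball r"
proof -
  interpret vector_space_pair scW scW by unfold_locales
  have "Vector_Spaces.linear scW scW (\<lambda>w. k w - w)"
    using displacement_hom linear_iff_additive_hom by blast
  then obtain R where R: "Vector_Spaces.linear scW scW R" "\<forall>i\<in>I. k (R i) - R i = i"
    using linear_exists_right_inverse_on[of "\<lambda>w. k w - w" UNIV] I subspace_UNIV by auto
  then obtain C where C: "C > 0" "\<forall>r>0. R ` ball r \<subseteq> ball (C * r)"
    using additive_hom_bounded linear_iff_additive_hom by blast
  have "I \<inter> ball (r / C) \<subseteq> (\<lambda>w. k w - w) ` ball r"
  proof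
    fix i assume i: "i \<in> I \<inter> ball (r / C)"
    have "r / C > 0" using C assms by simp
    then have "R i \<in> ball (C * (r / C))" using C(2) i by blast
    then have "R i \<in> ball r" using C(1) by simp
    then show "i \<in> (\<lambda>w. k w - w) ` ball r" using R(2) i by (intro image_eqI[of _ _ "R i"]) auto
  qed
  moreover have "r / C > 0" using C assms by simp
  ultimately show ?thesis by blast
qed

end

theorem commuting_lifts:
  fixes sc :: "'r \<Rightarrow> 's::ab_group_add \<Rightarrow> 's" and U :: "'w \<Rightarrow> 's \<Rightarrow> 's"
  assumes H: "heisenberg_system sc half_pairing U ball"
    and g: "additive_hom g" "\<And>x y. B (g x) (g y) = B x y" "bij g"
    and h: "additive_hom h" "\<And>x y. B (h x) (h y) = B x y" "bij h"
    and gh: "g \<circ> h = h \<circ> g"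
    and M: "Vector_Spaces.linear sc sc M" "bij M" "\<And>w s. M (U w s) = U (inv_into UNIV g w) (M s)"
    and N: "Vector_Spaces.linear sc sc N" "bij N" "\<And>w s. N (U w s) = U (inv_into UNIV h w) (N s)"
  shows "M \<circ> N = N \<circ> M"
proof -
  interpret H: heisenberg_system sc half_pairing U ball by (rule H)
  note g' = symplectic_inverse[OF g] and h' = symplectic_inverse[OF h]
  have bg: "bij (inv_into UNIV g)" "bij (inv_into UNIV h)" using g(3) h(3) by (simp_all add: bij_imp_bij_inv)
  have hom_perp: "H.perp = dperp" by (rule ext) (simp add: H.perp_def dperp_def H.b_def)
  \<comment> \<open>The relation of the metaplectic group makes \<open>M\<close> carry
    \<open>U w\<close> to the translation by the inverse image of \<open>w\<close> under
    \<open>g\<close>. So the automorphism of W attached to \<open>M\<close> is the inverse of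
    \<open>g\<close>; likewise the inverse of \<open>h\<close> goes with \<open>N\<close>, and
    \<open>h\<close> plays the part of \<open>hi\<close>.\<close>
  define k where "k = inv_into UNIV g"
  define K where "K = {w. k w = w}"
  define I where "I = range (\<lambda>w. k w - w)"
  note kk = g'(1,2)[folded k_def] bg(1)[folded k_def]
  have lin: "H.linear_op A" if "Vector_Spaces.linear sc sc A" for A
    using that by (auto simp: H.linear_op_def Vector_Spaces.linear_iff)
  have half: "half_pairing (f x) (f y) = half_pairing x y" if "\<And>x y. B (f x) (f y) = B x y" for f x y
    using that by (simp add: half_pairing_def)
  have comm: "inv_into UNIV h (k x) = k (inv_into UNIV h x)" for x
  proof -
    have "g (h (k (inv_into UNIV h x))) = x"
      using fun_cong[OF gh, of "k (inv_into UNIV h x)"] g'(3) h'(3) by (simp add: k_def)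
    then show ?thesis using g'(4) h'(4) by (metis k_def)
  qed
  have hi: "inv_into UNIV h (h x) = x" "h (inv_into UNIV h x) = x" for x using h'(3,4) by auto
  interpret heisenberg_commuting sc half_pairing U ball k M K I "inv_into UNIV h" h N "inv_into UNIV M" "inv_into UNIV N"
  proof
    show "M s = 0 \<Longrightarrow> s = 0" for s
      using M(2) H.linear_opD(3)[OF lin[OF M(1)]] by (metis bij_is_inj injD)
    show "\<exists>r'\<ge>r. \<forall>w\<in>H.perp (K \<inter> ball r'). \<exists>a\<in>H.perp K. w - a \<in> H.perp (ball r)" if "0 < r" for r
      unfolding hom_perp using dperp_decompose[OF subspace_fixed[OF kk K_def I_def] that] .
    show "\<exists>r'\<ge>r. \<forall>w\<in>H.perp (I \<inter> ball r'). \<exists>a\<in>H.perp I. w - a \<in> H.perp (ball r)" if "0 < r" for r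
      unfolding hom_perp using dperp_decompose[OF subspace_displaced[OF kk K_def I_def] that] .
    show "M (inv_into UNIV M s) = s" "inv_into UNIV M (M s) = s" "N (inv_into UNIV N s) = s" "inv_into UNIV N (N s) = s" for s
      using M(2) N(2) by (simp_all add: bij_is_inj bij_is_surj surj_f_inv_f)
  qed (use additive_hom_diff[OF kk(1)] half[OF kk(2)] lin[OF M(1)] lin[OF N(1)] M(3) N(3) K_def I_def
      additive_hom_bounded[OF kk(1)] displacement_open[OF kk K_def I_def]
      dperp_displaced[OF kk K_def I_def] dperp_fixed[OF kk K_def I_def] hom_perp
      additive_hom_diff[OF h'(1)] hi half[OF h'(2)] comm additive_hom_bounded[OF h(1)]
      additive_hom_bounded[OF h'(1)] in \<open>simp_all add: k_def\<close>)
  show ?thesis using lifts_commute by (simp add: fun_eq_iff)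
qed

end

section \<open>From records and topologies to the abstract setting: modules and the metaplectic
  group\<close>

subsection \<open>Vector spaces as modules over the ring of a field type\<close>

lemma ring_of_type_algebra_simps [simp]:
  "carrier ring_of_type_algebra = UNIV" "a \<otimes>\<^bsub>ring_of_type_algebra\<^esub> c = a * c"
  "a \<oplus>\<^bsub>ring_of_type_algebra\<^esub> c = a + c" "\<one>\<^bsub>ring_of_type_algebra\<^esub> = 1"
  "\<zero>\<^bsub>ring_of_type_algebra\<^esub> = 0"
  by (simp_all add: ring_of_type_algebra_def)

lemma space_of_simps [simp]:
  "carrier (space_of sc) = UNIV" "x \<oplus>\<^bsub>space_of sc\<^esub> y = x + y" "r \<odot>\<^bsub>space_of sc\<^esub> x = sc r x"
  "\<zero>\<^bsub>space_of sc\<^esub> = 0"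
  by (simp_all add: space_of_def)

lemma module_space_of:
  assumes "vector_space sc"
  shows "Module.module (ring_of_type_algebra :: 'r::field ring) (space_of sc)"
proof -
  interpret vector_space sc by fact
  show ?thesis
  proof (rule moduleI)
    show "cring (ring_of_type_algebra :: 'r ring)" by (rule cring_from_type_algebra)
    show "abelian_group (space_of sc)"
    proof (rule abelian_groupI)
      show "\<exists>y\<in>carrier (space_of sc). y \<oplus>\<^bsub>space_of sc\<^esub> x = \<zero>\<^bsub>space_of sc\<^esub>" for x
        by (intro bexI[of _ "- x"]) auto
    qed (auto simp: add_ac)
  qed (auto simp: scale_right_distrib scale_left_distrib)
qed

lemma submodule_space_of_iff:
  assumes "vector_space (sc :: 'r::field \<Rightarrow> 'a::ab_group_add \<Rightarrow> 'a)"
  shows "submodule N (ring_of_type_algebra :: 'r ring) (space_of sc) \<longleftrightarrow> Modules.module.subspace sc N"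
proof -
  interpret vector_space sc by fact
  interpret M: Module.module "ring_of_type_algebra :: 'r ring" "space_of sc"
    by (rule module_space_of[OF assms])
  have minus: "\<ominus>\<^bsub>space_of sc\<^esub> x = - x" for x by (rule M.minus_equality) auto
  show ?thesis
  proof
    assume N: "submodule N (ring_of_type_algebra :: 'r ring) (space_of sc)"
    have "0 \<in> N"
      using subgroup.one_closed[OF submodule.axioms(1)[OF N]] by simp
    then show "subspace N"
      using M.submoduleE(4,5)[OF N] by (simp add: subspace_def)
  next
    assume N: "subspace N"
    show "submodule N (ring_of_type_algebra :: 'r ring) (space_of sc)"
      by (rule M.submoduleI) (use N minus in \<open>simp_all add: subspace_0 subspace_neg subspace_add subspace_scale\<close>)
  qed
qed

subsection \<open>The topologies\<close>

lemma vec_top_neighbourhood: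
  assumes S: "nonarch_symplectic scW E v B \<psi>" and "openin (vec_top v scW) A" "0 \<in> A"
  shows "\<exists>r>0. nonarch_symplectic.ball scW E v r \<subseteq> A"
proof -
  interpret nonarch_symplectic scW E v B \<psi> by fact
  have "generate_topology_on {l -` D | l D. Vector_Spaces.linear scW (*) l \<and> openin (field_top v) D} A"
    using assms(2) by (simp add: vec_top_def openin_topology_generated_by_iff)
  then show ?thesis using assms(3)
  proof induction
    case (Int a b)
    then obtain r r' where "r > 0" "ball r \<subseteq> a" "r' > 0" "ball r' \<subseteq> b" by auto
    then show ?case
      using ball_mono[of "min r r'" r] ball_mono[of "min r r'" r'] by (intro exI[of _ "min r r'"]) auto
  next
    case (UN K)
    then show ?case by blast
  next
    case (Basis s)
    then obtain l D where l: "s = l -` D" "Vector_Spaces.linear scW (*) l" "openin (field_top v) D" by auto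
    then have f: "functional l" using linear_iff_functional by blast
    have "0 \<in> D" using Basis l functional_0[OF f] by simp
    then obtain c where c: "c > 0" "\<And>y. v (0 - y) < c \<Longrightarrow> y \<in> D"
      using l(3) openin_field_top[OF v] by blast
    obtain C where C: "C > 0" "\<forall>r>0. \<forall>w\<in>ball r. v (l w) \<le> C * r" using functional_bounded[OF f] by blast
    define r where "r = c / (2 * C)"
    have r: "r > 0" using c C by (simp add: r_def)
    have "ball r \<subseteq> s"
    proof
      fix w assume "w \<in> ball r"
      then have "v (l w) \<le> C * r" using C r by blast
      also have "C * r < c" using c C by (simp add: r_def)
      finally have "l w \<in> D" using c(2)[of "l w"] V(7) by simp
      then show "w \<in> s" using l by simp
    qed
    then show ?case using r by blast
  qed simp
qed

lemma topspace_vec_top: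
  assumes "vector_space scW" "nonarch_abs v"
  shows "topspace (vec_top v scW) = UNIV"
proof -
  have "Vector_Spaces.linear scW (*) (\<lambda>_. 0)"
    using assms(1) vector_space_self by (simp add: Vector_Spaces.linear_iff)
  moreover have "openin (field_top v) UNIV"
    using openin_field_top[OF assms(2)] by (auto intro: exI[of _ 1])
  ultimately have "(\<lambda>_. 0) -` UNIV \<in> {l -` D | l D. Vector_Spaces.linear scW (*) l \<and> openin (field_top v) D}"
    by blast
  then show ?thesis unfolding vec_top_def topology_generated_by_topspace by blast
qed

subsection \<open>The metaplectic group\<close>

lemma Sp_group_simps [simp]:
  "g \<in> carrier (Sp_group scW B) \<longleftrightarrow>
    Vector_Spaces.linear scW scW g \<and> bij g \<and> (\<forall>x y. B (g x) (g y) = B x y)"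
  "g \<otimes>\<^bsub>Sp_group scW B\<^esub> h = h \<circ> g" "\<one>\<^bsub>Sp_group scW B\<^esub> = id"
  by (simp_all add: Sp_group_def)

lemma linear_bij_inverse:
  assumes "Vector_Spaces.linear sc sc f" "bij f"
  shows "Vector_Spaces.linear sc sc (inv_into UNIV f)" "bij (inv_into UNIV f)"
    "f \<circ> inv_into UNIV f = id" "inv_into UNIV f \<circ> f = id" "f (inv_into UNIV f x) = x"
    "inv_into UNIV f (f x) = x"
proof -
  show 1: "f (inv_into UNIV f x) = x" for x using assms(2) by (simp add: bij_is_surj surj_f_inv_f)
  show 2: "inv_into UNIV f (f x) = x" for x using assms(2) by (simp add: bij_is_inj)
  show "f \<circ> inv_into UNIV f = id" "inv_into UNIV f \<circ> f = id" using 1 2 by auto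
  show "bij (inv_into UNIV f)" using assms(2) by (rule bij_imp_bij_inv)
  have f: "f (x + y) = f x + f y" "f (sc r x) = sc r (f x)" for x y r
    using assms(1) by (auto simp: Vector_Spaces.linear_iff)
  have "inv_into UNIV f (x + y) = inv_into UNIV f x + inv_into UNIV f y" for x y using f 1 2 by metis
  moreover have "inv_into UNIV f (sc r x) = sc r (inv_into UNIV f x)" for x r using f 1 2 by metis
  ultimately show "Vector_Spaces.linear sc sc (inv_into UNIV f)"
    using assms(1) by (auto simp: Vector_Spaces.linear_iff)
qed

lemma linear_comp: "Vector_Spaces.linear sc sc f \<Longrightarrow> Vector_Spaces.linear sc sc g \<Longrightarrow>
    Vector_Spaces.linear sc sc (f \<circ> g)"
  by (auto simp: Vector_Spaces.linear_iff)

lemma linear_identity: "vector_space sc \<Longrightarrow> Vector_Spaces.linear sc sc id"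
  by (auto simp: Vector_Spaces.linear_iff)

lemma Sp_inverse:
  assumes "g \<in> carrier (Sp_group scW B)"
  shows "inv_into UNIV g \<in> carrier (Sp_group scW B)"
proof -
  have g: "Vector_Spaces.linear scW scW g" "bij g" "\<And>x y. B (g x) (g y) = B x y" using assms by auto
  have "B (inv_into UNIV g x) (inv_into UNIV g y) = B x y" for x y
    using g(3)[of "inv_into UNIV g x" "inv_into UNIV g y"] linear_bij_inverse(5)[OF g(1,2)] by simp
  then show ?thesis using linear_bij_inverse(1,2)[OF g(1,2)] by simp
qed

lemma group_Sp: "vector_space scW \<Longrightarrow> Group.group (Sp_group scW B)"
proof (rule groupI)
  fix g assume "g \<in> carrier (Sp_group scW B)"
  then show "\<exists>h\<in>carrier (Sp_group scW B). h \<otimes>\<^bsub>Sp_group scW B\<^esub> g = \<one>\<^bsub>Sp_group scW B\<^esub>"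
    using Sp_inverse linear_bij_inverse(3) by (intro bexI[of _ "inv_into UNIV g"]) auto
qed (auto simp: linear_comp linear_identity bij_comp comp_assoc)

lemma Mp_group_simps:
  "x \<in> carrier (Mp_group scW B scS \<rho>) \<longleftrightarrow> fst x \<in> carrier (Sp_group scW B) \<and>
    Vector_Spaces.linear scS scS (snd x) \<and> bij (snd x) \<and>
    (\<forall>w t. snd x \<circ> \<rho> (w, t) \<circ> inv_into UNIV (snd x) = \<rho> (inv_into UNIV (fst x) w, t))"
  "x \<otimes>\<^bsub>Mp_group scW B scS \<rho>\<^esub> y = (fst y \<circ> fst x, snd x \<circ> snd y)"
  "\<one>\<^bsub>Mp_group scW B scS \<rho>\<^esub> = (id, id)"
  by (cases x; cases y; auto simp: Mp_group_def GL_group_def DirProd_def)+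

lemma Mp_inverse:
  assumes x: "x \<in> carrier (Mp_group scW B scS \<rho>)"
  shows "(inv_into UNIV (fst x), inv_into UNIV (snd x)) \<in> carrier (Mp_group scW B scS \<rho>)"
proof -
  obtain g M where gM: "x = (g, M)" by fastforce
  have g: "Vector_Spaces.linear scW scW g" "bij g" and M: "Vector_Spaces.linear scS scS M" "bij M"
    and rel: "\<And>w t. M \<circ> \<rho> (w, t) \<circ> inv_into UNIV M = \<rho> (inv_into UNIV g w, t)"
    using x by (auto simp: Mp_group_simps gM)
  note ig = linear_bij_inverse[OF g] and iM = linear_bij_inverse[OF M]
  have "inv_into UNIV M \<circ> \<rho> (w, t) \<circ> M = \<rho> (g w, t)" for w t
  proof
    fix s
    have "M (\<rho> (g w, t) (inv_into UNIV M (M s))) = \<rho> (w, t) (M s)"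
      using fun_cong[OF rel[of "g w" t], of "M s"] by (simp add: ig)
    then show "(inv_into UNIV M \<circ> \<rho> (w, t) \<circ> M) s = \<rho> (g w, t) s"
      using iM(6) by (metis comp_apply)
  qed
  moreover have "g \<in> carrier (Sp_group scW B)" using x by (simp only: Mp_group_simps gM fst_conv)
  then have "inv_into UNIV g \<in> carrier (Sp_group scW B)" by (rule Sp_inverse)
  ultimately show ?thesis
    using iM(1,2) g(2) M(2) by (simp add: Mp_group_simps gM inv_inv_eq del: Sp_group_simps)
qed

lemma group_Mp:
  assumes W: "vector_space scW" and S: "vector_space scS"
  shows "Group.group (Mp_group scW B scS \<rho>)"
proof (rule groupI)
  let ?G = "Mp_group scW B scS \<rho>"
  show "x \<otimes>\<^bsub>?G\<^esub> y \<in> carrier ?G" if xy: "x \<in> carrier ?G" "y \<in> carrier ?G" for x y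
  proof -
    obtain g M h N where e: "x = (g, M)" "y = (h, N)" by fastforce
    have b: "bij g" "bij h" "bij M" "bij N"
      and rel: "\<And>w t. M \<circ> \<rho> (w, t) \<circ> inv_into UNIV M = \<rho> (inv_into UNIV g w, t)"
        "\<And>w t. N \<circ> \<rho> (w, t) \<circ> inv_into UNIV N = \<rho> (inv_into UNIV h w, t)"
      using xy by (auto simp: Mp_group_simps e)
    have inv: "inv_into UNIV (M \<circ> N) = inv_into UNIV N \<circ> inv_into UNIV M"
      "inv_into UNIV (h \<circ> g) = inv_into UNIV g \<circ> inv_into UNIV h"
      using b by (simp_all add: o_inv_distrib)
    have "M \<circ> N \<circ> \<rho> (w, t) \<circ> inv_into UNIV (M \<circ> N) = \<rho> (inv_into UNIV (h \<circ> g) w, t)" for w t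
    proof -
      have "M \<circ> N \<circ> \<rho> (w, t) \<circ> inv_into UNIV (M \<circ> N)
          = M \<circ> (N \<circ> \<rho> (w, t) \<circ> inv_into UNIV N) \<circ> inv_into UNIV M"
        by (simp only: inv comp_assoc)
      then show ?thesis by (simp only: rel inv comp_apply)
    qed
    then show ?thesis using xy by (auto simp: Mp_group_simps e linear_comp bij_comp)
  qed
  show "\<one>\<^bsub>?G\<^esub> \<in> carrier ?G"
    by (simp add: Mp_group_simps linear_identity W S)
  show "\<exists>y\<in>carrier ?G. y \<otimes>\<^bsub>?G\<^esub> x = \<one>\<^bsub>?G\<^esub>" if "x \<in> carrier ?G" for x
  proof (rule bexI[OF _ Mp_inverse[OF that]])
    show "(inv_into UNIV (fst x), inv_into UNIV (snd x)) \<otimes>\<^bsub>?G\<^esub> x = \<one>\<^bsub>?G\<^esub>"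
      using that linear_bij_inverse(3,4) by (simp add: Mp_group_simps) blast
  qed
qed (auto simp: Mp_group_simps comp_assoc)

lemma subgroup_hat:
  assumes W: "vector_space scW" and S: "vector_space scS" and H: "subgroup H (Sp_group scW B)"
  shows "subgroup (carrier (hat_group scW B scS \<rho> H)) (Mp_group scW B scS \<rho>)"
proof -
  let ?M = "Mp_group scW B scS \<rho>"
  interpret M: Group.group ?M by (rule group_Mp[OF W S])
  interpret Sp: Group.group "Sp_group scW B" by (rule group_Sp[OF W])
  interpret D: subgroup "derived ?M (carrier ?M)" ?M by (rule M.derived_is_subgroup) simp
  have c: "x \<in> carrier (hat_group scW B scS \<rho> H) \<longleftrightarrow> x \<in> derived ?M (carrier ?M) \<and> fst x \<in> H" for x
    by (cases x) (auto simp: hat_group_def)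
  show ?thesis
  proof (rule M.subgroupI)
    show "carrier (hat_group scW B scS \<rho> H) \<subseteq> carrier ?M" using c D.subset by blast
    have "\<one>\<^bsub>?M\<^esub> \<in> carrier (hat_group scW B scS \<rho> H)"
      using c D.one_closed subgroup.one_closed[OF H] by (simp add: Mp_group_simps)
    then show "carrier (hat_group scW B scS \<rho> H) \<noteq> {}" by blast
  next
    fix x assume x: "x \<in> carrier (hat_group scW B scS \<rho> H)"
    then have xM: "x \<in> carrier ?M" using c D.subset by blast
    have "(inv_into UNIV (fst x), inv_into UNIV (snd x)) \<otimes>\<^bsub>?M\<^esub> x = \<one>\<^bsub>?M\<^esub>"
      using xM linear_bij_inverse(3,4) by (simp add: Mp_group_simps) blast
    then have invM: "inv\<^bsub>?M\<^esub> x = (inv_into UNIV (fst x), inv_into UNIV (snd x))"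
      using M.inv_equality xM Mp_inverse by blast
    have g: "fst x \<in> carrier (Sp_group scW B)" using xM by (simp add: Mp_group_simps)
    have "inv\<^bsub>Sp_group scW B\<^esub> (fst x) = inv_into UNIV (fst x)"
      by (rule Sp.inv_equality) (use g Sp_inverse[OF g] linear_bij_inverse(3) in auto)
    moreover have "inv\<^bsub>Sp_group scW B\<^esub> (fst x) \<in> H" using subgroup.m_inv_closed[OF H] x c by blast
    ultimately have "fst (inv\<^bsub>?M\<^esub> x) \<in> H" by (simp add: invM)
    moreover have "inv\<^bsub>?M\<^esub> x \<in> derived ?M (carrier ?M)" using x c D.m_inv_closed by blast
    ultimately show "inv\<^bsub>?M\<^esub> x \<in> carrier (hat_group scW B scS \<rho> H)" using c by blast
  next
    fix x y assume "x \<in> carrier (hat_group scW B scS \<rho> H)" "y \<in> carrier (hat_group scW B scS \<rho> H)"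
    then show "x \<otimes>\<^bsub>?M\<^esub> y \<in> carrier (hat_group scW B scS \<rho> H)"
      using c D.m_closed[of x y] subgroup.m_closed[OF H, of "fst x" "fst y"] by (simp add: Mp_group_simps)
  qed
qed

lemma hat_group_carrier:
  assumes "vector_space scW" "vector_space scS" "subgroup H (Sp_group scW B)"
    and "x \<in> carrier (hat_group scW B scS \<rho> H)"
  shows "x \<in> carrier (Mp_group scW B scS \<rho>)" "fst x \<in> H"
proof -
  show "x \<in> carrier (Mp_group scW B scS \<rho>)" using subgroup.subset[OF subgroup_hat[OF assms(1-3)]] assms(4) by blast
  show "fst x \<in> H" using assms(4) by (auto simp: hat_group_def)
qed

lemma hat_group_mult: "x \<otimes>\<^bsub>hat_group scW B scS \<rho> H\<^esub> y = (fst y \<circ> fst x, snd x \<circ> snd y)"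
  and hat_group_one: "\<one>\<^bsub>hat_group scW B scS \<rho> H\<^esub> = (id, id)"
  by (simp_all add: hat_group_def Mp_group_simps(2,3))

lemma group_hat:
  assumes "vector_space scW" "vector_space scS" "subgroup H (Sp_group scW B)"
  shows "Group.group (hat_group scW B scS \<rho> H)"
proof -
  have "hat_group scW B scS \<rho> H = (Mp_group scW B scS \<rho>)\<lparr>carrier := carrier (hat_group scW B scS \<rho> H)\<rparr>"
    by (simp add: hat_group_def)
  then show ?thesis
    using subgroup.subgroup_is_group[OF subgroup_hat[OF assms, where \<rho> = \<rho>] group_Mp[OF assms(1,2)]] by metis
qed

text \<open>A subbasic open set of the compact-open topology, for the compact set \<open>{s}\<close>
  and the open set \<open>{t}\<close> of the discrete space S. It makes the orbit maps of the Weil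
  representation locally constant, whence all smoothness below.\<close>

lemma openin_hat_top:
  assumes W: "vector_space scW" and S: "vector_space scS" and H: "subgroup H (Sp_group scW B)"
    and v: "nonarch_abs v"
  shows "openin (hat_top v scW B scS \<rho> H) {x \<in> carrier (hat_group scW B scS \<rho> H). snd x s = t}"
proof -
  let ?G = "carrier (hat_group scW B scS \<rho> H)" and ?M = "carrier (Mp_group scW B scS \<rho>)"
  have "openin (compact_open_top (discrete_topology UNIV) (discrete_topology UNIV)) {f. f ` {s} \<subseteq> {t}}"
  proof -
    have "compactin (discrete_topology UNIV) {s}" "openin (discrete_topology UNIV) {t}" by simp_all
    then show ?thesis unfolding compact_open_top_def by (intro topology_generated_by_Basis) blast
  qed
  then have "openin (GL_top scS) ({f. f ` {s} \<subseteq> {t}} \<inter> carrier (GL_group scS))"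
    unfolding GL_top_def openin_subtopology by blast
  moreover have "topspace (Sp_top v scW B) = carrier (Sp_group scW B)"
    by (simp add: Sp_top_def topspace_vec_top[OF W v])
  then have "openin (Sp_top v scW B) (carrier (Sp_group scW B))" by (metis openin_topspace)
  ultimately have "openin (prod_topology (Sp_top v scW B) (GL_top scS))
      (carrier (Sp_group scW B) \<times> ({f. f ` {s} \<subseteq> {t}} \<inter> carrier (GL_group scS)))"
    by (simp add: openin_prod_Times_iff)
  then have "openin (hat_top v scW B scS \<rho> H)
      ((carrier (Sp_group scW B) \<times> ({f. f ` {s} \<subseteq> {t}} \<inter> carrier (GL_group scS))) \<inter> ?M \<inter> ?G)"
    unfolding hat_top_def Mp_top_def openin_subtopology by blast
  also have "(carrier (Sp_group scW B) \<times> ({f. f ` {s} \<subseteq> {t}} \<inter> carrier (GL_group scS))) \<inter> ?M \<inter> ?G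
      = {x \<in> ?G. snd x s = t}"
  proof -
    have "x \<in> ?M \<and> fst x \<in> carrier (Sp_group scW B) \<and> snd x \<in> carrier (GL_group scS)" if "x \<in> ?G" for x
      using hat_group_carrier(1)[OF W S H that] by (auto simp: Mp_group_simps GL_group_def)
    then show ?thesis by (auto simp: mem_Times_iff simp del: Sp_group_simps)
  qed
  finally show ?thesis .
qed

subsection \<open>Commutation in the metaplectic group\<close>

lemma base_field_nonarch_symplectic:
  fixes v :: "'f::field \<Rightarrow> real" and \<psi> :: "'f \<Rightarrow> 'r::field"
  assumes base: "base_field p v" and char: "CHAR('f) \<noteq> 2" and sympl: "symplectic_space scW B"
    and psi: "smooth_character v \<psi>" "\<exists>t. \<psi> t \<noteq> 1"
  obtains E where "nonarch_symplectic scW E v B \<psi>"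
proof -
  note na = base_field_nonarch_abs[OF base]
  obtain E where E: "finite_dimensional_vector_space scW E" using sympl by (auto simp: symplectic_space_def)
  interpret finite_dimensional_vector_space scW E by (rule E)
  have \<psi>: "\<psi> x \<noteq> 0" "\<psi> (x + y) = \<psi> x * \<psi> y" "openin (field_top v) {x. \<psi> x = 1}" for x y
    using psi(1) by (auto simp: smooth_character_def)
  have "\<psi> 0 = 1" using \<psi>(2)[of 0 0] \<psi>(1)[of 0] by simp
  then obtain c where c: "c > 0" "\<And>y. v (0 - y) < c \<Longrightarrow> \<psi> y = 1"
    using \<psi>(3) unfolding openin_field_top[OF na] by blast
  have "(2 :: 'f) \<noteq> 0"
  proof
    assume "(2 :: 'f) = 0"
    then have "CHAR('f) dvd 2" using of_nat_eq_0_iff_char_dvd[of 2, where ?'a = 'f] by simp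
    moreover from this have "CHAR('f) \<noteq> 0" by (metis dvd_0_left_iff zero_neq_numeral)
    moreover from \<open>CHAR('f) dvd 2\<close> have "CHAR('f) \<le> 2" by (rule dvd_imp_le) simp
    moreover have "CHAR('f) \<noteq> 1" by simp
    ultimately show False using char by linarith
  qed
  \<comment> \<open>Half the radius turns the strict inequality into a weak one.\<close>
  moreover have "\<exists>c>0. \<forall>x. v x \<le> c \<longrightarrow> \<psi> x = 1"
    using c nonarch_absD(7)[OF na] by (intro exI[of _ "c / 2"]) (auto intro!: c(2))
  ultimately have "nonarch_symplectic scW E v B \<psi>"
    using E na base_field_cover[OF base] sympl \<psi> psi(2)
    by (auto simp: nonarch_symplectic_def nonarch_symplectic_axioms_def symplectic_space_def
        Vector_Spaces.linear_iff)
  then show thesis by (rule that)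
qed

text \<open>The centre acts by the scalars \<open>\<psi> t\<close>, so a subspace stable under all
  \<open>\<rho> (w, 0)\<close> is stable under the whole Heisenberg group. The multiplication law of
  the group shows that \<open>half_pairing\<close> is the cocycle.\<close>

lemma schroedinger_heisenberg_system:
  fixes \<psi> :: "'f::field \<Rightarrow> 'r::field" and scS :: "'r \<Rightarrow> 's::ab_group_add \<Rightarrow> 's"
  assumes N: "nonarch_symplectic scW E v B \<psi>" and S: "vector_space scS"
    and smooth: "smooth_rep (heisenberg B) (heisenberg_top v scW) (space_of scS) \<rho>"
    and irr: "irreducible_rep (heisenberg B) (space_of scS) \<rho>"
    and central: "\<And>t x. \<rho> (0, t) x = scS (\<psi> t) x"
  shows "heisenberg_system scS (nonarch_symplectic.half_pairing B \<psi>) (\<lambda>w. \<rho> (w, 0))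
      (nonarch_symplectic.ball scW E v)"
proof -
  interpret nonarch_symplectic scW E v B \<psi> by (rule N)
  interpret S: vector_space scS by (rule S)
  have rep: "Defs.representation (heisenberg B) (space_of scS) \<rho>" using smooth by (simp add: smooth_rep_def)
  have lin: "\<rho> g (x + y) = \<rho> g x + \<rho> g y" "\<rho> g (scS r x) = scS r (\<rho> g x)" for g x y r
    using rep by (cases g; simp add: Defs.representation_def lin_maps_def heisenberg_def)+
  have one: "\<rho> (0, 0) x = x" for x
    using rep by (simp add: Defs.representation_def heisenberg_def)
  have mult: "\<rho> (w + w', t + t' + B w w' / 2) x = \<rho> (w, t) (\<rho> (w', t') x)" for w t w' t' x
    using rep by (simp add: Defs.representation_def heisenberg_def)
  have twist: "\<rho> (w, t) x = scS (\<psi> t) (\<rho> (w, 0) x)" for w t x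
    using mult[of w 0 0 t x] by (simp add: central lin)
  show ?thesis
  proof
    fix x y z
    show "half_pairing (x + y) z = half_pairing x z * half_pairing y z"
      "half_pairing x (y + z) = half_pairing x y * half_pairing x z"
      by (simp_all add: half_pairing_def B_add_left B_add_right add_divide_distrib \<psi>_add)
    show "half_pairing x y \<noteq> 0" "half_pairing x x = 1"
      by (simp_all add: half_pairing_def \<psi>_nonzero B_self)
  next
    fix w w' s
    show "\<rho> (w, 0) (\<rho> (w', 0) s) = scS (half_pairing w w') (\<rho> (w + w', 0) s)"
      using mult[of w w' 0 0 s] twist[of "w + w'" "B w w' / 2"] by (simp add: half_pairing_def)
  next
    fix N assume N: "S.subspace N" "\<And>w s. s \<in> N \<Longrightarrow> \<rho> (w, 0) s \<in> N"
    have "\<rho> g s \<in> N" if "s \<in> N" for g s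
      using twist[of "fst g" "snd g" s] N(1) N(2)[OF that] by (simp add: S.subspace_scale)
    then have "\<forall>g\<in>carrier (heisenberg B). \<rho> g ` N \<subseteq> N" by blast
    moreover have "submodule N (ring_of_type_algebra :: 'r ring) (space_of scS)"
      using submodule_space_of_iff[OF S, of N] N(1) by blast
    ultimately have "N = {\<zero>\<^bsub>space_of scS\<^esub>} \<or> N = carrier (space_of scS)"
      using irr unfolding irreducible_rep_def by blast
    then show "N = {0} \<or> N = UNIV" by simp
  next
    have "UNIV \<noteq> {0::'s}" using irr unfolding irreducible_rep_def by simp
    then show "\<exists>s::'s. s \<noteq> 0" by blast
    fix s
    have op: "openin (prod_topology (vec_top v scW) (field_top v)) {g. \<rho> g s = s}"
      using smooth by (simp add: smooth_rep_def heisenberg_top_def heisenberg_def)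
    then obtain D D' where "openin (vec_top v scW) D" "0 \<in> D" "0 \<in> D'" "D \<times> D' \<subseteq> {g. \<rho> g s = s}"
      using op[unfolded openin_prod_topology_alt, rule_format, of 0 0] one[of s] by blast
    moreover from this obtain r where "r > 0" "ball r \<subseteq> D" using vec_top_neighbourhood[OF N] by blast
    ultimately show "\<exists>r>0. \<forall>w\<in>ball r. \<rho> (w, 0) s = s" by blast
  qed (auto simp: lin one ball_subgroup ball_mono[THEN subsetD] ball_cover ball_index ball_continuous
      ball_nondegenerate)
qed

lemma metaplectic_commute:
  fixes v :: "'f::field \<Rightarrow> real" and \<psi> :: "'f \<Rightarrow> 'r::field"
  assumes N: "nonarch_symplectic scW E v B \<psi>" and S: "vector_space scS"
    and smooth: "smooth_rep (heisenberg B) (heisenberg_top v scW) (space_of scS) \<rho>"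
    and irr: "irreducible_rep (heisenberg B) (space_of scS) \<rho>"
    and central: "\<And>t x. \<rho> (0, t) x = scS (\<psi> t) x"
    and x: "x \<in> carrier (Mp_group scW B scS \<rho>)" and y: "y \<in> carrier (Mp_group scW B scS \<rho>)"
    and comm: "fst x \<circ> fst y = fst y \<circ> fst x"
  shows "snd x \<circ> snd y = snd y \<circ> snd x"
proof -
  interpret nonarch_symplectic scW E v B \<psi> by (rule N)
  have props: "additive_hom (fst z)" "\<And>a b. B (fst z a) (fst z b) = B a b" "bij (fst z)"
    "Vector_Spaces.linear scS scS (snd z)" "bij (snd z)"
    "\<And>w s. snd z (\<rho> (w, 0) s) = \<rho> (inv_into UNIV (fst z) w, 0) (snd z s)"
    if z: "z \<in> carrier (Mp_group scW B scS \<rho>)" for z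
  proof -
    have *: "Vector_Spaces.linear scS scS (snd z)" "bij (snd z)" using z by (auto simp: Mp_group_simps)
    show "additive_hom (fst z)" "\<And>a b. B (fst z a) (fst z b) = B a b" "bij (fst z)"
      "Vector_Spaces.linear scS scS (snd z)" "bij (snd z)"
      using z linear_iff_additive_hom by (auto simp: Mp_group_simps)
    fix w s
    have "snd z \<circ> \<rho> (w, 0) \<circ> inv_into UNIV (snd z) = \<rho> (inv_into UNIV (fst z) w, 0)"
      using z by (simp add: Mp_group_simps)
    from fun_cong[OF this, of "snd z s"]
    show "snd z (\<rho> (w, 0) s) = \<rho> (inv_into UNIV (fst z) w, 0) (snd z s)"
      using linear_bij_inverse(6)[OF *] by simp
  qed
  show ?thesis
    by (rule commuting_lifts[OF schroedinger_heisenberg_system[OF N S smooth irr central]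
          props(1-3)[OF x] props(1-3)[OF y] comm props(4-6)[OF x] props(4-6)[OF y]])
qed

section \<open>Stable subspaces and sums of copies of an irreducible representation\<close>

subsection \<open>Submodules and intertwining maps\<close>

definition linear_subset :: "('r::field, 'a, 'm) module_scheme \<Rightarrow> 'a set \<Rightarrow> bool" where
  "linear_subset M N \<longleftrightarrow> N \<subseteq> carrier M \<and> \<zero>\<^bsub>M\<^esub> \<in> N \<and> (\<forall>x\<in>N. \<forall>y\<in>N. x \<oplus>\<^bsub>M\<^esub> y \<in> N) \<and>
     (\<forall>r. \<forall>x\<in>N. r \<odot>\<^bsub>M\<^esub> x \<in> N)"

abbreviation field_module :: "('r::field, 'a, 'm) module_scheme \<Rightarrow> bool" where
  "field_module M \<equiv> Module.module (ring_of_type_algebra :: 'r ring) M"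

lemma field_moduleD:
  assumes "field_module M"
  shows "x \<in> carrier M \<Longrightarrow> y \<in> carrier M \<Longrightarrow> x \<oplus>\<^bsub>M\<^esub> y \<in> carrier M"
    "\<zero>\<^bsub>M\<^esub> \<in> carrier M" "x \<in> carrier M \<Longrightarrow> r \<odot>\<^bsub>M\<^esub> x \<in> carrier M"
    "x \<in> carrier M \<Longrightarrow> \<zero>\<^bsub>M\<^esub> \<oplus>\<^bsub>M\<^esub> x = x" "x \<in> carrier M \<Longrightarrow> x \<oplus>\<^bsub>M\<^esub> \<zero>\<^bsub>M\<^esub> = x"
    "x \<in> carrier M \<Longrightarrow> y \<in> carrier M \<Longrightarrow> z \<in> carrier M \<Longrightarrow>
      (x \<oplus>\<^bsub>M\<^esub> y) \<oplus>\<^bsub>M\<^esub> z = x \<oplus>\<^bsub>M\<^esub> (y \<oplus>\<^bsub>M\<^esub> z)"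
    "x \<in> carrier M \<Longrightarrow> y \<in> carrier M \<Longrightarrow> x \<oplus>\<^bsub>M\<^esub> y = y \<oplus>\<^bsub>M\<^esub> x"
    "x \<in> carrier M \<Longrightarrow> (r + s) \<odot>\<^bsub>M\<^esub> x = r \<odot>\<^bsub>M\<^esub> x \<oplus>\<^bsub>M\<^esub> s \<odot>\<^bsub>M\<^esub> x"
    "x \<in> carrier M \<Longrightarrow> y \<in> carrier M \<Longrightarrow> r \<odot>\<^bsub>M\<^esub> (x \<oplus>\<^bsub>M\<^esub> y) = r \<odot>\<^bsub>M\<^esub> x \<oplus>\<^bsub>M\<^esub> r \<odot>\<^bsub>M\<^esub> y"
    "x \<in> carrier M \<Longrightarrow> (r * s) \<odot>\<^bsub>M\<^esub> x = r \<odot>\<^bsub>M\<^esub> (s \<odot>\<^bsub>M\<^esub> x)"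
    "x \<in> carrier M \<Longrightarrow> 1 \<odot>\<^bsub>M\<^esub> x = x" "x \<in> carrier M \<Longrightarrow> 0 \<odot>\<^bsub>M\<^esub> x = \<zero>\<^bsub>M\<^esub>"
    "r \<odot>\<^bsub>M\<^esub> \<zero>\<^bsub>M\<^esub> = \<zero>\<^bsub>M\<^esub>"
proof -
  interpret M: Module.module "ring_of_type_algebra :: 'a ring" M by fact
  show "x \<in> carrier M \<Longrightarrow> 0 \<odot>\<^bsub>M\<^esub> x = \<zero>\<^bsub>M\<^esub>" using M.smult_l_null[of x] by simp
  show "r \<odot>\<^bsub>M\<^esub> \<zero>\<^bsub>M\<^esub> = \<zero>\<^bsub>M\<^esub>" using M.smult_r_null[of r] by simp
  show "x \<in> carrier M \<Longrightarrow> r \<odot>\<^bsub>M\<^esub> x \<in> carrier M" using M.smult_closed[of r x] by simp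
  show "x \<in> carrier M \<Longrightarrow> (r + s) \<odot>\<^bsub>M\<^esub> x = r \<odot>\<^bsub>M\<^esub> x \<oplus>\<^bsub>M\<^esub> s \<odot>\<^bsub>M\<^esub> x"
    using M.smult_l_distr[of r s x] by simp
  show "x \<in> carrier M \<Longrightarrow> y \<in> carrier M \<Longrightarrow> r \<odot>\<^bsub>M\<^esub> (x \<oplus>\<^bsub>M\<^esub> y) = r \<odot>\<^bsub>M\<^esub> x \<oplus>\<^bsub>M\<^esub> r \<odot>\<^bsub>M\<^esub> y"
    using M.smult_r_distr[of r x y] by simp
  show "x \<in> carrier M \<Longrightarrow> (r * s) \<odot>\<^bsub>M\<^esub> x = r \<odot>\<^bsub>M\<^esub> (s \<odot>\<^bsub>M\<^esub> x)"
    using M.smult_assoc1[of r s x] by simp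
  show "x \<in> carrier M \<Longrightarrow> 1 \<odot>\<^bsub>M\<^esub> x = x" using M.smult_one[of x] by simp
qed (rule abelian_monoid.a_closed[OF abelian_group.axioms(1)[OF module.axioms(2)[OF assms]]]
    abelian_monoid.zero_closed[OF abelian_group.axioms(1)[OF module.axioms(2)[OF assms]]]
    abelian_monoid.l_zero[OF abelian_group.axioms(1)[OF module.axioms(2)[OF assms]]]
    abelian_monoid.r_zero[OF abelian_group.axioms(1)[OF module.axioms(2)[OF assms]]]
    abelian_monoid.a_assoc[OF abelian_group.axioms(1)[OF module.axioms(2)[OF assms]]]
    abelian_monoid.a_comm[OF abelian_group.axioms(1)[OF module.axioms(2)[OF assms]]]; assumption)+

text \<open>Written with the scalar -1, so that linear maps respect it by their two defining
  equations alone.\<close>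

abbreviation mdiff :: "('r::field, 'a, 'm) module_scheme \<Rightarrow> 'a \<Rightarrow> 'a \<Rightarrow> 'a" where
  "mdiff M x y \<equiv> x \<oplus>\<^bsub>M\<^esub> (- 1) \<odot>\<^bsub>M\<^esub> y"

lemma mdiff:
  assumes M: "field_module M" and xy: "x \<in> carrier M" "y \<in> carrier M"
  shows "mdiff M x y \<in> carrier M" "mdiff M x y \<oplus>\<^bsub>M\<^esub> y = x" "mdiff M x y = \<zero>\<^bsub>M\<^esub> \<longleftrightarrow> x = y"
proof -
  note m = field_moduleD[OF M]
  have z: "(- 1) \<odot>\<^bsub>M\<^esub> y \<oplus>\<^bsub>M\<^esub> y = \<zero>\<^bsub>M\<^esub>"
    using m(8)[OF xy(2), of "- 1" 1] m(11,12)[OF xy(2)] by simp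
  show "mdiff M x y \<in> carrier M" using m(1,3) xy by blast
  show *: "mdiff M x y \<oplus>\<^bsub>M\<^esub> y = x" using z m(5,6) m(3)[OF xy(2)] xy by simp
  show "mdiff M x y = \<zero>\<^bsub>M\<^esub> \<longleftrightarrow> x = y"
  proof
    assume "mdiff M x y = \<zero>\<^bsub>M\<^esub>"
    with * m(4)[OF xy(2)] show "x = y" by simp
  next
    assume "x = y"
    then show "mdiff M x y = \<zero>\<^bsub>M\<^esub>" using z m(7)[OF xy(2) m(3)[OF xy(2)]] by simp
  qed
qed

lemma linear_subset_iff_submodule:
  assumes M: "field_module (M :: ('r::field, 'a, 'm) module_scheme)"
  shows "linear_subset M N \<longleftrightarrow> submodule N (ring_of_type_algebra :: 'r ring) M"
proof
  interpret M: Module.module "ring_of_type_algebra :: 'r ring" M by fact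
  note m = field_moduleD[OF M]
  {
    assume N: "linear_subset M N"
    have "\<ominus>\<^bsub>M\<^esub> x = (- 1) \<odot>\<^bsub>M\<^esub> x" if "x \<in> carrier M" for x
    proof (rule M.minus_equality)
      show "(- 1) \<odot>\<^bsub>M\<^esub> x \<oplus>\<^bsub>M\<^esub> x = \<zero>\<^bsub>M\<^esub>"
        using m(8)[OF that, of "- 1" 1] m(11,12)[OF that] by simp
    qed (use that m(3) in auto)
    then show "submodule N (ring_of_type_algebra :: 'r ring) M"
      using N unfolding linear_subset_def by (intro M.submoduleI) (auto simp: subset_iff)
  next
    assume N: "submodule N (ring_of_type_algebra :: 'r ring) M"
    have "\<zero>\<^bsub>M\<^esub> \<in> N" using subgroup.one_closed[OF submodule.axioms(1)[OF N]] by simp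
    then show "linear_subset M N" using M.submoduleE(1,4,5)[OF N] by (simp add: linear_subset_def)
  }
qed

definition stable_subset ::
  "('g, 'k) monoid_scheme \<Rightarrow> ('r::field, 'a, 'm) module_scheme \<Rightarrow> ('g \<Rightarrow> 'a \<Rightarrow> 'a) \<Rightarrow> 'a set \<Rightarrow> bool" where
  "stable_subset G M \<sigma> N \<longleftrightarrow> linear_subset M N \<and> (\<forall>g\<in>carrier G. \<forall>x\<in>N. \<sigma> g x \<in> N)"

lemma stable_subsetI:
  assumes "N \<subseteq> carrier M" "\<zero>\<^bsub>M\<^esub> \<in> N" "\<And>x y. x \<in> N \<Longrightarrow> y \<in> N \<Longrightarrow> x \<oplus>\<^bsub>M\<^esub> y \<in> N"
    "\<And>r x. x \<in> N \<Longrightarrow> r \<odot>\<^bsub>M\<^esub> x \<in> N" "\<And>g x. g \<in> carrier G \<Longrightarrow> x \<in> N \<Longrightarrow> \<sigma> g x \<in> N"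
  shows "stable_subset G M \<sigma> N"
  using assms by (simp add: stable_subset_def linear_subset_def)

lemma stable_subsetD:
  assumes "stable_subset G M \<sigma> N"
  shows "N \<subseteq> carrier M" "\<zero>\<^bsub>M\<^esub> \<in> N" "x \<in> N \<Longrightarrow> y \<in> N \<Longrightarrow> x \<oplus>\<^bsub>M\<^esub> y \<in> N"
    "x \<in> N \<Longrightarrow> r \<odot>\<^bsub>M\<^esub> x \<in> N" "g \<in> carrier G \<Longrightarrow> x \<in> N \<Longrightarrow> \<sigma> g x \<in> N"
  using assms by (auto simp: stable_subset_def linear_subset_def)

lemma representationD:
  assumes "Defs.representation G M \<sigma>"
  shows "field_module M" "g \<in> carrier G \<Longrightarrow> x \<in> carrier M \<Longrightarrow> \<sigma> g x \<in> carrier M"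
    "g \<in> carrier G \<Longrightarrow> x \<in> carrier M \<Longrightarrow> y \<in> carrier M \<Longrightarrow> \<sigma> g (x \<oplus>\<^bsub>M\<^esub> y) = \<sigma> g x \<oplus>\<^bsub>M\<^esub> \<sigma> g y"
    "g \<in> carrier G \<Longrightarrow> x \<in> carrier M \<Longrightarrow> \<sigma> g (r \<odot>\<^bsub>M\<^esub> x) = r \<odot>\<^bsub>M\<^esub> \<sigma> g x"
    "x \<in> carrier M \<Longrightarrow> \<sigma> \<one>\<^bsub>G\<^esub> x = x"
    "g \<in> carrier G \<Longrightarrow> h \<in> carrier G \<Longrightarrow> x \<in> carrier M \<Longrightarrow> \<sigma> (g \<otimes>\<^bsub>G\<^esub> h) x = \<sigma> g (\<sigma> h x)"
  using assms by (auto simp: Defs.representation_def lin_maps_def Pi_iff)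

lemma lin_mapsD:
  assumes "f \<in> lin_maps M N"
  shows "x \<in> carrier M \<Longrightarrow> f x \<in> carrier N"
    "x \<in> carrier M \<Longrightarrow> y \<in> carrier M \<Longrightarrow> f (x \<oplus>\<^bsub>M\<^esub> y) = f x \<oplus>\<^bsub>N\<^esub> f y"
    "x \<in> carrier M \<Longrightarrow> f (r \<odot>\<^bsub>M\<^esub> x) = r \<odot>\<^bsub>N\<^esub> f x"
  using assms by (auto simp: lin_maps_def)

lemma lin_maps_zero:
  assumes "field_module M" "field_module N" "f \<in> lin_maps M N"
  shows "f \<zero>\<^bsub>M\<^esub> = \<zero>\<^bsub>N\<^esub>"
proof -
  have z: "\<zero>\<^bsub>M\<^esub> \<in> carrier M" by (rule field_moduleD(2)[OF assms(1)])
  have "f (0 \<odot>\<^bsub>M\<^esub> \<zero>\<^bsub>M\<^esub>) = 0 \<odot>\<^bsub>N\<^esub> f \<zero>\<^bsub>M\<^esub>" by (rule lin_mapsD(3)[OF assms(3) z])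
  then show ?thesis
    using field_moduleD(12)[OF assms(1) z] field_moduleD(12)[OF assms(2) lin_mapsD(1)[OF assms(3) z]] by simp
qed

lemma intertwinersD:
  assumes "f \<in> intertwiners G M \<sigma> N \<tau>"
  shows "f \<in> lin_maps M N" "x \<in> carrier M \<Longrightarrow> f x \<in> carrier N"
    "x \<in> carrier M \<Longrightarrow> y \<in> carrier M \<Longrightarrow> f (x \<oplus>\<^bsub>M\<^esub> y) = f x \<oplus>\<^bsub>N\<^esub> f y"
    "x \<in> carrier M \<Longrightarrow> f (r \<odot>\<^bsub>M\<^esub> x) = r \<odot>\<^bsub>N\<^esub> f x"
    "g \<in> carrier G \<Longrightarrow> x \<in> carrier M \<Longrightarrow> f (\<sigma> g x) = \<tau> g (f x)"
  using assms by (auto simp: intertwiners_def lin_maps_def)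

lemma intertwinersI:
  assumes "\<And>x. x \<in> carrier M \<Longrightarrow> f x \<in> carrier N"
    "\<And>x y. x \<in> carrier M \<Longrightarrow> y \<in> carrier M \<Longrightarrow> f (x \<oplus>\<^bsub>M\<^esub> y) = f x \<oplus>\<^bsub>N\<^esub> f y"
    "\<And>x r. x \<in> carrier M \<Longrightarrow> f (r \<odot>\<^bsub>M\<^esub> x) = r \<odot>\<^bsub>N\<^esub> f x"
    "\<And>g x. g \<in> carrier G \<Longrightarrow> x \<in> carrier M \<Longrightarrow> f (\<sigma> g x) = \<tau> g (f x)"
  shows "f \<in> intertwiners G M \<sigma> N \<tau>"
  using assms by (auto simp: intertwiners_def lin_maps_def)

lemma intertwiners_inverse:
  assumes f: "f \<in> intertwiners G M \<sigma> N \<tau>" "bij_betw f (carrier M) (carrier N)"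
    and rep: "Defs.representation G M \<sigma>"
  shows "the_inv_into (carrier M) f \<in> intertwiners G N \<tau> M \<sigma>"
    "bij_betw (the_inv_into (carrier M) f) (carrier N) (carrier M)"
    "x \<in> carrier M \<Longrightarrow> the_inv_into (carrier M) f (f x) = x"
    "y \<in> carrier N \<Longrightarrow> f (the_inv_into (carrier M) f y) = y"
proof -
  let ?h = "the_inv_into (carrier M) f"
  note r = representationD[OF rep] and m = field_moduleD[OF representationD(1)[OF rep]]
  have inj: "inj_on f (carrier M)" and img: "f ` carrier M = carrier N" using f(2) by (auto simp: bij_betw_def)
  show b: "bij_betw ?h (carrier N) (carrier M)" by (rule bij_betw_the_inv_into[OF f(2)])
  show hf: "x \<in> carrier M \<Longrightarrow> ?h (f x) = x" for x by (rule the_inv_into_f_f[OF inj])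
  show fh: "y \<in> carrier N \<Longrightarrow> f (?h y) = y" for y using f_the_inv_into_f[OF inj] img by blast
  have h: "y \<in> carrier N \<Longrightarrow> ?h y \<in> carrier M" for y using b by (auto simp: bij_betw_def)
  show "?h \<in> intertwiners G N \<tau> M \<sigma>"
  proof (rule intertwinersI)
    show "?h y \<in> carrier M" if "y \<in> carrier N" for y using h that .
    show "?h (x \<oplus>\<^bsub>N\<^esub> y) = ?h x \<oplus>\<^bsub>M\<^esub> ?h y" if "x \<in> carrier N" "y \<in> carrier N" for x y
      using intertwinersD(3)[OF f(1) h[OF that(1)] h[OF that(2)]] fh that hf[OF m(1)[OF h[OF that(1)] h[OF that(2)]]]
      by simp
    show "?h (r \<odot>\<^bsub>N\<^esub> x) = r \<odot>\<^bsub>M\<^esub> ?h x" if "x \<in> carrier N" for x r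
      using intertwinersD(4)[OF f(1) h[OF that], of r] fh that hf[OF m(3)[OF h[OF that]], of r] by simp
    show "?h (\<tau> g x) = \<sigma> g (?h x)" if "g \<in> carrier G" "x \<in> carrier N" for g x
      using intertwinersD(5)[OF f(1) that(1) h[OF that(2)]] fh that hf[OF r(2)[OF that(1) h[OF that(2)]]] by simp
  qed
qed

lemma intertwiners_comp:
  "f \<in> intertwiners G M \<sigma> N \<tau> \<Longrightarrow> f' \<in> intertwiners G N \<tau> L \<upsilon> \<Longrightarrow> (\<lambda>x. f' (f x)) \<in> intertwiners G M \<sigma> L \<upsilon>"
  by (rule intertwinersI) (simp_all add: intertwinersD)

definition cyclic ::
  "('g, 'k) monoid_scheme \<Rightarrow> ('r::field, 'a, 'm) module_scheme \<Rightarrow> ('g \<Rightarrow> 'a \<Rightarrow> 'a) \<Rightarrow> 'a \<Rightarrow> 'a set" where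
  "cyclic G M \<sigma> x = \<Inter> {N. stable_subset G M \<sigma> N \<and> x \<in> N}"

lemma cyclic_least: "stable_subset G M \<sigma> N \<Longrightarrow> x \<in> N \<Longrightarrow> cyclic G M \<sigma> x \<subseteq> N"
  by (auto simp: cyclic_def)

lemma cyclic_self: "x \<in> cyclic G M \<sigma> x"
  by (auto simp: cyclic_def)

lemma stable_subset_carrier:
  assumes "Defs.representation G M \<sigma>"
  shows "stable_subset G M \<sigma> (carrier M)"
  using field_moduleD(1-3)[OF representationD(1)[OF assms]] representationD(2)[OF assms]
  by (auto intro: stable_subsetI)

lemma stable_subset_cyclic:
  assumes "Defs.representation G M \<sigma>" "x \<in> carrier M"
  shows "stable_subset G M \<sigma> (cyclic G M \<sigma> x)"
proof (rule stable_subsetI)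
  show "cyclic G M \<sigma> x \<subseteq> carrier M" by (rule cyclic_least[OF stable_subset_carrier[OF assms(1)] assms(2)])
qed (auto simp: cyclic_def stable_subsetD)

lemma irreducible_stable_subset:
  assumes irr: "irreducible_rep G (space_of scV) \<pi>" and V: "vector_space scV"
    and N: "stable_subset G (space_of scV) \<pi> N" and x: "x \<in> N" "x \<noteq> 0"
  shows "N = UNIV"
proof -
  have "submodule N ring_of_type_algebra (space_of scV)"
    using N linear_subset_iff_submodule[OF module_space_of[OF V]] by (simp add: stable_subset_def)
  moreover have "\<forall>g\<in>carrier G. \<pi> g ` N \<subseteq> N" using N by (auto simp: stable_subset_def)
  ultimately have "N = {\<zero>\<^bsub>space_of scV\<^esub>} \<or> N = carrier (space_of scV)"
    using irr unfolding irreducible_rep_def by blast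
  then show ?thesis using x by auto
qed

text \<open>Two homomorphisms that agree at one vector agree on the stable subspace that it
  generates. For an irreducible source and a non-zero vector, this is everything.\<close>

lemma stable_subset_equalizer:
  assumes M: "Defs.representation G M \<sigma>" and N: "Defs.representation G N \<tau>"
    and f: "f \<in> intertwiners G M \<sigma> N \<tau>" and f': "f' \<in> intertwiners G M \<sigma> N \<tau>"
  shows "stable_subset G M \<sigma> {x \<in> carrier M. f x = f' x}"
proof -
  note m = field_moduleD[OF representationD(1)[OF M]] and i = intertwinersD[OF f] and i' = intertwinersD[OF f']
  have "f \<zero>\<^bsub>M\<^esub> = f' \<zero>\<^bsub>M\<^esub>"
    using lin_maps_zero[OF representationD(1)[OF M] representationD(1)[OF N]] i(1) i'(1) by metis
  then show ?thesis
    using m(1,2,3) representationD(2)[OF M] i(3,4,5) i'(3,4,5) by (intro stable_subsetI) auto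
qed

lemma zero_intertwiner:
  assumes "Defs.representation G N \<tau>"
  shows "(\<lambda>_. \<zero>\<^bsub>N\<^esub>) \<in> intertwiners G M \<sigma> N \<tau>"
proof -
  note m = field_moduleD[OF representationD(1)[OF assms]]
  have "\<tau> g \<zero>\<^bsub>N\<^esub> = \<zero>\<^bsub>N\<^esub>" if "g \<in> carrier G" for g
    using representationD(4)[OF assms that m(2), of 0] m(12)[OF m(2)]
      m(12)[OF representationD(2)[OF assms that m(2)]] by simp
  then show ?thesis using m(2,5,13) by (intro intertwinersI) auto
qed

lemma stable_subset_kernel:
  assumes "Defs.representation G M \<sigma>" "Defs.representation G N \<tau>" "f \<in> intertwiners G M \<sigma> N \<tau>"
  shows "stable_subset G M \<sigma> {x \<in> carrier M. f x = \<zero>\<^bsub>N\<^esub>}"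
  using stable_subset_equalizer[OF assms zero_intertwiner[OF assms(2)]] .

text \<open>
  If finitely many homomorphisms to the irreducible \<open>V\<close> separate the points of the module generated
  by \<open>x\<close>, then it is a sum of copies of \<open>V\<close>: one splits off a copy whenever the last homomorphism
  is needed.
\<close>

lemma separated_cyclic_isotypic:
  assumes M: "Defs.representation G M \<sigma>" and V: "vector_space scV"
    and \<pi>: "Defs.representation G (space_of scV) \<pi>" and irr: "irreducible_rep G (space_of scV) \<pi>"
    and "finite F" and "F \<subseteq> intertwiners G M \<sigma> (space_of scV) \<pi>" and "x \<in> carrier M"
    and "\<And>y. y \<in> cyclic G M \<sigma> x \<Longrightarrow> (\<And>f. f \<in> F \<Longrightarrow> f y = 0) \<Longrightarrow> y = \<zero>\<^bsub>M\<^esub>"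
    and P: "linear_subset M P"
    and "\<And>\<phi> v. \<phi> \<in> intertwiners G (space_of scV) \<pi> M \<sigma> \<Longrightarrow> range \<phi> \<subseteq> cyclic G M \<sigma> x \<Longrightarrow> \<phi> v \<in> P"
  shows "x \<in> P"
  using assms(5-8,10)
proof (induction F arbitrary: x rule: finite_induct)
  case empty
  have "x = \<zero>\<^bsub>M\<^esub>" by (rule empty.prems(3)[OF cyclic_self]) simp
  then show ?case using P by (simp add: linear_subset_def)
next
  case (insert f F)
  note M' = representationD(1)[OF M] and V' = representationD(1)[OF \<pi>]
  note m = field_moduleD[OF M'] and r = representationD[OF M]
  let ?C = "cyclic G M \<sigma> x"
  have f: "f \<in> intertwiners G M \<sigma> (space_of scV) \<pi>" and F: "F \<subseteq> intertwiners G M \<sigma> (space_of scV) \<pi>"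
    using insert.prems by auto
  note i = intertwinersD[OF f]
  have C: "stable_subset G M \<sigma> ?C" by (rule stable_subset_cyclic[OF M insert.prems(2)])
  define N where "N = {y \<in> ?C. \<forall>h\<in>F. h y = 0}"
  have N: "stable_subset G M \<sigma> N"
  proof -
    have "stable_subset G M \<sigma> {y \<in> carrier M. h y = 0}" if "h \<in> F" for h
      using stable_subset_kernel[OF M \<pi>, of h] that F by auto
    note k = stable_subsetD[OF this]
    show ?thesis
    proof (rule stable_subsetI)
      show "N \<subseteq> carrier M" using stable_subsetD(1)[OF C] by (auto simp: N_def)
      show "\<zero>\<^bsub>M\<^esub> \<in> N" using stable_subsetD(2)[OF C] k(2) by (auto simp: N_def)
    next
      fix y z assume "y \<in> N" "z \<in> N"
      then show "y \<oplus>\<^bsub>M\<^esub> z \<in> N"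
        using stable_subsetD(1,3)[OF C] k(3)[of _ y z] by (auto simp: N_def subset_iff)
    next
      fix s y assume "y \<in> N"
      then show "s \<odot>\<^bsub>M\<^esub> y \<in> N"
        using stable_subsetD(1,4)[OF C] k(4)[of _ y s] by (auto simp: N_def subset_iff)
    next
      fix g y assume "g \<in> carrier G" "y \<in> N"
      then show "\<sigma> g y \<in> N"
        using stable_subsetD(1,5)[OF C] k(5)[of _ g y] by (auto simp: N_def subset_iff)
    qed
  qed
  note Ns = stable_subsetD[OF N]
  have fN: "y = \<zero>\<^bsub>M\<^esub>" if "y \<in> N" "f y = 0" for y
    using that insert.prems(3)[of y] by (auto simp: N_def)
  show ?case
  proof (cases "N = {\<zero>\<^bsub>M\<^esub>}")
    case True
    show ?thesis
    proof (rule insert.IH[OF F insert.prems(2)])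
      fix y assume "y \<in> ?C" "\<And>h. h \<in> F \<Longrightarrow> h y = 0"
      then have "y \<in> N" by (simp add: N_def)
      then show "y = \<zero>\<^bsub>M\<^esub>" using True by blast
    next
      show "\<psi> v \<in> P" if "\<psi> \<in> intertwiners G (space_of scV) \<pi> M \<sigma>" "range \<psi> \<subseteq> ?C" for \<psi> v
        by (rule insert.prems(4)[OF that])
    qed
  next
    case False
    then obtain z where z: "z \<in> N" "z \<noteq> \<zero>\<^bsub>M\<^esub>" using Ns(2) by blast
    have inj: "inj_on f N"
    proof (rule inj_onI)
      fix y y' assume y: "y \<in> N" "y' \<in> N" "f y = f y'"
      interpret V: vector_space scV by fact
      have c: "y \<in> carrier M" "y' \<in> carrier M" using y Ns(1) by auto
      have "mdiff M y y' \<in> N" using y Ns(3,4) by blast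
      moreover have "f (mdiff M y y') = 0"
        using i(3)[OF c(1) m(3)[OF c(2)], of "- 1"] i(4)[OF c(2), of "- 1"] y(3) by simp
      ultimately show "y = y'" using fN mdiff(3)[OF M' c] by blast
    qed
    have cN: "y \<in> carrier M" if "y \<in> N" for y using that Ns(1) by blast
    have "stable_subset G (space_of scV) \<pi> (f ` N)"
    proof (rule stable_subsetI)
      show "\<zero>\<^bsub>space_of scV\<^esub> \<in> f ` N" using lin_maps_zero[OF M' V' i(1)] Ns(2) by (metis image_eqI)
    next
      fix a b assume "a \<in> f ` N" "b \<in> f ` N"
      then obtain y y' where "a = f y" "b = f y'" "y \<in> N" "y' \<in> N" by blast
      then show "a \<oplus>\<^bsub>space_of scV\<^esub> b \<in> f ` N"
        using i(3)[OF cN cN, of y y'] Ns(3) by (intro image_eqI[of _ _ "y \<oplus>\<^bsub>M\<^esub> y'"]) auto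
    next
      fix s a assume "a \<in> f ` N"
      then obtain y where "a = f y" "y \<in> N" by blast
      then show "s \<odot>\<^bsub>space_of scV\<^esub> a \<in> f ` N"
        using i(4)[OF cN, of y s] Ns(4) by (intro image_eqI[of _ _ "s \<odot>\<^bsub>M\<^esub> y"]) auto
    next
      fix g a assume "g \<in> carrier G" "a \<in> f ` N"
      then obtain y where "a = f y" "y \<in> N" by blast
      then show "\<pi> g a \<in> f ` N"
        using i(5)[OF \<open>g \<in> carrier G\<close> cN, of y] Ns(5) \<open>g \<in> carrier G\<close> by (intro image_eqI[of _ _ "\<sigma> g y"]) auto
    qed simp
    then have surj: "f ` N = UNIV"
      using irreducible_stable_subset[OF irr V, of "f ` N" "f z"] fN[OF z(1)] z by blast
    define \<phi> where "\<phi> = the_inv_into N f"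
    have \<phi>N: "\<phi> v \<in> N" and f\<phi>: "f (\<phi> v) = v" for v
      using the_inv_into_into[OF inj, of v N] f_the_inv_into_f[OF inj, of v] surj by (auto simp: \<phi>_def)
    have \<phi>eq: "\<phi> v = y" if "y \<in> N" "f y = v" for v y
      using inj \<phi>N f\<phi> that by (auto dest: inj_onD)
    have \<phi>: "\<phi> \<in> intertwiners G (space_of scV) \<pi> M \<sigma>"
    proof (rule intertwinersI)
      show "\<phi> v \<in> carrier M" for v using \<phi>N cN by blast
      show "\<phi> (v \<oplus>\<^bsub>space_of scV\<^esub> w) = \<phi> v \<oplus>\<^bsub>M\<^esub> \<phi> w" for v w
        using i(3)[OF cN[OF \<phi>N] cN[OF \<phi>N], of v w] f\<phi> by (intro \<phi>eq Ns(3) \<phi>N) simp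
      show "\<phi> (s \<odot>\<^bsub>space_of scV\<^esub> v) = s \<odot>\<^bsub>M\<^esub> \<phi> v" for s v
        using i(4)[OF cN[OF \<phi>N], of s v] f\<phi> by (intro \<phi>eq Ns(4) \<phi>N) simp
      show "\<phi> (\<pi> g v) = \<sigma> g (\<phi> v)" if "g \<in> carrier G" for g v
        using i(5)[OF that cN[OF \<phi>N], of v] f\<phi> by (intro \<phi>eq Ns(5) \<phi>N that) simp
    qed
    have \<phi>C: "range \<phi> \<subseteq> ?C" using \<phi>N by (auto simp: N_def)
    \<comment> \<open>The inverse \<open>\<phi>\<close> of \<open>f\<close> on \<open>N\<close>
      splits off the part of \<open>x\<close> seen by \<open>f\<close>. The difference
      \<open>x'\<close> lies in the kernel of \<open>f\<close>, so the other homomorphisms separate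
      the module it generates.\<close>
    let ?y = "\<phi> (f x)"
    have cy: "?y \<in> carrier M" using \<phi>N cN by blast
    define x' where "x' = mdiff M x ?y"
    have x': "x' \<in> carrier M" "x' \<oplus>\<^bsub>M\<^esub> ?y = x" using mdiff[OF M' insert.prems(2) cy] by (auto simp: x'_def)
    have "?y \<in> ?C" using \<phi>C by blast
    then have "x' \<in> ?C" unfolding x'_def by (intro stable_subsetD(3,4)[OF C] cyclic_self)
    then have sub: "cyclic G M \<sigma> x' \<subseteq> ?C" by (rule cyclic_least[OF C])
    interpret V: vector_space scV by fact
    have "f x' = 0"
      unfolding x'_def
      using i(3)[OF insert.prems(2) m(3)[OF cy], of "- 1"] i(4)[OF cy, of "- 1"] f\<phi>[of "f x"] by simp
    then have ker: "cyclic G M \<sigma> x' \<subseteq> {y \<in> carrier M. f y = 0}"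
      using stable_subset_kernel[OF M \<pi> f] x'(1) by (intro cyclic_least) auto
    have "x' \<in> P"
    proof (rule insert.IH[OF F x'(1)])
      fix y assume "y \<in> cyclic G M \<sigma> x'" "\<And>h. h \<in> F \<Longrightarrow> h y = 0"
      then show "y = \<zero>\<^bsub>M\<^esub>" using sub ker insert.prems(3)[of y] by blast
    next
      show "\<psi> v \<in> P" if "\<psi> \<in> intertwiners G (space_of scV) \<pi> M \<sigma>" "range \<psi> \<subseteq> cyclic G M \<sigma> x'" for \<psi> v
        using insert.prems(4) that sub by blast
    qed
    moreover have "?y \<in> P" using insert.prems(4)[OF \<phi> \<phi>C] .
    ultimately show ?thesis using P x'(2) unfolding linear_subset_def by metis
  qed
qed

section \<open>Quotients, free spaces and the tensor product over the division ring D\<close>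

subsection \<open>Quotients\<close>

text \<open>Serves for the isotypic quotient of S, where the carrier is the whole type, and for the
  tensor product, where it is the free space on a subset of the type.\<close>

locale subquotient = vector_space sc
  for sc :: "'r::field \<Rightarrow> 'a::ab_group_add \<Rightarrow> 'a" +
  fixes M :: "('r, 'a) module" and N :: "'a set"
  assumes add_M: "x \<oplus>\<^bsub>M\<^esub> y = x + y" and smult_M: "r \<odot>\<^bsub>M\<^esub> x = sc r x"
    and carrier_subspace: "subspace (carrier M)" and N_subspace: "subspace N" and N_sub: "N \<subseteq> carrier M"
begin

lemma N_subgroup: "add_subgroup N"
  using N_subspace subspace_0 subspace_diff by (auto simp: add_subgroup_def)

lemma coset_eq: "coset N x = coset N y \<longleftrightarrow> x - y \<in> N"
  by (rule coset_eq_iff[OF N_subgroup])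

lemma a_r_coset_eq: "N +>\<^bsub>M\<^esub> x = coset N x"
proof -
  have "y \<in> (\<Union>h\<in>N. {h + x})" if "y - x \<in> N" for y using that by (intro UN_I[of "y - x"]) auto
  then show ?thesis by (auto simp: a_r_coset_def' add_M coset_def)
qed

lemma quot_carrier: "carrier (quot_space M N) = coset N ` carrier M"
  by (auto simp: quot_space_def A_RCOSETS_def' a_r_coset_eq)

lemma set_add_N:
  assumes "x \<in> D" "\<And>y. y \<in> D \<Longrightarrow> y - x \<in> N"
  shows "set_add M N D = coset N x"
proof
  show "set_add M N D \<subseteq> coset N x"
  proof
    fix z assume "z \<in> set_add M N D"
    then obtain n y where "n \<in> N" "y \<in> D" "z = n + y" by (auto simp: set_add_def' add_M)
    then show "z \<in> coset N x" using subspace_add[OF N_subspace, of n "y - x"] assms(2)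
      by (simp add: coset_def algebra_simps)
  qed
  show "coset N x \<subseteq> set_add M N D"
  proof
    fix z assume "z \<in> coset N x"
    then show "z \<in> set_add M N D"
      unfolding set_add_def' add_M using assms(1) by (intro UN_I[of "z - x"] UN_I[of x]) (auto simp: coset_def)
  qed
qed

lemma quot_add: "coset N x \<oplus>\<^bsub>quot_space M N\<^esub> coset N y = coset N (x + y)"
proof -
  have "set_add M (coset N x) (coset N y) = coset N (x + y)"
  proof
    show "set_add M (coset N x) (coset N y) \<subseteq> coset N (x + y)"
      using subspace_add[OF N_subspace, of "_ - x" "_ - y"]
      by (auto simp: set_add_def' add_M coset_def algebra_simps)
    show "coset N (x + y) \<subseteq> set_add M (coset N x) (coset N y)"
    proof
      fix z assume "z \<in> coset N (x + y)"
      then show "z \<in> set_add M (coset N x) (coset N y)"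
        unfolding set_add_def' add_M using subspace_0[OF N_subspace]
        by (intro UN_I[of "z - y"] UN_I[of y]) (auto simp: coset_def algebra_simps)
    qed
  qed
  then show ?thesis by (simp add: quot_space_def)
qed

lemma quot_smult: "r \<odot>\<^bsub>quot_space M N\<^esub> coset N x = coset N (sc r x)"
proof -
  have "set_add M N (sc r ` coset N x) = coset N (sc r x)"
    using subspace_0[OF N_subspace] subspace_scale[OF N_subspace, of _ r]
    by (intro set_add_N) (auto simp: coset_def scale_right_diff_distrib[symmetric])
  then show ?thesis by (simp add: quot_space_def smult_M[abs_def])
qed

lemma quot_zero: "\<zero>\<^bsub>quot_space M N\<^esub> = coset N 0"
  by (auto simp: quot_space_def coset_def)

lemma quot_module: "field_module (quot_space M N)"
proof (rule moduleI)
  let ?Q = "quot_space M N"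
  show "cring (ring_of_type_algebra :: 'r ring)" by (rule cring_from_type_algebra)
  show "abelian_group ?Q"
  proof (rule abelian_groupI)
    fix C assume "C \<in> carrier ?Q"
    then obtain x where x: "C = coset N x" "x \<in> carrier M" by (auto simp: quot_carrier)
    then show "\<exists>y\<in>carrier ?Q. y \<oplus>\<^bsub>?Q\<^esub> C = \<zero>\<^bsub>?Q\<^esub>"
      using subspace_neg[OF carrier_subspace x(2)]
      by (intro bexI[of _ "coset N (- x)"]) (auto simp: quot_carrier quot_add quot_zero)
  qed (use subspace_0[OF carrier_subspace] subspace_add[OF carrier_subspace] in
      \<open>auto simp: quot_carrier quot_add quot_zero add_ac\<close>)
qed (use subspace_scale[OF carrier_subspace] in
    \<open>auto simp: quot_carrier quot_add quot_smult scale_left_distrib scale_right_distrib\<close>)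

lemma quot_zero_iff: "coset N x = \<zero>\<^bsub>quot_space M N\<^esub> \<longleftrightarrow> x \<in> N"
  by (simp add: quot_zero coset_eq)

end

subsection \<open>Free vector spaces\<close>

lemma lookup_free_scale [simp]: "Poly_Mapping.lookup (free_scale r u) k = r * Poly_Mapping.lookup u k"
  by (simp add: free_scale_def Poly_Mapping.map.rep_eq when_def)

lemma vector_space_free_scale: "vector_space (free_scale :: 'r::field \<Rightarrow> ('a \<Rightarrow>\<^sub>0 'r) \<Rightarrow> _)"
  by unfold_locales (auto intro!: poly_mapping_eqI simp: lookup_add algebra_simps)

interpretation free: vector_space "free_scale :: 'r::field \<Rightarrow> ('a \<Rightarrow>\<^sub>0 'r) \<Rightarrow> _"
  by (rule vector_space_free_scale)

lemma free_scale_single: "free_scale r (Poly_Mapping.single k a) = Poly_Mapping.single k (r * a)"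
  by (rule poly_mapping_eqI) (simp add: lookup_single when_def)

lemma keys_free_scale: "Poly_Mapping.keys (free_scale r u) \<subseteq> Poly_Mapping.keys u"
  by (auto simp: in_keys_iff)

definition free_lift :: "('r::field \<Rightarrow> 'b::ab_group_add \<Rightarrow> 'b) \<Rightarrow> ('a \<Rightarrow> 'b) \<Rightarrow> ('a \<Rightarrow>\<^sub>0 'r) \<Rightarrow> 'b" where
  "free_lift sc f u = (\<Sum>k\<in>Poly_Mapping.keys u. sc (Poly_Mapping.lookup u k) (f k))"

context vector_space begin

lemma free_lift_superset:
  assumes "finite K" "Poly_Mapping.keys u \<subseteq> K"
  shows "free_lift scale f u = (\<Sum>k\<in>K. scale (Poly_Mapping.lookup u k) (f k))"
  unfolding free_lift_def using assms by (intro sum.mono_neutral_left) (auto simp: in_keys_iff)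

lemma free_lift_add: "free_lift scale f (u + u') = free_lift scale f u + free_lift scale f u'"
proof -
  let ?K = "Poly_Mapping.keys u \<union> Poly_Mapping.keys u'"
  have "free_lift scale f (u + u') = (\<Sum>k\<in>?K. scale (Poly_Mapping.lookup (u + u') k) (f k))"
    using Poly_Mapping.keys_add[of u u'] by (intro free_lift_superset) auto
  then show ?thesis
    using free_lift_superset[of ?K u f] free_lift_superset[of ?K u' f]
    by (simp add: lookup_add scale_left_distrib sum.distrib)
qed

lemma free_lift_scale: "free_lift scale f (free_scale r u) = scale r (free_lift scale f u)"
proof -
  have "free_lift scale f (free_scale r u) = (\<Sum>k\<in>Poly_Mapping.keys u. scale (Poly_Mapping.lookup (free_scale r u) k) (f k))"
    by (rule free_lift_superset) (simp_all add: keys_free_scale)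
  then show ?thesis by (simp add: free_lift_def scale_sum_right)
qed

lemma free_lift_0 [simp]: "free_lift scale f 0 = 0"
  by (simp add: free_lift_def)

lemma free_lift_diff: "free_lift scale f (u - u') = free_lift scale f u - free_lift scale f u'"
  using free_lift_add[of f "u - u'" u'] by (simp add: algebra_simps)

lemma free_lift_sum: "free_lift scale f (\<Sum>i\<in>A. u i) = (\<Sum>i\<in>A. free_lift scale f (u i))"
  by (induction A rule: infinite_finite_induct) (auto simp: free_lift_add)

lemma free_lift_single [simp]: "free_lift scale f (Poly_Mapping.single k a) = scale a (f k)"
  by (cases "a = 0") (simp_all add: free_lift_def)

end

subsection \<open>Tensor products over the endomorphism ring\<close>

locale theta_bimodule =
  fixes G\<^sub>1 :: "('g, 'k) monoid_scheme" and G\<^sub>2 :: "('h, 'l) monoid_scheme"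
    and scV :: "'r::field \<Rightarrow> 'v::ab_group_add \<Rightarrow> 'v" and \<pi> :: "'g \<Rightarrow> 'v \<Rightarrow> 'v"
    and \<Theta> :: "('r, 't) module" and \<theta> :: "'h \<Rightarrow> 't \<Rightarrow> 't" and act :: "'t \<Rightarrow> ('v \<Rightarrow> 'v) \<Rightarrow> 't"
  assumes G\<^sub>1: "Group.group G\<^sub>1" and G\<^sub>2: "Group.group G\<^sub>2" and V: "vector_space scV"
    and \<pi>: "Defs.representation G\<^sub>1 (space_of scV) \<pi>" and irr: "irreducible_rep G\<^sub>1 (space_of scV) \<pi>"
    and \<theta>: "Defs.representation G\<^sub>2 \<Theta> \<theta>"
    and act_intertwiner: "d \<in> carrier (End_ring G\<^sub>1 scV \<pi>) \<Longrightarrow> (\<lambda>x. act x d) \<in> intertwiners G\<^sub>2 \<Theta> \<theta> \<Theta> \<theta>"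
    and act_one: "x \<in> carrier \<Theta> \<Longrightarrow> act x id = x"
    and act_mult: "x \<in> carrier \<Theta> \<Longrightarrow> d \<in> carrier (End_ring G\<^sub>1 scV \<pi>) \<Longrightarrow>
      d' \<in> carrier (End_ring G\<^sub>1 scV \<pi>) \<Longrightarrow> act x (d \<circ> d') = act (act x d) d'"
    and act_add: "x \<in> carrier \<Theta> \<Longrightarrow> d \<in> carrier (End_ring G\<^sub>1 scV \<pi>) \<Longrightarrow>
      d' \<in> carrier (End_ring G\<^sub>1 scV \<pi>) \<Longrightarrow> act x (\<lambda>v. d v + d' v) = act x d \<oplus>\<^bsub>\<Theta>\<^esub> act x d'"
    and act_scalar: "x \<in> carrier \<Theta> \<Longrightarrow> act x (scV r) = r \<odot>\<^bsub>\<Theta>\<^esub> x"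
begin

sublocale V: vector_space scV by (rule V)

abbreviation D :: "('v \<Rightarrow> 'v) set" where "D \<equiv> intertwiners G\<^sub>1 (space_of scV) \<pi> (space_of scV) \<pi>"

lemma D_carrier: "carrier (End_ring G\<^sub>1 scV \<pi>) = D"
  by (simp add: End_ring_def)

lemmas act_int = act_intertwiner[unfolded D_carrier]
lemmas act_rules = act_one act_mult[unfolded D_carrier] act_add[unfolded D_carrier] act_scalar

lemma \<Theta>_module: "field_module \<Theta>"
  by (rule representationD(1)[OF \<theta>])

lemmas \<Theta>_rules = field_moduleD[OF \<Theta>_module]

lemma act_closed: "x \<in> carrier \<Theta> \<Longrightarrow> d \<in> D \<Longrightarrow> act x d \<in> carrier \<Theta>"
  using intertwinersD(2)[OF act_int] .

lemma \<pi>_rules: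
  "g \<in> carrier G\<^sub>1 \<Longrightarrow> \<pi> g (v + w) = \<pi> g v + \<pi> g w" "g \<in> carrier G\<^sub>1 \<Longrightarrow> \<pi> g (scV r v) = scV r (\<pi> g v)"
  "\<pi> \<one>\<^bsub>G\<^sub>1\<^esub> v = v" "g \<in> carrier G\<^sub>1 \<Longrightarrow> h \<in> carrier G\<^sub>1 \<Longrightarrow> \<pi> (g \<otimes>\<^bsub>G\<^sub>1\<^esub> h) v = \<pi> g (\<pi> h v)"
  using representationD[OF \<pi>] by simp_all

lemma D_rules:
  assumes "d \<in> D"
  shows "d (v + w) = d v + d w" "d (scV r v) = scV r (d v)" "g \<in> carrier G\<^sub>1 \<Longrightarrow> d (\<pi> g v) = \<pi> g (d v)"
  using intertwinersD(3-5)[OF assms] by simp_all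

lemma D_zero: "d \<in> D \<Longrightarrow> d 0 = 0"
  using D_rules(2)[of d 0 0] by simp

lemma D_id: "id \<in> D" and D_scalar: "scV r \<in> D" and D_comp: "d \<in> D \<Longrightarrow> d' \<in> D \<Longrightarrow> d \<circ> d' \<in> D"
  and D_add: "d \<in> D \<Longrightarrow> d' \<in> D \<Longrightarrow> (\<lambda>v. d v + d' v) \<in> D"
  by (rule intertwinersI;
      simp add: D_rules \<pi>_rules V.scale_right_distrib mult.commute add_ac)+

text \<open>Kernel and range are stable, so irreducibility makes every endomorphism with a non-zero
  value bijective.\<close>

lemma division:
  assumes d: "d \<in> D" "d v0 \<noteq> 0"
  obtains d' where "d' \<in> D" "\<And>v. d (d' v) = v" "\<And>v. d' (d v) = v"
proof -
  have ker: "stable_subset G\<^sub>1 (space_of scV) \<pi> {v. d v = 0}"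
    using stable_subset_kernel[OF \<pi> \<pi> d(1)] by simp
  have k0: "v = 0" if "d v = 0" for v
    using irreducible_stable_subset[OF irr V ker, of v] that d(2) by blast
  have inj: "inj d"
  proof (rule injI)
    fix v w assume "d v = d w"
    moreover have "d (v + scV (- 1) w) = d v + scV (- 1) (d w)" by (simp only: D_rules(1,2)[OF d(1)])
    ultimately have "d (v + scV (- 1) w) = 0" by simp
    then show "v = w" using k0 by fastforce
  qed
  have "stable_subset G\<^sub>1 (space_of scV) \<pi> (range d)"
  proof (rule stable_subsetI)
    show "\<zero>\<^bsub>space_of scV\<^esub> \<in> range d" using D_zero[OF d(1)] by (metis rangeI space_of_simps(4))
    show "x \<oplus>\<^bsub>space_of scV\<^esub> y \<in> range d" if "x \<in> range d" "y \<in> range d" for x y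
      using that by (auto simp: D_rules(1)[OF d(1), symmetric])
    show "r \<odot>\<^bsub>space_of scV\<^esub> x \<in> range d" if "x \<in> range d" for r x
      using that by (auto simp: D_rules(2)[OF d(1), symmetric])
    show "\<pi> g x \<in> range d" if "g \<in> carrier G\<^sub>1" "x \<in> range d" for g x
      using that by (auto simp: D_rules(3)[OF d(1), symmetric])
  qed simp
  then have "range d = UNIV" using irreducible_stable_subset[OF irr V, of "range d" "d v0"] d(2) by blast
  then have b: "bij_betw d (carrier (space_of scV)) (carrier (space_of scV))"
    using inj by (simp add: bij_betw_def)
  show thesis
    using that intertwiners_inverse[OF d(1) b \<pi>] by auto
qed

lemma act_zero: "x \<in> carrier \<Theta> \<Longrightarrow> act x (\<lambda>_. 0) = \<zero>\<^bsub>\<Theta>\<^esub>"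
proof -
  assume x: "x \<in> carrier \<Theta>"
  have "scV 0 = (\<lambda>_. 0)" by auto
  then show ?thesis using act_scalar[OF x, of 0] \<Theta>_rules(12)[OF x] by simp
qed

definition D_submodule :: "'t set \<Rightarrow> bool" where
  "D_submodule Z \<longleftrightarrow> Z \<subseteq> carrier \<Theta> \<and> \<zero>\<^bsub>\<Theta>\<^esub> \<in> Z \<and> (\<forall>x\<in>Z. \<forall>y\<in>Z. x \<oplus>\<^bsub>\<Theta>\<^esub> y \<in> Z) \<and>
     (\<forall>x\<in>Z. \<forall>d\<in>D. act x d \<in> Z)"

lemma D_submoduleD:
  assumes "D_submodule Z"
  shows "x \<in> Z \<Longrightarrow> x \<in> carrier \<Theta>" "\<zero>\<^bsub>\<Theta>\<^esub> \<in> Z" "x \<in> Z \<Longrightarrow> y \<in> Z \<Longrightarrow> x \<oplus>\<^bsub>\<Theta>\<^esub> y \<in> Z"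
    "x \<in> Z \<Longrightarrow> d \<in> D \<Longrightarrow> act x d \<in> Z" "x \<in> Z \<Longrightarrow> r \<odot>\<^bsub>\<Theta>\<^esub> x \<in> Z"
proof -
  show *: "x \<in> Z \<Longrightarrow> x \<in> carrier \<Theta>" "\<zero>\<^bsub>\<Theta>\<^esub> \<in> Z" "x \<in> Z \<Longrightarrow> y \<in> Z \<Longrightarrow> x \<oplus>\<^bsub>\<Theta>\<^esub> y \<in> Z"
    "x \<in> Z \<Longrightarrow> d \<in> D \<Longrightarrow> act x d \<in> Z" for x y d
    using assms by (auto simp: D_submodule_def)
  show "x \<in> Z \<Longrightarrow> r \<odot>\<^bsub>\<Theta>\<^esub> x \<in> Z" using *(1,4)[of x] act_scalar[of x r] D_scalar[of r] by metis
qed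

text \<open>A D-linear form from \<open>\<Theta>\<close> to D. Its values are operators on V, hence
  the second argument: composing with \<open>d\<close> on the right is evaluating at
  \<open>d v\<close>.\<close>

definition functional :: "('t \<Rightarrow> 'v \<Rightarrow> 'v) \<Rightarrow> bool" where
  "functional l \<longleftrightarrow> (\<forall>x\<in>carrier \<Theta>. l x \<in> D) \<and>
     (\<forall>x\<in>carrier \<Theta>. \<forall>y\<in>carrier \<Theta>. \<forall>v. l (x \<oplus>\<^bsub>\<Theta>\<^esub> y) v = l x v + l y v) \<and>
     (\<forall>x\<in>carrier \<Theta>. \<forall>d\<in>D. \<forall>v. l (act x d) v = l x (d v))"

text \<open>Over the division ring \<open>D\<close>, a submodule maximal among those avoiding \<open>x\<close> is a hyperplane.\<close>

lemma functional_exists: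
  assumes Z0: "D_submodule Z0" and x: "x \<in> carrier \<Theta>" "x \<notin> Z0"
  obtains l where "functional l" "\<And>z v. z \<in> Z0 \<Longrightarrow> l z v = 0" "\<And>v. l x v = v"
proof -
  let ?S = "{Z. D_submodule Z \<and> Z0 \<subseteq> Z \<and> x \<notin> Z}"
  have "\<exists>Z\<in>?S. \<forall>Z'\<in>?S. Z \<subseteq> Z' \<longrightarrow> Z' = Z"
  proof (rule subset_Zorn_nonempty)
    show "?S \<noteq> {}" using Z0 x by blast
    fix \<C> assume C: "\<C> \<noteq> {}" "subset.chain ?S \<C>"
    then have sub: "\<C> \<subseteq> ?S" and lin: "\<And>A B. A \<in> \<C> \<Longrightarrow> B \<in> \<C> \<Longrightarrow> A \<subseteq> B \<or> B \<subseteq> A"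
      by (auto simp: subset.chain_def)
    have "D_submodule (\<Union>\<C>)"
      unfolding D_submodule_def
    proof (intro conjI ballI)
      show "\<Union>\<C> \<subseteq> carrier \<Theta>" using sub D_submoduleD(1) by blast
      show "\<zero>\<^bsub>\<Theta>\<^esub> \<in> \<Union>\<C>" using C(1) sub D_submoduleD(2) by blast
      show "a \<oplus>\<^bsub>\<Theta>\<^esub> c \<in> \<Union>\<C>" if ac: "a \<in> \<Union>\<C>" "c \<in> \<Union>\<C>" for a c
      proof -
        obtain A A' where "A \<in> \<C>" "a \<in> A" "A' \<in> \<C>" "c \<in> A'" using ac by blast
        then obtain A'' where A'': "A'' \<in> \<C>" "a \<in> A''" "c \<in> A''" using lin[of A A'] by blast
        then have "D_submodule A''" using sub by blast
        from D_submoduleD(3)[OF this A''(2,3)] A''(1) show ?thesis by blast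
      qed
      show "act a d \<in> \<Union>\<C>" if a: "a \<in> \<Union>\<C>" "d \<in> D" for a d
      proof -
        obtain A where A: "A \<in> \<C>" "a \<in> A" using a by blast
        then have "D_submodule A" using sub by blast
        from D_submoduleD(4)[OF this A(2) a(2)] A(1) show ?thesis by blast
      qed
    qed
    moreover have "Z0 \<subseteq> \<Union>\<C>" using C(1) sub by blast
    ultimately show "\<Union>\<C> \<in> ?S" using sub by blast
  qed
  then obtain Z where ZS: "Z \<in> ?S" "\<forall>Z'\<in>?S. Z \<subseteq> Z' \<longrightarrow> Z' = Z" by (elim bexE)
  then have Z: "D_submodule Z" "Z0 \<subseteq> Z" "x \<notin> Z" by auto
  have max: "Z' = Z" if "D_submodule Z'" "Z \<subseteq> Z'" "x \<notin> Z'" for Z'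
    using ZS(2)[rule_format, of Z'] that Z(2) by simp
  note Zs = D_submoduleD[OF Z(1)]
  \<comment> \<open>Adjoining \<open>z\<close> to the maximal \<open>Z\<close> must capture
    \<open>x\<close>, so \<open>x\<close> is an element of \<open>Z\<close> plus
    \<open>act z d\<close>. The coefficient \<open>d\<close> is non-zero, hence invertible, and the
    equation can be solved for \<open>z\<close>.\<close>
  have ex: "\<exists>d\<in>D. \<exists>m\<in>Z. z = m \<oplus>\<^bsub>\<Theta>\<^esub> act x d" if z: "z \<in> carrier \<Theta>" for z
  proof (cases "z \<in> Z")
    case True
    moreover have "(\<lambda>_. 0) \<in> D" using D_scalar[of 0] by (simp add: V.scale_zero_left[abs_def])
    ultimately show ?thesis
      using act_zero[OF x(1)] \<Theta>_rules(5)[OF z] by (intro bexI[of _ "\<lambda>_. 0"] bexI[of _ z]) auto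
  next
    case False
    let ?Z = "{m \<oplus>\<^bsub>\<Theta>\<^esub> act z d | m d. m \<in> Z \<and> d \<in> D}"
    have zero_D: "(\<lambda>_. 0) \<in> D" using D_scalar[of 0] by (simp add: V.scale_zero_left[abs_def])
    have "D_submodule ?Z"
      unfolding D_submodule_def
    proof (intro conjI ballI)
      show "?Z \<subseteq> carrier \<Theta>" using Zs(1) act_closed[OF z] \<Theta>_rules(1) by blast
      show "\<zero>\<^bsub>\<Theta>\<^esub> \<in> ?Z"
        using Zs(2) zero_D act_zero[OF z] \<Theta>_rules(5)[OF \<Theta>_rules(2)] by (intro CollectI exI[of _ "\<zero>\<^bsub>\<Theta>\<^esub>"] exI[of _ "\<lambda>_. 0"]) auto
    next
      fix a c assume "a \<in> ?Z" "c \<in> ?Z"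
      then obtain m d m' d' where e: "a = m \<oplus>\<^bsub>\<Theta>\<^esub> act z d" "m \<in> Z" "d \<in> D" "c = m' \<oplus>\<^bsub>\<Theta>\<^esub> act z d'" "m' \<in> Z" "d' \<in> D"
        by blast
      note cl = Zs(1)[OF e(2)] Zs(1)[OF e(5)] act_closed[OF z e(3)] act_closed[OF z e(6)]
      have "a \<oplus>\<^bsub>\<Theta>\<^esub> c = (m \<oplus>\<^bsub>\<Theta>\<^esub> m') \<oplus>\<^bsub>\<Theta>\<^esub> (act z d \<oplus>\<^bsub>\<Theta>\<^esub> act z d')"
        using cl e \<Theta>_rules(1) by (simp add: \<Theta>_rules(6)) (metis \<Theta>_rules(6,7))
      also have "\<dots> = (m \<oplus>\<^bsub>\<Theta>\<^esub> m') \<oplus>\<^bsub>\<Theta>\<^esub> act z (\<lambda>v. d v + d' v)" using act_rules(3)[OF z e(3,6)] by simp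
      finally show "a \<oplus>\<^bsub>\<Theta>\<^esub> c \<in> ?Z" using Zs(3)[OF e(2,5)] D_add[OF e(3,6)] by blast
    next
      fix a c assume "a \<in> ?Z" and c: "c \<in> D"
      then obtain m d where e: "a = m \<oplus>\<^bsub>\<Theta>\<^esub> act z d" "m \<in> Z" "d \<in> D" by blast
      have "act a c = act m c \<oplus>\<^bsub>\<Theta>\<^esub> act z (d \<circ> c)"
        using intertwinersD(3)[OF act_int[OF c] Zs(1)[OF e(2)] act_closed[OF z e(3)]] act_rules(2)[OF z e(3) c] e
        by simp
      then show "act a c \<in> ?Z" using Zs(4)[OF e(2) c] D_comp[OF e(3) c] by blast
    qed
    moreover have "Z \<subseteq> ?Z"
    proof
      fix m assume "m \<in> Z"
      then have "m = m \<oplus>\<^bsub>\<Theta>\<^esub> act z (\<lambda>_. 0)" using act_zero[OF z] \<Theta>_rules(5)[OF Zs(1)] by simp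
      then show "m \<in> ?Z" using \<open>m \<in> Z\<close> zero_D by blast
    qed
    moreover have "z \<in> ?Z"
      using act_rules(1)[OF z] \<Theta>_rules(4)[OF z] Zs(2) D_id by (intro CollectI exI[of _ "\<zero>\<^bsub>\<Theta>\<^esub>"] exI[of _ id]) auto
    ultimately have "x \<in> ?Z" using max[of ?Z] False by blast
    then obtain m d where e: "x = m \<oplus>\<^bsub>\<Theta>\<^esub> act z d" "m \<in> Z" "d \<in> D" by blast
    have "\<exists>v. d v \<noteq> 0"
    proof (rule ccontr)
      assume "\<not> ?thesis"
      then have "d = (\<lambda>_. 0)" by auto
      then show False using e act_zero[OF z] \<Theta>_rules(5)[OF Zs(1)[OF e(2)]] Z(3) by simp
    qed
    then obtain d' where d': "d' \<in> D" "\<And>v. d (d' v) = v" using division[OF e(3)] by metis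
    have dd': "d \<circ> d' = id" using d'(2) by auto
    have cm: "m \<in> carrier \<Theta>" "act z d \<in> carrier \<Theta>" using Zs(1) e act_closed[OF z] by auto
    have "act z d = (- 1) \<odot>\<^bsub>\<Theta>\<^esub> m \<oplus>\<^bsub>\<Theta>\<^esub> x"
    proof -
      have "(- 1) \<odot>\<^bsub>\<Theta>\<^esub> m \<oplus>\<^bsub>\<Theta>\<^esub> m = \<zero>\<^bsub>\<Theta>\<^esub>"
        using \<Theta>_rules(8)[OF cm(1), of "- 1" 1] \<Theta>_rules(11,12)[OF cm(1)] by simp
      then show ?thesis
        using \<Theta>_rules(6)[OF \<Theta>_rules(3)[OF cm(1)] cm, of "- 1"] \<Theta>_rules(4)[OF cm(2)] e(1) by simp
    qed
    then have "z = act ((- 1) \<odot>\<^bsub>\<Theta>\<^esub> m \<oplus>\<^bsub>\<Theta>\<^esub> x) d'"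
      using act_rules(2)[OF z e(3) d'(1)] act_rules(1)[OF z] dd' by simp
    also have "\<dots> = act ((- 1) \<odot>\<^bsub>\<Theta>\<^esub> m) d' \<oplus>\<^bsub>\<Theta>\<^esub> act x d'"
      using intertwinersD(3)[OF act_int[OF d'(1)] \<Theta>_rules(3)[OF cm(1)] x(1)] .
    finally show ?thesis using Zs(4)[OF Zs(5)[OF e(2)] d'(1)] d'(1) by blast
  qed
  \<comment> \<open>If two coefficients differed, \<open>act x c\<close> would lie in
    \<open>Z\<close> for their non-zero difference \<open>c\<close>; inverting \<open>c\<close>
    would put \<open>x\<close> into \<open>Z\<close>.\<close>
  have uniq: "d v = d' v" if eq: "m \<oplus>\<^bsub>\<Theta>\<^esub> act x d = m' \<oplus>\<^bsub>\<Theta>\<^esub> act x d'" and m: "m \<in> Z" "m' \<in> Z" "d \<in> D" "d' \<in> D"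
    for m d m' d' v
  proof (rule ccontr)
    assume ne: "d v \<noteq> d' v"
    define c where "c = (\<lambda>v. d v + scV (- 1) (d' v))"
    have c: "c \<in> D"
      using D_add[OF m(3) D_comp[OF D_scalar[of "- 1"] m(4)]] by (simp add: c_def o_def)
    have cl: "m \<in> carrier \<Theta>" "m' \<in> carrier \<Theta>" "act x d \<in> carrier \<Theta>" "act x d' \<in> carrier \<Theta>"
      using m Zs(1) act_closed[OF x(1)] by auto
    have "act x (\<lambda>v. c v + d' v) = act x c \<oplus>\<^bsub>\<Theta>\<^esub> act x d'" by (rule act_rules(3)[OF x(1) c m(4)])
    moreover have "(\<lambda>v. c v + d' v) = d" by (simp add: c_def)
    ultimately have sum: "act x d = act x c \<oplus>\<^bsub>\<Theta>\<^esub> act x d'" by simp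
    have cc: "act x c \<in> carrier \<Theta>" using act_closed[OF x(1) c] .
    interpret A: abelian_group \<Theta> using \<Theta>_module by (simp add: module_def)
    have "(m \<oplus>\<^bsub>\<Theta>\<^esub> act x c) \<oplus>\<^bsub>\<Theta>\<^esub> act x d' = m' \<oplus>\<^bsub>\<Theta>\<^esub> act x d'"
      using eq sum \<Theta>_rules(6)[OF cl(1) cc cl(4)] by simp
    then have mm: "m \<oplus>\<^bsub>\<Theta>\<^esub> act x c = m'"
      using A.add.right_cancel[of "act x d'" "m \<oplus>\<^bsub>\<Theta>\<^esub> act x c" m'] cl cc \<Theta>_rules(1) by simp
    have "(- 1) \<odot>\<^bsub>\<Theta>\<^esub> m \<oplus>\<^bsub>\<Theta>\<^esub> m = \<zero>\<^bsub>\<Theta>\<^esub>"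
      using \<Theta>_rules(8)[OF cl(1), of "- 1" 1] \<Theta>_rules(11,12)[OF cl(1)] by simp
    then have "act x c = (- 1) \<odot>\<^bsub>\<Theta>\<^esub> m \<oplus>\<^bsub>\<Theta>\<^esub> m'"
      using \<Theta>_rules(6)[OF \<Theta>_rules(3)[OF cl(1)] cl(1) cc, of "- 1"] \<Theta>_rules(4)[OF cc] mm by simp
    then have "act x c \<in> Z" using Zs(3)[OF Zs(5)[OF m(1)] m(2)] by simp
    moreover have "c v \<noteq> 0" using ne by (simp add: c_def)
    then obtain c' where c': "c' \<in> D" "\<And>v. c (c' v) = v" using division[OF c] by metis
    moreover have "act (act x c) c' = x"
    proof -
      have "c \<circ> c' = id" using c'(2) by auto
      then show ?thesis using act_rules(2)[OF x(1) c c'(1)] act_rules(1)[OF x(1)] by simp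
    qed
    ultimately show False using Zs(4) Z(3) by metis
  qed
  define l where "l z = (SOME d. d \<in> D \<and> (\<exists>m\<in>Z. z = m \<oplus>\<^bsub>\<Theta>\<^esub> act x d))" for z
  have l: "l z \<in> D" "\<exists>m\<in>Z. z = m \<oplus>\<^bsub>\<Theta>\<^esub> act x (l z)" if "z \<in> carrier \<Theta>" for z
    using someI_ex[of "\<lambda>d. d \<in> D \<and> (\<exists>m\<in>Z. z = m \<oplus>\<^bsub>\<Theta>\<^esub> act x d)"] ex[OF that] unfolding l_def by blast+
  have leq: "l z v = d v" if "z = m \<oplus>\<^bsub>\<Theta>\<^esub> act x d" "m \<in> Z" "d \<in> D" for z m d v
  proof -
    have "z \<in> carrier \<Theta>" using that Zs(1) act_closed[OF x(1)] \<Theta>_rules(1) by blast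
    then show ?thesis using l[of z] uniq that by metis
  qed
  have zero_D: "(\<lambda>_. 0) \<in> D" using D_scalar[of 0] by (simp add: V.scale_zero_left[abs_def])
  have "functional l"
    unfolding functional_def
  proof (intro conjI ballI allI)
    show "l z \<in> D" if "z \<in> carrier \<Theta>" for z using l(1)[OF that] .
  next
    fix y z v assume yz: "y \<in> carrier \<Theta>" "z \<in> carrier \<Theta>"
    obtain m m' where m: "m \<in> Z" "y = m \<oplus>\<^bsub>\<Theta>\<^esub> act x (l y)" "m' \<in> Z" "z = m' \<oplus>\<^bsub>\<Theta>\<^esub> act x (l z)"
      using l(2)[OF yz(1)] l(2)[OF yz(2)] by blast
    note ld = l(1)[OF yz(1)] l(1)[OF yz(2)]
    note cl = Zs(1)[OF m(1)] Zs(1)[OF m(3)] act_closed[OF x(1) ld(1)] act_closed[OF x(1) ld(2)]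
    have "y \<oplus>\<^bsub>\<Theta>\<^esub> z = (m \<oplus>\<^bsub>\<Theta>\<^esub> act x (l y)) \<oplus>\<^bsub>\<Theta>\<^esub> (m' \<oplus>\<^bsub>\<Theta>\<^esub> act x (l z))" using m(2,4) by simp
    also have "\<dots> = (m \<oplus>\<^bsub>\<Theta>\<^esub> m') \<oplus>\<^bsub>\<Theta>\<^esub> (act x (l y) \<oplus>\<^bsub>\<Theta>\<^esub> act x (l z))"
      using cl \<Theta>_rules(1) by (simp add: \<Theta>_rules(6)) (metis \<Theta>_rules(6,7))
    also have "\<dots> = (m \<oplus>\<^bsub>\<Theta>\<^esub> m') \<oplus>\<^bsub>\<Theta>\<^esub> act x (\<lambda>v. l y v + l z v)" using act_rules(3)[OF x(1) ld] by simp
    finally show "l (y \<oplus>\<^bsub>\<Theta>\<^esub> z) v = l y v + l z v" using leq[OF _ Zs(3)[OF m(1,3)] D_add[OF ld]] by blast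
  next
    fix z d v assume z: "z \<in> carrier \<Theta>" and d: "d \<in> D"
    obtain m where m: "m \<in> Z" "z = m \<oplus>\<^bsub>\<Theta>\<^esub> act x (l z)" using l(2)[OF z] by blast
    note ld = l(1)[OF z]
    have "act z d = act m d \<oplus>\<^bsub>\<Theta>\<^esub> act (act x (l z)) d"
      using intertwinersD(3)[OF act_int[OF d] Zs(1)[OF m(1)] act_closed[OF x(1) ld]] m(2) by simp
    also have "\<dots> = act m d \<oplus>\<^bsub>\<Theta>\<^esub> act x (l z \<circ> d)" using act_rules(2)[OF x(1) ld d] by simp
    finally show "l (act z d) v = l z (d v)" using leq[OF _ Zs(4)[OF m(1) d] D_comp[OF ld d]] by simp
  qed
  moreover have "l z v = 0" if "z \<in> Z0" for z v
  proof -
    have zZ: "z \<in> Z" using that Z(2) by blast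
    then have "z = z \<oplus>\<^bsub>\<Theta>\<^esub> act x (\<lambda>_. 0)" using act_zero[OF x(1)] \<Theta>_rules(5)[OF Zs(1)[OF zZ]] by simp
    then show ?thesis using leq[OF _ zZ zero_D] by simp
  qed
  moreover have "l x v = v" for v
  proof -
    have "x = \<zero>\<^bsub>\<Theta>\<^esub> \<oplus>\<^bsub>\<Theta>\<^esub> act x id" using act_rules(1)[OF x(1)] \<Theta>_rules(4)[OF x(1)] by simp
    then show ?thesis using leq[OF _ Zs(2) D_id, of x v] by simp
  qed
  ultimately show thesis by (rule that)
qed

end

lemma free_expand: "u = (\<Sum>k\<in>Poly_Mapping.keys u. free_scale (Poly_Mapping.lookup u k) (Poly_Mapping.single k 1))"
proof (rule poly_mapping_eqI)
  fix j
  have "(\<Sum>k\<in>Poly_Mapping.keys u. Poly_Mapping.lookup (free_scale (Poly_Mapping.lookup u k) (Poly_Mapping.single k 1)) j)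
      = (\<Sum>k\<in>Poly_Mapping.keys u. if k = j then Poly_Mapping.lookup u j else 0)"
    by (intro sum.cong) (auto simp: lookup_single when_def)
  also have "\<dots> = Poly_Mapping.lookup u j" by (simp add: in_keys_iff)
  finally show "Poly_Mapping.lookup u j = Poly_Mapping.lookup (\<Sum>k\<in>Poly_Mapping.keys u.
      free_scale (Poly_Mapping.lookup u k) (Poly_Mapping.single k 1)) j"
    by (simp only: lookup_sum)
qed

lemma free_subspace_eqI:
  assumes "free.subspace Y" "\<And>k. k \<in> K \<Longrightarrow> Poly_Mapping.single k 1 \<in> Y" "Poly_Mapping.keys u \<subseteq> K"
  shows "u \<in> Y"
proof -
  have "(\<Sum>k\<in>Poly_Mapping.keys u. free_scale (Poly_Mapping.lookup u k) (Poly_Mapping.single k 1)) \<in> Y"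
    using assms by (intro free.subspace_sum free.subspace_scale) auto
  then show ?thesis using free_expand[of u] by metis
qed

context theta_bimodule begin

abbreviation C :: "'t set" where "C \<equiv> carrier \<Theta>"
abbreviation e :: "'t \<Rightarrow> 'v \<Rightarrow> ('t \<times> 'v \<Rightarrow>\<^sub>0 'r)" where "e x v \<equiv> Poly_Mapping.single (x, v) 1"

definition N :: "('t \<times> 'v \<Rightarrow>\<^sub>0 'r) set" where
  "N = free.span (tensor_relations (End_ring G\<^sub>1 scV \<pi>) \<Theta> act scV)"

abbreviation base :: "('r, 't \<times> 'v \<Rightarrow>\<^sub>0 'r) module" where "base \<equiv> free_space (C \<times> UNIV)"

definition Tsp :: "('r, ('t \<times> 'v \<Rightarrow>\<^sub>0 'r) set) module" where
  "Tsp = tensor_space (End_ring G\<^sub>1 scV \<pi>) \<Theta> act scV"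

lemma Tsp_quot: "Tsp = quot_space base N"
  by (simp add: Tsp_def tensor_space_def N_def)

lemma base_carrier: "carrier base = {u. Poly_Mapping.keys u \<subseteq> C \<times> UNIV}"
  by (simp add: free_space_def)

lemma e_base: "x \<in> C \<Longrightarrow> e x v \<in> carrier base"
  by (simp add: base_carrier)

lemma base_subspace: "free.subspace (carrier base)"
  unfolding free.subspace_def base_carrier
proof (intro conjI ballI allI; clarsimp)
  show "(a, b) \<in> Poly_Mapping.keys (x + y) \<Longrightarrow> Poly_Mapping.keys x \<subseteq> C \<times> UNIV \<Longrightarrow>
      Poly_Mapping.keys y \<subseteq> C \<times> UNIV \<Longrightarrow> a \<in> C" for x y :: "'t \<times> 'v \<Rightarrow>\<^sub>0 'r" and a b
    using Poly_Mapping.keys_add[of x y] by auto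
  show "(a, b) \<in> Poly_Mapping.keys (free_scale c x) \<Longrightarrow> Poly_Mapping.keys x \<subseteq> C \<times> UNIV \<Longrightarrow> a \<in> C"
    for x :: "'t \<times> 'v \<Rightarrow>\<^sub>0 'r" and a b c
    using keys_free_scale[of c x] by auto
qed

lemma base_ext:
  assumes "free.subspace Y" "\<And>x v. x \<in> C \<Longrightarrow> e x v \<in> Y" "u \<in> carrier base"
  shows "u \<in> Y"
proof (rule free_subspace_eqI[OF assms(1)])
  show "Poly_Mapping.keys u \<subseteq> C \<times> UNIV" using assms(3) unfolding base_carrier by blast
  show "Poly_Mapping.single k 1 \<in> Y" if "k \<in> C \<times> UNIV" for k
    using assms(2)[of "fst k" "snd k"] that by (cases k) simp
qed

lemma N_rel:
  assumes "x \<in> C"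
  shows "x' \<in> C \<Longrightarrow> e (x \<oplus>\<^bsub>\<Theta>\<^esub> x') v - e x v - e x' v \<in> N"
    "e x (v + v') - e x v - e x v' \<in> N"
    "e (r \<odot>\<^bsub>\<Theta>\<^esub> x) v - free_scale r (e x v) \<in> N"
    "e x (scV r v) - free_scale r (e x v) \<in> N"
    "d \<in> D \<Longrightarrow> e (act x d) v - e x (d v) \<in> N"
  unfolding N_def
  by (rule free.span_base; insert assms; unfold tensor_relations_def Let_def D_carrier; blast)+

lemma N_induct:
  assumes Y: "free.subspace Y"
    and "\<And>x x' v. x \<in> C \<Longrightarrow> x' \<in> C \<Longrightarrow> e (x \<oplus>\<^bsub>\<Theta>\<^esub> x') v - e x v - e x' v \<in> Y"
    and "\<And>x v v'. x \<in> C \<Longrightarrow> e x (v + v') - e x v - e x v' \<in> Y"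
    and "\<And>x r v. x \<in> C \<Longrightarrow> e (r \<odot>\<^bsub>\<Theta>\<^esub> x) v - free_scale r (e x v) \<in> Y"
    and "\<And>x r v. x \<in> C \<Longrightarrow> e x (scV r v) - free_scale r (e x v) \<in> Y"
    and "\<And>x d v. x \<in> C \<Longrightarrow> d \<in> D \<Longrightarrow> e (act x d) v - e x (d v) \<in> Y"
  shows "N \<subseteq> Y"
  unfolding N_def
proof (rule free.span_minimal[OF _ Y])
  show "tensor_relations (End_ring G\<^sub>1 scV \<pi>) \<Theta> act scV \<subseteq> Y"
    unfolding tensor_relations_def Let_def D_carrier using assms(2-6) by blast
qed

lemma N_subspace: "free.subspace N"
  unfolding N_def by (rule free.subspace_span)

lemma N_base: "N \<subseteq> carrier base"
  by (rule N_induct[OF base_subspace])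
    (intro free.subspace_diff[OF base_subspace] free.subspace_scale[OF base_subspace] e_base;
      simp add: \<Theta>_rules(1,3) act_closed)+

sublocale T: subquotient free_scale base N
proof
  show "x \<oplus>\<^bsub>base\<^esub> y = x + y" "r \<odot>\<^bsub>base\<^esub> x = free_scale r x" for x y r
    by (simp_all add: free_space_def space_of_def)
qed (rule base_subspace N_subspace N_base)+

lemma T_carrier: "carrier Tsp = coset N ` carrier base"
  by (simp add: Tsp_quot T.quot_carrier)

lemma T_add: "coset N u \<oplus>\<^bsub>Tsp\<^esub> coset N u' = coset N (u + u')"
  and T_smult: "r \<odot>\<^bsub>Tsp\<^esub> coset N u = coset N (free_scale r u)"
  and T_zero: "\<zero>\<^bsub>Tsp\<^esub> = coset N 0"
  and T_module: "field_module Tsp"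
  unfolding Tsp_quot by (rule T.quot_add T.quot_smult T.quot_zero T.quot_module)+

text \<open>The universal property of the tensor product modulo a subspace \<open>Y\<close>: a map
  that is bilinear and balanced up to \<open>Y\<close> sends the relations into \<open>Y\<close>.
  With \<open>Y\<close> the space of relations it gives the group action, with 0 the pairings, and
  with the isotypic kernel the evaluation map.\<close>

lemma lift_kills:
  assumes W: "vector_space sc" and Y: "Modules.module.subspace sc Y"
    and "\<And>x x' v. x \<in> C \<Longrightarrow> x' \<in> C \<Longrightarrow> f (x \<oplus>\<^bsub>\<Theta>\<^esub> x') v - f x v - f x' v \<in> Y"
    and "\<And>x v v'. x \<in> C \<Longrightarrow> f x (v + v') - f x v - f x v' \<in> Y"
    and "\<And>x r v. x \<in> C \<Longrightarrow> f (r \<odot>\<^bsub>\<Theta>\<^esub> x) v - sc r (f x v) \<in> Y"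
    and "\<And>x r v. x \<in> C \<Longrightarrow> f x (scV r v) - sc r (f x v) \<in> Y"
    and "\<And>x d v. x \<in> C \<Longrightarrow> d \<in> D \<Longrightarrow> f (act x d) v - f x (d v) \<in> Y"
    and u: "u \<in> N"
  shows "free_lift sc (\<lambda>k. f (fst k) (snd k)) u \<in> Y"
proof -
  interpret W: vector_space sc by fact
  let ?L = "free_lift sc (\<lambda>k. f (fst k) (snd k))"
  have "free.subspace {u. ?L u \<in> Y}"
    unfolding free.subspace_def
    by (simp add: W.free_lift_add W.free_lift_scale W.subspace_add[OF Y] W.subspace_scale[OF Y] W.subspace_0[OF Y])
  then have "N \<subseteq> {u. ?L u \<in> Y}"
    by (rule N_induct) (simp_all add: W.free_lift_diff W.free_lift_scale assms(3-7))
  then show ?thesis using u by blast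
qed

definition push :: "('t \<Rightarrow> 't) \<Rightarrow> ('v \<Rightarrow> 'v) \<Rightarrow> ('t \<times> 'v \<Rightarrow>\<^sub>0 'r) \<Rightarrow> ('t \<times> 'v \<Rightarrow>\<^sub>0 'r)" where
  "push f g = free_lift free_scale (\<lambda>k. e (f (fst k)) (g (snd k)))"

lemma tensor_map_push: "tensor_map f g A = push f g ` A"
  by (simp add: tensor_map_def push_def free_lift_def[abs_def] free_scale_single)

lemma push_e [simp]: "push f g (e x v) = e (f x) (g v)"
  by (simp add: push_def)

lemma push_add: "push f g (u + u') = push f g u + push f g u'"
  and push_diff: "push f g (u - u') = push f g u - push f g u'"
  and push_scale: "push f g (free_scale r u) = free_scale r (push f g u)"
  and push_0 [simp]: "push f g 0 = 0"
  and push_sum: "push f g (\<Sum>i\<in>A. h i) = (\<Sum>i\<in>A. push f g (h i))"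
  by (simp_all add: push_def free.free_lift_add free.free_lift_diff free.free_lift_scale free.free_lift_sum)

definition \<tau> :: "'g \<Rightarrow> 'h \<Rightarrow> ('t \<times> 'v \<Rightarrow>\<^sub>0 'r) set \<Rightarrow> ('t \<times> 'v \<Rightarrow>\<^sub>0 'r) set" where
  "\<tau> g h = tensor_map (\<theta> h) (\<pi> g)"

lemmas \<theta>_rules = representationD[OF \<theta>]

lemma \<theta>_act: "h \<in> carrier G\<^sub>2 \<Longrightarrow> x \<in> C \<Longrightarrow> d \<in> D \<Longrightarrow> \<theta> h (act x d) = act (\<theta> h x) d"
  using intertwinersD(5)[OF act_int] by metis

lemma push_base:
  assumes "h \<in> carrier G\<^sub>2" "u \<in> carrier base"
  shows "push (\<theta> h) g u \<in> carrier base"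
proof -
  have "free.subspace {u. push (\<theta> h) g u \<in> carrier base}"
    unfolding free.subspace_def
    using free.subspace_add[OF base_subspace] free.subspace_scale[OF base_subspace] free.subspace_0[OF base_subspace]
    by (simp add: push_add push_scale)
  then have "u \<in> {u. push (\<theta> h) g u \<in> carrier base}"
    by (rule base_ext) (use \<theta>_rules(2)[OF assms(1)] e_base assms in auto)
  then show ?thesis by simp
qed

lemma push_N:
  assumes g: "g \<in> carrier G\<^sub>1" and h: "h \<in> carrier G\<^sub>2" and u: "u \<in> N"
  shows "push (\<theta> h) (\<pi> g) u \<in> N"
  unfolding push_def
proof (rule lift_kills[OF vector_space_free_scale N_subspace _ _ _ _ _ u, of "\<lambda>x v. e (\<theta> h x) (\<pi> g v)"])
  fix x x' v assume "x \<in> C" "x' \<in> C"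
  then show "e (\<theta> h (x \<oplus>\<^bsub>\<Theta>\<^esub> x')) (\<pi> g v) - e (\<theta> h x) (\<pi> g v) - e (\<theta> h x') (\<pi> g v) \<in> N"
    using N_rel(1)[OF \<theta>_rules(2)[OF h]] \<theta>_rules(2,3)[OF h] by simp
next
  fix x d v assume x: "x \<in> C" and d: "d \<in> D"
  show "e (\<theta> h (act x d)) (\<pi> g v) - e (\<theta> h x) (\<pi> g (d v)) \<in> N"
    using N_rel(5)[OF \<theta>_rules(2)[OF h x] d, of "\<pi> g v"] \<theta>_act[OF h x d] D_rules(3)[OF d g] by simp
qed (use N_rel(2,3,4)[OF \<theta>_rules(2)[OF h]] \<theta>_rules(4)[OF h] \<pi>_rules(1,2)[OF g] in simp_all)

lemma push_comp:
  assumes "h \<in> carrier G\<^sub>2" "h' \<in> carrier G\<^sub>2" "g \<in> carrier G\<^sub>1" "g' \<in> carrier G\<^sub>1" "u \<in> carrier base"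
  shows "push (\<theta> (h \<otimes>\<^bsub>G\<^sub>2\<^esub> h')) (\<pi> (g \<otimes>\<^bsub>G\<^sub>1\<^esub> g')) u = push (\<theta> h) (\<pi> g) (push (\<theta> h') (\<pi> g') u)"
proof -
  let ?Y = "{u. push (\<theta> (h \<otimes>\<^bsub>G\<^sub>2\<^esub> h')) (\<pi> (g \<otimes>\<^bsub>G\<^sub>1\<^esub> g')) u = push (\<theta> h) (\<pi> g) (push (\<theta> h') (\<pi> g') u)}"
  have "free.subspace ?Y" by (simp add: free.subspace_def push_add push_scale)
  then have "u \<in> ?Y"
    by (rule base_ext) (use assms \<theta>_rules(6) \<pi>_rules(4) in auto)
  then show ?thesis by simp
qed

lemma push_one:
  assumes "u \<in> carrier base"
  shows "push (\<theta> \<one>\<^bsub>G\<^sub>2\<^esub>) (\<pi> \<one>\<^bsub>G\<^sub>1\<^esub>) u = u"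
proof -
  have "free.subspace {u. push (\<theta> \<one>\<^bsub>G\<^sub>2\<^esub>) (\<pi> \<one>\<^bsub>G\<^sub>1\<^esub>) u = u}"
    by (simp add: free.subspace_def push_add push_scale)
  then have "u \<in> {u. push (\<theta> \<one>\<^bsub>G\<^sub>2\<^esub>) (\<pi> \<one>\<^bsub>G\<^sub>1\<^esub>) u = u}"
    by (rule base_ext) (use assms \<theta>_rules(5) \<pi>_rules(3) in auto)
  then show ?thesis by simp
qed

text \<open>The action on the tensor product takes images of cosets as sets. That the image is a
  full coset, and not merely contained in one, follows from the inverse group elements.\<close>

lemma \<tau>_coset:
  assumes g: "g \<in> carrier G\<^sub>1" and h: "h \<in> carrier G\<^sub>2" and u: "u \<in> carrier base"
  shows "\<tau> g h (coset N u) = coset N (push (\<theta> h) (\<pi> g) u)"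
proof -
  interpret G1: Group.group G\<^sub>1 by (rule G\<^sub>1)
  interpret G2: Group.group G\<^sub>2 by (rule G\<^sub>2)
  let ?F = "push (\<theta> h) (\<pi> g)" and ?F' = "push (\<theta> (inv\<^bsub>G\<^sub>2\<^esub> h)) (\<pi> (inv\<^bsub>G\<^sub>1\<^esub> g))"
  have FF': "?F (?F' z) = z" and F'F: "?F' (?F z) = z" if "z \<in> carrier base" for z
    using push_comp[of h "inv\<^bsub>G\<^sub>2\<^esub> h" g "inv\<^bsub>G\<^sub>1\<^esub> g" z] push_comp[of "inv\<^bsub>G\<^sub>2\<^esub> h" h "inv\<^bsub>G\<^sub>1\<^esub> g" g z]
      push_one[OF that] g h that by simp_all
  have "?F ` coset N u = coset N (?F u)"
  proof
    show "?F ` coset N u \<subseteq> coset N (?F u)"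
      using push_N[OF g h] by (auto simp: coset_def push_diff[symmetric])
    show "coset N (?F u) \<subseteq> ?F ` coset N u"
    proof
      fix z assume z: "z \<in> coset N (?F u)"
      then have zN: "z - ?F u \<in> N" by (simp add: coset_def)
      then have "z - ?F u \<in> carrier base" using N_base by blast
      from free.subspace_add[OF base_subspace this push_base[OF h u, of "\<pi> g"]] have zb: "z \<in> carrier base" by simp
      have "?F' (z - ?F u) \<in> N" using push_N[OF _ _ zN] g h by simp
      then have "?F' z \<in> coset N u" using F'F[OF u] by (simp add: coset_def push_diff)
      then show "z \<in> ?F ` coset N u" using FF'[OF zb] by (metis image_eqI)
    qed
  qed
  then show ?thesis by (simp add: \<tau>_def tensor_map_push)
qed

lemma T_cases:
  assumes "t \<in> carrier Tsp"
  obtains u where "u \<in> carrier base" "t = coset N u"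
  using assms by (auto simp: T_carrier)

lemma \<tau>_rep: "Defs.representation (G\<^sub>1 \<times>\<times> G\<^sub>2) Tsp (\<lambda>(g, h). \<tau> g h)"
  unfolding Defs.representation_def
proof (intro conjI ballI)
  interpret G1: Group.group G\<^sub>1 by (rule G\<^sub>1)
  interpret G2: Group.group G\<^sub>2 by (rule G\<^sub>2)
  show "field_module Tsp" by (rule T_module)
  show "(\<lambda>(g, h). \<tau> g h) gh \<in> lin_maps Tsp Tsp" if gh_mem: "gh \<in> carrier (G\<^sub>1 \<times>\<times> G\<^sub>2)" for gh
  proof -
    obtain g h where gh: "gh = (g, h)" "g \<in> carrier G\<^sub>1" "h \<in> carrier G\<^sub>2" using gh_mem by auto
    show ?thesis
      unfolding lin_maps_def gh(1)
    proof (intro CollectI conjI ballI allI; simp)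
      show "\<tau> g h \<in> carrier Tsp \<rightarrow> carrier Tsp"
        using push_base[OF gh(3)] by (auto simp: T_carrier \<tau>_coset[OF gh(2,3)])
      show "\<tau> g h (s \<oplus>\<^bsub>Tsp\<^esub> t) = \<tau> g h s \<oplus>\<^bsub>Tsp\<^esub> \<tau> g h t" if "s \<in> carrier Tsp" "t \<in> carrier Tsp" for s t
        using that free.subspace_add[OF base_subspace]
        by (auto simp: T_carrier T_add \<tau>_coset[OF gh(2,3)] push_add)
      show "\<tau> g h (r \<odot>\<^bsub>Tsp\<^esub> t) = r \<odot>\<^bsub>Tsp\<^esub> \<tau> g h t" if "t \<in> carrier Tsp" for r t
        using that free.subspace_scale[OF base_subspace]
        by (auto simp: T_carrier T_smult \<tau>_coset[OF gh(2,3)] push_scale)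
    qed
  qed
  show "(\<lambda>(g, h). \<tau> g h) \<one>\<^bsub>G\<^sub>1 \<times>\<times> G\<^sub>2\<^esub> t = t" if "t \<in> carrier Tsp" for t
    using that by (auto simp: T_carrier \<tau>_coset push_one)
  show "(\<lambda>(g, h). \<tau> g h) (gh \<otimes>\<^bsub>G\<^sub>1 \<times>\<times> G\<^sub>2\<^esub> gh') t = (\<lambda>(g, h). \<tau> g h) gh ((\<lambda>(g, h). \<tau> g h) gh' t)"
    if "gh \<in> carrier (G\<^sub>1 \<times>\<times> G\<^sub>2)" "gh' \<in> carrier (G\<^sub>1 \<times>\<times> G\<^sub>2)" "t \<in> carrier Tsp" for gh gh' t
    using that push_base by (auto simp: T_carrier \<tau>_coset push_comp)
qed

abbreviation \<tau>\<^sub>1 :: "'g \<Rightarrow> ('t \<times> 'v \<Rightarrow>\<^sub>0 'r) set \<Rightarrow> ('t \<times> 'v \<Rightarrow>\<^sub>0 'r) set" where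
  "\<tau>\<^sub>1 g \<equiv> \<tau> g \<one>\<^bsub>G\<^sub>2\<^esub>"

end

lemma representation_restrict_fst:
  assumes "Defs.representation (G \<times>\<times> H) M \<sigma>" "Group.group H"
  shows "Defs.representation G M (\<lambda>g. \<sigma> (g, \<one>\<^bsub>H\<^esub>))"
proof -
  interpret Group.group H by fact
  show ?thesis
    unfolding Defs.representation_def
  proof (intro conjI ballI)
    show "field_module M" by (rule representationD(1)[OF assms(1)])
    show "\<sigma> (g, \<one>\<^bsub>H\<^esub>) \<in> lin_maps M M" if "g \<in> carrier G" for g
      using assms(1) that unfolding Defs.representation_def by simp
    show "\<sigma> (\<one>\<^bsub>G\<^esub>, \<one>\<^bsub>H\<^esub>) x = x" if "x \<in> carrier M" for x
      using representationD(5)[OF assms(1) that] by simp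
    show "\<sigma> (g \<otimes>\<^bsub>G\<^esub> h, \<one>\<^bsub>H\<^esub>) x = \<sigma> (g, \<one>\<^bsub>H\<^esub>) (\<sigma> (h, \<one>\<^bsub>H\<^esub>) x)"
      if "g \<in> carrier G" "h \<in> carrier G" "x \<in> carrier M" for g h x
      using representationD(6)[OF assms(1), of "(g, \<one>\<^bsub>H\<^esub>)" "(h, \<one>\<^bsub>H\<^esub>)" x] that by simp
  qed
qed

context theta_bimodule begin

lemma \<tau>\<^sub>1_rep: "Defs.representation G\<^sub>1 Tsp \<tau>\<^sub>1"
  using representation_restrict_fst[OF \<tau>_rep G\<^sub>2] by simp

lemma one_G2: "\<one>\<^bsub>G\<^sub>2\<^esub> \<in> carrier G\<^sub>2"
  using Group.group.is_monoid[OF G\<^sub>2] by (rule monoid.one_closed)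

definition tens :: "'t \<Rightarrow> 'v \<Rightarrow> ('t \<times> 'v \<Rightarrow>\<^sub>0 'r) set" where "tens x v = coset N (e x v)"

lemma tens_closed: "x \<in> C \<Longrightarrow> tens x v \<in> carrier Tsp"
  by (auto simp: tens_def T_carrier e_base)

lemma tens_add_left: "x \<in> C \<Longrightarrow> y \<in> C \<Longrightarrow> tens (x \<oplus>\<^bsub>\<Theta>\<^esub> y) v = tens x v \<oplus>\<^bsub>Tsp\<^esub> tens y v"
  using N_rel(1) by (simp add: tens_def T_add T.coset_eq diff_diff_eq)

lemma tens_add_right: "x \<in> C \<Longrightarrow> tens x (v + w) = tens x v \<oplus>\<^bsub>Tsp\<^esub> tens x w"
  using N_rel(2) by (simp add: tens_def T_add T.coset_eq diff_diff_eq)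

lemma tens_smult_left: "x \<in> C \<Longrightarrow> tens (r \<odot>\<^bsub>\<Theta>\<^esub> x) v = r \<odot>\<^bsub>Tsp\<^esub> tens x v"
  using N_rel(3) by (simp add: tens_def T_smult T.coset_eq)

lemma tens_smult_right: "x \<in> C \<Longrightarrow> tens x (scV r v) = r \<odot>\<^bsub>Tsp\<^esub> tens x v"
  using N_rel(4) by (simp add: tens_def T_smult T.coset_eq)

lemma tens_act: "x \<in> C \<Longrightarrow> d \<in> D \<Longrightarrow> tens (act x d) v = tens x (d v)"
  using N_rel(5) by (simp add: tens_def T.coset_eq)

lemma tens_zero_left: "tens \<zero>\<^bsub>\<Theta>\<^esub> v = \<zero>\<^bsub>Tsp\<^esub>"
  using tens_smult_left[OF \<Theta>_rules(2), of 0 v] \<Theta>_rules(13)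
    field_moduleD(12)[OF T_module tens_closed[OF \<Theta>_rules(2), of v]] by simp

lemma tens_zero_right: "x \<in> C \<Longrightarrow> tens x 0 = \<zero>\<^bsub>Tsp\<^esub>"
  using tens_smult_right[of x 0 0] field_moduleD(12)[OF T_module tens_closed[of x 0]] by simp

lemma \<tau>_tens:
  "g \<in> carrier G\<^sub>1 \<Longrightarrow> h \<in> carrier G\<^sub>2 \<Longrightarrow> x \<in> C \<Longrightarrow> \<tau> g h (tens x v) = tens (\<theta> h x) (\<pi> g v)"
  by (simp add: tens_def \<tau>_coset e_base)

lemma tens_intertwiner: "x \<in> C \<Longrightarrow> tens x \<in> intertwiners G\<^sub>1 (space_of scV) \<pi> Tsp \<tau>\<^sub>1"
  by (rule intertwinersI)
    (simp_all add: tens_closed tens_add_right tens_smult_right \<tau>_tens one_G2 \<theta>_rules(5))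

lemma T_generated:
  assumes P: "linear_subset Tsp P" and "\<And>x v. x \<in> C \<Longrightarrow> tens x v \<in> P"
  shows "carrier Tsp \<subseteq> P"
proof
  fix t assume "t \<in> carrier Tsp"
  then obtain u where u: "u \<in> carrier base" "t = coset N u" by (rule T_cases)
  have "free.subspace {u. coset N u \<in> P}"
    using P unfolding free.subspace_def linear_subset_def
    by (simp add: T_add[symmetric] T_smult[symmetric] T_zero[symmetric])
  then have "u \<in> {u. coset N u \<in> P}"
    by (rule base_ext) (use assms(2) u in \<open>auto simp: tens_def\<close>)
  then show "t \<in> P" using u by simp
qed

text \<open>The tensor with component \<open>w x\<close> at each \<open>x\<close> of the finite set
  \<open>A\<close>; repetitions of \<open>x\<close> are collected by additivity in the second
  factor.\<close>

definition comb :: "'t set \<Rightarrow> ('t \<Rightarrow> 'v) \<Rightarrow> ('t \<times> 'v \<Rightarrow>\<^sub>0 'r) set" where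
  "comb A w = coset N (\<Sum>x\<in>A. e x (w x))"

lemma comb_empty: "comb {} w = \<zero>\<^bsub>Tsp\<^esub>"
  by (simp add: comb_def T_zero)

lemma comb_insert: "finite A \<Longrightarrow> x \<notin> A \<Longrightarrow> comb (insert x A) w = tens x (w x) \<oplus>\<^bsub>Tsp\<^esub> comb A w"
  by (simp add: comb_def tens_def T_add)

lemma comb_cong: "(\<And>x. x \<in> A \<Longrightarrow> w x = w' x) \<Longrightarrow> comb A w = comb A w'"
  by (simp add: comb_def)

lemma comb_base: "A \<subseteq> C \<Longrightarrow> (\<Sum>x\<in>A. e x (w x)) \<in> carrier base"
  using e_base by (intro free.subspace_sum[OF base_subspace]) auto

lemma comb_closed: "A \<subseteq> C \<Longrightarrow> comb A w \<in> carrier Tsp"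
  using comb_base by (auto simp: comb_def T_carrier)

lemma coset_sum_cong:
  "(\<And>x. x \<in> A \<Longrightarrow> f x - f' x \<in> N) \<Longrightarrow> coset N (\<Sum>x\<in>A. f x) = coset N (\<Sum>x\<in>A. f' x)"
  unfolding T.coset_eq sum_subtractf[symmetric] by (rule free.subspace_sum[OF N_subspace])

lemma comb_add: "A \<subseteq> C \<Longrightarrow> comb A (\<lambda>x. w x + w' x) = comb A w \<oplus>\<^bsub>Tsp\<^esub> comb A w'"
  unfolding comb_def T_add sum.distrib[symmetric]
  using N_rel(2) by (intro coset_sum_cong) (auto simp: diff_diff_eq)

lemma comb_smult: "A \<subseteq> C \<Longrightarrow> comb A (\<lambda>x. scV r (w x)) = r \<odot>\<^bsub>Tsp\<^esub> comb A w"
  unfolding comb_def T_smult free.scale_sum_right using N_rel(4) by (intro coset_sum_cong) auto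

lemma comb_\<tau>:
  assumes "A \<subseteq> C" "g \<in> carrier G\<^sub>1"
  shows "\<tau>\<^sub>1 g (comb A w) = comb A (\<lambda>x. \<pi> g (w x))"
proof -
  have "\<theta> \<one>\<^bsub>G\<^sub>2\<^esub> x = x" if "x \<in> A" for x using that assms(1) \<theta>_rules(5) by blast
  then show ?thesis
    unfolding comb_def using assms by (simp add: \<tau>_coset[OF assms(2) one_G2 comb_base] push_sum)
qed

lemma comb_superset:
  assumes "finite A'" "A \<subseteq> A'" "A' \<subseteq> C"
  shows "comb A w = comb A' (\<lambda>x. if x \<in> A then w x else 0)"
proof -
  have "coset N (\<Sum>x\<in>A'. e x (if x \<in> A then w x else 0)) = coset N (\<Sum>x\<in>A'. if x \<in> A then e x (w x) else 0)"
  proof (rule coset_sum_cong)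
    fix x assume "x \<in> A'"
    then have "coset N (e x 0) = coset N 0" using tens_zero_right[of x] assms by (auto simp: tens_def T_zero)
    then show "e x (if x \<in> A then w x else 0) - (if x \<in> A then e x (w x) else 0) \<in> N"
      unfolding T.coset_eq using free.subspace_0[OF N_subspace] by auto
  qed
  also have "(\<Sum>x\<in>A'. if x \<in> A then e x (w x) else 0) = (\<Sum>x\<in>A. e x (w x))"
    using assms by (subst sum.inter_restrict[symmetric]) (auto simp: Int_absorb1)
  finally show ?thesis by (simp add: comb_def)
qed

lemma comb_exists:
  assumes "t \<in> carrier Tsp"
  obtains A w where "finite A" "A \<subseteq> C" "t = comb A w"
proof -
  let ?P = "{t. \<exists>A w. finite A \<and> A \<subseteq> C \<and> t = comb A w}"
  have "linear_subset Tsp ?P"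
    unfolding linear_subset_def
  proof (intro conjI ballI allI)
    show "?P \<subseteq> carrier Tsp" using comb_closed by blast
    show "\<zero>\<^bsub>Tsp\<^esub> \<in> ?P" using comb_empty by (intro CollectI exI[of _ "{}"]) auto
  next
    fix s t assume "s \<in> ?P" "t \<in> ?P"
    then obtain A w A' w' where *: "finite A" "A \<subseteq> C" "s = comb A w" "finite A'" "A' \<subseteq> C" "t = comb A' w'" by blast
    let ?B = "A \<union> A'"
    have "s \<oplus>\<^bsub>Tsp\<^esub> t = comb ?B (\<lambda>x. (if x \<in> A then w x else 0) + (if x \<in> A' then w' x else 0))"
      using * comb_superset[of ?B A w] comb_superset[of ?B A' w'] by (simp add: comb_add)
    then show "s \<oplus>\<^bsub>Tsp\<^esub> t \<in> ?P" using * by (intro CollectI exI[of _ ?B]) auto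
  next
    fix r t assume "t \<in> ?P"
    then obtain A w where *: "finite A" "A \<subseteq> C" "t = comb A w" by blast
    then have "r \<odot>\<^bsub>Tsp\<^esub> t = comb A (\<lambda>x. scV r (w x))" by (simp add: comb_smult)
    then show "r \<odot>\<^bsub>Tsp\<^esub> t \<in> ?P" using * by blast
  qed
  moreover have "tens x v \<in> ?P" if "x \<in> C" for x v
    using that by (intro CollectI exI[of _ "{x}"] exI[of _ "\<lambda>_. v"]) (simp add: comb_def tens_def)
  ultimately have "carrier Tsp \<subseteq> ?P" by (rule T_generated)
  then show thesis using that assms by blast
qed

text \<open>The map that sends the tensor of \<open>x\<close> and \<open>v\<close> to
  \<open>l x v\<close>, read off an arbitrary representative.\<close>

definition pairing :: "('t \<Rightarrow> 'v \<Rightarrow> 'v) \<Rightarrow> ('t \<times> 'v \<Rightarrow>\<^sub>0 'r) set \<Rightarrow> 'v" where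
  "pairing l t = free_lift scV (\<lambda>k. l (fst k) (snd k)) (rep t)"

lemma functionalD:
  assumes "functional l"
  shows "x \<in> C \<Longrightarrow> l x \<in> D" "x \<in> C \<Longrightarrow> y \<in> C \<Longrightarrow> l (x \<oplus>\<^bsub>\<Theta>\<^esub> y) v = l x v + l y v"
    "x \<in> C \<Longrightarrow> d \<in> D \<Longrightarrow> l (act x d) v = l x (d v)" "x \<in> C \<Longrightarrow> l (r \<odot>\<^bsub>\<Theta>\<^esub> x) v = scV r (l x v)"
proof -
  show *: "x \<in> C \<Longrightarrow> l x \<in> D" "x \<in> C \<Longrightarrow> y \<in> C \<Longrightarrow> l (x \<oplus>\<^bsub>\<Theta>\<^esub> y) v = l x v + l y v"
    "x \<in> C \<Longrightarrow> d \<in> D \<Longrightarrow> l (act x d) v = l x (d v)" for x y d v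
    using assms by (auto simp: functional_def)
  show "x \<in> C \<Longrightarrow> l (r \<odot>\<^bsub>\<Theta>\<^esub> x) v = scV r (l x v)"
    using *(3)[OF _ D_scalar[of r], of x v] act_scalar[of x r] D_rules(2)[OF *(1)[of x]] by simp
qed

lemma pairing_coset:
  assumes l: "functional l"
  shows "pairing l (coset N u) = free_lift scV (\<lambda>k. l (fst k) (snd k)) u"
proof -
  note f = functionalD[OF l]
  have "rep (coset N u) - u \<in> N" by (rule rep_coset[OF T.N_subgroup])
  then have "free_lift scV (\<lambda>k. l (fst k) (snd k)) (rep (coset N u) - u) \<in> {0}"
    by (intro lift_kills[OF V]) (simp_all add: f D_rules[OF f(1)] V.subspace_0)
  then show ?thesis by (simp add: pairing_def V.free_lift_diff)
qed

lemma pairing_tens: "functional l \<Longrightarrow> pairing l (tens x v) = l x v"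
  by (simp add: tens_def pairing_coset)

lemma pairing_comb: "functional l \<Longrightarrow> pairing l (comb A w) = (\<Sum>x\<in>A. l x (w x))"
  by (simp add: comb_def pairing_coset V.free_lift_sum)

lemma pairing_intertwiner:
  assumes l: "functional l"
  shows "pairing l \<in> intertwiners G\<^sub>1 Tsp \<tau>\<^sub>1 (space_of scV) \<pi>"
proof (rule intertwinersI)
  let ?L = "free_lift scV (\<lambda>k. l (fst k) (snd k))"
  show "pairing l (s \<oplus>\<^bsub>Tsp\<^esub> t) = pairing l s \<oplus>\<^bsub>space_of scV\<^esub> pairing l t"
    if "s \<in> carrier Tsp" "t \<in> carrier Tsp" for s t
    using that by (auto simp: T_carrier T_add pairing_coset[OF l] V.free_lift_add)
  show "pairing l (r \<odot>\<^bsub>Tsp\<^esub> t) = r \<odot>\<^bsub>space_of scV\<^esub> pairing l t" if "t \<in> carrier Tsp" for t r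
    using that by (auto simp: T_carrier T_smult pairing_coset[OF l] V.free_lift_scale)
  show "pairing l (\<tau>\<^sub>1 g t) = \<pi> g (pairing l t)" if g: "g \<in> carrier G\<^sub>1" and t: "t \<in> carrier Tsp" for g t
  proof -
    obtain u where u: "u \<in> carrier base" "t = coset N u" using t by (rule T_cases)
    have pz: "\<pi> g 0 = 0" using \<pi>_rules(2)[OF g, of 0 0] by simp
    have "free.subspace {u. ?L (push (\<theta> \<one>\<^bsub>G\<^sub>2\<^esub>) (\<pi> g) u) = \<pi> g (?L u)}"
      by (simp add: free.subspace_def push_add push_scale V.free_lift_add V.free_lift_scale \<pi>_rules(1,2)[OF g] pz)
    then have "u \<in> {u. ?L (push (\<theta> \<one>\<^bsub>G\<^sub>2\<^esub>) (\<pi> g) u) = \<pi> g (?L u)}"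
      by (rule base_ext) (use u \<theta>_rules(5) D_rules(3)[OF functionalD(1)[OF l] g] in auto)
    then show ?thesis using u by (simp add: \<tau>_coset[OF g one_G2] pairing_coset[OF l])
  qed
qed simp

inductive_set D_span :: "'t set \<Rightarrow> 't set" for A where
  D_span_zero: "\<zero>\<^bsub>\<Theta>\<^esub> \<in> D_span A"
| D_span_base: "x \<in> A \<Longrightarrow> x \<in> D_span A"
| D_span_add: "x \<in> D_span A \<Longrightarrow> y \<in> D_span A \<Longrightarrow> x \<oplus>\<^bsub>\<Theta>\<^esub> y \<in> D_span A"
| D_span_act: "x \<in> D_span A \<Longrightarrow> d \<in> D \<Longrightarrow> act x d \<in> D_span A"

lemma D_span_carrier:
  assumes "A \<subseteq> C" "x \<in> D_span A"
  shows "x \<in> C"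
  using assms(2) by induction (use assms(1) in \<open>auto simp: \<Theta>_rules(1,2) act_closed\<close>)

lemma D_submodule_span: "A \<subseteq> C \<Longrightarrow> D_submodule (D_span A)"
  using D_span_carrier by (auto simp: D_submodule_def intro: D_span.intros)

lemma tens_D_span:
  assumes A: "A \<subseteq> C" "finite A" and y: "y \<in> D_span A"
  shows "\<exists>w. tens y v = comb A w"
  using y
proof (induction arbitrary: v rule: D_span.induct)
  case D_span_zero
  have "comb A (\<lambda>_. 0) = comb {} (\<lambda>_. 0)" using comb_superset[of A "{}" "\<lambda>_. 0"] A by simp
  then show ?case using tens_zero_left comb_empty by metis
next
  case (D_span_base x)
  have "tens x v = comb {x} (\<lambda>_. v)" by (simp add: comb_def tens_def)
  then show ?case using comb_superset[of A "{x}"] A D_span_base by auto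
next
  case (D_span_add x y)
  then obtain w w' where "tens x v = comb A w" "tens y v = comb A w'" by blast
  then have "tens (x \<oplus>\<^bsub>\<Theta>\<^esub> y) v = comb A (\<lambda>x. w x + w' x)"
    using tens_add_left D_span_carrier[OF A(1)] D_span_add.hyps comb_add[OF A(1)] by simp
  then show ?case by blast
next
  case (D_span_act x d)
  then show ?case using tens_act[of x d v] D_span_carrier[OF A(1)] by metis
qed

text \<open>A representation with as few terms as possible has D-independent first factors. The
  forms dual to them recover the vectors \<open>w' x\<close>, so the tensor has well-defined
  coordinates.\<close>

lemma independent_comb_exists:
  assumes t: "t \<in> carrier Tsp"
  obtains A w l where "finite A" "A \<subseteq> C" "t = comb A w" "\<And>x. x \<in> A \<Longrightarrow> functional (l x)"
    "\<And>w' x. x \<in> A \<Longrightarrow> pairing (l x) (comb A w') = w' x"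
proof -
  let ?P = "\<lambda>n. \<exists>A w. finite A \<and> A \<subseteq> C \<and> t = comb A w \<and> card A = n"
  have ex: "\<exists>n. ?P n" using comb_exists[OF t] by metis
  define n where "n = (LEAST n. ?P n)"
  have "?P n" unfolding n_def by (rule LeastI_ex[OF ex])
  then obtain A w where A: "finite A" "A \<subseteq> C" "t = comb A w" "card A = n" by blast
  have minimal: "n \<le> card A'" if "finite A'" "A' \<subseteq> C" "t = comb A' w'" for A' w'
    unfolding n_def by (rule Least_le) (use that in blast)
  \<comment> \<open>If \<open>x\<close> were in the span of the others, its term could be
    distributed over them, which gives a shorter representation.\<close>
  have indep: "x \<notin> D_span (A - {x})" if x: "x \<in> A" for x
  proof
    assume "x \<in> D_span (A - {x})"
    then obtain w' where w': "tens x (w x) = comb (A - {x}) w'"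
      using tens_D_span[of "A - {x}" x "w x"] A by auto
    have "t = tens x (w x) \<oplus>\<^bsub>Tsp\<^esub> comb (A - {x}) w"
      using A comb_insert[of "A - {x}" x w] x by (simp add: insert_absorb)
    also have "\<dots> = comb (A - {x}) (\<lambda>y. w' y + w y)" unfolding w' using A by (subst comb_add) auto
    finally have "n \<le> card (A - {x})" using A by (intro minimal) auto
    moreover have "card (A - {x}) < card A" using A(1) x by (rule card_Diff1_less)
    ultimately show False using A(4) by simp
  qed
  have "\<forall>x. \<exists>l. x \<in> A \<longrightarrow> functional l \<and> (\<forall>y\<in>A - {x}. \<forall>v. l y v = 0) \<and> (\<forall>v. l x v = v)"
  proof (intro allI)
    fix x
    show "\<exists>l. x \<in> A \<longrightarrow> functional l \<and> (\<forall>y\<in>A - {x}. \<forall>v. l y v = 0) \<and> (\<forall>v. l x v = v)"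
    proof (cases "x \<in> A")
      case True
      have "A - {x} \<subseteq> C" using A by blast
      from functional_exists[OF D_submodule_span[OF this], of x] True A(2) indep[OF True]
      obtain l where "functional l" "\<And>z v. z \<in> D_span (A - {x}) \<Longrightarrow> l z v = 0" "\<And>v. l x v = v" by blast
      then show ?thesis using D_span_base by blast
    qed simp
  qed
  then obtain l where l: "\<And>x. x \<in> A \<Longrightarrow> functional (l x)"
    "\<And>x y v. x \<in> A \<Longrightarrow> y \<in> A - {x} \<Longrightarrow> l x y v = 0" "\<And>x v. x \<in> A \<Longrightarrow> l x x v = v" by metis
  have dual: "pairing (l x) (comb A w') = w' x" if x: "x \<in> A" for x w'
  proof -
    have "(\<Sum>y\<in>A. l x y (w' y)) = l x x (w' x) + (\<Sum>y\<in>A - {x}. l x y (w' y))"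
      using A(1) x by (rule sum.remove)
    also have "(\<Sum>y\<in>A - {x}. l x y (w' y)) = 0" using l(2)[OF x] by (intro sum.neutral) auto
    finally show ?thesis using pairing_comb[OF l(1)[OF x]] l(3)[OF x] by simp
  qed
  show thesis by (rule that[of A w l]) (use A l(1) dual in auto)
qed

lemma comb_D_tens:
  assumes "finite A" "A \<subseteq> C" "\<And>x. x \<in> A \<Longrightarrow> d x \<in> D"
  shows "\<exists>y\<in>C. \<forall>v. comb A (\<lambda>x. d x v) = tens y v"
  using assms
proof (induction A rule: finite_induct)
  case empty
  then show ?case using comb_empty tens_zero_left \<Theta>_rules(2) by metis
next
  case (insert x A)
  then obtain y where y: "y \<in> C" "\<forall>v. comb A (\<lambda>x. d x v) = tens y v" by auto
  have x: "x \<in> C" "d x \<in> D" using insert.prems by auto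
  have "comb (insert x A) (\<lambda>x. d x v) = tens (act x (d x) \<oplus>\<^bsub>\<Theta>\<^esub> y) v" for v
    using insert.hyps y by (simp add: comb_insert tens_add_left act_closed x tens_act)
  then show ?case using \<Theta>_rules(1)[OF act_closed[OF x] y(1)] by blast
qed

lemma nonzero_vector: obtains v0 :: 'v where "v0 \<noteq> 0"
proof -
  have "UNIV \<noteq> {0 :: 'v}" using irr by (simp add: irreducible_rep_def)
  then show thesis using that by blast
qed

lemma intertwiners_agree:
  assumes \<phi>: "\<phi> \<in> intertwiners G\<^sub>1 (space_of scV) \<pi> Tsp \<tau>\<^sub>1" and x: "x \<in> C"
    and v0: "v0 \<noteq> 0" "\<phi> v0 = tens x v0"
  shows "\<phi> v = tens x v"
proof -
  have "stable_subset G\<^sub>1 (space_of scV) \<pi> {v. \<phi> v = tens x v}"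
    using stable_subset_equalizer[OF \<pi> \<tau>\<^sub>1_rep \<phi> tens_intertwiner[OF x]] by simp
  then have "{v. \<phi> v = tens x v} = UNIV"
    using irreducible_stable_subset[OF irr V _ _ v0(1)] v0(2) by blast
  then show ?thesis by blast
qed

text \<open>In the coordinates of the single tensor \<open>\<phi> v0\<close>, the homomorphism
  \<open>\<phi>\<close> has components in D. Moving these into the first factor gives one
  \<open>y\<close> whose tensors agree with \<open>\<phi>\<close> at \<open>v0\<close>, hence
  everywhere by irreducibility. Together with \<open>tens_inject\<close> it identifies
  \<open>\<Theta>\<close> with the homomorphisms from V to the tensor product.\<close>

lemma hom_is_tens:
  assumes \<phi>: "\<phi> \<in> intertwiners G\<^sub>1 (space_of scV) \<pi> Tsp \<tau>\<^sub>1"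
  obtains x where "x \<in> C" "\<And>v. \<phi> v = tens x v"
proof -
  obtain v0 :: 'v where v0: "v0 \<noteq> 0" by (rule nonzero_vector)
  have t: "\<phi> v0 \<in> carrier Tsp" using intertwinersD(2)[OF \<phi>] by simp
  obtain A w l where A: "finite A" "A \<subseteq> C" "\<phi> v0 = comb A w" "\<And>x. x \<in> A \<Longrightarrow> functional (l x)"
    "\<And>w' x. x \<in> A \<Longrightarrow> pairing (l x) (comb A w') = w' x"
    using independent_comb_exists[OF t] by metis
  define d where "d x = (\<lambda>v. pairing (l x) (\<phi> v))" for x
  have d: "d x \<in> D" if "x \<in> A" for x
    unfolding d_def using intertwiners_comp[OF \<phi> pairing_intertwiner[OF A(4)[OF that]]] .
  obtain y where y: "y \<in> C" "\<And>v. comb A (\<lambda>x. d x v) = tens y v" using comb_D_tens[of A d] A(1,2) d by blast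
  have "\<phi> v0 = comb A (\<lambda>x. d x v0)" unfolding A(3) using A(5) by (intro comb_cong) (simp add: d_def A(3))
  then have "\<phi> v0 = tens y v0" using y(2) by simp
  then show thesis using that[OF y(1)] intertwiners_agree[OF \<phi> y(1) v0] by blast
qed

text \<open>A D-linear form with value the identity at a non-zero \<open>x\<close> would give a
  pairing that recovers \<open>v\<close> from the tensor of \<open>x\<close> and
  \<open>v\<close>.\<close>

lemma tens_eq_zero:
  assumes x: "x \<in> C" and z: "\<And>v. tens x v = \<zero>\<^bsub>Tsp\<^esub>"
  shows "x = \<zero>\<^bsub>\<Theta>\<^esub>"
proof (rule ccontr)
  assume "x \<noteq> \<zero>\<^bsub>\<Theta>\<^esub>"
  have "D_submodule {\<zero>\<^bsub>\<Theta>\<^esub>}"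
    unfolding D_submodule_def
    using \<Theta>_rules(2,5) lin_maps_zero[OF \<Theta>_module \<Theta>_module intertwinersD(1)[OF act_int]] by auto
  moreover have "x \<notin> {\<zero>\<^bsub>\<Theta>\<^esub>}" using \<open>x \<noteq> \<zero>\<^bsub>\<Theta>\<^esub>\<close> by simp
  ultimately obtain l where l: "functional l" "\<And>v. l x v = v"
    using functional_exists[OF _ x] by metis
  obtain v0 :: 'v where v0: "v0 \<noteq> 0" by (rule nonzero_vector)
  have "pairing l (tens x v0) = v0" using l by (simp add: pairing_tens)
  moreover have "pairing l \<zero>\<^bsub>Tsp\<^esub> = 0"
    using lin_maps_zero[OF T_module module_space_of[OF V] intertwinersD(1)[OF pairing_intertwiner[OF l(1)]]] by simp
  ultimately show False using z v0 by simp
qed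

lemma tens_inject:
  assumes "x \<in> C" "y \<in> C" "\<And>v. tens x v = tens y v"
  shows "x = y"
proof -
  have "tens (mdiff \<Theta> x y) v = mdiff Tsp (tens x v) (tens y v)" for v
    using assms(1,2) \<Theta>_rules(3) by (simp add: tens_add_left tens_smult_left)
  then have "tens (mdiff \<Theta> x y) v = \<zero>\<^bsub>Tsp\<^esub>" for v
    using mdiff(3)[OF T_module tens_closed[OF assms(1)] tens_closed[OF assms(2)]] assms(3) by simp
  then have "mdiff \<Theta> x y = \<zero>\<^bsub>\<Theta>\<^esub>"
    using tens_eq_zero[OF mdiff(1)[OF \<Theta>_module assms(1,2)]] by blast
  then show ?thesis using mdiff(3)[OF \<Theta>_module assms(1,2)] by simp
qed

text \<open>The module generated by \<open>t\<close> lies among the tensors with first factors in a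
  finite independent set, so the dual pairings separate it and it is spanned by images of
  homomorphisms from V. By \<open>hom_is_tens\<close> such an image consists of the tensors with one
  fixed \<open>x\<close>; thus a stable subspace containing none of these is 0.\<close>

lemma submodule_detected:
  assumes K: "stable_subset G\<^sub>1 Tsp \<tau>\<^sub>1 K" and t: "t \<in> K"
    and z: "\<And>x. x \<in> C \<Longrightarrow> (\<And>v. tens x v \<in> K) \<Longrightarrow> x = \<zero>\<^bsub>\<Theta>\<^esub>"
  shows "t = \<zero>\<^bsub>Tsp\<^esub>"
proof -
  have tc: "t \<in> carrier Tsp" using stable_subsetD(1)[OF K] t by blast
  obtain A w l where A: "finite A" "A \<subseteq> C" "t = comb A w" "\<And>x. x \<in> A \<Longrightarrow> functional (l x)"
    "\<And>w' x. x \<in> A \<Longrightarrow> pairing (l x) (comb A w') = w' x"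
    using independent_comb_exists[OF tc] by metis
  let ?Y = "{comb A w' | w'. True}"
  have Y: "stable_subset G\<^sub>1 Tsp \<tau>\<^sub>1 ?Y"
  proof (rule stable_subsetI)
    show "?Y \<subseteq> carrier Tsp" using comb_closed[OF A(2)] by blast
    have "comb A (\<lambda>_. 0) = comb {} (\<lambda>_. 0)" using comb_superset[of A "{}" "\<lambda>_. 0"] A by simp
    then show "\<zero>\<^bsub>Tsp\<^esub> \<in> ?Y" using comb_empty by (intro CollectI exI[of _ "\<lambda>_. 0"]) simp
    show "a \<oplus>\<^bsub>Tsp\<^esub> c \<in> ?Y" if "a \<in> ?Y" "c \<in> ?Y" for a c using that comb_add[OF A(2)] by blast
    show "r \<odot>\<^bsub>Tsp\<^esub> a \<in> ?Y" if "a \<in> ?Y" for r a using that comb_smult[OF A(2)] by blast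
    show "\<tau>\<^sub>1 g a \<in> ?Y" if "g \<in> carrier G\<^sub>1" "a \<in> ?Y" for g a using that comb_\<tau>[OF A(2)] by blast
  qed
  have cycY: "cyclic G\<^sub>1 Tsp \<tau>\<^sub>1 t \<subseteq> ?Y" using A(3) by (intro cyclic_least[OF Y]) blast
  have cycK: "cyclic G\<^sub>1 Tsp \<tau>\<^sub>1 t \<subseteq> K" by (rule cyclic_least[OF K t])
  have "t \<in> {\<zero>\<^bsub>Tsp\<^esub>}"
  proof (rule separated_cyclic_isotypic[OF \<tau>\<^sub>1_rep V \<pi> irr _ _ tc])
    show "finite ((\<lambda>x. pairing (l x)) ` A)" using A(1) by simp
    show "(\<lambda>x. pairing (l x)) ` A \<subseteq> intertwiners G\<^sub>1 Tsp \<tau>\<^sub>1 (space_of scV) \<pi>"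
      using pairing_intertwiner A(4) by blast
    show "y = \<zero>\<^bsub>Tsp\<^esub>" if y: "y \<in> cyclic G\<^sub>1 Tsp \<tau>\<^sub>1 t" "\<And>f. f \<in> (\<lambda>x. pairing (l x)) ` A \<Longrightarrow> f y = 0" for y
    proof -
      obtain w' where w': "y = comb A w'" using cycY y(1) by blast
      have "w' x = 0" if "x \<in> A" for x using y(2)[of "pairing (l x)"] A(5)[OF that] w' that by auto
      then have "y = comb A (\<lambda>_. 0)" unfolding w' by (intro comb_cong) auto
      also have "\<dots> = \<zero>\<^bsub>Tsp\<^esub>" using comb_superset[of A "{}" "\<lambda>_. 0"] A comb_empty by simp
      finally show ?thesis .
    qed
    show "linear_subset Tsp {\<zero>\<^bsub>Tsp\<^esub>}"
      using field_moduleD(2,4,13)[OF T_module] by (auto simp: linear_subset_def)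
    show "\<phi> v \<in> {\<zero>\<^bsub>Tsp\<^esub>}"
      if \<phi>: "\<phi> \<in> intertwiners G\<^sub>1 (space_of scV) \<pi> Tsp \<tau>\<^sub>1" "range \<phi> \<subseteq> cyclic G\<^sub>1 Tsp \<tau>\<^sub>1 t" for \<phi> v
    proof -
      obtain x where x: "x \<in> C" "\<And>v. \<phi> v = tens x v" using hom_is_tens[OF \<phi>(1)] by blast
      have "tens x v \<in> K" for v using \<phi>(2) cycK x(2) by (metis rangeI subsetD)
      then have "x = \<zero>\<^bsub>\<Theta>\<^esub>" by (rule z[OF x(1)])
      then show ?thesis using x(2) tens_zero_left by simp
    qed
  qed
  then show ?thesis by simp
qed

end

section \<open>Recovering the bimodule from its tensor product\<close>

subsection \<open>Uniqueness\<close>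

lemma theta_bimodule_of_right_module_rep:
  assumes "Group.group G\<^sub>1" "Group.group G\<^sub>2" "vector_space scV"
    "Defs.representation G\<^sub>1 (space_of scV) \<pi>" "irreducible_rep G\<^sub>1 (space_of scV) \<pi>"
    and "right_module_rep G\<^sub>2 T\<^sub>2 scS (End_ring G\<^sub>1 scV \<pi>) scV \<Theta> \<theta> act"
  shows "theta_bimodule G\<^sub>1 G\<^sub>2 scV \<pi> \<Theta> \<theta> act"
  unfolding theta_bimodule_def
  using assms by (auto simp: right_module_rep_def smooth_rep_def End_ring_def)

text \<open>An isomorphism \<open>F\<close> carries the homomorphism \<open>A.tens x\<close> to one
  from V to the other tensor product, which is \<open>B.tens x'\<close> for a unique
  \<open>x'\<close>. Uniqueness makes \<open>x\<close> to \<open>x'\<close> compatible with all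
  structures, and the inverse of \<open>F\<close> gives surjectivity.\<close>

lemma bimodule_iso_of_tensor_iso:
  assumes A: "theta_bimodule G\<^sub>1 G\<^sub>2 scV \<pi> \<Theta> \<theta> act" and B: "theta_bimodule G\<^sub>1 G\<^sub>2 scV \<pi> \<Theta>' \<theta>' act'"
    and F: "F \<in> intertwiners (G\<^sub>1 \<times>\<times> G\<^sub>2)
        (tensor_space (End_ring G\<^sub>1 scV \<pi>) \<Theta> act scV) (\<lambda>(g, h). tensor_map (\<theta> h) (\<pi> g))
        (tensor_space (End_ring G\<^sub>1 scV \<pi>) \<Theta>' act' scV) (\<lambda>(g, h). tensor_map (\<theta>' h) (\<pi> g))"
    and bij: "bij_betw F (carrier (tensor_space (End_ring G\<^sub>1 scV \<pi>) \<Theta> act scV))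
        (carrier (tensor_space (End_ring G\<^sub>1 scV \<pi>) \<Theta>' act' scV))"
  shows "bimodule_iso G\<^sub>2 (End_ring G\<^sub>1 scV \<pi>) \<Theta> \<theta> act \<Theta>' \<theta>' act'"
proof -
  interpret A: theta_bimodule G\<^sub>1 G\<^sub>2 scV \<pi> \<Theta> \<theta> act by (rule A)
  interpret B: theta_bimodule G\<^sub>1 G\<^sub>2 scV \<pi> \<Theta>' \<theta>' act' by (rule B)
  have F': "F \<in> intertwiners (G\<^sub>1 \<times>\<times> G\<^sub>2) A.Tsp (\<lambda>(g, h). A.\<tau> g h) B.Tsp (\<lambda>(g, h). B.\<tau> g h)"
    using F by (simp add: A.Tsp_def B.Tsp_def A.\<tau>_def B.\<tau>_def)
  have b: "bij_betw F (carrier A.Tsp) (carrier B.Tsp)" using bij by (simp add: A.Tsp_def B.Tsp_def)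
  note Fs = intertwinersD[OF F']
  have F\<tau>: "F (A.\<tau> g h t) = B.\<tau> g h (F t)" if "g \<in> carrier G\<^sub>1" "h \<in> carrier G\<^sub>2" "t \<in> carrier A.Tsp" for g h t
    using Fs(5)[of "(g, h)" t] that by simp
  have one1: "\<one>\<^bsub>G\<^sub>1\<^esub> \<in> carrier G\<^sub>1"
    using Group.group.is_monoid[OF A.G\<^sub>1] by (rule monoid.one_closed)
  have F1: "F \<in> intertwiners G\<^sub>1 A.Tsp A.\<tau>\<^sub>1 B.Tsp B.\<tau>\<^sub>1"
    by (rule intertwinersI) (use Fs F\<tau> A.one_G2 in auto)
  note Fi = intertwiners_inverse[OF F1 b A.\<tau>\<^sub>1_rep]
  have ex: "\<exists>x'. x' \<in> carrier \<Theta>' \<and> (\<forall>v. F (A.tens x v) = B.tens x' v)" if x: "x \<in> carrier \<Theta>" for x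
    using B.hom_is_tens[OF intertwiners_comp[OF A.tens_intertwiner[OF x] F1]] by metis
  define f where "f x = (SOME x'. x' \<in> carrier \<Theta>' \<and> (\<forall>v. F (A.tens x v) = B.tens x' v))" for x
  have f: "f x \<in> carrier \<Theta>'" "F (A.tens x v) = B.tens (f x) v" if "x \<in> carrier \<Theta>" for x v
    using someI_ex[OF ex[OF that]] unfolding f_def by blast+
  have feq: "f x = x'" if "x \<in> carrier \<Theta>" "x' \<in> carrier \<Theta>'" "\<And>v. F (A.tens x v) = B.tens x' v" for x x'
    using B.tens_inject[OF f(1)[OF that(1)] that(2)] f(2)[OF that(1)] that(3) by simp
  have fint: "f \<in> intertwiners G\<^sub>2 \<Theta> \<theta> \<Theta>' \<theta>'"
  proof (rule intertwinersI)
    show "f x \<in> carrier \<Theta>'" if "x \<in> carrier \<Theta>" for x by (rule f(1)[OF that])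
    show "f (x \<oplus>\<^bsub>\<Theta>\<^esub> y) = f x \<oplus>\<^bsub>\<Theta>'\<^esub> f y" if "x \<in> carrier \<Theta>" "y \<in> carrier \<Theta>" for x y
      using that by (intro feq)
        (simp_all add: A.\<Theta>_rules(1) B.\<Theta>_rules(1) f A.tens_add_left B.tens_add_left Fs(3) A.tens_closed)
    show "f (r \<odot>\<^bsub>\<Theta>\<^esub> x) = r \<odot>\<^bsub>\<Theta>'\<^esub> f x" if "x \<in> carrier \<Theta>" for x r
      using that by (intro feq)
        (simp_all add: A.\<Theta>_rules(3) B.\<Theta>_rules(3) f A.tens_smult_left B.tens_smult_left Fs(4) A.tens_closed)
    show "f (\<theta> h x) = \<theta>' h (f x)" if h: "h \<in> carrier G\<^sub>2" and x: "x \<in> carrier \<Theta>" for h x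
    proof (rule feq)
      show "\<theta> h x \<in> carrier \<Theta>" "\<theta>' h (f x) \<in> carrier \<Theta>'" using A.\<theta>_rules(2) B.\<theta>_rules(2) f(1) h x by auto
      show "F (A.tens (\<theta> h x) v) = B.tens (\<theta>' h (f x)) v" for v
        using F\<tau>[OF one1 h A.tens_closed[OF x], of v] A.\<tau>_tens[OF one1 h x, of v]
          B.\<tau>_tens[OF one1 h f(1)[OF x], of v] f(2)[OF x, of v] A.\<pi>_rules(3) by simp
    qed
  qed
  have inj: "inj_on f (carrier \<Theta>)"
  proof (rule inj_onI)
    fix x y assume xy: "x \<in> carrier \<Theta>" "y \<in> carrier \<Theta>" "f x = f y"
    have "A.tens x v = A.tens y v" for v
      using f(2)[OF xy(1), of v] f(2)[OF xy(2), of v] xy(3) bij_betw_imp_inj_on[OF b]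
        A.tens_closed[OF xy(1)] A.tens_closed[OF xy(2)] by (metis inj_onD)
    then show "x = y" by (rule A.tens_inject[OF xy(1,2)])
  qed
  have surj: "x' \<in> f ` carrier \<Theta>" if x': "x' \<in> carrier \<Theta>'" for x'
  proof -
    obtain x where x: "x \<in> carrier \<Theta>" "\<And>v. the_inv_into (carrier A.Tsp) F (B.tens x' v) = A.tens x v"
      using A.hom_is_tens[OF intertwiners_comp[OF B.tens_intertwiner[OF x'] Fi(1)]] by metis
    have "F (A.tens x v) = B.tens x' v" for v using Fi(4)[OF B.tens_closed[OF x'], of v] x(2) by simp
    then have "f x = x'" by (rule feq[OF x(1) x'])
    then show ?thesis using x(1) by blast
  qed
  have "bij_betw f (carrier \<Theta>) (carrier \<Theta>')"
    unfolding bij_betw_def using inj surj f(1) by blast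
  moreover have "f (act x d) = act' (f x) d" if x: "x \<in> carrier \<Theta>" and d: "d \<in> A.D" for x d
    by (rule feq[OF A.act_closed[OF x d] B.act_closed[OF f(1)[OF x] d]])
      (simp add: A.tens_act[OF x d] B.tens_act[OF f(1)[OF x] d] f(2)[OF x])
  ultimately show ?thesis
    unfolding bimodule_iso_def A.D_carrier using fint by blast
qed

section \<open>The homomorphisms from pi to the isotypic quotient as theta lift\<close>

subsection \<open>Existence\<close>

locale commuting_weil_pair = vector_space scS
  for scS :: "'r::field \<Rightarrow> 's::ab_group_add \<Rightarrow> 's" +
  fixes G\<^sub>1 G\<^sub>2 :: "(('w \<Rightarrow> 'w) \<times> ('s \<Rightarrow> 's)) monoid" and T\<^sub>1 T\<^sub>2 :: "(('w \<Rightarrow> 'w) \<times> ('s \<Rightarrow> 's)) topology"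
    and scV :: "'r \<Rightarrow> 'v::ab_group_add \<Rightarrow> 'v" and \<pi> :: "('w \<Rightarrow> 'w) \<times> ('s \<Rightarrow> 's) \<Rightarrow> 'v \<Rightarrow> 'v"
  assumes G\<^sub>1: "Group.group G\<^sub>1" and G\<^sub>2: "Group.group G\<^sub>2" and V: "vector_space scV"
    and \<pi>: "Defs.representation G\<^sub>1 (space_of scV) \<pi>" and irr: "irreducible_rep G\<^sub>1 (space_of scV) \<pi>"
    and adm: "admissible G\<^sub>1 T\<^sub>1 scV \<pi>"
    and weil_add: "g \<in> carrier G\<^sub>1 \<union> carrier G\<^sub>2 \<Longrightarrow> weil_rep g (s + t) = weil_rep g s + weil_rep g t"
    and weil_scale: "g \<in> carrier G\<^sub>1 \<union> carrier G\<^sub>2 \<Longrightarrow> weil_rep g (scS r s) = scS r (weil_rep g s)"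
    and weil_mult1: "weil_rep (g \<otimes>\<^bsub>G\<^sub>1\<^esub> g') s = weil_rep g (weil_rep g' s)"
    and weil_mult2: "weil_rep (h \<otimes>\<^bsub>G\<^sub>2\<^esub> h') s = weil_rep h (weil_rep h' s)"
    and weil_one: "weil_rep \<one>\<^bsub>G\<^sub>1\<^esub> s = s" "weil_rep \<one>\<^bsub>G\<^sub>2\<^esub> s = s"
    and weil_commute: "g \<in> carrier G\<^sub>1 \<Longrightarrow> h \<in> carrier G\<^sub>2 \<Longrightarrow> weil_rep g (weil_rep h s) = weil_rep h (weil_rep g s)"
    and weil_open1: "openin T\<^sub>1 {g \<in> carrier G\<^sub>1. weil_rep g s = t}"
    and weil_open2: "openin T\<^sub>2 {h \<in> carrier G\<^sub>2. weil_rep h s = t}"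
begin

sublocale V: vector_space scV by (rule V)

abbreviation Homs :: "('s \<Rightarrow> 'v) set" where
  "Homs \<equiv> intertwiners G\<^sub>1 (space_of scS) weil_rep (space_of scV) \<pi>"

definition K\<^sub>\<pi> :: "'s set" where "K\<^sub>\<pi> = isotypic_kernel G\<^sub>1 scS scV \<pi>"

lemma K_mem: "s \<in> K\<^sub>\<pi> \<longleftrightarrow> (\<forall>f\<in>Homs. f s = 0)"
  by (auto simp: K\<^sub>\<pi>_def isotypic_kernel_def)

lemma Homs_rules:
  assumes "f \<in> Homs"
  shows "f (s + t) = f s + f t" "f (scS r s) = scV r (f s)" "g \<in> carrier G\<^sub>1 \<Longrightarrow> f (weil_rep g s) = \<pi> g (f s)"
    "f 0 = 0" "f (s - t) = f s - f t"
proof -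
  show *: "f (s + t) = f s + f t" "f (scS r s) = scV r (f s)"
    "g \<in> carrier G\<^sub>1 \<Longrightarrow> f (weil_rep g s) = \<pi> g (f s)" for s t r g
    using intertwinersD(3-5)[OF assms] by simp_all
  show "f 0 = 0" using *(2)[of 0 0] by simp
  show "f (s - t) = f s - f t" using *(1)[of "s - t" t] by simp
qed

lemma \<pi>_rules:
  "g \<in> carrier G\<^sub>1 \<Longrightarrow> \<pi> g (v + w) = \<pi> g v + \<pi> g w" "g \<in> carrier G\<^sub>1 \<Longrightarrow> \<pi> g (scV r v) = scV r (\<pi> g v)"
  "g \<in> carrier G\<^sub>1 \<Longrightarrow> \<pi> g 0 = 0"
proof -
  show *: "g \<in> carrier G\<^sub>1 \<Longrightarrow> \<pi> g (v + w) = \<pi> g v + \<pi> g w" "g \<in> carrier G\<^sub>1 \<Longrightarrow> \<pi> g (scV r v) = scV r (\<pi> g v)"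
    for g v w r
    using representationD(3,4)[OF \<pi>] by simp_all
  show "g \<in> carrier G\<^sub>1 \<Longrightarrow> \<pi> g 0 = 0" using *(2)[of g 0 0] by simp
qed

lemma K_subspace: "subspace K\<^sub>\<pi>"
  unfolding subspace_def
proof (intro conjI ballI allI)
  show "0 \<in> K\<^sub>\<pi>" unfolding K_mem using Homs_rules(4) by blast
  show "s + t \<in> K\<^sub>\<pi>" if "s \<in> K\<^sub>\<pi>" "t \<in> K\<^sub>\<pi>" for s t
    unfolding K_mem
  proof
    fix f assume f: "f \<in> Homs"
    then have "f s = 0" "f t = 0" using that K_mem by blast+
    then show "f (s + t) = 0" by (simp add: Homs_rules(1)[OF f])
  qed
  show "scS r s \<in> K\<^sub>\<pi>" if "s \<in> K\<^sub>\<pi>" for r s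
    unfolding K_mem
  proof
    fix f assume f: "f \<in> Homs"
    then have "f s = 0" using that K_mem by blast
    then show "f (scS r s) = 0" by (simp add: Homs_rules(2)[OF f])
  qed
qed

lemma K_stable:
  assumes "g \<in> carrier G\<^sub>1 \<union> carrier G\<^sub>2" "s \<in> K\<^sub>\<pi>"
  shows "weil_rep g s \<in> K\<^sub>\<pi>"
  unfolding K_mem
proof
  fix f assume f: "f \<in> Homs"
  show "f (weil_rep g s) = 0"
  proof (cases "g \<in> carrier G\<^sub>1")
    case True
    have "f s = 0" using assms(2) f K_mem by blast
    then show ?thesis using Homs_rules(3)[OF f True] \<pi>_rules(3)[OF True] by simp
  next
    case False
    then have g: "g \<in> carrier G\<^sub>2" using assms(1) by blast
    \<comment> \<open>The second group permutes the homomorphisms to pi by composition, because its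
      operators commute with those of the first.\<close>
    have "(\<lambda>s. f (weil_rep g s)) \<in> Homs"
      by (rule intertwinersI) (simp_all add: weil_add weil_scale g Homs_rules[OF f] weil_commute[symmetric])
    from bspec[OF assms(2)[unfolded K_mem] this] show ?thesis .
  qed
qed

sublocale Q: subquotient scS "space_of scS" "K\<^sub>\<pi>"
  by unfold_locales (auto simp: K_subspace)

abbreviation Q :: "('r, 's set) module" where "Q \<equiv> quot_space (space_of scS) K\<^sub>\<pi>"

lemma Q_carrier: "carrier Q = range (coset K\<^sub>\<pi>)"
  by (simp add: Q.quot_carrier)

lemma weil_coset:
  assumes g: "g \<in> carrier G\<^sub>1 \<union> carrier G\<^sub>2"
  shows "weil_rep g ` coset K\<^sub>\<pi> s = coset K\<^sub>\<pi> (weil_rep g s)"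
proof -
  obtain g' where g': "g' \<in> carrier G\<^sub>1 \<union> carrier G\<^sub>2" "\<And>s. weil_rep g (weil_rep g' s) = s" "\<And>s. weil_rep g' (weil_rep g s) = s"
  proof (cases "g \<in> carrier G\<^sub>1")
    case True
    interpret Group.group G\<^sub>1 by (rule G\<^sub>1)
    show thesis
      using that[of "inv\<^bsub>G\<^sub>1\<^esub> g"] True weil_mult1[of g "inv\<^bsub>G\<^sub>1\<^esub> g"] weil_mult1[of "inv\<^bsub>G\<^sub>1\<^esub> g" g] weil_one by simp
  next
    case False
    then have g2: "g \<in> carrier G\<^sub>2" using g by blast
    interpret Group.group G\<^sub>2 by (rule G\<^sub>2)
    show thesis
      using that[of "inv\<^bsub>G\<^sub>2\<^esub> g"] g2 weil_mult2[of g "inv\<^bsub>G\<^sub>2\<^esub> g"] weil_mult2[of "inv\<^bsub>G\<^sub>2\<^esub> g" g] weil_one by simp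
  qed
  have diff: "weil_rep k (s - t) = weil_rep k s - weil_rep k t" if "k \<in> carrier G\<^sub>1 \<union> carrier G\<^sub>2" for k s t
    using weil_add[OF that, of "s - t" t] by simp
  show ?thesis
  proof
    show "weil_rep g ` coset K\<^sub>\<pi> s \<subseteq> coset K\<^sub>\<pi> (weil_rep g s)"
      using K_stable[OF g] by (auto simp: coset_def diff[OF g, symmetric])
    show "coset K\<^sub>\<pi> (weil_rep g s) \<subseteq> weil_rep g ` coset K\<^sub>\<pi> s"
    proof
      fix z assume "z \<in> coset K\<^sub>\<pi> (weil_rep g s)"
      then have "weil_rep g' (z - weil_rep g s) \<in> K\<^sub>\<pi>" using K_stable[OF g'(1)] by (simp add: coset_def)
      then have "weil_rep g' z \<in> coset K\<^sub>\<pi> s" by (simp add: coset_def diff[OF g'(1)] g'(3))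
      then show "z \<in> weil_rep g ` coset K\<^sub>\<pi> s" using g'(2) by (metis image_eqI)
    qed
  qed
qed

definition \<sigma> where "\<sigma> = (\<lambda>(g, h) D. (weil_rep g \<circ> weil_rep h) ` D)"
definition \<sigma>\<^sub>0 where "\<sigma>\<^sub>0 g D = weil_rep g ` D"

lemma \<sigma>\<^sub>0_coset: "g \<in> carrier G\<^sub>1 \<union> carrier G\<^sub>2 \<Longrightarrow> \<sigma>\<^sub>0 g (coset K\<^sub>\<pi> s) = coset K\<^sub>\<pi> (weil_rep g s)"
  by (simp add: \<sigma>\<^sub>0_def weil_coset)

lemma \<sigma>_eq: "\<sigma> (g, h) D = \<sigma>\<^sub>0 g (\<sigma>\<^sub>0 h D)"
  by (simp add: \<sigma>_def \<sigma>\<^sub>0_def image_comp)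

lemma \<sigma>_coset: "g \<in> carrier G\<^sub>1 \<Longrightarrow> h \<in> carrier G\<^sub>2 \<Longrightarrow> \<sigma> (g, h) (coset K\<^sub>\<pi> s) = coset K\<^sub>\<pi> (weil_rep g (weil_rep h s))"
  by (simp add: \<sigma>_eq \<sigma>\<^sub>0_coset)

lemma \<sigma>\<^sub>0_rep:
  assumes G: "G = G\<^sub>1 \<or> G = G\<^sub>2"
  shows "Defs.representation G Q \<sigma>\<^sub>0"
  unfolding Defs.representation_def lin_maps_def
proof (intro conjI ballI CollectI allI)
  have sub: "carrier G \<subseteq> carrier G\<^sub>1 \<union> carrier G\<^sub>2" using G by blast
  have mem: "g \<in> carrier G\<^sub>1 \<union> carrier G\<^sub>2" if "g \<in> carrier G" for g using that sub by blast
  interpret Group.group G using G G\<^sub>1 G\<^sub>2 by blast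
  show "field_module Q" by (rule Q.quot_module)
  show "\<sigma>\<^sub>0 g \<in> carrier Q \<rightarrow> carrier Q" if "g \<in> carrier G" for g
    by (auto simp: Q_carrier \<sigma>\<^sub>0_coset[OF mem[OF that]])
  show "\<sigma>\<^sub>0 g (x \<oplus>\<^bsub>Q\<^esub> y) = \<sigma>\<^sub>0 g x \<oplus>\<^bsub>Q\<^esub> \<sigma>\<^sub>0 g y" if "g \<in> carrier G" "x \<in> carrier Q" "y \<in> carrier Q" for g x y
    using that(2,3) mem[OF that(1)] by (auto simp: Q_carrier \<sigma>\<^sub>0_coset Q.quot_add weil_add)
  show "\<sigma>\<^sub>0 g (r \<odot>\<^bsub>Q\<^esub> x) = r \<odot>\<^bsub>Q\<^esub> \<sigma>\<^sub>0 g x" if "g \<in> carrier G" "x \<in> carrier Q" for g r x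
    using that(2) mem[OF that(1)] by (auto simp: Q_carrier \<sigma>\<^sub>0_coset Q.quot_smult weil_scale)
  show "\<sigma>\<^sub>0 \<one>\<^bsub>G\<^esub> x = x" if "x \<in> carrier Q" for x
    using G weil_one by (auto simp: \<sigma>\<^sub>0_def)
  show "\<sigma>\<^sub>0 (g \<otimes>\<^bsub>G\<^esub> h) x = \<sigma>\<^sub>0 g (\<sigma>\<^sub>0 h x)" if "g \<in> carrier G" "h \<in> carrier G" "x \<in> carrier Q" for g h x
  proof -
    have "weil_rep (g \<otimes>\<^bsub>G\<^esub> h) s = weil_rep g (weil_rep h s)" for s
      using G weil_mult1[of g h] weil_mult2[of g h] by blast
    then show ?thesis by (simp add: \<sigma>\<^sub>0_def image_image)
  qed
qed

lemmas \<sigma>1_rules = representationD[OF \<sigma>\<^sub>0_rep[OF disjI1[OF refl]]]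
lemmas \<sigma>2_rules = representationD[OF \<sigma>\<^sub>0_rep[OF disjI2[OF refl]]]

lemma \<sigma>\<^sub>0_commute:
  assumes "g \<in> carrier G\<^sub>1" "h \<in> carrier G\<^sub>2" "c \<in> carrier Q"
  shows "\<sigma>\<^sub>0 g (\<sigma>\<^sub>0 h c) = \<sigma>\<^sub>0 h (\<sigma>\<^sub>0 g c)"
  using assms by (auto simp: Q_carrier \<sigma>\<^sub>0_coset weil_commute[OF assms(1,2)])

lemma \<sigma>_rep: "Defs.representation (G\<^sub>1 \<times>\<times> G\<^sub>2) Q \<sigma>"
  unfolding Defs.representation_def
proof (intro conjI ballI)
  show "field_module Q" by (rule Q.quot_module)
  show "\<sigma> gh \<in> lin_maps Q Q" if gh_mem: "gh \<in> carrier (G\<^sub>1 \<times>\<times> G\<^sub>2)" for gh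
  proof -
    obtain g h where "gh = (g, h)" "g \<in> carrier G\<^sub>1" "h \<in> carrier G\<^sub>2" using gh_mem by auto
    then show ?thesis
      unfolding lin_maps_def by (simp add: \<sigma>_eq \<sigma>1_rules \<sigma>2_rules)
  qed
  show "\<sigma> \<one>\<^bsub>G\<^sub>1 \<times>\<times> G\<^sub>2\<^esub> x = x" if "x \<in> carrier Q" for x
    using that by (simp add: \<sigma>_eq \<sigma>1_rules \<sigma>2_rules)
  show "\<sigma> (gh \<otimes>\<^bsub>G\<^sub>1 \<times>\<times> G\<^sub>2\<^esub> gh') x = \<sigma> gh (\<sigma> gh' x)"
    if mem: "gh \<in> carrier (G\<^sub>1 \<times>\<times> G\<^sub>2)" "gh' \<in> carrier (G\<^sub>1 \<times>\<times> G\<^sub>2)" "x \<in> carrier Q" for gh gh' x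
  proof -
    obtain g h g' h' where *: "gh = (g, h)" "gh' = (g', h')" "g \<in> carrier G\<^sub>1" "h \<in> carrier G\<^sub>2"
      "g' \<in> carrier G\<^sub>1" "h' \<in> carrier G\<^sub>2" using mem by auto
    have x': "\<sigma>\<^sub>0 h' x \<in> carrier Q" using \<sigma>2_rules(2) * mem by blast
    then have "\<sigma>\<^sub>0 h (\<sigma>\<^sub>0 h' x) \<in> carrier Q" using \<sigma>2_rules(2) * by blast
    then show ?thesis
      using * mem(3) \<sigma>1_rules(6)[OF *(3,5)] \<sigma>2_rules(6)[OF *(4,6) mem(3)] \<sigma>\<^sub>0_commute[OF *(5,4) x']
      by (simp add: \<sigma>_eq)
  qed
qed

lemma \<sigma>_smooth: "smooth_rep (G\<^sub>1 \<times>\<times> G\<^sub>2) (prod_topology T\<^sub>1 T\<^sub>2) Q \<sigma>"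
  unfolding smooth_rep_def
proof (intro conjI ballI)
  show "Defs.representation (G\<^sub>1 \<times>\<times> G\<^sub>2) Q \<sigma>" by (rule \<sigma>_rep)
  fix c assume "c \<in> carrier Q"
  then obtain s where s: "c = coset K\<^sub>\<pi> s" by (auto simp: Q_carrier)
  show "openin (prod_topology T\<^sub>1 T\<^sub>2) {gh \<in> carrier (G\<^sub>1 \<times>\<times> G\<^sub>2). \<sigma> gh c = c}"
    unfolding openin_prod_topology_alt
  proof (intro allI impI)
    fix g h assume "(g, h) \<in> {gh \<in> carrier (G\<^sub>1 \<times>\<times> G\<^sub>2). \<sigma> gh c = c}"
    then have gh: "g \<in> carrier G\<^sub>1" "h \<in> carrier G\<^sub>2" "\<sigma> (g, h) c = c" by auto
    let ?A = "{g' \<in> carrier G\<^sub>1. weil_rep g' (weil_rep h s) = weil_rep g (weil_rep h s)}"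
    let ?B = "{h' \<in> carrier G\<^sub>2. weil_rep h' s = weil_rep h s}"
    have "?A \<times> ?B \<subseteq> {gh \<in> carrier (G\<^sub>1 \<times>\<times> G\<^sub>2). \<sigma> gh c = c}"
    proof
      fix p assume "p \<in> ?A \<times> ?B"
      then obtain g' h' where p: "p = (g', h')" "g' \<in> carrier G\<^sub>1" "h' \<in> carrier G\<^sub>2"
        "weil_rep h' s = weil_rep h s" "weil_rep g' (weil_rep h s) = weil_rep g (weil_rep h s)" by auto
      have "\<sigma> p c = \<sigma> (g, h) c" using p gh by (simp add: s \<sigma>_coset)
      then show "p \<in> {gh \<in> carrier (G\<^sub>1 \<times>\<times> G\<^sub>2). \<sigma> gh c = c}" using p gh(3) by simp
    qed
    then show "\<exists>A B. openin T\<^sub>1 A \<and> openin T\<^sub>2 B \<and> g \<in> A \<and> h \<in> B \<and>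
        A \<times> B \<subseteq> {gh \<in> carrier (G\<^sub>1 \<times>\<times> G\<^sub>2). \<sigma> gh c = c}"
      using gh weil_open1 weil_open2 by (intro exI[of _ ?A] exI[of _ ?B]) auto
  qed
qed

text \<open>The space Hom(pi, Q). Since V is a whole type, homomorphisms are determined as functions
  and can be the elements of the carrier; D acts on the right by composition.\<close>

definition \<Theta> :: "('r, 'v \<Rightarrow> 's set) module" where
  "\<Theta> = \<lparr>carrier = intertwiners G\<^sub>1 (space_of scV) \<pi> Q \<sigma>\<^sub>0, monoid.mult = undefined, one = undefined,
     ring.zero = (\<lambda>_. \<zero>\<^bsub>Q\<^esub>), add = (\<lambda>\<phi> \<phi>' v. \<phi> v \<oplus>\<^bsub>Q\<^esub> \<phi>' v), smult = (\<lambda>r \<phi> v. r \<odot>\<^bsub>Q\<^esub> \<phi> v)\<rparr>"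

definition \<theta> where "\<theta> h \<phi> = (\<lambda>v. \<sigma>\<^sub>0 h (\<phi> v))"

lemma \<Theta>_simps [simp]:
  "carrier \<Theta> = intertwiners G\<^sub>1 (space_of scV) \<pi> Q \<sigma>\<^sub>0" "\<zero>\<^bsub>\<Theta>\<^esub> = (\<lambda>_. \<zero>\<^bsub>Q\<^esub>)"
  "\<phi> \<oplus>\<^bsub>\<Theta>\<^esub> \<phi>' = (\<lambda>v. \<phi> v \<oplus>\<^bsub>Q\<^esub> \<phi>' v)" "r \<odot>\<^bsub>\<Theta>\<^esub> \<phi> = (\<lambda>v. r \<odot>\<^bsub>Q\<^esub> \<phi> v)"
  by (simp_all add: \<Theta>_def)

lemmas Q_rules = field_moduleD[OF Q.quot_module]

lemma hom_rules:
  assumes "\<phi> \<in> intertwiners G\<^sub>1 (space_of scV) \<pi> Q \<sigma>\<^sub>0"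
  shows "\<phi> v \<in> carrier Q" "\<phi> (v + w) = \<phi> v \<oplus>\<^bsub>Q\<^esub> \<phi> w" "\<phi> (scV r v) = r \<odot>\<^bsub>Q\<^esub> \<phi> v"
    "g \<in> carrier G\<^sub>1 \<Longrightarrow> \<phi> (\<pi> g v) = \<sigma>\<^sub>0 g (\<phi> v)"
  using intertwinersD(2-5)[OF assms] by simp_all

lemma Q_interchange:
  assumes "a \<in> carrier Q" "b \<in> carrier Q" "c \<in> carrier Q" "d \<in> carrier Q"
  shows "(a \<oplus>\<^bsub>Q\<^esub> b) \<oplus>\<^bsub>Q\<^esub> (c \<oplus>\<^bsub>Q\<^esub> d) = (a \<oplus>\<^bsub>Q\<^esub> c) \<oplus>\<^bsub>Q\<^esub> (b \<oplus>\<^bsub>Q\<^esub> d)"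
  using assms by (auto simp: Q_carrier Q.quot_add add_ac)

lemma Q_smult_commute: "a \<in> carrier Q \<Longrightarrow> r \<odot>\<^bsub>Q\<^esub> (s \<odot>\<^bsub>Q\<^esub> a) = s \<odot>\<^bsub>Q\<^esub> (r \<odot>\<^bsub>Q\<^esub> a)"
  by (auto simp: Q_carrier Q.quot_smult mult.commute)

lemma hom_add:
  assumes "\<phi> \<in> carrier \<Theta>" "\<phi>' \<in> carrier \<Theta>"
  shows "\<phi> \<oplus>\<^bsub>\<Theta>\<^esub> \<phi>' \<in> carrier \<Theta>"
  using assms hom_rules[of \<phi>] hom_rules[of \<phi>'] unfolding \<Theta>_simps
  by (intro intertwinersI) (simp_all add: Q_rules(1,9) Q_interchange \<sigma>1_rules)

lemma hom_smult: "\<phi> \<in> carrier \<Theta> \<Longrightarrow> r \<odot>\<^bsub>\<Theta>\<^esub> \<phi> \<in> carrier \<Theta>"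
  using hom_rules[of \<phi>] unfolding \<Theta>_simps
  by (intro intertwinersI) (simp_all add: Q_rules(3,9) Q_smult_commute \<sigma>1_rules)

lemma hom_zero: "(\<lambda>_. \<zero>\<^bsub>Q\<^esub>) \<in> intertwiners G\<^sub>1 (space_of scV) \<pi> Q \<sigma>\<^sub>0"
  by (rule zero_intertwiner[OF \<sigma>\<^sub>0_rep[OF disjI1[OF refl]]])

lemma \<Theta>_module: "field_module \<Theta>"
proof (rule moduleI)
  show "cring (ring_of_type_algebra :: 'r ring)" by (rule cring_from_type_algebra)
  show "abelian_group \<Theta>"
  proof (rule abelian_groupI)
    show "\<phi> \<oplus>\<^bsub>\<Theta>\<^esub> \<phi>' \<in> carrier \<Theta>" if "\<phi> \<in> carrier \<Theta>" "\<phi>' \<in> carrier \<Theta>" for \<phi> \<phi>' using hom_add that by blast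
    show "\<exists>y\<in>carrier \<Theta>. y \<oplus>\<^bsub>\<Theta>\<^esub> \<phi> = \<zero>\<^bsub>\<Theta>\<^esub>" if \<phi>: "\<phi> \<in> carrier \<Theta>" for \<phi>
    proof (rule bexI[OF _ hom_smult[OF \<phi>, of "- 1"]])
      have "(- 1) \<odot>\<^bsub>Q\<^esub> \<phi> v \<oplus>\<^bsub>Q\<^esub> \<phi> v = \<zero>\<^bsub>Q\<^esub>" for v
        using Q_rules(8)[of "\<phi> v" "- 1" 1] Q_rules(11,12)[of "\<phi> v"] hom_rules(1)[of \<phi> v] \<phi> by simp
      then show "(- 1) \<odot>\<^bsub>\<Theta>\<^esub> \<phi> \<oplus>\<^bsub>\<Theta>\<^esub> \<phi> = \<zero>\<^bsub>\<Theta>\<^esub>" by simp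
    qed
  qed (use hom_zero hom_rules(1) Q_rules(4,6,7) in auto)
  show "r \<odot>\<^bsub>\<Theta>\<^esub> \<phi> \<in> carrier \<Theta>" if "\<phi> \<in> carrier \<Theta>" for r \<phi> using hom_smult that by blast
qed (use hom_rules(1) Q_rules(8,9,10,11) in auto)

lemma \<theta>_closed:
  assumes h: "h \<in> carrier G\<^sub>2" and \<phi>: "\<phi> \<in> carrier \<Theta>"
  shows "\<theta> h \<phi> \<in> carrier \<Theta>"
  using \<phi> hom_rules[of \<phi>] h unfolding \<Theta>_simps \<theta>_def
  by (intro intertwinersI) (simp_all add: \<sigma>2_rules \<sigma>\<^sub>0_commute[OF _ h, symmetric])

lemma \<theta>_rep: "Defs.representation G\<^sub>2 \<Theta> \<theta>"
  unfolding Defs.representation_def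
proof (intro conjI ballI)
  show "field_module \<Theta>" by (rule \<Theta>_module)
  show "\<theta> h \<in> lin_maps \<Theta> \<Theta>" if h: "h \<in> carrier G\<^sub>2" for h
    unfolding lin_maps_def
  proof (intro CollectI conjI ballI allI)
    show "\<theta> h \<in> carrier \<Theta> \<rightarrow> carrier \<Theta>" using \<theta>_closed[OF h] by blast
  qed (use hom_rules(1) \<sigma>2_rules(3,4)[OF h] in \<open>auto simp: \<theta>_def\<close>)
  show "\<theta> \<one>\<^bsub>G\<^sub>2\<^esub> \<phi> = \<phi>" if "\<phi> \<in> carrier \<Theta>" for \<phi>
    using that hom_rules(1)[of \<phi>] \<sigma>2_rules(5) by (simp add: \<theta>_def)
  show "\<theta> (h \<otimes>\<^bsub>G\<^sub>2\<^esub> h') \<phi> = \<theta> h (\<theta> h' \<phi>)" if "h \<in> carrier G\<^sub>2" "h' \<in> carrier G\<^sub>2" "\<phi> \<in> carrier \<Theta>" for h h' \<phi>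
    using that hom_rules(1)[of \<phi>] \<sigma>2_rules(6) by (simp add: \<theta>_def)
qed

lemma nonzero_vector: obtains v0 :: 'v where "v0 \<noteq> 0"
proof -
  have "UNIV \<noteq> {0 :: 'v}" using irr by (simp add: irreducible_rep_def)
  then show thesis using that by blast
qed

text \<open>A homomorphism on the irreducible \<open>V\<close> is determined by one vector, whence smoothness.\<close>

lemma \<theta>_smooth: "smooth_rep G\<^sub>2 T\<^sub>2 \<Theta> \<theta>"
  unfolding smooth_rep_def
proof (intro conjI ballI)
  show "Defs.representation G\<^sub>2 \<Theta> \<theta>" by (rule \<theta>_rep)
  fix \<phi> assume \<phi>: "\<phi> \<in> carrier \<Theta>"
  obtain v0 :: 'v where v0: "v0 \<noteq> 0" by (rule nonzero_vector)
  obtain s where s: "\<phi> v0 = coset K\<^sub>\<pi> s" using hom_rules(1)[of \<phi> v0] \<phi> by (auto simp: Q_carrier)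
  have "\<theta> h \<phi> = \<phi> \<longleftrightarrow> weil_rep h s \<in> coset K\<^sub>\<pi> s" if h: "h \<in> carrier G\<^sub>2" for h
  proof
    assume "\<theta> h \<phi> = \<phi>"
    then have "coset K\<^sub>\<pi> (weil_rep h s) = coset K\<^sub>\<pi> s" using s h by (metis UnI2 \<sigma>\<^sub>0_coset \<theta>_def)
    then show "weil_rep h s \<in> coset K\<^sub>\<pi> s" using Q.coset_eq by (simp add: coset_def)
  next
    assume "weil_rep h s \<in> coset K\<^sub>\<pi> s"
    then have "coset K\<^sub>\<pi> (weil_rep h s) = coset K\<^sub>\<pi> s" using Q.coset_eq by (simp add: coset_def)
    then have eq: "\<theta> h \<phi> v0 = \<phi> v0" using s h by (simp add: \<theta>_def \<sigma>\<^sub>0_coset)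
    have "stable_subset G\<^sub>1 (space_of scV) \<pi> {v. \<theta> h \<phi> v = \<phi> v}"
      using stable_subset_equalizer[OF \<pi> \<sigma>\<^sub>0_rep[OF disjI1[OF refl]], of "\<theta> h \<phi>" \<phi>] \<theta>_closed[OF h \<phi>] \<phi> by simp
    from irreducible_stable_subset[OF irr V this _ v0] eq show "\<theta> h \<phi> = \<phi>" by auto
  qed
  \<comment> \<open>The stabilizer of \<open>\<phi>\<close> is that of the class of
    \<open>s\<close>, a union of open sets on which the operator has a fixed value at
    \<open>s\<close>.\<close>
  then have "{h \<in> carrier G\<^sub>2. \<theta> h \<phi> = \<phi>} = (\<Union>t\<in>coset K\<^sub>\<pi> s. {h \<in> carrier G\<^sub>2. weil_rep h s = t})" by blast
  then show "openin T\<^sub>2 {h \<in> carrier G\<^sub>2. \<theta> h \<phi> = \<phi>}" using weil_open2 by auto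
qed

lemma \<Theta>_right_module: "right_module_rep G\<^sub>2 T\<^sub>2 scS (End_ring G\<^sub>1 scV \<pi>) scV \<Theta> \<theta> (\<circ>)"
  unfolding right_module_rep_def
proof (intro conjI ballI allI)
  let ?D = "carrier (End_ring G\<^sub>1 scV \<pi>)"
  have D: "d (v + w) = d v + d w" "d (scV r v) = scV r (d v)" "g \<in> carrier G\<^sub>1 \<Longrightarrow> d (\<pi> g v) = \<pi> g (d v)"
    if "d \<in> ?D" for d v w r g
    using that intertwinersD(3-5)[of d G\<^sub>1 "space_of scV" \<pi> "space_of scV" \<pi>] by (simp_all add: End_ring_def)
  show "smooth_rep G\<^sub>2 T\<^sub>2 \<Theta> \<theta>" by (rule \<theta>_smooth)
  show "genuine G\<^sub>2 scS \<Theta> \<theta>"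
    unfolding genuine_def
  proof (intro allI impI ballI)
    fix r \<phi> assume r: "(id, scS r) \<in> carrier G\<^sub>2" and \<phi>: "\<phi> \<in> carrier \<Theta>"
    have "\<sigma>\<^sub>0 (id :: 'w \<Rightarrow> 'w, scS r) c = r \<odot>\<^bsub>Q\<^esub> c" if c: "c \<in> carrier Q" for c
    proof -
      obtain s where s: "c = coset K\<^sub>\<pi> s" using c by (auto simp: Q_carrier)
      show ?thesis using \<sigma>\<^sub>0_coset[of "(id :: 'w \<Rightarrow> 'w, scS r)" s] r by (simp add: s Q.quot_smult weil_rep_def)
    qed
    then show "\<theta> (id :: 'w \<Rightarrow> 'w, scS r) \<phi> = r \<odot>\<^bsub>\<Theta>\<^esub> \<phi>" using \<phi> hom_rules(1)[of \<phi>] by (simp add: \<theta>_def)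
  qed
  show "(\<lambda>\<phi>. \<phi> \<circ> d) \<in> intertwiners G\<^sub>2 \<Theta> \<theta> \<Theta> \<theta>" if d: "d \<in> ?D" for d
  proof (rule intertwinersI)
    show "\<phi> \<circ> d \<in> carrier \<Theta>" if "\<phi> \<in> carrier \<Theta>" for \<phi>
      using that hom_rules[of \<phi>] unfolding \<Theta>_simps by (intro intertwinersI) (simp_all add: D[OF d])
  qed (auto simp: \<theta>_def)
  show "\<phi> \<circ> \<one>\<^bsub>End_ring G\<^sub>1 scV \<pi>\<^esub> = \<phi>" for \<phi> :: "'v \<Rightarrow> 's set" by (simp add: End_ring_def)
  show "\<phi> \<circ> (d \<otimes>\<^bsub>End_ring G\<^sub>1 scV \<pi>\<^esub> d') = \<phi> \<circ> d \<circ> d'" for \<phi> :: "'v \<Rightarrow> 's set" and d d'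
    by (simp add: End_ring_def comp_assoc)
  show "\<phi> \<circ> (d \<oplus>\<^bsub>End_ring G\<^sub>1 scV \<pi>\<^esub> d') = (\<phi> \<circ> d) \<oplus>\<^bsub>\<Theta>\<^esub> (\<phi> \<circ> d')" if "\<phi> \<in> carrier \<Theta>" for \<phi> d d'
    using that hom_rules(2)[of \<phi>] by (auto simp: End_ring_def)
  show "\<phi> \<circ> scV r = r \<odot>\<^bsub>\<Theta>\<^esub> \<phi>" if "\<phi> \<in> carrier \<Theta>" for \<phi> r
    using that hom_rules(3)[of \<phi>] by auto
qed

sublocale B: theta_bimodule G\<^sub>1 G\<^sub>2 scV \<pi> \<Theta> \<theta> "(\<circ>)"
  by (rule theta_bimodule_of_right_module_rep[OF G\<^sub>1 G\<^sub>2 V \<pi> irr \<Theta>_right_module])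

definition descend :: "('s \<Rightarrow> 'v) \<Rightarrow> 's set \<Rightarrow> 'v" where "descend f c = f (rep c)"

lemma descend_coset:
  assumes f: "f \<in> Homs"
  shows "descend f (coset K\<^sub>\<pi> s) = f s"
proof -
  have "rep (coset K\<^sub>\<pi> s) - s \<in> K\<^sub>\<pi>" by (rule rep_coset[OF Q.N_subgroup])
  then have "f (rep (coset K\<^sub>\<pi> s) - s) = 0" using f K_mem by blast
  then show ?thesis by (simp add: descend_def Homs_rules(5)[OF f])
qed

lemma descend_intertwiner:
  assumes f: "f \<in> Homs"
  shows "descend f \<in> intertwiners G\<^sub>1 Q \<sigma>\<^sub>0 (space_of scV) \<pi>"
  by (rule intertwinersI)
    (auto simp: Q_carrier Q.quot_add Q.quot_smult \<sigma>\<^sub>0_coset descend_coset[OF f] Homs_rules[OF f])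

text \<open>
  By admissibility the vectors \<open>f s\<close> span a finite-dimensional space, so finitely many \<open>f\<close> separate
  the module generated by the class of \<open>s\<close>.
\<close>

lemma finite_separating:
  "\<exists>F. finite F \<and> F \<subseteq> intertwiners G\<^sub>1 Q \<sigma>\<^sub>0 (space_of scV) \<pi> \<and>
     (\<forall>y\<in>cyclic G\<^sub>1 Q \<sigma>\<^sub>0 (coset K\<^sub>\<pi> s). (\<forall>f\<in>F. f y = 0) \<longrightarrow> y = \<zero>\<^bsub>Q\<^esub>)"
proof -
  interpret G1: Group.group G\<^sub>1 by (rule G\<^sub>1)
  let ?c = "coset K\<^sub>\<pi> s"
  have cQ: "?c \<in> carrier Q" by (simp add: Q_carrier)
  \<comment> \<open>The stabilizer of the class of \<open>s\<close> is an open subgroup, so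
    admissibility bounds the vectors of V that it fixes. Every homomorphism takes \<open>s\<close>
    to such a vector.\<close>
  define K where "K = {g \<in> carrier G\<^sub>1. \<sigma>\<^sub>0 g ?c = ?c}"
  have "subgroup K G\<^sub>1"
  proof (rule G1.subgroupI)
    show "K \<subseteq> carrier G\<^sub>1" by (auto simp: K_def)
    have "\<one>\<^bsub>G\<^sub>1\<^esub> \<in> K" unfolding K_def using \<sigma>1_rules(5)[OF cQ] by simp
    then show "K \<noteq> {}" by blast
    show "inv\<^bsub>G\<^sub>1\<^esub> g \<in> K" if "g \<in> K" for g
    proof -
      have g: "g \<in> carrier G\<^sub>1" "\<sigma>\<^sub>0 g ?c = ?c" using that by (auto simp: K_def)
      have "\<sigma>\<^sub>0 (inv\<^bsub>G\<^sub>1\<^esub> g) (\<sigma>\<^sub>0 g ?c) = ?c"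
        using \<sigma>1_rules(6)[of "inv\<^bsub>G\<^sub>1\<^esub> g" g ?c] \<sigma>1_rules(5)[OF cQ] g(1) cQ by simp
      then show ?thesis using g by (simp add: K_def)
    qed
    show "g \<otimes>\<^bsub>G\<^sub>1\<^esub> h \<in> K" if "g \<in> K" "h \<in> K" for g h
      using that \<sigma>1_rules(6)[of g h ?c] cQ by (simp add: K_def)
  qed
  moreover have "\<sigma>\<^sub>0 g ?c = ?c \<longleftrightarrow> weil_rep g s \<in> ?c" if "g \<in> carrier G\<^sub>1" for g
    using \<sigma>\<^sub>0_coset[of g s] that Q.coset_eq[of "weil_rep g s" s] by (simp add: coset_def)
  then have "K = (\<Union>t\<in>?c. {g \<in> carrier G\<^sub>1. weil_rep g s = t})"
    unfolding K_def by blast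
  then have "openin T\<^sub>1 K" using weil_open1 by auto
  ultimately obtain B where B: "finite B" "{v. \<forall>k\<in>K. \<pi> k v = v} = V.span B"
    using adm unfolding admissible_def by blast
  let ?W = "(\<lambda>f. f s) ` Homs"
  have "?W \<subseteq> V.span B"
  proof
    fix v assume "v \<in> ?W"
    then obtain f where f: "f \<in> Homs" "v = f s" by blast
    have "\<pi> k v = v" if "k \<in> K" for k
    proof -
      have k: "k \<in> carrier G\<^sub>1" "\<sigma>\<^sub>0 k ?c = ?c" using that by (auto simp: K_def)
      have "\<pi> k (descend f ?c) = descend f (\<sigma>\<^sub>0 k ?c)"
        using intertwinersD(5)[OF descend_intertwiner[OF f(1)] k(1) cQ] by simp
      then show ?thesis using k f by (simp add: descend_coset)
    qed
    then show "v \<in> V.span B" using B(2) by blast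
  qed
  moreover obtain B' where B': "B' \<subseteq> ?W" "V.independent B'" "?W \<subseteq> V.span B'"
    using V.maximal_independent_subset[of ?W] by blast
  ultimately have finB': "finite B'" using V.independent_span_bound[OF B(1) B'(2)] by blast
  have "\<forall>v. \<exists>f. v \<in> B' \<longrightarrow> f \<in> Homs \<and> f s = v" using B'(1) by blast
  then obtain p where p: "\<And>v. v \<in> B' \<Longrightarrow> p v \<in> Homs" "\<And>v. v \<in> B' \<Longrightarrow> p v s = v" by metis
  let ?F = "(\<lambda>v. descend (p v)) ` B'"
  have "y = \<zero>\<^bsub>Q\<^esub>" if y: "y \<in> cyclic G\<^sub>1 Q \<sigma>\<^sub>0 ?c" "\<forall>f\<in>?F. f y = 0" for y
  proof -
    have "y \<in> carrier Q"
      using y(1) stable_subsetD(1)[OF stable_subset_cyclic[OF \<sigma>\<^sub>0_rep[OF disjI1[OF refl]] cQ]] by blast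
    then obtain z where z: "y = coset K\<^sub>\<pi> z" by (auto simp: Q_carrier)
    have "f z = 0" if f: "f \<in> Homs" for f
    proof -
      have "f s \<in> V.span B'" using B'(3) f by blast
      then obtain r where r: "f s = (\<Sum>v\<in>B'. scV (r v) v)" using V.span_finite[OF finB'] by auto
      \<comment> \<open>The combination of the chosen homomorphisms with the value
        \<open>f s\<close> at \<open>s\<close>. It agrees with \<open>f\<close> on the class of
        \<open>s\<close>, hence on the module generated by it, so the chosen homomorphisms detect
        whatever \<open>f\<close> detects there.\<close>
      define q where "q c = (\<Sum>v\<in>B'. scV (r v) (descend (p v) c))" for c
      have \<pi>_sum: "\<pi> g (\<Sum>v\<in>A. x v) = (\<Sum>v\<in>A. \<pi> g (x v))" if "g \<in> carrier G\<^sub>1" for g A and x :: "'v \<Rightarrow> 'v"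
        by (induction A rule: infinite_finite_induct) (auto simp: \<pi>_rules[OF that])
      have "q \<in> intertwiners G\<^sub>1 Q \<sigma>\<^sub>0 (space_of scV) \<pi>"
      proof (rule intertwinersI)
        show "q (c \<oplus>\<^bsub>Q\<^esub> c') = q c \<oplus>\<^bsub>space_of scV\<^esub> q c'" if "c \<in> carrier Q" "c' \<in> carrier Q" for c c'
          using intertwinersD(3)[OF descend_intertwiner[OF p(1)] that]
          by (simp add: q_def V.scale_right_distrib sum.distrib)
        show "q (a \<odot>\<^bsub>Q\<^esub> c) = a \<odot>\<^bsub>space_of scV\<^esub> q c" if "c \<in> carrier Q" for c a
          using intertwinersD(4)[OF descend_intertwiner[OF p(1)] that, of _ a]
          by (simp add: q_def V.scale_sum_right mult.commute)
        show "q (\<sigma>\<^sub>0 g c) = \<pi> g (q c)" if "g \<in> carrier G\<^sub>1" "c \<in> carrier Q" for g c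
          using intertwinersD(5)[OF descend_intertwiner[OF p(1)] that]
          by (simp add: q_def \<pi>_sum[OF that(1)] \<pi>_rules[OF that(1)])
      qed simp
      from stable_subset_equalizer[OF \<sigma>\<^sub>0_rep[OF disjI1[OF refl]] \<pi> descend_intertwiner[OF f] this]
      have "cyclic G\<^sub>1 Q \<sigma>\<^sub>0 ?c \<subseteq> {c \<in> carrier Q. descend f c = q c}"
        by (rule cyclic_least) (simp add: cQ descend_coset f q_def p r)
      then have "descend f y = q y" using y(1) by blast
      also have "q y = 0" using y(2) by (simp add: q_def)
      finally show ?thesis by (simp add: z descend_coset f)
    qed
    then have "z \<in> K\<^sub>\<pi>" using K_mem by blast
    then show ?thesis by (simp add: z Q.quot_zero_iff)
  qed
  moreover have "?F \<subseteq> intertwiners G\<^sub>1 Q \<sigma>\<^sub>0 (space_of scV) \<pi>" using descend_intertwiner p(1) by blast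
  ultimately show ?thesis using finB' by (intro exI[of _ ?F]) blast
qed

text \<open>The evaluation map, sending the tensor of \<open>\<phi>\<close> and \<open>v\<close> to
  \<open>\<phi> v\<close>. Representatives are chosen in S so that the free lift can be formed in a
  vector space on a type; \<open>ev_coset\<close> shows that the choice does not matter modulo the
  kernel.\<close>

definition ev :: "(('v \<Rightarrow> 's set) \<times> 'v \<Rightarrow>\<^sub>0 'r) set \<Rightarrow> 's set" where
  "ev t = coset K\<^sub>\<pi> (free_lift scS (\<lambda>k. rep (fst k (snd k))) (rep t))"

lemma coset_rep: "c \<in> carrier Q \<Longrightarrow> coset K\<^sub>\<pi> (rep c) = c"
  using rep_coset[OF Q.N_subgroup] Q.coset_eq by (auto simp: Q_carrier)

lemma ev_coset: "ev (coset B.N u) = coset K\<^sub>\<pi> (free_lift scS (\<lambda>k. rep (fst k (snd k))) u)"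
proof -
  have rep_add: "rep (c \<oplus>\<^bsub>Q\<^esub> c') - rep c - rep c' \<in> K\<^sub>\<pi>" if "c \<in> carrier Q" "c' \<in> carrier Q" for c c'
  proof -
    have "coset K\<^sub>\<pi> (rep (c \<oplus>\<^bsub>Q\<^esub> c')) = coset K\<^sub>\<pi> (rep c + rep c')"
      using that Q_rules(1) coset_rep Q.quot_add by metis
    then show ?thesis using Q.coset_eq by (simp add: diff_diff_eq)
  qed
  have rep_smult: "rep (r \<odot>\<^bsub>Q\<^esub> c) - scS r (rep c) \<in> K\<^sub>\<pi>" if "c \<in> carrier Q" for r c
  proof -
    have "coset K\<^sub>\<pi> (rep (r \<odot>\<^bsub>Q\<^esub> c)) = coset K\<^sub>\<pi> (scS r (rep c))"
      using that Q_rules(3) coset_rep Q.quot_smult by metis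
    then show ?thesis using Q.coset_eq by simp
  qed
  have hom_add: "rep (\<phi> (v + w)) - rep (\<phi> v) - rep (\<phi> w) \<in> K\<^sub>\<pi>"
    and hom_smult: "rep (\<phi> (scV r v)) - scS r (rep (\<phi> v)) \<in> K\<^sub>\<pi>"
    if \<phi>: "\<phi> \<in> carrier \<Theta>" for \<phi> v w r
    using \<phi> hom_rules(1-3)[of \<phi>] rep_add[of "\<phi> v" "\<phi> w"] rep_smult[of "\<phi> v" r] by simp_all
  have sum_rel: "rep (\<phi> v \<oplus>\<^bsub>Q\<^esub> \<phi>' v) - rep (\<phi> v) - rep (\<phi>' v) \<in> K\<^sub>\<pi>"
    and smult_rel: "rep (r \<odot>\<^bsub>Q\<^esub> \<phi> v) - scS r (rep (\<phi> v)) \<in> K\<^sub>\<pi>"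
    if "\<phi> \<in> carrier \<Theta>" "\<phi>' \<in> carrier \<Theta>" for \<phi> \<phi>' v r
    using that hom_rules(1)[of \<phi>] hom_rules(1)[of \<phi>'] rep_add[of "\<phi> v" "\<phi>' v"] rep_smult[of "\<phi> v" r]
    by simp_all
  have "rep (coset B.N u) - u \<in> B.N" by (rule rep_coset[OF B.T.N_subgroup])
  then have "free_lift scS (\<lambda>k. rep (fst k (snd k))) (rep (coset B.N u) - u) \<in> K\<^sub>\<pi>"
  proof (intro B.lift_kills[OF vector_space_axioms K_subspace, of "\<lambda>\<phi> v. rep (\<phi> v)"])
  qed (use hom_add hom_smult sum_rel smult_rel subspace_0[OF K_subspace] in auto)
  then show ?thesis unfolding ev_def Q.coset_eq by (simp add: free_lift_diff)
qed

lemma ev_tens: "\<phi> \<in> carrier \<Theta> \<Longrightarrow> ev (B.tens \<phi> v) = \<phi> v"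
  by (simp add: B.tens_def ev_coset coset_rep hom_rules(1))

lemma ev_intertwiner: "ev \<in> intertwiners (G\<^sub>1 \<times>\<times> G\<^sub>2) B.Tsp (\<lambda>(g, h). B.\<tau> g h) Q \<sigma>"
proof (rule intertwinersI)
  show closed: "ev t \<in> carrier Q" for t by (simp add: ev_def Q_carrier)
  show add: "ev (t \<oplus>\<^bsub>B.Tsp\<^esub> t') = ev t \<oplus>\<^bsub>Q\<^esub> ev t'" if "t \<in> carrier B.Tsp" "t' \<in> carrier B.Tsp" for t t'
    using that by (auto simp: B.T_carrier B.T_add ev_coset Q.quot_add free_lift_add)
  show smult: "ev (r \<odot>\<^bsub>B.Tsp\<^esub> t) = r \<odot>\<^bsub>Q\<^esub> ev t" if "t \<in> carrier B.Tsp" for r t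
    using that by (auto simp: B.T_carrier B.T_smult ev_coset Q.quot_smult free_lift_scale)
  fix gh t assume "gh \<in> carrier (G\<^sub>1 \<times>\<times> G\<^sub>2)" and t: "t \<in> carrier B.Tsp"
  then obtain g h where gh: "gh = (g, h)" "g \<in> carrier G\<^sub>1" "h \<in> carrier G\<^sub>2" by auto
  then have ghm: "(g, h) \<in> carrier (G\<^sub>1 \<times>\<times> G\<^sub>2)" by simp
  note \<tau>r = representationD[OF B.\<tau>_rep] and \<sigma>r = representationD[OF \<sigma>_rep]
  note Tm = field_moduleD[OF B.T_module]
  let ?P = "{t \<in> carrier B.Tsp. ev (B.\<tau> g h t) = \<sigma> (g, h) (ev t)}"
  have "carrier B.Tsp \<subseteq> ?P"
  proof (rule B.T_generated)
    have \<tau>c: "B.\<tau> g h t \<in> carrier B.Tsp" if "t \<in> carrier B.Tsp" for t using \<tau>r(2)[OF ghm that] by simp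
    have \<tau>lin: "B.\<tau> g h (t \<oplus>\<^bsub>B.Tsp\<^esub> t') = B.\<tau> g h t \<oplus>\<^bsub>B.Tsp\<^esub> B.\<tau> g h t'"
      "B.\<tau> g h (r \<odot>\<^bsub>B.Tsp\<^esub> t) = r \<odot>\<^bsub>B.Tsp\<^esub> B.\<tau> g h t"
      if "t \<in> carrier B.Tsp" "t' \<in> carrier B.Tsp" for t t' r
      using \<tau>r(3)[OF ghm that] \<tau>r(4)[OF ghm that(1)] by simp_all
    show "linear_subset B.Tsp ?P"
      unfolding linear_subset_def
    proof (intro conjI ballI allI)
      have z: "\<zero>\<^bsub>B.Tsp\<^esub> = 0 \<odot>\<^bsub>B.Tsp\<^esub> \<zero>\<^bsub>B.Tsp\<^esub>" using Tm(13) by simp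
      have z2: "B.\<tau> g h \<zero>\<^bsub>B.Tsp\<^esub> = \<zero>\<^bsub>B.Tsp\<^esub>"
        using \<tau>lin(2)[OF Tm(2) Tm(2), of 0] Tm(12)[OF \<tau>c[OF Tm(2)]] Tm(13) by simp
      have z3: "ev \<zero>\<^bsub>B.Tsp\<^esub> = \<zero>\<^bsub>Q\<^esub>" by (simp add: B.T_zero ev_coset Q.quot_zero)
      have "\<sigma> (g, h) \<zero>\<^bsub>Q\<^esub> = \<zero>\<^bsub>Q\<^esub>"
        using \<sigma>r(4)[OF ghm Q_rules(2), of 0] Q_rules(12)[OF \<sigma>r(2)[OF ghm Q_rules(2)]] Q_rules(13) by simp
      then show "\<zero>\<^bsub>B.Tsp\<^esub> \<in> ?P" using z2 z3 Tm(2) by simp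
    next
      show "x \<oplus>\<^bsub>B.Tsp\<^esub> y \<in> ?P" if "x \<in> ?P" "y \<in> ?P" for x y
        using that Tm(1) by (simp add: \<tau>lin add \<tau>c \<sigma>r(3)[OF ghm closed closed])
      show "r \<odot>\<^bsub>B.Tsp\<^esub> x \<in> ?P" if "x \<in> ?P" for r x
      proof -
        have x: "x \<in> carrier B.Tsp" "ev (B.\<tau> g h x) = \<sigma> (g, h) (ev x)" using that by auto
        then show ?thesis
          using \<tau>lin(2)[OF x(1,1), of r] smult[OF \<tau>c[OF x(1)], of r] smult[OF x(1), of r]
            \<sigma>r(4)[OF ghm closed, of r x] Tm(3)[OF x(1), of r] by simp
      qed
    qed blast
    show "B.tens \<phi> v \<in> ?P" if \<phi>: "\<phi> \<in> carrier \<Theta>" for \<phi> v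
    proof -
      have "ev (B.\<tau> g h (B.tens \<phi> v)) = \<theta> h \<phi> (\<pi> g v)"
        using B.\<tau>_tens[OF gh(2,3) \<phi>] ev_tens[OF \<theta>_closed[OF gh(3) \<phi>]] by simp
      also have "\<dots> = \<sigma>\<^sub>0 g (\<theta> h \<phi> v)"
        using hom_rules(4)[of "\<theta> h \<phi>" g v] \<theta>_closed[OF gh(3) \<phi>] gh(2) by simp
      also have "\<dots> = \<sigma> (g, h) (ev (B.tens \<phi> v))" using ev_tens[OF \<phi>] by (simp add: \<theta>_def \<sigma>_eq)
      finally show ?thesis using B.tens_closed[OF \<phi>] by simp
    qed
  qed
  then show "ev ((\<lambda>(g, h). B.\<tau> g h) gh t) = \<sigma> gh (ev t)" using t gh by auto
qed

lemmas ev_rules = intertwinersD[OF ev_intertwiner]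

lemma ev_intertwiner1: "ev \<in> intertwiners G\<^sub>1 B.Tsp B.\<tau>\<^sub>1 Q \<sigma>\<^sub>0"
proof (rule intertwinersI)
  show "ev (B.\<tau>\<^sub>1 g t) = \<sigma>\<^sub>0 g (ev t)" if "g \<in> carrier G\<^sub>1" "t \<in> carrier B.Tsp" for g t
    using ev_rules(5)[of "(g, \<one>\<^bsub>G\<^sub>2\<^esub>)" t] that B.one_G2 ev_rules(2)[OF that(2)] \<sigma>2_rules(5) by (simp add: \<sigma>_eq)
qed (use ev_rules in auto)

text \<open>The kernel is stable under the first group; the tensors with a fixed
  \<open>\<phi>\<close> lie in it only if \<open>\<phi>\<close> is 0, so it vanishes by
  \<open>submodule_detected\<close>. The image contains the image of every homomorphism from V to Q,
  and by admissibility these span Q.\<close>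

lemma ev_bij: "bij_betw ev (carrier B.Tsp) (carrier Q)"
  unfolding bij_betw_def
proof
  show "inj_on ev (carrier B.Tsp)"
  proof (rule inj_onI)
    fix t t' assume t: "t \<in> carrier B.Tsp" "t' \<in> carrier B.Tsp" "ev t = ev t'"
    note Tm = field_moduleD[OF B.T_module]
    let ?K = "{t \<in> carrier B.Tsp. ev t = \<zero>\<^bsub>Q\<^esub>}"
    have K: "stable_subset G\<^sub>1 B.Tsp B.\<tau>\<^sub>1 ?K"
      by (rule stable_subset_kernel[OF B.\<tau>\<^sub>1_rep \<sigma>\<^sub>0_rep[OF disjI1[OF refl]] ev_intertwiner1])
    have "ev (mdiff B.Tsp t t') = mdiff Q (ev t) (ev t')"
      using ev_rules(3)[OF t(1) Tm(3)[OF t(2)], of "- 1"] ev_rules(4)[OF t(2), of "- 1"] by simp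
    then have "mdiff B.Tsp t t' \<in> ?K"
      using mdiff(1)[OF B.T_module t(1,2)] mdiff(3)[OF Q.quot_module ev_rules(2)[OF t(1)] ev_rules(2)[OF t(2)]] t(3)
      by simp
    then have "mdiff B.Tsp t t' = \<zero>\<^bsub>B.Tsp\<^esub>"
    proof (rule B.submodule_detected[OF K])
      fix \<phi> assume \<phi>: "\<phi> \<in> carrier \<Theta>" and "\<And>v. B.tens \<phi> v \<in> ?K"
      then have "\<phi> v = \<zero>\<^bsub>Q\<^esub>" for v using ev_tens[OF \<phi>, of v] by fastforce
      then show "\<phi> = \<zero>\<^bsub>\<Theta>\<^esub>" by auto
    qed
    then show "t = t'" using mdiff(3)[OF B.T_module t(1,2)] by simp
  qed
  show "ev ` carrier B.Tsp = carrier Q"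
  proof
    show "ev ` carrier B.Tsp \<subseteq> carrier Q" using ev_rules(2) by blast
    show "carrier Q \<subseteq> ev ` carrier B.Tsp"
    proof
      fix c assume c: "c \<in> carrier Q"
      then obtain s where s: "c = coset K\<^sub>\<pi> s" by (auto simp: Q_carrier)
      obtain F where F: "finite F" "F \<subseteq> intertwiners G\<^sub>1 Q \<sigma>\<^sub>0 (space_of scV) \<pi>"
        "\<forall>y\<in>cyclic G\<^sub>1 Q \<sigma>\<^sub>0 c. (\<forall>f\<in>F. f y = 0) \<longrightarrow> y = \<zero>\<^bsub>Q\<^esub>"
        using finite_separating[of s] s by blast
      have lin: "linear_subset Q (ev ` carrier B.Tsp)"
        unfolding linear_subset_def
      proof (intro conjI ballI allI)
        note Tm = field_moduleD[OF B.T_module]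
        show "ev ` carrier B.Tsp \<subseteq> carrier Q" using ev_rules(2) by blast
        show "\<zero>\<^bsub>Q\<^esub> \<in> ev ` carrier B.Tsp"
          using lin_maps_zero[OF B.T_module Q.quot_module ev_rules(1)] Tm(2) by (metis image_eqI)
        show "x \<oplus>\<^bsub>Q\<^esub> y \<in> ev ` carrier B.Tsp" if xy: "x \<in> ev ` carrier B.Tsp" "y \<in> ev ` carrier B.Tsp" for x y
        proof -
          obtain t t' where "t \<in> carrier B.Tsp" "t' \<in> carrier B.Tsp" "x = ev t" "y = ev t'" using xy by blast
          then show ?thesis using ev_rules(3)[of t t'] Tm(1)[of t t'] by (metis image_eqI)
        qed
        show "r \<odot>\<^bsub>Q\<^esub> x \<in> ev ` carrier B.Tsp" if x: "x \<in> ev ` carrier B.Tsp" for r x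
        proof -
          obtain t where "t \<in> carrier B.Tsp" "x = ev t" using x by blast
          then show ?thesis using ev_rules(4)[of t r] Tm(3)[of t r] by (metis image_eqI)
        qed
      qed
      show "c \<in> ev ` carrier B.Tsp"
      proof (rule separated_cyclic_isotypic[OF \<sigma>\<^sub>0_rep[OF disjI1[OF refl]] V \<pi> irr F(1,2) c _ lin])
        show "y = \<zero>\<^bsub>Q\<^esub>" if "y \<in> cyclic G\<^sub>1 Q \<sigma>\<^sub>0 c" "\<And>f. f \<in> F \<Longrightarrow> f y = 0" for y using F(3) that by blast
        show "\<phi> v \<in> ev ` carrier B.Tsp" if "\<phi> \<in> intertwiners G\<^sub>1 (space_of scV) \<pi> Q \<sigma>\<^sub>0" for \<phi> v
          using ev_tens[of \<phi> v] B.tens_closed[of \<phi> v] that by (metis \<Theta>_simps(1) image_eqI)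
      qed
    qed
  qed
qed

lemma tensor_smooth: "smooth_rep (G\<^sub>1 \<times>\<times> G\<^sub>2) (prod_topology T\<^sub>1 T\<^sub>2) B.Tsp (\<lambda>(g, h). B.\<tau> g h)"
  unfolding smooth_rep_def
proof (intro conjI ballI)
  show "Defs.representation (G\<^sub>1 \<times>\<times> G\<^sub>2) B.Tsp (\<lambda>(g, h). B.\<tau> g h)" by (rule B.\<tau>_rep)
  fix t assume t: "t \<in> carrier B.Tsp"
  have "{gh \<in> carrier (G\<^sub>1 \<times>\<times> G\<^sub>2). (\<lambda>(g, h). B.\<tau> g h) gh t = t} = {gh \<in> carrier (G\<^sub>1 \<times>\<times> G\<^sub>2). \<sigma> gh (ev t) = ev t}"
  proof (intro Collect_cong conj_cong refl)
    fix gh assume gh: "gh \<in> carrier (G\<^sub>1 \<times>\<times> G\<^sub>2)"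
    have "(\<lambda>(g, h). B.\<tau> g h) gh t \<in> carrier B.Tsp" using representationD(2)[OF B.\<tau>_rep gh t] .
    then show "(\<lambda>(g, h). B.\<tau> g h) gh t = t \<longleftrightarrow> \<sigma> gh (ev t) = ev t"
      using ev_rules(5)[OF gh t] bij_betw_imp_inj_on[OF ev_bij] t by (metis inj_onD)
  qed
  then show "openin (prod_topology T\<^sub>1 T\<^sub>2) {gh \<in> carrier (G\<^sub>1 \<times>\<times> G\<^sub>2). (\<lambda>(g, h). B.\<tau> g h) gh t = t}"
    using \<sigma>_smooth ev_rules(2)[OF t] by (simp add: smooth_rep_def)
qed

theorem theta_lift_exists: "theta_lift G\<^sub>1 T\<^sub>1 G\<^sub>2 T\<^sub>2 scS scV \<pi> \<Theta> \<theta> (\<circ>)"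
proof -
  note inv = intertwiners_inverse[OF ev_intertwiner ev_bij B.\<tau>_rep]
  have "smooth_rep_iso (G\<^sub>1 \<times>\<times> G\<^sub>2) (prod_topology T\<^sub>1 T\<^sub>2) Q \<sigma> B.Tsp (\<lambda>(g, h). B.\<tau> g h)"
    unfolding smooth_rep_iso_def using \<sigma>_smooth tensor_smooth inv(1,2) by blast
  then show ?thesis
    unfolding theta_lift_def using \<Theta>_right_module
    by (simp add: \<sigma>_def B.Tsp_def B.\<tau>_def K\<^sub>\<pi>_def comp_def)
qed

end

lemma weil_rep_eq: "weil_rep = snd"
  by (auto simp: weil_rep_def)

lemma bimodule_iso_of_theta_lifts:
  assumes "Group.group G\<^sub>1" "Group.group G\<^sub>2" "vector_space scV"
    and \<pi>: "Defs.representation G\<^sub>1 (space_of scV) \<pi>" "irreducible_rep G\<^sub>1 (space_of scV) \<pi>"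
    and A: "theta_lift G\<^sub>1 T\<^sub>1 G\<^sub>2 T\<^sub>2 scS scV \<pi> \<Theta> \<theta> act"
    and B: "theta_lift G\<^sub>1 T\<^sub>1 G\<^sub>2 T\<^sub>2 scS scV \<pi> \<Theta>' \<theta>' act'"
  shows "bimodule_iso G\<^sub>2 (End_ring G\<^sub>1 scV \<pi>) \<Theta> \<theta> act \<Theta>' \<theta>' act'"
proof -
  let ?T = "tensor_space (End_ring G\<^sub>1 scV \<pi>) \<Theta> act scV" and ?T' = "tensor_space (End_ring G\<^sub>1 scV \<pi>) \<Theta>' act' scV"
  let ?\<tau> = "\<lambda>(g, h). tensor_map (\<theta> h) (\<pi> g)" and ?\<tau>' = "\<lambda>(g, h). tensor_map (\<theta>' h) (\<pi> g)"
  define Q where "Q = quot_space (space_of scS) (isotypic_kernel G\<^sub>1 scS scV \<pi>)"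
  define \<sigma> where "\<sigma> = (\<lambda>(g :: ('a \<Rightarrow> 'a) \<times> ('b \<Rightarrow> 'b), h :: ('a \<Rightarrow> 'a) \<times> ('b \<Rightarrow> 'b)) C. (weil_rep g \<circ> weil_rep h) ` C)"
  have iso: "smooth_rep_iso (G\<^sub>1 \<times>\<times> G\<^sub>2) (prod_topology T\<^sub>1 T\<^sub>2) Q \<sigma> ?T ?\<tau>"
    "smooth_rep_iso (G\<^sub>1 \<times>\<times> G\<^sub>2) (prod_topology T\<^sub>1 T\<^sub>2) Q \<sigma> ?T' ?\<tau>'"
    using A B unfolding theta_lift_def Q_def \<sigma>_def by blast+
  then obtain f f' where f: "f \<in> intertwiners (G\<^sub>1 \<times>\<times> G\<^sub>2) Q \<sigma> ?T ?\<tau>" "bij_betw f (carrier Q) (carrier ?T)"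
    and f': "f' \<in> intertwiners (G\<^sub>1 \<times>\<times> G\<^sub>2) Q \<sigma> ?T' ?\<tau>'" "bij_betw f' (carrier Q) (carrier ?T')"
    unfolding smooth_rep_iso_def by blast
  have "Defs.representation (G\<^sub>1 \<times>\<times> G\<^sub>2) Q \<sigma>" using iso(1) unfolding smooth_rep_iso_def smooth_rep_def by blast
  note inv = intertwiners_inverse[OF f this]
  note R = theta_bimodule_of_right_module_rep[OF assms(1-5)]
  show ?thesis
  proof (rule bimodule_iso_of_tensor_iso)
    show "theta_bimodule G\<^sub>1 G\<^sub>2 scV \<pi> \<Theta> \<theta> act" using A R unfolding theta_lift_def by blast
    show "theta_bimodule G\<^sub>1 G\<^sub>2 scV \<pi> \<Theta>' \<theta>' act'" using B R unfolding theta_lift_def by blast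
    show "(\<lambda>t. f' (the_inv_into (carrier Q) f t)) \<in> intertwiners (G\<^sub>1 \<times>\<times> G\<^sub>2) ?T ?\<tau> ?T' ?\<tau>'"
      by (rule intertwiners_comp[OF inv(1) f'(1)])
    show "bij_betw (\<lambda>t. f' (the_inv_into (carrier Q) f t)) (carrier ?T) (carrier ?T')"
      using bij_betw_trans[OF inv(2) f'(2)] by (simp add: comp_def)
  qed
qed

text \<open>Existence fixes the type of the lift, namely functions from V to classes in S;
  uniqueness compares lifts on arbitrary types.\<close>

theorem mainTheorem5:
  fixes v :: "'f::field \<Rightarrow> real" and p :: nat
    and scW :: "'f \<Rightarrow> 'w::ab_group_add \<Rightarrow> 'w" and B :: "'w \<Rightarrow> 'w \<Rightarrow> 'f"
    and \<psi> :: "'f \<Rightarrow> 'r::field"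
    and scS :: "'r \<Rightarrow> 's::ab_group_add \<Rightarrow> 's" and \<rho> :: "'w \<times> 'f \<Rightarrow> 's \<Rightarrow> 's"
    and H\<^sub>1 H\<^sub>2 :: "('w \<Rightarrow> 'w) set"
    and scV :: "'r \<Rightarrow> 'v::ab_group_add \<Rightarrow> 'v"
    and \<pi>\<^sub>1 :: "('w \<Rightarrow> 'w) \<times> ('s \<Rightarrow> 's) \<Rightarrow> 'v \<Rightarrow> 'v"
    and G\<^sub>1 G\<^sub>2 :: "(('w \<Rightarrow> 'w) \<times> ('s \<Rightarrow> 's)) monoid"
    and T\<^sub>1 T\<^sub>2 :: "(('w \<Rightarrow> 'w) \<times> ('s \<Rightarrow> 's)) topology"
  assumes base: "base_field p v" and char: "CHAR('f) \<noteq> 2"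
    and symplectic: "symplectic_space scW B"
    and psi: "smooth_character v \<psi>" "\<exists>t. \<psi> t \<noteq> 1"
    and S: "vector_space scS"
    and rho_smooth: "smooth_rep (heisenberg B) (heisenberg_top v scW) (space_of scS) \<rho>"
    and rho_irreducible: "irreducible_rep (heisenberg B) (space_of scS) \<rho>"
    and rho_central: "\<And>t x. \<rho> (0, t) x = scS (\<psi> t) x"
    and dual_pair: "reductive_dual_pair scW B H\<^sub>1 H\<^sub>2"
    and G\<^sub>1: "G\<^sub>1 = hat_group scW B scS \<rho> H\<^sub>1" and T\<^sub>1: "T\<^sub>1 = hat_top v scW B scS \<rho> H\<^sub>1"
    and G\<^sub>2: "G\<^sub>2 = hat_group scW B scS \<rho> H\<^sub>2" and T\<^sub>2: "T\<^sub>2 = hat_top v scW B scS \<rho> H\<^sub>2"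
    and V: "vector_space scV"
    and pi_smooth: "smooth_rep G\<^sub>1 T\<^sub>1 (space_of scV) \<pi>\<^sub>1"
    and pi_genuine: "genuine G\<^sub>1 scS (space_of scV) \<pi>\<^sub>1"
    and pi_irreducible: "irreducible_rep G\<^sub>1 (space_of scV) \<pi>\<^sub>1"
    and pi_admissible: "admissible G\<^sub>1 T\<^sub>1 scV \<pi>\<^sub>1"
  shows "(\<exists>(\<Theta> :: ('r, 'v \<Rightarrow> 's set) module) \<theta> act.
            theta_lift G\<^sub>1 T\<^sub>1 G\<^sub>2 T\<^sub>2 scS scV \<pi>\<^sub>1 \<Theta> \<theta> act) \<and>
         (\<forall>(\<Theta> :: ('r, 't) module) \<theta> act (\<Theta>' :: ('r, 'u) module) \<theta>' act'.
            theta_lift G\<^sub>1 T\<^sub>1 G\<^sub>2 T\<^sub>2 scS scV \<pi>\<^sub>1 \<Theta> \<theta> act \<and>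
            theta_lift G\<^sub>1 T\<^sub>1 G\<^sub>2 T\<^sub>2 scS scV \<pi>\<^sub>1 \<Theta>' \<theta>' act' \<longrightarrow>
            bimodule_iso G\<^sub>2 (End_ring G\<^sub>1 scV \<pi>\<^sub>1) \<Theta> \<theta> act \<Theta>' \<theta>' act')"
proof -
  obtain E where N: "nonarch_symplectic scW E v B \<psi>"
    by (rule base_field_nonarch_symplectic[OF base char symplectic psi])
  have W: "vector_space scW"
    using symplectic by (auto simp: symplectic_space_def finite_dimensional_vector_space_def)
  have H: "subgroup H\<^sub>1 (Sp_group scW B)" "subgroup H\<^sub>2 (Sp_group scW B)"
    and H2: "H\<^sub>2 = Sp_centralizer scW B H\<^sub>1"
    using dual_pair unfolding reductive_dual_pair_def reductive_subgroup_def by blast+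
  have G: "Group.group G\<^sub>1" "Group.group G\<^sub>2"
    unfolding G\<^sub>1 G\<^sub>2 using group_hat[OF W S H(1)] group_hat[OF W S H(2)] by blast+
  have Mp1: "g \<in> carrier (Mp_group scW B scS \<rho>)" "fst g \<in> H\<^sub>1" if "g \<in> carrier G\<^sub>1" for g
    using hat_group_carrier[OF W S H(1)] that unfolding G\<^sub>1 by blast+
  have Mp2: "h \<in> carrier (Mp_group scW B scS \<rho>)" "fst h \<in> H\<^sub>2" if "h \<in> carrier G\<^sub>2" for h
    using hat_group_carrier[OF W S H(2)] that unfolding G\<^sub>2 by blast+
  have lin: "Vector_Spaces.linear scS scS (snd g)" if "g \<in> carrier G\<^sub>1 \<union> carrier G\<^sub>2" for g
    using that Mp1(1) Mp2(1) Mp_group_simps(1) by blast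
  have \<pi>: "Defs.representation G\<^sub>1 (space_of scV) \<pi>\<^sub>1" using pi_smooth unfolding smooth_rep_def by blast
  interpret commuting_weil_pair scS G\<^sub>1 G\<^sub>2 T\<^sub>1 T\<^sub>2 scV \<pi>\<^sub>1
  proof (rule commuting_weil_pair.intro[OF S], rule commuting_weil_pair_axioms.intro)
    show "Group.group G\<^sub>1" "Group.group G\<^sub>2" by (rule G)+
    show "vector_space scV" by (rule V)
    show "Defs.representation G\<^sub>1 (space_of scV) \<pi>\<^sub>1" by (rule \<pi>)
    show "irreducible_rep G\<^sub>1 (space_of scV) \<pi>\<^sub>1" by (rule pi_irreducible)
    show "admissible G\<^sub>1 T\<^sub>1 scV \<pi>\<^sub>1" by (rule pi_admissible)
    show "weil_rep g (s + t) = weil_rep g s + weil_rep g t" "weil_rep g (scS r s) = scS r (weil_rep g s)"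
      if "g \<in> carrier G\<^sub>1 \<union> carrier G\<^sub>2" for g s t r
      using lin[OF that] by (simp_all add: weil_rep_eq Vector_Spaces.linear_iff)
    show "weil_rep (g \<otimes>\<^bsub>G\<^sub>1\<^esub> g') s = weil_rep g (weil_rep g' s)"
      "weil_rep (g \<otimes>\<^bsub>G\<^sub>2\<^esub> g') s = weil_rep g (weil_rep g' s)" for g g' s
      by (simp_all add: weil_rep_eq G\<^sub>1 G\<^sub>2 hat_group_mult)
    show "weil_rep \<one>\<^bsub>G\<^sub>1\<^esub> s = s" "weil_rep \<one>\<^bsub>G\<^sub>2\<^esub> s = s" for s
      by (simp_all add: weil_rep_eq G\<^sub>1 G\<^sub>2 hat_group_one)
    \<comment> \<open>The elements lie over commuting transformations of W, as the second group of
      the pair centralizes the first, so their operators commute without a scalar.\<close>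
    show "weil_rep g (weil_rep h s) = weil_rep h (weil_rep g s)"
      if g: "g \<in> carrier G\<^sub>1" and h: "h \<in> carrier G\<^sub>2" for g h s
    proof -
      have "fst g \<circ> fst h = fst h \<circ> fst g" using Mp1(2)[OF g] Mp2(2)[OF h] by (simp add: H2 Sp_centralizer_def)
      from metaplectic_commute[OF N S rho_smooth rho_irreducible rho_central Mp1(1)[OF g] Mp2(1)[OF h] this]
      show ?thesis unfolding weil_rep_eq by (metis comp_apply)
    qed
    show "openin T\<^sub>1 {g \<in> carrier G\<^sub>1. weil_rep g s = t}" "openin T\<^sub>2 {h \<in> carrier G\<^sub>2. weil_rep h s = t}" for s t
      unfolding weil_rep_eq G\<^sub>1 G\<^sub>2 T\<^sub>1 T\<^sub>2
      using openin_hat_top[OF W S H(1) base_field_nonarch_abs[OF base]]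
        openin_hat_top[OF W S H(2) base_field_nonarch_abs[OF base]] by blast+
  qed
  show ?thesis
    using theta_lift_exists bimodule_iso_of_theta_lifts[OF G V \<pi> pi_irreducible] by blast
qed

end
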